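(* Let $d\ge 2$, and for $c\in(0,\infty)$ let $m_c$ and $\widehat m_c$ be the variational quantities defined in the context. Then there exists some $c_*\in(0,\infty)$ such that: (i) For all $c\in(0,c_* )$ we have $m_c<2\pi\,\widehat m_{(2\pi)^{-1}c}$. (ii) For all $c\in[c_*,\infty)$ we have $m_c=2\pi\,\widehat m_{(2\pi)^{-1}c}$. Moreover, if $c\in(c_*,\infty)$, then any minimizer $u_c$ of $m_c$ must satisfy $\partial_y u_c=0$.
   Context: $\mathbb T=\mathbb R/2\pi\mathbb Z$. Points of $\mathbb R^d\times\mathbb T$ are written $(x,y)$, $x\in\mathbb R^d$, $y\in\mathbb T$. Functions are complex-valued. For $u\in H^1(\mathbb R^d\times\mathbb T)$, with all norms taken over $\mathbb R^d\times\mathbb T$, define $$M(u)=\|u\|_{L^2}^2,\qquad E(u)=\tfrac12\|\nabla_{x,y}u\|_{L^2}^2-\tfrac{d-1}{2(d+1)}\|u\|_{L^{2+4/(d-1)}}^{2+4/(d-1)},\qquad Q(u)=\|\nabla_x u\|_{L^2}^2-\tfrac{d}{d+1}\|u\|_{L^{2+4/(d-1)}}^{2+4/(d-1)}.$$ For $u\in H^1(\mathbb R^d)$, with all norms taken over $\mathbb R^d$, define $$\widehat M(u)=\|u\|_{L^2}^2,\qquad \widehat E(u)=\tfrac12\|\nabla_x u\|_{L^2}^2-\tfrac{d-1}{2(d+1)}\|u\|_{L^{2+4/(d-1)}}^{2+4/(d-1)},\qquad \widehat Q(u)=\|\nabla_x u\|_{L^2}^2-\tfrac{d}{d+1}\|u\|_{L^{2+4/(d-1)}}^{2+4/(d-1)}.$$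 For $c\in(0,\infty)$ set $$m_c:=\inf\{E(u):u\in H^1(\mathbb R^d\times\mathbb T),\ M(u)=c,\ Q(u)=0\},$$ $$\widehat m_c:=\inf\{\widehat E(u):u\in H^1(\mathbb R^d),\ \widehat M(u)=c,\ \widehat Q(u)=0\}.$$ A minimizer of $m_c$ is an admissible function $u$ ($M(u)=c$, $Q(u)=0$) with $E(u)=m_c$. *)

theory Defs
  imports "HOL-Analysis.Analysis"
begin

section \<open>Smooth functions, Lebesgue norms and weak derivatives\<close>

primrec C_k :: "nat \<Rightarrow> ('a::euclidean_space \<Rightarrow> real) \<Rightarrow> bool" where
  "C_k 0 f \<longleftrightarrow> continuous_on UNIV f"
| "C_k (Suc k) f \<longleftrightarrow> f differentiable_on UNIV \<and>
     (\<forall>b\<in>Basis. C_k k (\<lambda>x. frechet_derivative f (at x) b))"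

definition smooth :: "('a::euclidean_space \<Rightarrow> real) \<Rightarrow> bool" where
  "smooth f \<longleftrightarrow> (\<forall>k. C_k k f)"

definition Lp_norm :: "'a measure \<Rightarrow> real \<Rightarrow> ('a \<Rightarrow> 'b::real_normed_vector) \<Rightarrow> real" where
  "Lp_norm M p u = (\<integral>z. norm (u z) powr p \<partial>M) powr (1 / p)"

definition L2_space :: "'a measure \<Rightarrow> ('a \<Rightarrow> complex) set" where
  "L2_space M = {u \<in> borel_measurable M. integrable M (\<lambda>z. (norm (u z))\<^sup>2)}"

definition is_weak_deriv ::
    "'a::euclidean_space measure \<Rightarrow> ('a \<Rightarrow> real) set \<Rightarrow> 'a \<Rightarrow> ('a \<Rightarrow> complex) \<Rightarrow> ('a \<Rightarrow> complex) \<Rightarrow> bool"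
  where
  "is_weak_deriv M \<Phi> v u g \<longleftrightarrow>
     (\<forall>\<phi>\<in>\<Phi>. (\<integral>z. u z * of_real (frechet_derivative \<phi> (at z) v) \<partial>M)
              = - (\<integral>z. g z * of_real (\<phi> z) \<partial>M))"

text \<open>
  In both settings below the weak derivative is chosen by \<open>SOME\<close>. It is unique up to null sets,
  so norms of it and almost-everywhere statements about it do not depend on the choice.
  Elements of \<open>H\<^sup>1\<close> are represented by functions rather than by classes of
  almost everywhere equal functions. The power \<open>2 + 4/(d-1)\<close> of the modulus of an \<open>H\<^sup>1\<close>
  function is integrable by the Sobolev embedding, both on \<open>\<real>\<^sup>d\<close> and (where the exponent is the
  critical one) on the product of \<open>\<real>\<^sup>d\<close> with the circle, so no integral below
  takes the default value \<open>0\<close> of a non-integrable function.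
\<close>

definition nl_exponent :: "real \<Rightarrow> real" where
  "nl_exponent d = 2 + 4 / (d - 1)"


section \<open>The Euclidean space \<open>\<real>\<^sup>d\<close>, with \<open>d = CARD('n)\<close>\<close>

definition eu_test :: "(real^'n \<Rightarrow> real) set" where
  "eu_test = {\<phi>. smooth \<phi> \<and> compact (closure {x. \<phi> x \<noteq> 0})}"

definition eu_H1 :: "(real^'n \<Rightarrow> complex) set" where
  "eu_H1 = {u \<in> L2_space lebesgue.
     \<forall>v\<in>Basis. \<exists>g\<in>L2_space lebesgue. is_weak_deriv lebesgue eu_test v u g}"

definition eu_deriv :: "real^'n \<Rightarrow> (real^'n \<Rightarrow> complex) \<Rightarrow> real^'n \<Rightarrow> complex" where
  "eu_deriv v u = (SOME g. g \<in> L2_space lebesgue \<and> is_weak_deriv lebesgue eu_test v u g)"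

definition eu_grad :: "(real^'n \<Rightarrow> complex) \<Rightarrow> real^'n \<Rightarrow> complex^'n" where
  "eu_grad u x = (\<chi> i. eu_deriv (axis i 1) u x)"

definition eu_M :: "(real^'n \<Rightarrow> complex) \<Rightarrow> real" where
  "eu_M u = (Lp_norm lebesgue 2 u)\<^sup>2"

definition eu_E :: "(real^'n \<Rightarrow> complex) \<Rightarrow> real" where
  "eu_E u = (let d = real CARD('n); p = nl_exponent d in
     1 / 2 * (Lp_norm lebesgue 2 (eu_grad u))\<^sup>2
     - (d - 1) / (2 * (d + 1)) * Lp_norm lebesgue p u powr p)"

definition eu_Q :: "(real^'n \<Rightarrow> complex) \<Rightarrow> real" where
  "eu_Q u = (let d = real CARD('n); p = nl_exponent d in
     (Lp_norm lebesgue 2 (eu_grad u))\<^sup>2 - d / (d + 1) * Lp_norm lebesgue p u powr p)"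

definition eu_admissible :: "real \<Rightarrow> (real^'n \<Rightarrow> complex) set" where
  "eu_admissible c = {u \<in> eu_H1. eu_M u = c \<and> eu_Q u = 0}"

text \<open>
  For \<open>d \<ge> 2\<close> and \<open>c > 0\<close> the infima here and in \<open>cyl_m\<close> are genuine real infima:
  \<open>Q u = 0\<close> forces \<open>E u \<ge> 0\<close>, and an admissible function is obtained
  from any \<open>u \<noteq> 0\<close> in \<open>H\<^sup>1\<close> of mass \<open>c\<close> by a mass-preserving dilation in \<open>x\<close>.
  The \<open>itself\<close> argument carries the dimension.
\<close>

definition eu_m :: "'n::finite itself \<Rightarrow> real \<Rightarrow> real" where
  "eu_m n c = Inf (eu_E ` (eu_admissible c :: (real^'n \<Rightarrow> complex) set))"


section \<open>The product of \<open>\<real>\<^sup>d\<close> with the circle of length \<open>2\<pi>\<close>\<close>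

text \<open>
  Functions on the product are functions on \<open>\<real>\<^sup>d \<times> \<real>\<close> that are \<open>2\<pi>\<close>-periodic in the second
  variable, and integrals are taken over one period.
\<close>

definition y_periodic :: "('x \<times> real \<Rightarrow> 'b) \<Rightarrow> bool" where
  "y_periodic u \<longleftrightarrow> (\<forall>x y. u (x, y + 2 * pi) = u (x, y))"

definition cyl :: "((real^'n) \<times> real) measure" where
  "cyl = lebesgue_on (UNIV \<times> {0..<2 * pi})"

text \<open>
  Test functions have compact support in the product, that is, bounded support in \<open>x\<close>. They need
  not vanish at the ends of the period, so the weak derivative is the one on the circle.
\<close>

definition cyl_test :: "((real^'n) \<times> real \<Rightarrow> real) set" where
  "cyl_test = {\<phi>. smooth \<phi> \<and> y_periodic \<phi> \<and> compact (closure {x. \<exists>y. \<phi> (x, y) \<noteq> 0})}"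

definition cyl_L2 :: "((real^'n) \<times> real \<Rightarrow> complex) set" where
  "cyl_L2 = {u \<in> L2_space cyl. y_periodic u}"

definition cyl_H1 :: "((real^'n) \<times> real \<Rightarrow> complex) set" where
  "cyl_H1 = {u \<in> cyl_L2. \<forall>v\<in>Basis. \<exists>g\<in>cyl_L2. is_weak_deriv cyl cyl_test v u g}"

definition cyl_deriv ::
    "(real^'n) \<times> real \<Rightarrow> ((real^'n) \<times> real \<Rightarrow> complex) \<Rightarrow> (real^'n) \<times> real \<Rightarrow> complex" where
  "cyl_deriv v u = (SOME g. g \<in> cyl_L2 \<and> is_weak_deriv cyl cyl_test v u g)"

definition cyl_grad_x :: "((real^'n) \<times> real \<Rightarrow> complex) \<Rightarrow> (real^'n) \<times> real \<Rightarrow> complex^'n" where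
  "cyl_grad_x u z = (\<chi> i. cyl_deriv (axis i 1, 0) u z)"

definition cyl_deriv_y :: "((real^'n) \<times> real \<Rightarrow> complex) \<Rightarrow> (real^'n) \<times> real \<Rightarrow> complex" where
  "cyl_deriv_y u = cyl_deriv (0, 1) u"

definition cyl_grad ::
    "((real^'n) \<times> real \<Rightarrow> complex) \<Rightarrow> (real^'n) \<times> real \<Rightarrow> (complex^'n) \<times> complex" where
  "cyl_grad u z = (cyl_grad_x u z, cyl_deriv_y u z)"

definition cyl_M :: "((real^'n) \<times> real \<Rightarrow> complex) \<Rightarrow> real" where
  "cyl_M u = (Lp_norm cyl 2 u)\<^sup>2"

definition cyl_E :: "((real^'n) \<times> real \<Rightarrow> complex) \<Rightarrow> real" where
  "cyl_E u = (let d = real CARD('n); p = nl_exponent d in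
     1 / 2 * (Lp_norm cyl 2 (cyl_grad u))\<^sup>2
     - (d - 1) / (2 * (d + 1)) * Lp_norm cyl p u powr p)"

definition cyl_Q :: "((real^'n) \<times> real \<Rightarrow> complex) \<Rightarrow> real" where
  "cyl_Q u = (let d = real CARD('n); p = nl_exponent d in
     (Lp_norm cyl 2 (cyl_grad_x u))\<^sup>2 - d / (d + 1) * Lp_norm cyl p u powr p)"

definition cyl_admissible :: "real \<Rightarrow> ((real^'n) \<times> real \<Rightarrow> complex) set" where
  "cyl_admissible c = {u \<in> cyl_H1. cyl_M u = c \<and> cyl_Q u = 0}"

definition cyl_m :: "'n::finite itself \<Rightarrow> real \<Rightarrow> real" where
  "cyl_m n c = Inf (cyl_E ` (cyl_admissible c :: ((real^'n) \<times> real \<Rightarrow> complex) set))"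

definition cyl_minimizer :: "real \<Rightarrow> ((real^'n) \<times> real \<Rightarrow> complex) \<Rightarrow> bool" where
  "cyl_minimizer c u \<longleftrightarrow> u \<in> cyl_admissible c \<and> cyl_E u = cyl_m TYPE('n) c"

end

theory Submission
  imports Defs "HOL-Real_Asymp.Real_Asymp"
begin

text \<open>Let \<open>d = CARD('n)\<close>, \<open>\<kappa> = d / (d + 1)\<close>, and let \<open>M\<close>, \<open>A\<close>, \<open>B\<close>, \<open>P\<close> be the mass, the squared norms of
  the \<open>x\<close>-gradient and of the \<open>y\<close>-derivative, and the potential of a function on the cylinder. On the
  constraint \<open>A = \<kappa> P\<close> the energy is \<open>A / (2 d) + B / 2\<close>, and dilation in \<open>x\<close> alone reduces mass \<open>c\<close> to mass
  one, where \<open>c\<close> times the energy reads \<open>A / (2 d) + c\<^sup>2 B / 2\<close>. Functions independent of \<open>y\<close> have \<open>B = 0\<close> and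
  give the infimum \<open>L / (2 d)\<close>, so the threshold is the least \<open>c\<close> with \<open>A / (2 d) + c\<^sup>2 B / 2 \<ge> L / (2 d)\<close> for all
  competitors of unit mass. This monotonicity in \<open>c\<close> also forces \<open>B = 0\<close> for minimizers above the
  threshold.

  The threshold is positive because multiplying a near-optimal function of \<open>x\<close> by \<open>sin y\<close> produces a
  competitor with \<open>A < L\<close>. It is finite because \<open>L - A \<le> K B\<close> for small \<open>B\<close>: split \<open>u\<close> into its average over
  the circle and a remainder \<open>w\<close>; the linear term of the potential in \<open>w\<close> vanishes after integrating over
  the circle, and the rest is absorbed by the gradient of \<open>w\<close>, using the Poincare inequality on
  the circle and the Gagliardo--Nirenberg inequality \<open>P ^ (d - 1) \<le> C A ^ d (B + M)\<close> on the cylinder. The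
  latter comes from a discrete Loomis--Whitney inequality for averages of \<open>u\<close> over small cubes.\<close>

section \<open>Discrete Loomis--Whitney and Gagliardo--Nirenberg inequalities\<close>

text \<open>The power \<open>2 + 4 / (d - 1)\<close> is the critical Sobolev exponent in dimension d
  + 1, and this shapes the proof in three ways. The dilation \<open>l^((d-1)/2) u (l x, y)\<close>
  multiplies A and P by l and divides M and B by l, so it preserves the constraint and one parameter
  connects all masses. In the estimate for cube averages all powers of the mesh size cancel, so the
  mesh may shrink while the constants stay fixed. Finally, the inequality on the cylinder has one
  factor for the circle and d factors for space, so B enters it to the first power. A weak
  derivative is known only through test functions. Tested against a trapezoid in its own direction
  and smoothed indicators in the others, it bounds the difference of two box integrals, and this one
  bound yields both the Gagliardo--Nirenberg and the Poincare inequality. The delicate point of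
  finiteness is linearity in B. The mixed Hoelder term X between average and remainder is not linear
  in B, but X^(d+1) is at most a constant times A'^d B, with A' the x-gradient of the remainder;
  hence X is at most A'/4 plus a multiple of B.\<close>

lemma Holder_prod_sum:
  fixes a :: "'i \<Rightarrow> 't \<Rightarrow> real"
  assumes J: "finite J" "J \<noteq> {}" and T: "finite T" and nn: "\<And>i t. i \<in> J \<Longrightarrow> t \<in> T \<Longrightarrow> 0 \<le> a i t"
  shows "(\<Sum>t\<in>T. \<Prod>i\<in>J. a i t powr (1 / card J)) \<le> (\<Prod>i\<in>J. (\<Sum>t\<in>T. a i t) powr (1 / card J))"
proof (cases "\<exists>i\<in>J. (\<Sum>t\<in>T. a i t) = 0")
  case True
  then obtain i where i: "i \<in> J" "(\<Sum>t\<in>T. a i t) = 0" by blast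
  then have "\<forall>t\<in>T. a i t = 0" using nn T by (subst (asm) sum_nonneg_eq_0_iff) auto
  then have "(\<Prod>i\<in>J. a i t powr (1 / card J)) = 0" if "t \<in> T" for t
    using i J that by (auto intro!: prod_zero bexI[of _ i])
  then show ?thesis by (simp add: prod_nonneg)
next
  case False
  define A where "A i = (\<Sum>t\<in>T. a i t)" for i
  define n where "n = card J"
  have n: "n > 0" using J by (auto simp: n_def card_gt_0_iff)
  have A: "A i > 0" if "i \<in> J" for i
    using False that nn by (metis A_def less_eq_real_def sum_nonneg)
  define C where "C = (\<Prod>i\<in>J. A i powr (1 / n))"
  have "(\<Sum>t\<in>T. \<Prod>i\<in>J. a i t powr (1 / n)) = C * (\<Sum>t\<in>T. \<Prod>i\<in>J. (a i t / A i) powr (1 / n))"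
  proof -
    have "(\<Prod>i\<in>J. a i t powr (1 / n)) = C * (\<Prod>i\<in>J. (a i t / A i) powr (1 / n))" if "t \<in> T" for t
      unfolding C_def prod.distrib[symmetric]
      by (rule prod.cong, simp) (use A nn that in \<open>fastforce simp: powr_divide\<close>)
    then show ?thesis by (simp add: sum_distrib_left)
  qed
  \<comment> \<open>With every family divided by its own sum \<open>A i\<close>, the
    arithmetic-geometric mean inequality at each \<open>t\<close> adds up to the constant 1.\<close>
  also have "\<dots> \<le> C * (\<Sum>t\<in>T. \<Sum>i\<in>J. (a i t / A i) / n)"
  proof (intro mult_left_mono sum_mono)
    fix t assume t: "t \<in> T"
    have "(\<Prod>i\<in>J. a i t / A i) powr (1 / n) \<le> (\<Sum>i\<in>J. (a i t / A i) / n)"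
      unfolding n_def by (rule arith_geom_mean) (use J A nn t in \<open>auto simp: less_imp_le\<close>)
    then show "(\<Prod>i\<in>J. (a i t / A i) powr (1 / n)) \<le> (\<Sum>i\<in>J. (a i t / A i) / n)"
      using A nn t by (simp add: prod_powr_distrib less_imp_le)
  qed (auto simp: C_def intro!: prod_nonneg)
  also have "(\<Sum>t\<in>T. \<Sum>i\<in>J. (a i t / A i) / n) = (\<Sum>i\<in>J. A i / A i / n)"
    unfolding A_def sum_divide_distrib by (rule sum.swap)
  also have "\<dots> = (\<Sum>i\<in>J. 1 / n)" by (rule sum.cong) (use A in \<open>force+\<close>)
  also have "\<dots> = 1" using n by (simp add: n_def)
  finally show ?thesis by (simp add: C_def A_def n_def)
qed

text \<open>A partial sum is again a function of the whole index vector, constant in the summed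
  coordinate. Iterated sums therefore compose as operators of a single type and can be reordered
  freely.\<close>

definition csum :: "('i \<Rightarrow> nat) \<Rightarrow> 'i \<Rightarrow> (('i \<Rightarrow> nat) \<Rightarrow> real) \<Rightarrow> ('i \<Rightarrow> nat) \<Rightarrow> real" where
  "csum R i F k = (\<Sum>t<R i. F (k(i := t)))"

abbreviation lsum :: "('i \<Rightarrow> nat) \<Rightarrow> 'i list \<Rightarrow> (('i \<Rightarrow> nat) \<Rightarrow> real) \<Rightarrow> ('i \<Rightarrow> nat) \<Rightarrow> real" where
  "lsum R js \<equiv> foldr (csum R) js"

lemma csum_commute: "csum R i (csum R j F) = csum R j (csum R i F)"
proof (cases "i = j")
  case False
  then show ?thesis unfolding csum_def fun_eq_iff
    by (auto simp: fun_upd_twist[OF False] intro: sum.swap)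
qed simp

lemma lsum_csum: "lsum R js (csum R i F) = csum R i (lsum R js F)"
  by (induction js) (auto simp: csum_commute[of R i])

lemma lsum_remove1: "i \<in> set js \<Longrightarrow> lsum R (remove1 i js) (csum R i F) = lsum R js F"
  by (induction js) (auto simp: lsum_csum csum_commute[of R i])

lemma csum_mono: "(\<And>k. F k \<le> G k) \<Longrightarrow> csum R i F k \<le> csum R i G k"
  unfolding csum_def by (rule sum_mono) auto

lemma lsum_mono: "(\<And>k. F k \<le> G k) \<Longrightarrow> lsum R js F k \<le> lsum R js G k"
  by (induction js arbitrary: k) (auto intro: csum_mono)

lemma lsum_zero: "lsum R js (\<lambda>_. 0) = (\<lambda>_. 0)"
  by (induction js) (auto simp: csum_def)

lemma lsum_nonneg: "(\<And>k. 0 \<le> F k) \<Longrightarrow> 0 \<le> lsum R js F k"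
  using lsum_mono[of "\<lambda>_. 0" F R js k] by (simp add: lsum_zero)

lemma csum_indep: "csum R i F (k(i := t)) = csum R i F k"
  by (simp add: csum_def)

lemma lsum_indep:
  assumes "\<And>k t. F (k(i := t)) = F k"
  shows "lsum R js F (k(i := t)) = lsum R js F k"
proof (induction js arbitrary: k)
  case (Cons j js)
  have "csum R j (lsum R js F) (k(i := t)) = csum R j (lsum R js F) k"
  proof (cases "j = i")
    case False
    then have "k(i := t, j := s) = k(j := s, i := t)" for s by auto
    then show ?thesis unfolding csum_def[of R j "lsum R js F"] by (simp only: Cons)
  qed (simp add: csum_indep)
  then show ?case by (simp only: foldr.simps comp_def)
qed (simp add: assms)

text \<open>Bridge from the iterated form, suited to induction over directions, to a single finite
  sum over a window; \<open>k\<close> supplies the coordinates outside \<open>js\<close>.\<close>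

lemma lsum_PiE:
  assumes "distinct js"
  shows "lsum R js F k = (\<Sum>t\<in>PiE (set js) (\<lambda>j. {..<R j}). F (override_on k t (set js)))"
  using assms
proof (induction js arbitrary: k)
  case (Cons j js)
  let ?P = "PiE (set js) (\<lambda>j. {..<R j})"
  have inj: "inj_on (\<lambda>(y, g). g(j := y)) ({..<R j} \<times> ?P)"
    using Cons.prems by (intro inj_combinator) auto
  have "lsum R (j # js) F k = (\<Sum>s<R j. \<Sum>t\<in>?P. F (override_on (k(j := s)) t (set js)))"
    using Cons by (simp add: csum_def[of R j "lsum R js F"])
  also have "\<dots> = (\<Sum>(s,t)\<in>{..<R j} \<times> ?P. F (override_on (k(j := s)) t (set js)))"
    by (rule sum.cartesian_product)
  also have "\<dots> = (\<Sum>(s,t)\<in>{..<R j} \<times> ?P. F (override_on k (t(j := s)) (insert j (set js))))"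
    by (rule sum.cong) (use Cons.prems in \<open>auto intro!: arg_cong[of _ _ F] simp: override_on_def fun_eq_iff\<close>)
  also have "\<dots> = (\<Sum>t\<in>PiE (insert j (set js)) (\<lambda>j. {..<R j}). F (override_on k t (insert j (set js))))"
    unfolding PiE_insert_eq by (subst sum.reindex[OF inj]) (simp add: case_prod_unfold)
  finally show ?case by simp
qed simp

text \<open>Induction on the list of summed directions, with the exponent \<open>1 / m\<close> fixed
  throughout. In direction \<open>j\<close> the factor \<open>F j\<close> is constant and leaves the
  sum; exactly \<open>m\<close> factors with exponent \<open>1 / m\<close> remain, which is
  Hoelder's inequality. \<open>remove1\<close> records that each factor is summed in every direction
  but its own.\<close>

lemma Loomis_Whitney_lsum:
  fixes F :: "'i \<Rightarrow> ('i \<Rightarrow> nat) \<Rightarrow> real"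
  assumes I: "finite I" "card I = Suc m" "0 < m"
    and js: "distinct js" "set js \<subseteq> I"
    and nn: "\<And>i k. i \<in> I \<Longrightarrow> 0 \<le> F i k"
    and indep: "\<And>i k t. i \<in> I \<Longrightarrow> F i (k(i := t)) = F i k"
  shows "lsum R js (\<lambda>k. \<Prod>i\<in>I. F i k powr (1 / m)) k
       \<le> (\<Prod>i\<in>I. lsum R (remove1 i js) (F i) k powr (1 / m))"
  using js
proof (induction js arbitrary: k)
  case (Cons j js)
  let ?J = "I - {j}"
  have j: "j \<in> I" "j \<notin> set js" "distinct js" "set js \<subseteq> I" using Cons.prems by auto
  have cJ: "card ?J = m" using I j by simp
  have J: "finite ?J" "?J \<noteq> {}" using I cJ by (simp, metis card.empty less_irrefl)
  define a where "a i t = lsum R (remove1 i js) (F i) (k(j := t))" for i t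
  have ann: "0 \<le> a i t" if "i \<in> I" for i t
    unfolding a_def by (rule lsum_nonneg) (use nn that in auto)
  have aj: "a j t = lsum R js (F j) k" for t
    unfolding a_def using j by (simp add: remove1_idem lsum_indep indep)
  have "lsum R (j # js) (\<lambda>k. \<Prod>i\<in>I. F i k powr (1 / m)) k
      \<le> (\<Sum>t<R j. \<Prod>i\<in>I. a i t powr (1 / m))"
    using Cons.IH[OF j(3,4)] by (simp add: csum_def[of R j "lsum R js G" for G] a_def sum_mono)
  also have "\<dots> = (\<Sum>t<R j. lsum R js (F j) k powr (1 / m) * (\<Prod>i\<in>?J. a i t powr (1 / m)))"
    using I(1) j(1) by (simp add: prod.remove aj)
  also have "\<dots> = lsum R js (F j) k powr (1 / m) * (\<Sum>t<R j. (\<Prod>i\<in>?J. a i t powr (1 / m)))"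
    by (simp add: sum_distrib_left)
  also have "\<dots> \<le> lsum R js (F j) k powr (1 / m) * (\<Prod>i\<in>?J. (\<Sum>t<R j. a i t) powr (1 / m))"
    using Holder_prod_sum[OF J, of "{..<R j}" a] ann unfolding cJ by (intro mult_left_mono) auto
  also have "(\<Prod>i\<in>?J. (\<Sum>t<R j. a i t) powr (1 / m))
      = (\<Prod>i\<in>?J. lsum R (remove1 i (j # js)) (F i) k powr (1 / m))"
    by (rule prod.cong) (auto simp: a_def csum_def)
  also have "lsum R js (F j) k = lsum R (remove1 j (j # js)) (F j) k" by simp
  finally show ?case using I(1) j(1) by (simp add: prod.remove)
qed simp

text \<open>The value at \<open>k\<close> exceeds the value at any \<open>l\<close> by at most the
  total variation; averaging over \<open>l\<close> produces the term \<open>\<phi> j / R\<close>. It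
  stands in for a boundary value, since nothing vanishes at the ends of the window, and it is the
  origin of the mass in the final inequality.\<close>

lemma interval_point_le_variation:
  fixes \<phi> :: "nat \<Rightarrow> real"
  assumes k: "k < R" and nn: "\<And>j. 0 \<le> \<phi> j"
  shows "\<phi> k \<le> (\<Sum>j<R. (if Suc j < R then \<bar>\<phi> (Suc j) - \<phi> j\<bar> else 0) + \<phi> j / R)"
proof -
  define V where "V = (\<Sum>j<R. if Suc j < R then \<bar>\<phi> (Suc j) - \<phi> j\<bar> else 0)"
  have le: "\<bar>\<phi> b - \<phi> a\<bar> \<le> V" if "a \<le> b" "b < R" for a b
  proof -
    have "\<bar>\<phi> b - \<phi> a\<bar> = \<bar>\<Sum>j=a..<b. \<phi> (Suc j) - \<phi> j\<bar>"
      by (subst sum_Suc_diff'[OF that(1)]) simp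
    also have "\<dots> \<le> (\<Sum>j=a..<b. \<bar>\<phi> (Suc j) - \<phi> j\<bar>)" by (rule sum_abs)
    also have "\<dots> = (\<Sum>j=a..<b. if Suc j < R then \<bar>\<phi> (Suc j) - \<phi> j\<bar> else 0)"
      by (rule sum.cong) (use that in auto)
    also have "\<dots> \<le> V" unfolding V_def by (rule sum_mono2) (use that in auto)
    finally show ?thesis .
  qed
  have "\<phi> k \<le> V + \<phi> l" if "l < R" for l
    using le[of k l] le[of l k] that k by (cases "k \<le> l") (auto simp: abs_le_iff)
  then have "(\<Sum>l<R. \<phi> k) \<le> (\<Sum>l<R. V + \<phi> l)" by (intro sum_mono) auto
  then have "R * \<phi> k \<le> R * V + (\<Sum>l<R. \<phi> l)" by (simp add: sum.distrib)
  then have "\<phi> k \<le> V + (\<Sum>l<R. \<phi> l) / R" using k by (simp add: field_simps)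
  then show ?thesis by (simp add: V_def sum.distrib sum_divide_distrib)
qed

text \<open>Mean value theorem, with the intermediate point replaced by both end points to keep the
  bound symmetric. The end point 0 is treated apart because the power is differentiated only at
  positive points.\<close>

lemma abs_powr_diff_le:
  fixes x y g :: real
  assumes "0 \<le> x" "0 \<le> y" "1 \<le> g"
  shows "\<bar>x powr g - y powr g\<bar> \<le> g * (x powr (g - 1) + y powr (g - 1)) * \<bar>x - y\<bar>"
proof -
  have main: "b powr g - a powr g \<le> g * (b powr (g - 1) + a powr (g - 1)) * (b - a)"
    if ab: "0 \<le> a" "a < b" for a b :: real
  proof (cases "a = 0")
    case True
    have "b powr g = b powr (g - 1) * b" using ab True by (simp add: powr_diff)
    also have "\<dots> \<le> g * (b powr (g - 1) * b)"
      using assms(3) ab mult_right_mono[of 1 g "b powr (g - 1) * b"] by simp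
    finally show ?thesis using True assms by (simp add: algebra_simps)
  next
    case False
    with ab have a: "0 < a" by simp
    have "\<exists>z. a < z \<and> z < b \<and> b powr g - a powr g = (b - a) * (g * z powr (g - 1))"
    proof (rule MVT2[OF ab(2)])
      fix z assume "a \<le> z" "z \<le> b"
      then show "((\<lambda>z. z powr g) has_real_derivative g * z powr (g - 1)) (at z)"
        using a by (auto intro!: derivative_eq_intros simp: powr_diff)
    qed
    then obtain z where z: "a < z" "z < b" "b powr g - a powr g = (b - a) * (g * z powr (g - 1))" by blast
    have "z powr (g - 1) \<le> b powr (g - 1) + a powr (g - 1)"
      using powr_mono2[of "g - 1" z b] z a assms by (smt (verit) powr_ge_zero)
    then have "(b - a) * (g * z powr (g - 1)) \<le> (b - a) * (g * (b powr (g - 1) + a powr (g - 1)))"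
      using ab assms by (intro mult_left_mono) auto
    then show ?thesis using z by (simp add: algebra_simps)
  qed
  show ?thesis
  proof (cases x y rule: linorder_cases)
    case less
    then have "x powr g \<le> y powr g" using assms by (simp add: powr_mono2)
    then show ?thesis using main[of x y] less assms by (simp add: algebra_simps)
  next
    case greater
    then have "y powr g \<le> x powr g" using assms by (simp add: powr_mono2)
    then show ?thesis using main[of y x] greater assms by (simp add: algebra_simps)
  qed simp
qed

lemma lsum_mono_window:
  assumes "distinct js" "\<And>k. (\<And>i. i \<in> set js \<Longrightarrow> k i < R i) \<Longrightarrow> F k \<le> G k"
  shows "lsum R js F k \<le> lsum R js G k"
  unfolding lsum_PiE[OF assms(1)]
  by (intro sum_mono assms(2)) (auto simp: PiE_def Pi_def)

lemma lsum_Cauchy_Schwarz: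
  assumes "distinct js"
  shows "lsum R js (\<lambda>k. F k * G k) k
    \<le> sqrt (lsum R js (\<lambda>k. (F k)\<^sup>2) k) * sqrt (lsum R js (\<lambda>k. (G k)\<^sup>2) k)"
  unfolding lsum_PiE[OF assms] real_sqrt_mult[symmetric]
  by (intro real_le_rsqrt Cauchy_Schwarz_ineq_sum)

text \<open>The shift maps the guarded indices injectively back into the window, so only nonnegative
  terms are lost.\<close>

lemma lsum_shift_le:
  assumes "i \<in> set js" and nn: "\<And>k. 0 \<le> H k"
  shows "lsum R js (\<lambda>k. if Suc (k i) < R i then H (k(i := Suc (k i))) else 0) k \<le> lsum R js H k"
  unfolding lsum_remove1[OF assms(1), symmetric]
proof (rule lsum_mono)
  fix k
  have "(\<Sum>t<R i. if Suc t < R i then H (k(i := Suc t)) else 0)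
      = (\<Sum>t\<in>{t. Suc t < R i}. H (k(i := Suc t)))"
    by (rule sum.mono_neutral_cong_right) auto
  also have "\<dots> = (\<Sum>t\<in>Suc ` {t. Suc t < R i}. H (k(i := t)))"
    by (subst sum.reindex) auto
  also have "\<dots> \<le> (\<Sum>t<R i. H (k(i := t)))"
    by (rule sum_mono2) (auto simp: nn)
  finally show "csum R i (\<lambda>k. if Suc (k i) < R i then H (k(i := Suc (k i))) else 0) k \<le> csum R i H k"
    by (simp add: csum_def cong: if_cong)
qed

text \<open>Loomis--Whitney is applied to \<open>\<phi> = |f|^\<gamma>\<close>, bounded in each
  direction by its variation along a line. The exponent is tuned twice:
  \<open>\<gamma> * (d + 1) / d = p\<close> lets the \<open>d + 1\<close> factors with exponent
  \<open>1 / d\<close> reproduce the potential, and \<open>\<gamma> - 1 = p / 2\<close> lets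
  Cauchy--Schwarz return \<open>sqrt X\<close> times an l2 norm. Then \<open>X^(2d)\<close> is at
  most \<open>X^(d+1)\<close> times the product, and powers of \<open>X\<close> cancel.\<close>

theorem discrete_Gagliardo_Nirenberg:
  fixes f :: "('i \<Rightarrow> nat) \<Rightarrow> 'b::real_normed_vector" and d :: nat and R js k
  defines "p \<equiv> 2 * (real d + 1) / (real d - 1)" and "\<gamma> \<equiv> 2 * real d / (real d - 1)"
  defines "X \<equiv> lsum R js (\<lambda>k. norm (f k) powr p) k"
    and "Z \<equiv> lsum R js (\<lambda>k. (norm (f k))\<^sup>2) k"
    and "Y \<equiv> \<lambda>i. lsum R js (\<lambda>k. if Suc (k i) < R i then (norm (f (k(i := Suc (k i))) - f k))\<^sup>2 else 0) k"
  assumes js: "distinct js" and len: "length js = Suc d" and d: "2 \<le> d"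
  shows "X ^ (d - 1) \<le> (\<Prod>i\<in>set js. (2 * \<gamma> * sqrt (Y i) + sqrt Z / R i)\<^sup>2)"
proof -
  let ?I = "set js"
  have card: "card ?I = Suc d" using js len by (simp add: distinct_card)
  have g: "\<gamma> = p / 2 + 1" "1 \<le> \<gamma>" and p: "\<gamma> * ((real d + 1) / d) = p"
    using d by (auto simp: \<gamma>_def p_def field_simps)
  define S where "S G = lsum R js G k" for G
  have S: "S G = (\<Sum>t\<in>PiE (set js) (\<lambda>j. {..<R j}). G (override_on k t (set js)))" for G
    unfolding S_def by (rule lsum_PiE[OF js])
  define \<phi> where "\<phi> k = norm (f k) powr \<gamma>" for k
  define sh where "sh i k = k(i := Suc (k i))" for i :: 'i and k :: "'i \<Rightarrow> nat"
  define a where "a i k = (if Suc (k i) < R i then \<bar>\<phi> (sh i k) - \<phi> k\<bar> else 0) + \<phi> k / R i" for i k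
  define D where "D i k = (if Suc (k i) < R i then norm (f (sh i k) - f k) else 0)" for i k
  define W where "W i = 2 * \<gamma> * sqrt (Y i) + sqrt Z / R i" for i
  have X0: "0 \<le> X" unfolding X_def by (rule lsum_nonneg) auto
  have Z0: "0 \<le> Z" unfolding Z_def by (rule lsum_nonneg) auto
  have Y0: "0 \<le> Y i" for i unfolding Y_def by (rule lsum_nonneg) auto
  have W0: "0 \<le> W i" for i using g Y0 Z0 by (auto simp: W_def intro!: add_nonneg_nonneg mult_nonneg_nonneg)
  have a0: "0 \<le> a i k" for i k by (auto simp: a_def \<phi>_def)
  have YD: "S (\<lambda>k. (D i k)\<^sup>2) = Y i" for i
    unfolding S_def Y_def D_def sh_def by (rule arg_cong[of _ _ "\<lambda>F. lsum R js F k"]) auto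
  have sq: "(x powr (p / 2))\<^sup>2 = x powr p" if "0 \<le> x" for x :: real
    using that by (simp add: power2_eq_square flip: powr_add)
  have Sa: "S (a i) \<le> sqrt X * W i" if i: "i \<in> ?I" for i
  proof -
    let ?u = "\<lambda>k. if Suc (k i) < R i then norm (f (sh i k)) powr (p / 2) else 0"
    let ?v = "\<lambda>k. norm (f k) powr (p / 2)"
    have "a i k \<le> \<gamma> * (?u k * D i k) + \<gamma> * (?v k * D i k) + ?v k * norm (f k) / R i" for k
    proof -
      have "\<phi> k = ?v k * norm (f k)" unfolding \<phi>_def g(1) by (simp add: powr_add)
      moreover have "\<bar>\<phi> (sh i k) - \<phi> k\<bar> \<le> \<gamma> * (norm (f (sh i k)) powr (p / 2) + ?v k) * norm (f (sh i k) - f k)"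
      proof -
        have "\<bar>\<phi> (sh i k) - \<phi> k\<bar> \<le> \<gamma> * (norm (f (sh i k)) powr (\<gamma> - 1) + norm (f k) powr (\<gamma> - 1))
            * \<bar>norm (f (sh i k)) - norm (f k)\<bar>"
          unfolding \<phi>_def by (rule abs_powr_diff_le) (use g in auto)
        also have "\<dots> \<le> \<gamma> * (norm (f (sh i k)) powr (\<gamma> - 1) + norm (f k) powr (\<gamma> - 1)) * norm (f (sh i k) - f k)"
          by (intro mult_left_mono norm_triangle_ineq3) (use g in auto)
        finally show ?thesis using g(1) by simp
      qed
      ultimately show ?thesis by (auto simp: a_def D_def algebra_simps)
    qed
    then have "S (a i) \<le> S (\<lambda>k. \<gamma> * (?u k * D i k) + \<gamma> * (?v k * D i k) + ?v k * norm (f k) / R i)"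
      unfolding S_def by (intro lsum_mono)
    also have "\<dots> = \<gamma> * S (\<lambda>k. ?u k * D i k) + \<gamma> * S (\<lambda>k. ?v k * D i k) + S (\<lambda>k. ?v k * norm (f k)) / R i"
      unfolding S by (simp only: sum.distrib sum_distrib_left sum_divide_distrib)
    also have "\<dots> \<le> \<gamma> * (sqrt X * sqrt (Y i)) + \<gamma> * (sqrt X * sqrt (Y i)) + (sqrt X * sqrt Z) / R i"
    proof (intro add_mono mult_left_mono divide_right_mono)
      have "S (\<lambda>k. ?u k * D i k) \<le> sqrt (S (\<lambda>k. (?u k)\<^sup>2)) * sqrt (Y i)"
        unfolding YD[symmetric] unfolding S_def by (rule lsum_Cauchy_Schwarz[OF js])
      also have "(\<lambda>k. (?u k)\<^sup>2) = (\<lambda>k. if Suc (k i) < R i then norm (f (sh i k)) powr p else 0)"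
        by (auto simp: sq)
      also have "S \<dots> \<le> X" unfolding S_def X_def sh_def by (rule lsum_shift_le[OF i]) auto
      then have "sqrt (S (\<lambda>k. if Suc (k i) < R i then norm (f (sh i k)) powr p else 0)) * sqrt (Y i)
        \<le> sqrt X * sqrt (Y i)" using Y0 by (intro mult_right_mono) auto
      finally show "S (\<lambda>k. ?u k * D i k) \<le> sqrt X * sqrt (Y i)" .
      have "S (\<lambda>k. ?v k * D i k) \<le> sqrt (S (\<lambda>k. (?v k)\<^sup>2)) * sqrt (Y i)"
        unfolding YD[symmetric] unfolding S_def by (rule lsum_Cauchy_Schwarz[OF js])
      then show "S (\<lambda>k. ?v k * D i k) \<le> sqrt X * sqrt (Y i)" by (simp add: sq S_def X_def)
      have "S (\<lambda>k. ?v k * norm (f k)) \<le> sqrt (S (\<lambda>k. (?v k)\<^sup>2)) * sqrt Z"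
        unfolding Z_def S_def by (rule lsum_Cauchy_Schwarz[OF js])
      then show "S (\<lambda>k. ?v k * norm (f k)) \<le> sqrt X * sqrt Z" by (simp add: sq S_def X_def)
    qed (use g in auto)
    also have "\<dots> = sqrt X * W i" by (simp add: W_def algebra_simps)
    finally show ?thesis .
  qed
  have "X \<le> S (\<lambda>k. \<Prod>i\<in>?I. csum R i (a i) k powr (1 / d))"
    unfolding X_def S_def
  proof (rule lsum_mono_window[OF js])
    fix k assume k: "\<And>i. i \<in> ?I \<Longrightarrow> k i < R i"
    have le: "\<phi> k \<le> csum R i (a i) k" if "i \<in> ?I" for i
      using interval_point_le_variation[OF k[OF that], of "\<lambda>t. \<phi> (k(i := t))"]
      by (simp add: csum_def a_def sh_def \<phi>_def cong: if_cong)
    have "norm (f k) powr p = (\<Prod>i\<in>?I. \<phi> k powr (1 / d))"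
    proof -
      have "(\<Prod>i\<in>?I. \<phi> k powr (1 / d)) = (\<phi> k powr (1 / d)) ^ Suc d" by (simp add: card)
      also have "\<dots> = norm (f k) powr (\<gamma> * ((real d + 1) / d))"
        unfolding \<phi>_def by (cases "f k = 0") (simp_all add: powr_power powr_powr add.commute mult.commute del: power_Suc)
      finally show ?thesis by (simp only: p)
    qed
    also have "\<dots> \<le> (\<Prod>i\<in>?I. csum R i (a i) k powr (1 / d))"
      by (intro prod_mono conjI powr_mono2 le) (auto simp: \<phi>_def)
    finally show "norm (f k) powr p \<le> (\<Prod>i\<in>?I. csum R i (a i) k powr (1 / d))" .
  qed
  \<comment> \<open>Summing \<open>a i\<close> along its own direction gives a function independent
    of that coordinate, as Loomis--Whitney asks; \<open>lsum_remove1\<close> then completes the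
    remaining directions to the full sum.\<close>
  also have "\<dots> \<le> (\<Prod>i\<in>?I. lsum R (remove1 i js) (csum R i (a i)) k powr (1 / d))"
    unfolding S_def
    by (rule Loomis_Whitney_lsum)
       (use js card d in \<open>auto simp: csum_def a0 intro!: sum_nonneg\<close>)
  also have "\<dots> = (\<Prod>i\<in>?I. S (a i) powr (1 / d))"
    by (rule prod.cong) (auto simp: lsum_remove1 S_def)
  also have "\<dots> \<le> (\<Prod>i\<in>?I. (sqrt X * W i) powr (1 / d))"
    by (intro prod_mono conjI powr_mono2 Sa) (auto simp: S_def intro!: lsum_nonneg a0)
  finally have main: "X \<le> (\<Prod>i\<in>?I. (sqrt X * W i) powr (1 / d))" .
  show ?thesis
  proof (cases "X = 0")
    case True
    then show ?thesis using d by (auto simp: power_0_left intro!: prod_nonneg)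
  next
    case False
    then have X: "0 < X" using X0 by simp
    have "X ^ (2 * d) \<le> (\<Prod>i\<in>?I. (sqrt X * W i) powr (1 / d)) ^ (2 * d)"
      by (rule power_mono[OF main X0])
    also have "\<dots> = (\<Prod>i\<in>?I. (sqrt X * W i)\<^sup>2)"
      unfolding prod_power_distrib
    proof (rule prod.cong)
      fix i
      have "0 \<le> sqrt X * W i" using W0 X by auto
      moreover have "(x powr (1 / d)) ^ (2 * d) = x\<^sup>2" if "0 \<le> x" for x :: real
        using d that by (cases "x = 0") (simp_all add: powr_power)
      ultimately show "((sqrt X * W i) powr (1 / d)) ^ (2 * d) = (sqrt X * W i)\<^sup>2" by blast
    qed simp
    also have "\<dots> = X ^ Suc d * (\<Prod>i\<in>?I. (W i)\<^sup>2)"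
      using X by (simp add: power_mult_distrib prod.distrib card)
    also have "X ^ (2 * d) = X ^ Suc d * X ^ (d - 1)"
      using d by (simp add: mult_2 flip: power_add power_Suc)
    finally show ?thesis using X by (simp add: W_def)
  qed
qed

section \<open>From cube averages to the Gagliardo--Nirenberg inequality\<close>

lemma set_integrable_square:
  fixes f :: "'a \<Rightarrow> 'b::{banach, second_countable_topology}"
  assumes A: "A \<in> sets M" "emeasure M A < \<infinity>" and f[measurable]: "f \<in> borel_measurable M"
    and i2: "integrable M (\<lambda>x. (norm (f x))\<^sup>2)"
  shows "set_integrable M A f"
  unfolding set_integrable_def
proof (rule Bochner_Integration.integrable_bound)
  show "integrable M (\<lambda>x. indicator A x + (norm (f x))\<^sup>2)"
    using A i2 by (intro Bochner_Integration.integrable_add) auto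
  have "t \<le> 1 + t\<^sup>2" for t :: real
  proof -
    have "0 \<le> (t - 1/2)\<^sup>2 + 3/4" by (intro add_nonneg_nonneg) auto
    then show ?thesis by (simp add: power2_eq_square algebra_simps)
  qed
  then show "AE x in M. norm (indicator A x *\<^sub>R f x) \<le> norm (indicator A x + (norm (f x))\<^sup>2)"
    by (intro always_eventually) (auto simp: indicator_def abs_of_nonneg add_nonneg_nonneg)
qed (use A in measurable)

text \<open>The integral of \<open>(f - c)^2\<close> over \<open>A\<close> is nonnegative for every
  \<open>c\<close>; the optimal \<open>c\<close> is the mean of \<open>f\<close>.\<close>

lemma set_integral_Cauchy_Schwarz:
  fixes f :: "'a \<Rightarrow> real"
  assumes A: "A \<in> sets M" "emeasure M A < \<infinity>" and f[measurable]: "f \<in> borel_measurable M"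
    and i2: "integrable M (\<lambda>x. (f x)\<^sup>2)"
  shows "(LINT x:A|M. f x)\<^sup>2 \<le> measure M A * (LINT x:A|M. (f x)\<^sup>2)"
proof -
  have i1: "set_integrable M A f" using set_integrable_square[of A M f] A i2 by simp
  have iA: "set_integrable M A (\<lambda>x. (f x)\<^sup>2)"
    unfolding set_integrable_def using i2 A by (intro integrable_mult_indicator)
  have ic: "set_integrable M A (\<lambda>x. c)" for c :: real
    unfolding set_integrable_def using A by simp
  let ?I = "LINT x:A|M. f x" and ?J = "LINT x:A|M. (f x)\<^sup>2" and ?m = "measure M A"
  have *: "0 \<le> ?J - 2 * c * ?I + c\<^sup>2 * ?m" for c
  proof -
    have "0 \<le> (LINT x:A|M. (f x - c)\<^sup>2)"
      unfolding set_lebesgue_integral_def by (rule integral_nonneg_AE) auto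
    also have "(\<lambda>x. (f x - c)\<^sup>2) = (\<lambda>x. ((f x)\<^sup>2 - (2 * c) * f x) + c\<^sup>2)"
      by (simp add: power2_eq_square algebra_simps)
    also have "(LINT x:A|M. \<dots> x) = ?J - 2 * c * ?I + c\<^sup>2 * ?m"
      using i1 iA ic A
      by (simp add: set_integral_add set_integral_diff)
         (simp add: set_lebesgue_integral_def)
    finally show ?thesis .
  qed
  show ?thesis
  proof (cases "?m = 0")
    case True
    have "?I = 0"
    proof (rule ccontr)
      assume "?I \<noteq> 0"
      \<comment> \<open>With measure 0 the quadratic in \<open>c\<close> degenerates to an affine
        function, and this \<open>c\<close> gives it the value -1.\<close>
      then show False using *[of "(?J + 1) / (2 * ?I)"] True by (simp add: field_simps)
    qed
    then show ?thesis using True by simp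
  next
    case False
    then have m: "?m > 0" by (simp add: less_le)
    have "0 \<le> ?m * (?J - 2 * (?I / ?m) * ?I + (?I / ?m)\<^sup>2 * ?m)"
      using *[of "?I / ?m"] m by simp
    also have "\<dots> = ?m * ?J - ?I\<^sup>2" using m by (simp add: field_simps power2_eq_square)
    finally show ?thesis by simp
  qed
qed

text \<open>A box condition splits into coordinates, so counting the grid boxes around a point
  reduces to the one-dimensional counts below.\<close>

lemma sum_PiE_indicator:
  fixes P :: "'i \<Rightarrow> nat \<Rightarrow> bool"
  assumes "finite I"
  shows "(\<Sum>t\<in>PiE I (\<lambda>i. {..<R i}). of_bool (\<forall>i\<in>I. P i (t i))) = (\<Prod>i\<in>I. real (card {t. t < R i \<and> P i t}))"
proof -
  have eq: "of_bool (\<forall>i\<in>I. P i (t i)) = (\<Prod>i\<in>I. of_bool (P i (t i)) :: real)" for t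
    using assms by (induction I) auto
  have "(\<Prod>i\<in>I. \<Sum>s<R i. of_bool (P i s) :: real) = (\<Prod>i\<in>I. real (card {t. t < R i \<and> P i t}))"
  proof (intro prod.cong refl)
    fix i
    have "{..<R i} \<inter> {s. P i s} = {t. t < R i \<and> P i t}" by auto
    then show "(\<Sum>s<R i. of_bool (P i s) :: real) = real (card {t. t < R i \<and> P i t})"
      by (simp add: sum.If_cases of_bool_def)
  qed
  then show ?thesis unfolding eq using assms by (subst prod_sum_PiE[symmetric]) auto
qed

lemma card_grid_cell:
  fixes a h x :: real
  and R :: nat
  assumes "0 < h" "a \<le> x" "x < a + h * real R"
  shows "card {t. t < R \<and> a + h * real t \<le> x \<and> x < a + h * real t + h} = 1"
proof -
  define m where "m = nat \<lfloor>(x - a) / h\<rfloor>"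
  have 0: "0 \<le> (x - a) / h" using assms by simp
  have m: "real m \<le> (x - a) / h" "(x - a) / h < real m + 1"
    unfolding m_def using 0 by (auto simp: of_nat_nat)
  have "{t. t < R \<and> a + h * real t \<le> x \<and> x < a + h * real t + h} = {m}"
  proof (intro set_eqI iffI; clarsimp)
    fix t assume "a + h * real t \<le> x" "x < a + h * real t + h"
    then have "real t \<le> (x - a) / h" "(x - a) / h < real t + 1" using assms by (auto simp: field_simps)
    with m show "t = m" by linarith
  next
    have "(x - a) / h < R" using assms by (auto simp: field_simps)
    with m have "real m < real R" by linarith
    then show "m < R \<and> a + h * real m \<le> x \<and> x < a + h * real m + h"
      using m assms by (auto simp: field_simps)
  qed
  then show ?thesis by simp
qed

lemma card_grid_interval_le:
  fixes a h x :: real and j :: nat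
  assumes "0 < h"
  shows "card {t. t < R \<and> a + h * real t < x \<and> x < a + h * real t + real j * h} \<le> j"
proof -
  let ?S = "{t. t < R \<and> a + h * real t < x \<and> x < a + h * real t + real j * h}"
  have bd: "real t < (x - a) / h" "(x - a) / h < real t + real j" if "t \<in> ?S" for t
    using that assms by (auto simp: field_simps)
  show ?thesis
  proof (cases "?S = {}")
    case False
    define m where "m = Min ?S"
    have fin: "finite ?S" by auto
    have m: "m \<in> ?S" "\<And>t. t \<in> ?S \<Longrightarrow> m \<le> t" unfolding m_def using Min_in[OF fin False] Min_le[OF fin] by blast+
    have "?S \<subseteq> {m..<m + j}"
    proof
      fix t assume t: "t \<in> ?S"
      show "t \<in> {m..<m + j}" using bd[OF t] bd[OF m(1)] m(2)[OF t] by (simp; linarith)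
    qed
    then have "card ?S \<le> card {m..<m + j}" by (rule card_mono[rotated]) simp
    then show ?thesis by simp
  next
    case True
    show ?thesis unfolding True by simp
  qed
qed

text \<open>The cube has its lower corner at \<open>z\<close>: such cubes fit a grid indexed by
  natural numbers, and near the lower end of the strip they stay inside it.\<close>

definition avg :: "real \<Rightarrow> ('a::euclidean_space \<Rightarrow> 'b::{banach,second_countable_topology}) \<Rightarrow> 'a \<Rightarrow> 'b" where
  "avg h u z = (LINT \<zeta>:box z (z + h *\<^sub>R One)|lborel. u \<zeta>) /\<^sub>R h ^ DIM('a)"

lemma emeasure_box_finite: "emeasure lborel (box a (b::'a::euclidean_space)) < top"
  using emeasure_bounded_finite[of "box a b"] by simp

lemma measure_box_lborel:
  fixes a c :: "'a::euclidean_space"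
  assumes "\<And>b. b \<in> Basis \<Longrightarrow> 0 \<le> c \<bullet> b"
  shows "measure lborel (box a (a + c)) = (\<Prod>b\<in>Basis. c \<bullet> b)"
  using assms by (subst measure_lborel_box) (auto simp: inner_add_left)

text \<open>Boxes that are \<open>w b\<close> cells wide, one at each grid point, cover any point at
  most as often as the product of the widths says. All widths are 1 for the function itself; one
  width is 2 for a derivative.\<close>

lemma sum_integral_grid_boxes_le:
  fixes F :: "'a::euclidean_space \<Rightarrow> real" and w :: "'a \<Rightarrow> nat"
  assumes h: "0 < h" and F: "integrable lborel F" "\<And>z. 0 \<le> F z"
    and z: "\<And>t. z t = z0 + h *\<^sub>R (\<Sum>b\<in>Basis. real (t b) *\<^sub>R b)"
  shows "(\<Sum>t\<in>PiE Basis (\<lambda>b. {..<R b}).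
            LINT \<zeta>:box (z t) (z t + h *\<^sub>R (\<Sum>b\<in>Basis. real (w b) *\<^sub>R b))|lborel. F \<zeta>)
       \<le> real (\<Prod>b\<in>Basis. w b) * (LINT \<zeta>|lborel. F \<zeta>)"
proof -
  let ?P = "PiE Basis (\<lambda>b. {..<R b})"
  let ?B = "\<lambda>t. box (z t) (z t + h *\<^sub>R (\<Sum>b\<in>Basis. real (w b) *\<^sub>R b))"
  have int: "integrable lborel (\<lambda>\<zeta>. indicator (?B t) \<zeta> *\<^sub>R F \<zeta>)" for t
    by (rule integrable_mult_indicator) (use F in auto)
  have "(\<Sum>t\<in>?P. LINT \<zeta>:?B t|lborel. F \<zeta>) = (LINT \<zeta>|lborel. (\<Sum>t\<in>?P. indicator (?B t) \<zeta> *\<^sub>R F \<zeta>))"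
    unfolding set_lebesgue_integral_def
    by (rule Bochner_Integration.integral_sum[symmetric]) (rule int)
  also have "\<dots> \<le> (LINT \<zeta>|lborel. real (\<Prod>b\<in>Basis. w b) * F \<zeta>)"
  proof (rule integral_mono)
    fix \<zeta>
    have "(\<Sum>t\<in>?P. indicator (?B t) \<zeta> *\<^sub>R F \<zeta>) = (\<Sum>t\<in>?P. indicator (?B t) \<zeta>) * F \<zeta>"
      by (simp add: sum_distrib_right)
    also have "(\<Sum>t\<in>?P. indicator (?B t) \<zeta>)
        = (\<Sum>t\<in>?P. of_bool (\<forall>b\<in>Basis. z0 \<bullet> b + h * real (t b) < \<zeta> \<bullet> b \<and> \<zeta> \<bullet> b < z0 \<bullet> b + h * real (t b) + real (w b) * h))"
      by (rule sum.cong) (auto simp: indicator_def mem_box z inner_add_left algebra_simps)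
    also have "\<dots> = (\<Prod>b\<in>Basis. real (card {t. t < R b \<and> z0 \<bullet> b + h * real t < \<zeta> \<bullet> b \<and> \<zeta> \<bullet> b < z0 \<bullet> b + h * real t + real (w b) * h}))"
      by (rule sum_PiE_indicator) simp
    also have "\<dots> \<le> (\<Prod>b\<in>Basis. real (w b))"
      by (intro prod_mono conjI) (use card_grid_interval_le[OF h] in auto)
    finally show "(\<Sum>t\<in>?P. indicator (?B t) \<zeta> *\<^sub>R F \<zeta>) \<le> real (\<Prod>b\<in>Basis. w b) * F \<zeta>"
      using F(2) by (auto intro: mult_right_mono)
  qed (use int F in auto)
  finally show ?thesis by simp
qed

lemma norm_avg_square_le:
  fixes u :: "'a::euclidean_space \<Rightarrow> complex"
  assumes h: "0 < h" and [measurable]: "u \<in> borel_measurable borel"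
    and u2: "integrable lborel (\<lambda>z. (norm (u z))\<^sup>2)"
  shows "(norm (avg h u z))\<^sup>2 \<le> (LINT \<zeta>:box z (z + h *\<^sub>R One)|lborel. (norm (u \<zeta>))\<^sup>2) / h ^ DIM('a)"
proof -
  let ?B = "box z (z + h *\<^sub>R One)" and ?n = "DIM('a)"
  have m: "measure lborel ?B = h ^ ?n" using h by (subst measure_box_lborel) auto
  have "norm (LINT \<zeta>:?B|lborel. u \<zeta>) \<le> (LINT \<zeta>:?B|lborel. norm (u \<zeta>))"
    by (rule set_integral_norm_bound) (intro set_integrable_square, use u2 in \<open>auto simp: emeasure_box_finite\<close>)
  then have "(norm (LINT \<zeta>:?B|lborel. u \<zeta>))\<^sup>2 \<le> (LINT \<zeta>:?B|lborel. norm (u \<zeta>))\<^sup>2"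
    by (intro power_mono) auto
  also have "\<dots> \<le> h ^ ?n * (LINT \<zeta>:?B|lborel. (norm (u \<zeta>))\<^sup>2)"
    unfolding m[symmetric] by (intro set_integral_Cauchy_Schwarz) (use u2 in \<open>auto simp: emeasure_box_finite\<close>)
  finally have "(norm (LINT \<zeta>:?B|lborel. u \<zeta>))\<^sup>2 / (h ^ ?n)\<^sup>2
      \<le> h ^ ?n * (LINT \<zeta>:?B|lborel. (norm (u \<zeta>))\<^sup>2) / (h ^ ?n)\<^sup>2"
    by (intro divide_right_mono) auto
  then show ?thesis
    using h by (simp add: avg_def power_divide power_mult_distrib field_simps power2_eq_square)
qed

text \<open>The averages \<open>f t\<close> obey the discrete inequality with \<open>Z\<close> at
  most \<open>U / h^(d+1)\<close> and \<open>Y b\<close> at most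
  \<open>4 * \<Gamma> b * h^2 / h^(d+1)\<close>. Since \<open>(h^(d+1))^(d-1)\<close> distributes as
  one factor \<open>h^(d-1)\<close> to each of the \<open>d + 1\<close> directions, every power of
  \<open>h\<close> disappears: this is criticality. Differences are assumed only for boxes inside
  the slab between 0 and \<open>L\<close>, because the function will be cut off outside one
  period.\<close>

lemma grid_Gagliardo_Nirenberg:
  fixes u :: "'a::euclidean_space \<Rightarrow> complex" and g :: "'a \<Rightarrow> 'a \<Rightarrow> complex"
    and R :: "'a \<Rightarrow> nat" and d :: nat and h L :: real
  defines "p \<equiv> 2 * (real d + 1) / (real d - 1)" and "\<gamma> \<equiv> 2 * real d / (real d - 1)"
  assumes d: "2 \<le> d" "DIM('a) = Suc d" and e: "e \<in> Basis"
    and meas[measurable]: "u \<in> borel_measurable borel" "\<And>b. g b \<in> borel_measurable borel"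
    and u2: "integrable lborel (\<lambda>z. (norm (u z))\<^sup>2)"
    and g2: "\<And>b. b \<in> Basis \<Longrightarrow> integrable lborel (\<lambda>z. (norm (g b z))\<^sup>2)"
    and diff: "\<And>b h a. \<lbrakk>b \<in> Basis; 0 < h; 0 \<le> a \<bullet> e; (a + h *\<^sub>R One + h *\<^sub>R b) \<bullet> e \<le> L\<rbrakk> \<Longrightarrow>
        norm ((LINT z:box (a + h *\<^sub>R b) (a + h *\<^sub>R b + h *\<^sub>R One)|lborel. u z) - (LINT z:box a (a + h *\<^sub>R One)|lborel. u z))
        \<le> h * (LINT z:box a (a + h *\<^sub>R One + h *\<^sub>R b)|lborel. norm (g b z))"
    and h: "0 < h" and R: "\<And>b. b \<in> Basis \<Longrightarrow> 0 < R b"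
    and z0: "0 \<le> z0 \<bullet> e" "z0 \<bullet> e + h * R e \<le> L"
  shows "(h ^ Suc d * (\<Sum>t\<in>PiE Basis (\<lambda>b. {..<R b}).
            norm (avg h u (z0 + h *\<^sub>R (\<Sum>b\<in>Basis. real (t b) *\<^sub>R b))) powr p)) ^ (d - 1)
       \<le> (\<Prod>b\<in>Basis. (4 * \<gamma> * sqrt (LINT z|lborel. (norm (g b z))\<^sup>2)
                + sqrt (LINT z|lborel. (norm (u z))\<^sup>2) / (h * R b))\<^sup>2)"
proof -
  obtain js :: "'a list" where js: "set js = Basis" "distinct js"
    using finite_distinct_list[OF finite_Basis] by blast
  have len: "length js = Suc d" using js d by (metis distinct_card)
  let ?P = "PiE Basis (\<lambda>b. {..<R b})"
  define z where "z t = z0 + h *\<^sub>R (\<Sum>b\<in>Basis. real (t b) *\<^sub>R b)" for t :: "'a \<Rightarrow> nat"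
  define f where "f t = avg h u (z t)" for t
  \<comment> \<open>Members of \<open>PiE\<close> are \<open>undefined\<close> outside
    \<open>Basis\<close>, so overriding this base vector on \<open>Basis\<close> returns
    \<open>t\<close> itself.\<close>
  define k :: "'a \<Rightarrow> nat" where "k = (\<lambda>_. undefined)"
  have S: "lsum R js G k = (\<Sum>t\<in>?P. G t)" for G
  proof -
    have "override_on k t Basis = t" if "t \<in> ?P" for t
      using that by (auto simp: fun_eq_iff override_on_def k_def PiE_def extensional_def)
    then show ?thesis by (simp add: lsum_PiE[OF js(2)] js(1))
  qed
  define X where "X = (\<Sum>t\<in>?P. norm (f t) powr p)"
  define Z where "Z = (\<Sum>t\<in>?P. (norm (f t))\<^sup>2)"
  define Y where "Y b = (\<Sum>t\<in>?P. if Suc (t b) < R b then (norm (f (t(b := Suc (t b))) - f t))\<^sup>2 else 0)" for b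
  define U where "U = (LINT z|lborel. (norm (u z))\<^sup>2)"
  define \<Gamma> where "\<Gamma> b = (LINT z|lborel. (norm (g b z))\<^sup>2)" for b
  have U0: "0 \<le> U" unfolding U_def by (rule integral_nonneg_AE) auto
  have \<Gamma>0: "0 \<le> \<Gamma> b" for b unfolding \<Gamma>_def by (rule integral_nonneg_AE) auto
  have g0: "0 \<le> \<gamma>" using d by (auto simp: \<gamma>_def)
  have main: "X ^ (d - 1) \<le> (\<Prod>b\<in>Basis. (2 * \<gamma> * sqrt (Y b) + sqrt Z / R b)\<^sup>2)"
    using discrete_Gagliardo_Nirenberg[OF js(2) len d(1), of R f k]
    unfolding S js(1) X_def Z_def Y_def p_def \<gamma>_def by simp
  have One_eq: "One = (\<Sum>b\<in>Basis. real 1 *\<^sub>R (b::'a))" by simp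
  have Zle: "Z \<le> U / h ^ Suc d"
  proof -
    have "Z \<le> (\<Sum>t\<in>?P. (LINT \<zeta>:box (z t) (z t + h *\<^sub>R One)|lborel. (norm (u \<zeta>))\<^sup>2) / h ^ Suc d)"
      unfolding Z_def f_def d(2)[symmetric] by (intro sum_mono norm_avg_square_le h u2 meas)
    also have "\<dots> = (\<Sum>t\<in>?P. (LINT \<zeta>:box (z t) (z t + h *\<^sub>R One)|lborel. (norm (u \<zeta>))\<^sup>2)) / h ^ Suc d"
      by (simp add: sum_divide_distrib)
    also have "\<dots> \<le> (real (\<Prod>b\<in>(Basis::'a set). 1) * U) / h ^ Suc d"
      unfolding U_def One_eq
      by (intro divide_right_mono sum_integral_grid_boxes_le[OF h u2 _ z_def]) (use h in auto)
    finally show ?thesis by simp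
  qed
  \<comment> \<open>The 4 is a product of two 2s: the swept box has volume
    \<open>2 * h ^ Suc d\<close>, which enters through Cauchy--Schwarz, and such boxes overlap at
    most twice.\<close>
  have Yle: "Y b \<le> 4 * \<Gamma> b * h\<^sup>2 / h ^ Suc d" if b: "b \<in> Basis" for b
  proof -
    define w where "w c = (if c = b then 2 else 1 :: nat)" for c :: 'a
    have wsum: "(\<Sum>c\<in>Basis. real (w c) *\<^sub>R c) = One + b"
    proof -
      have "(\<Sum>c\<in>Basis. real (w c) *\<^sub>R c) = (\<Sum>c\<in>Basis. c + (if c = b then b else 0))"
        by (rule sum.cong) (auto simp: w_def scaleR_2)
      then show ?thesis using b by (simp add: sum.distrib)
    qed
    have wprod: "(\<Prod>c\<in>Basis. w c) = 2"
      using b by (simp add: w_def prod.If_cases Int_absorb1)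
    let ?D = "\<lambda>t. box (z t) (z t + h *\<^sub>R (One + b))"
    have step: "(norm (f (t(b := Suc (t b))) - f t))\<^sup>2
        \<le> 2 * h\<^sup>2 / h ^ Suc d * (LINT \<zeta>:?D t|lborel. (norm (g b \<zeta>))\<^sup>2)"
      if t: "t \<in> ?P" "Suc (t b) < R b" for t
    proof -
      have zs: "z (t(b := Suc (t b))) = z t + h *\<^sub>R b"
      proof -
        have "(\<Sum>c\<in>Basis. real ((t(b := Suc (t b))) c) *\<^sub>R c) = (\<Sum>c\<in>Basis. real (t c) *\<^sub>R c + (if c = b then b else 0))"
          by (rule sum.cong) (auto simp: algebra_simps)
        then show ?thesis using b by (simp add: z_def sum.distrib algebra_simps)
      qed
      have ze: "z t \<bullet> e = z0 \<bullet> e + h * real (t e)"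
        using e by (simp add: z_def inner_add_left)
      have be: "b \<bullet> e = (if b = e then 1 else 0)" using b e by (simp add: inner_Basis)
      have te: "real (t e) + 1 + b \<bullet> e \<le> R e"
      proof (cases "b = e")
        case False
        have "t e < R e" using t e by (auto simp: PiE_def Pi_def)
        then show ?thesis using False be by simp
      qed (use t be in auto)
      have "(z t + h *\<^sub>R One + h *\<^sub>R b) \<bullet> e = z0 \<bullet> e + h * (real (t e) + 1 + b \<bullet> e)"
        using e by (simp add: ze inner_add_left algebra_simps)
      also have "\<dots> \<le> z0 \<bullet> e + h * R e" using te h by simp
      finally have top: "(z t + h *\<^sub>R One + h *\<^sub>R b) \<bullet> e \<le> L" using z0 by simp
      let ?I = "LINT \<zeta>:?D t|lborel. norm (g b \<zeta>)"
      have mD: "measure lborel (?D t) = 2 * h ^ Suc d"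
      proof -
        have "measure lborel (?D t) = (\<Prod>c\<in>Basis. (h *\<^sub>R (One + b)) \<bullet> c)"
          by (rule measure_box_lborel) (use h b in \<open>auto simp: inner_add_left inner_Basis\<close>)
        also have "\<dots> = (\<Prod>c\<in>Basis. h * real (w c))"
          by (rule prod.cong) (use b in \<open>auto simp: w_def inner_add_left inner_Basis\<close>)
        also have "\<dots> = h ^ Suc d * real (\<Prod>c\<in>(Basis::'a set). w c)"
          by (simp add: prod.distrib d(2))
        finally show ?thesis by (simp add: wprod)
      qed
      have "norm (f (t(b := Suc (t b))) - f t) = norm ((LINT \<zeta>:box (z t + h *\<^sub>R b) (z t + h *\<^sub>R b + h *\<^sub>R One)|lborel. u \<zeta>)
          - (LINT \<zeta>:box (z t) (z t + h *\<^sub>R One)|lborel. u \<zeta>)) / h ^ Suc d"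
        unfolding f_def zs avg_def scaleR_diff_right[symmetric] d(2) using h
        by (simp add: norm_mult norm_inverse norm_power divide_inverse)
      also have "\<dots> \<le> h * (LINT \<zeta>:box (z t) (z t + h *\<^sub>R One + h *\<^sub>R b)|lborel. norm (g b \<zeta>)) / h ^ Suc d"
        by (intro divide_right_mono diff b h top) (use ze z0 h in auto)
      also have "z t + h *\<^sub>R One + h *\<^sub>R b = z t + h *\<^sub>R (One + b)" by (simp add: algebra_simps)
      finally have "norm (f (t(b := Suc (t b))) - f t) \<le> h * ?I / h ^ Suc d" .
      then have "(norm (f (t(b := Suc (t b))) - f t))\<^sup>2 \<le> (h * ?I / h ^ Suc d)\<^sup>2"
        by (intro power_mono) auto
      also have "\<dots> = h\<^sup>2 * ?I\<^sup>2 / (h ^ Suc d)\<^sup>2" by (simp add: power_divide power_mult_distrib)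
      also have "\<dots> \<le> h\<^sup>2 * (2 * h ^ Suc d * (LINT \<zeta>:?D t|lborel. (norm (g b \<zeta>))\<^sup>2)) / (h ^ Suc d)\<^sup>2"
        unfolding mD[symmetric]
        by (intro divide_right_mono mult_left_mono set_integral_Cauchy_Schwarz) (use g2 b in \<open>auto simp: emeasure_box_finite\<close>)
      also have "\<dots> = 2 * h\<^sup>2 / h ^ Suc d * (LINT \<zeta>:?D t|lborel. (norm (g b \<zeta>))\<^sup>2)"
        using h by (simp add: power2_eq_square)
      finally show ?thesis .
    qed
    have "Y b \<le> (\<Sum>t\<in>?P. 2 * h\<^sup>2 / h ^ Suc d * (LINT \<zeta>:?D t|lborel. (norm (g b \<zeta>))\<^sup>2))"
      unfolding Y_def
    proof (intro sum_mono)
      fix t assume t: "t \<in> ?P"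
      have "0 \<le> 2 * h\<^sup>2 / h ^ Suc d * (LINT \<zeta>:?D t|lborel. (norm (g b \<zeta>))\<^sup>2)"
        unfolding set_lebesgue_integral_def
        using h by (intro mult_nonneg_nonneg integral_nonneg_AE divide_nonneg_nonneg) auto
      with step[OF t] show "(if Suc (t b) < R b then (norm (f (t(b := Suc (t b))) - f t))\<^sup>2 else 0)
        \<le> 2 * h\<^sup>2 / h ^ Suc d * (LINT \<zeta>:?D t|lborel. (norm (g b \<zeta>))\<^sup>2)"
        by simp
    qed
    also have "\<dots> = 2 * h\<^sup>2 / h ^ Suc d * (\<Sum>t\<in>?P. (LINT \<zeta>:?D t|lborel. (norm (g b \<zeta>))\<^sup>2))"
      by (simp only: sum_distrib_left)
    also have "\<dots> \<le> 2 * h\<^sup>2 / h ^ Suc d * (real (\<Prod>c\<in>(Basis::'a set). w c) * \<Gamma> b)"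
      unfolding \<Gamma>_def wsum[symmetric]
      by (intro mult_left_mono sum_integral_grid_boxes_le[OF h g2[OF b] _ z_def]) (use h in auto)
    also have "\<dots> = 4 * \<Gamma> b * h\<^sup>2 / h ^ Suc d" by (simp add: wprod)
    finally show ?thesis .
  qed
  define W where "W b = 4 * \<gamma> * sqrt (\<Gamma> b) + sqrt U / (h * R b)" for b
  have "(h ^ Suc d * X) ^ (d - 1) = (h ^ (d - 1)) ^ Suc d * X ^ (d - 1)"
    by (simp only: power_mult_distrib power_mult[symmetric] mult.commute)
  also have "\<dots> \<le> (h ^ (d - 1)) ^ Suc d * (\<Prod>b\<in>Basis. (2 * \<gamma> * sqrt (Y b) + sqrt Z / R b)\<^sup>2)"
    by (intro mult_left_mono main) (use h in auto)
  also have "\<dots> = (\<Prod>b\<in>(Basis::'a set). h ^ (d - 1) * (2 * \<gamma> * sqrt (Y b) + sqrt Z / R b)\<^sup>2)"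
    by (simp add: prod.distrib d(2))
  also have "\<dots> \<le> (\<Prod>b\<in>Basis. (W b)\<^sup>2)"
  proof (intro prod_mono conjI)
    fix b :: 'a assume b: "b \<in> Basis"
    have hd: "h ^ Suc d = h\<^sup>2 * h ^ (d - 1)" using d by (cases d) (simp_all add: power2_eq_square)
    have "sqrt (Y b) \<le> sqrt (4 * \<Gamma> b * h\<^sup>2 / h ^ Suc d)" using Yle[OF b] by simp
    also have "\<dots> = 2 * sqrt (\<Gamma> b) / sqrt (h ^ (d - 1))"
      using h unfolding hd by (simp add: real_sqrt_divide real_sqrt_mult)
    finally have 1: "sqrt (Y b) \<le> 2 * sqrt (\<Gamma> b) / sqrt (h ^ (d - 1))" .
    have "sqrt Z \<le> sqrt (U / h ^ Suc d)" using Zle by simp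
    also have "\<dots> = sqrt U / h / sqrt (h ^ (d - 1))"
      using h unfolding hd by (simp add: real_sqrt_divide real_sqrt_mult)
    finally have 2: "sqrt Z \<le> sqrt U / h / sqrt (h ^ (d - 1))" .
    have "2 * \<gamma> * sqrt (Y b) + sqrt Z / R b
        \<le> 2 * \<gamma> * (2 * sqrt (\<Gamma> b) / sqrt (h ^ (d - 1))) + (sqrt U / h / sqrt (h ^ (d - 1))) / R b"
      by (intro add_mono mult_left_mono divide_right_mono 1 2) (use g0 in auto)
    also have "\<dots> = W b / sqrt (h ^ (d - 1))"
      by (simp add: W_def add_divide_distrib algebra_simps)
    finally have "2 * \<gamma> * sqrt (Y b) + sqrt Z / R b \<le> W b / sqrt (h ^ (d - 1))" .
    moreover have "0 \<le> 2 * \<gamma> * sqrt (Y b) + sqrt Z / R b"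
      using g0 by (intro add_nonneg_nonneg mult_nonneg_nonneg divide_nonneg_nonneg)
        (auto simp: Y_def Z_def intro!: sum_nonneg)
    ultimately have "(2 * \<gamma> * sqrt (Y b) + sqrt Z / R b)\<^sup>2 \<le> (W b / sqrt (h ^ (d - 1)))\<^sup>2"
      by (intro power_mono)
    then show "h ^ (d - 1) * (2 * \<gamma> * sqrt (Y b) + sqrt Z / R b)\<^sup>2 \<le> (W b)\<^sup>2"
      using h by (simp add: power_divide field_simps)
    show "0 \<le> h ^ (d - 1) * (2 * \<gamma> * sqrt (Y b) + sqrt Z / R b)\<^sup>2" using h by simp
  qed
  finally show ?thesis
    by (simp add: X_def f_def z_def W_def \<Gamma>_def U_def)
qed

text \<open>Lebesgue differentiation. The sequence is quantified inside \<open>AE\<close>, so one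
  null set serves all sequences, even one chosen after the point \<open>z\<close>.\<close>

lemma avg_tendsto_AE:
  fixes u :: "'a::euclidean_space \<Rightarrow> complex"
  assumes [measurable]: "u \<in> borel_measurable borel"
    and u2: "integrable lborel (\<lambda>z. (norm (u z))\<^sup>2)"
  shows "AE z in lborel. \<forall>h. (\<forall>n::nat. 0 < h n) \<longrightarrow> h \<longlonglongrightarrow> 0 \<longrightarrow> (\<lambda>n. avg (h n) u z) \<longlonglongrightarrow> u z"
proof -
  have si: "set_integrable lborel (cbox a b) u" for a b
    by (rule set_integrable_square) (use u2 emeasure_bounded_finite[of "cbox a b"] in auto)
  have "u integrable_on cbox a b" for a b
    using set_borel_integral_eq_integral(1)[OF si] .
  then obtain N where N: "negligible N" "\<And>x e. \<lbrakk>x \<notin> N; 0 < e\<rbrakk> \<Longrightarrow> \<exists>d>0. \<forall>h. 0 < h \<and> h < d \<longrightarrow>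
      norm (integral (cbox x (x + h *\<^sub>R One)) u /\<^sub>R h ^ DIM('a) - u x) < e"
    using integrable_ccontinuous_explicit[of u] by metis
  have si': "set_integrable lborel (box a b) u" for a b
    by (rule set_integrable_square) (use u2 emeasure_bounded_finite[of "box a b"] in auto)
  have avg: "avg h u x = integral (cbox x (x + h *\<^sub>R One)) u /\<^sub>R h ^ DIM('a)" for h x
    unfolding avg_def set_borel_integral_eq_integral(2)[OF si'] integral_open_interval ..
  have "(\<lambda>n. avg (h n) u z) \<longlonglongrightarrow> u z" if z: "z \<notin> N" and h: "\<forall>n::nat. 0 < h n" "h \<longlonglongrightarrow> 0" for z h
  proof (rule LIMSEQ_I)
    fix r :: real assume "0 < r"
    then obtain d where d: "d > 0" "\<And>h. 0 < h \<Longrightarrow> h < d \<Longrightarrow> norm (avg h u z - u z) < r"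
      using N(2)[OF z, of r] unfolding avg by blast
    have "eventually (\<lambda>n. h n < d) sequentially" using order_tendstoD(2)[OF h(2) d(1)] .
    then show "\<exists>no. \<forall>n\<ge>no. norm (avg (h n) u z - u z) < r"
      using d(2) h(1) unfolding eventually_sequentially by blast
  qed
  moreover have "AE z in lebesgue. z \<notin> N"
    using N(1) by (auto simp: negligible_iff_null_sets intro: AE_not_in)
  ultimately have "AE z in lebesgue. \<forall>h. (\<forall>n::nat. 0 < h n) \<longrightarrow> h \<longlonglongrightarrow> 0 \<longrightarrow> (\<lambda>n. avg (h n) u z) \<longlonglongrightarrow> u z"
    by (auto elim!: eventually_mono)
  then show ?thesis by (simp add: AE_completion_iff)
qed

lemma borel_measurable_avg[measurable]:
  fixes u :: "'a::euclidean_space \<Rightarrow> complex"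
  assumes [measurable]: "u \<in> borel_measurable borel"
  shows "avg h u \<in> borel_measurable borel"
proof -
  have [measurable]: "Measurable.pred (borel \<Otimes>\<^sub>M borel) (\<lambda>x. snd x \<in> box (fst x) (fst x + h *\<^sub>R (One::'a)))"
    unfolding mem_box by measurable
  have "(\<lambda>z. (LINT \<zeta>|lborel. (if \<zeta> \<in> box z (z + h *\<^sub>R (One::'a)) then u \<zeta> else 0)) /\<^sub>R h ^ DIM('a)) \<in> borel_measurable borel"
    by measurable
  then show ?thesis
    by (simp add: avg_def[abs_def] set_lebesgue_integral_def indicator_scaleR_eq_if)
qed

text \<open>The meshes shrink while the windows exhaust the slab, and Fatou's lemma with
  \<open>avg_tendsto_AE\<close> passes to the limit. The mass term survives only in direction
  \<open>e\<close>, where the window length tends to \<open>L\<close> instead of infinity.\<close>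

lemma Gagliardo_Nirenberg_of_differences:
  fixes u :: "'a::euclidean_space \<Rightarrow> complex" and g :: "'a \<Rightarrow> 'a \<Rightarrow> complex"
    and d :: nat and L :: real
  defines "p \<equiv> 2 * (real d + 1) / (real d - 1)" and "\<gamma> \<equiv> 2 * real d / (real d - 1)"
  assumes d: "2 \<le> d" "DIM('a) = Suc d" and e: "e \<in> Basis" and L: "0 < L"
    and meas[measurable]: "u \<in> borel_measurable borel" "\<And>b. g b \<in> borel_measurable borel"
    and u2: "integrable lborel (\<lambda>z. (norm (u z))\<^sup>2)"
    and g2: "\<And>b. b \<in> Basis \<Longrightarrow> integrable lborel (\<lambda>z. (norm (g b z))\<^sup>2)"
    and diff: "\<And>b h a. \<lbrakk>b \<in> Basis; 0 < h; 0 \<le> a \<bullet> e; (a + h *\<^sub>R One + h *\<^sub>R b) \<bullet> e \<le> L\<rbrakk> \<Longrightarrow>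
        norm ((LINT z:box (a + h *\<^sub>R b) (a + h *\<^sub>R b + h *\<^sub>R One)|lborel. u z) - (LINT z:box a (a + h *\<^sub>R One)|lborel. u z))
        \<le> h * (LINT z:box a (a + h *\<^sub>R One + h *\<^sub>R b)|lborel. norm (g b z))"
    and zero: "\<And>z. \<not> (0 \<le> z \<bullet> e \<and> z \<bullet> e < L) \<Longrightarrow> u z = 0"
  shows "integrable lborel (\<lambda>z. norm (u z) powr p)"
    and "(LINT z|lborel. norm (u z) powr p) ^ (d - 1)
       \<le> (\<Prod>b\<in>Basis. (4 * \<gamma> * sqrt (LINT z|lborel. (norm (g b z))\<^sup>2)
                + (if b = e then sqrt (LINT z|lborel. (norm (u z))\<^sup>2) / L else 0))\<^sup>2)"
proof -
  have p: "0 < p" using d by (auto simp: p_def)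
  define U where "U = (LINT z|lborel. (norm (u z))\<^sup>2)"
  define \<Gamma> where "\<Gamma> b = (LINT z|lborel. (norm (g b z))\<^sup>2)" for b
  define h where "h N = L / (real N + 2)" for N :: nat
  \<comment> \<open>Direction \<open>e\<close> uses \<open>N + 1\<close> of the \<open>N + 2\<close>
    cells that fit into \<open>L\<close>; the spare cell absorbs the offset of \<open>z0\<close>. In
    the other directions \<open>(N + 2)\<^sup>2\<close> cells of size \<open>L / (N + 2)\<close>
    have total length \<open>L * (N + 2)\<close>, centred at 0 by \<open>base\<close>.\<close>
  define R where "R N b = (if b = e then N + 1 else (N + 2)\<^sup>2)" for N :: nat and b :: 'a
  define base where "base N = (- L * (real N + 2) / 2) *\<^sub>R (One - e)" for N :: nat
  define cell where "cell N = {z. \<forall>b\<in>Basis. base N \<bullet> b \<le> z \<bullet> b \<and> z \<bullet> b < base N \<bullet> b + h N}" for N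
  define win where "win N = {z. \<forall>b\<in>Basis. base N \<bullet> b \<le> z \<bullet> b \<and> z \<bullet> b < base N \<bullet> b + h N * R N b}" for N
  define AV where "AV N z = norm (avg (h N) u z) powr p" for N z
  define K where "K N = (\<Prod>b\<in>Basis. (4 * \<gamma> * sqrt (\<Gamma> b) + sqrt U / (h N * R N b))\<^sup>2)" for N
  define K' where "K' = (\<Prod>b\<in>Basis. (4 * \<gamma> * sqrt (\<Gamma> b) + (if b = e then sqrt U / L else 0))\<^sup>2)"
  have K0: "0 \<le> K N" "0 \<le> K'" for N by (auto simp: K_def K'_def intro!: prod_nonneg)
  have h0: "0 < h N" for N using L by (simp add: h_def)
  have R0: "0 < R N b" for N b by (simp add: R_def)
  have base_b: "base N \<bullet> b = (if b = e then 0 else - L * (real N + 2) / 2)" if "b \<in> Basis" for N b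
    using that e by (auto simp: base_def inner_diff_left inner_Basis)
  have hR: "h N * R N b = (if b = e then L * (real N + 1) / (real N + 2) else L * (real N + 2))" for N b
  proof -
    have "L / x * x\<^sup>2 = L * x" if "x \<noteq> 0" for x using that by (simp add: power2_eq_square)
    from this[of "real N + 2"] show ?thesis by (simp add: h_def R_def add.commute)
  qed
  have [measurable]: "AV N \<in> borel_measurable borel" for N unfolding AV_def by measurable
  have cellm[measurable]: "cell N \<in> sets borel" for N
    unfolding cell_def by measurable
  have winm[measurable]: "win N \<in> sets borel" for N
    unfolding win_def by measurable
  let ?P = "\<lambda>N. PiE Basis (\<lambda>b. {..<R N b})"
  define v where "v N t = h N *\<^sub>R (\<Sum>b\<in>Basis. real (t b) *\<^sub>R b)" for N and t :: "'a \<Rightarrow> nat"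
  have vb: "v N t \<bullet> b = h N * real (t b)" if "b \<in> Basis" for N t b
    using that by (simp add: v_def)
  have bound: "(\<Sum>t\<in>?P N. AV N (z0 + v N t)) \<le> root (d - 1) (K N) / h N ^ Suc d" if z0: "z0 \<in> cell N" for z0 N
  proof -
    have "h N * (real N + 2) = L" by (simp add: h_def)
    then have z0e: "0 \<le> z0 \<bullet> e" "z0 \<bullet> e + h N * R N e \<le> L"
      using z0 e by (auto simp: cell_def base_b R_def algebra_simps)
    have "(h N ^ Suc d * (\<Sum>t\<in>?P N. AV N (z0 + v N t))) ^ (d - 1) \<le> K N"
      unfolding K_def AV_def v_def p_def \<gamma>_def \<Gamma>_def U_def
      by (rule grid_Gagliardo_Nirenberg[where R = "R N" and h = "h N" and u = u and g = g and L = L and e = e])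
        (rule d e meas u2 h0 R0 z0e | fact g2 diff)+
    then have "root (d - 1) ((h N ^ Suc d * (\<Sum>t\<in>?P N. AV N (z0 + v N t))) ^ (d - 1)) \<le> root (d - 1) (K N)"
      using d by simp
    moreover have "0 \<le> h N ^ Suc d * (\<Sum>t\<in>?P N. AV N (z0 + v N t))"
      using h0[of N] by (intro mult_nonneg_nonneg sum_nonneg) (auto simp: AV_def)
    ultimately have "h N ^ Suc d * (\<Sum>t\<in>?P N. AV N (z0 + v N t)) \<le> root (d - 1) (K N)"
      using d by (subst (asm) real_root_power_cancel) auto
    then show ?thesis using h0[of N] by (simp add: field_simps)
  qed
  have win_sum: "indicator (win N) \<zeta> = (\<Sum>t\<in>?P N. indicator (cell N) (\<zeta> - v N t) :: real)" for N \<zeta>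
  proof -
    have "(\<Sum>t\<in>?P N. indicator (cell N) (\<zeta> - v N t) :: real)
       = (\<Sum>t\<in>?P N. of_bool (\<forall>b\<in>Basis. base N \<bullet> b + h N * real (t b) \<le> \<zeta> \<bullet> b \<and> \<zeta> \<bullet> b < base N \<bullet> b + h N * real (t b) + h N))"
      by (rule sum.cong) (auto simp: indicator_def cell_def inner_diff_left vb algebra_simps)
    also have "\<dots> = (\<Prod>b\<in>Basis. real (card {t. t < R N b \<and> base N \<bullet> b + h N * real t \<le> \<zeta> \<bullet> b \<and> \<zeta> \<bullet> b < base N \<bullet> b + h N * real t + h N}))"
      by (rule sum_PiE_indicator) simp
    also have "\<dots> = indicator (win N) \<zeta>"
    proof (cases "\<zeta> \<in> win N")
      case True
      then have "card {t. t < R N b \<and> base N \<bullet> b + h N * real t \<le> \<zeta> \<bullet> b \<and> \<zeta> \<bullet> b < base N \<bullet> b + h N * real t + h N} = 1"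
        if "b \<in> Basis" for b
        using that by (intro card_grid_cell[OF h0]) (auto simp: win_def)
      then show ?thesis using True by simp
    next
      case False
      then obtain b where b: "b \<in> Basis" "\<not> (base N \<bullet> b \<le> \<zeta> \<bullet> b \<and> \<zeta> \<bullet> b < base N \<bullet> b + h N * R N b)"
        by (auto simp: win_def)
      have "{t. t < R N b \<and> base N \<bullet> b + h N * real t \<le> \<zeta> \<bullet> b \<and> \<zeta> \<bullet> b < base N \<bullet> b + h N * real t + h N} = {}"
      proof (rule ccontr)
        assume "\<not> ?thesis"
        then obtain t where t: "t < R N b" "base N \<bullet> b + h N * real t \<le> \<zeta> \<bullet> b" "\<zeta> \<bullet> b < base N \<bullet> b + h N * real t + h N"
          by blast
        have 1: "h N * real t \<ge> 0" using h0[of N] by simp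
        have "h N * (real t + 1) \<le> h N * real (R N b)"
          using t(1) h0[of N] by (intro mult_left_mono) auto
        then have "h N * real t + h N \<le> h N * real (R N b)" by (simp add: algebra_simps)
        then show False using 1 t b(2) by linarith
      qed
      then have "(\<Prod>b\<in>Basis. real (card {t. t < R N b \<and> base N \<bullet> b + h N * real t \<le> \<zeta> \<bullet> b \<and> \<zeta> \<bullet> b < base N \<bullet> b + h N * real t + h N})) = 0"
        using b(1) by (intro prod_zero) (auto intro!: bexI[of _ b])
      then show ?thesis using False by simp
    qed
    finally show ?thesis ..
  qed
  \<comment> \<open>Translating every cell of the window back to the base cell turns the integral of
    \<open>AV N\<close> into an integral over offsets, where \<open>bound\<close> applies; the
    volume \<open>h N ^ Suc d\<close> of the cell cancels.\<close>
  have int_le: "(\<integral>\<^sup>+\<zeta>. ennreal (indicator (win N) \<zeta> * AV N \<zeta>) \<partial>lborel) \<le> ennreal (root (d - 1) (K N))" for N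
  proof -
    have "(\<integral>\<^sup>+\<zeta>. ennreal (indicator (win N) \<zeta> * AV N \<zeta>) \<partial>lborel)
        = (\<integral>\<^sup>+\<zeta>. (\<Sum>t\<in>?P N. ennreal (indicator (cell N) (\<zeta> - v N t) * AV N \<zeta>)) \<partial>lborel)"
      by (rule nn_integral_cong) (simp add: win_sum sum_distrib_right AV_def)
    also have "\<dots> = (\<Sum>t\<in>?P N. \<integral>\<^sup>+\<zeta>. ennreal (indicator (cell N) (\<zeta> - v N t) * AV N \<zeta>) \<partial>lborel)"
      by (rule nn_integral_sum) measurable
    also have "\<dots> = (\<Sum>t\<in>?P N. \<integral>\<^sup>+\<zeta>. ennreal (indicator (cell N) \<zeta> * AV N (\<zeta> + v N t)) \<partial>lborel)"
    proof (rule sum.cong[OF refl])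
      fix t
      have "(\<integral>\<^sup>+\<zeta>. ennreal (indicator (cell N) (\<zeta> - v N t) * AV N \<zeta>) \<partial>lborel)
          = (\<integral>\<^sup>+\<zeta>. ennreal (indicator (cell N) (\<zeta> - v N t) * AV N \<zeta>) \<partial>(distr lborel borel ((+) (v N t))))"
        by (simp only: lborel_distr_plus)
      also have "\<dots> = (\<integral>\<^sup>+\<zeta>. ennreal (indicator (cell N) \<zeta> * AV N (\<zeta> + v N t)) \<partial>lborel)"
        by (subst nn_integral_distr) (auto simp: add.commute)
      finally show "(\<integral>\<^sup>+\<zeta>. ennreal (indicator (cell N) (\<zeta> - v N t) * AV N \<zeta>) \<partial>lborel)
          = (\<integral>\<^sup>+\<zeta>. ennreal (indicator (cell N) \<zeta> * AV N (\<zeta> + v N t)) \<partial>lborel)" .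
    qed
    also have "\<dots> = (\<integral>\<^sup>+\<zeta>. (\<Sum>t\<in>?P N. ennreal (indicator (cell N) \<zeta> * AV N (\<zeta> + v N t))) \<partial>lborel)"
      by (rule nn_integral_sum[symmetric]) measurable
    also have "\<dots> \<le> (\<integral>\<^sup>+\<zeta>. ennreal (root (d - 1) (K N) / h N ^ Suc d) * indicator (cell N) \<zeta> \<partial>lborel)"
    proof (rule nn_integral_mono)
      fix \<zeta>
      show "(\<Sum>t\<in>?P N. ennreal (indicator (cell N) \<zeta> * AV N (\<zeta> + v N t)))
        \<le> ennreal (root (d - 1) (K N) / h N ^ Suc d) * indicator (cell N) \<zeta>"
      proof (cases "\<zeta> \<in> cell N")
        case True
        then have "(\<Sum>t\<in>?P N. ennreal (indicator (cell N) \<zeta> * AV N (\<zeta> + v N t))) = ennreal (\<Sum>t\<in>?P N. AV N (\<zeta> + v N t))"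
          by (simp add: AV_def)
        also have "\<dots> \<le> ennreal (root (d - 1) (K N) / h N ^ Suc d)"
          by (intro ennreal_leI bound True)
        finally show ?thesis using True by simp
      qed simp
    qed
    also have "\<dots> = ennreal (root (d - 1) (K N) / h N ^ Suc d) * emeasure lborel (cell N)"
      by (rule nn_integral_cmult_indicator) simp
    also have "\<dots> \<le> ennreal (root (d - 1) (K N) / h N ^ Suc d) * ennreal (h N ^ Suc d)"
    proof (rule mult_left_mono)
      have "emeasure lborel (cell N) \<le> emeasure lborel (cbox (base N) (base N + h N *\<^sub>R One))"
        by (rule emeasure_mono) (auto simp: cell_def mem_box inner_add_left less_imp_le)
      also have "\<dots> = ennreal (h N ^ Suc d)"
        using h0[of N] by (subst emeasure_lborel_cbox) (auto simp: inner_add_left d(2))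
      finally show "emeasure lborel (cell N) \<le> ennreal (h N ^ Suc d)" .
    qed simp
    also have "\<dots> = ennreal (root (d - 1) (K N))"
      using h0[of N] K0(1)[of N] by (subst ennreal_mult[symmetric]) (auto simp: real_root_ge_zero intro!: divide_nonneg_nonneg)
    finally show ?thesis .
  qed
  have hlim: "h \<longlonglongrightarrow> 0" unfolding h_def by real_asymp
  have AElim: "AE z in lborel. ennreal (norm (u z) powr p) \<le> liminf (\<lambda>N. ennreal (indicator (win N) z * AV N z))"
    using avg_tendsto_AE[OF meas(1) u2]
  proof eventually_elim
    case (elim z)
    show ?case
    proof (cases "0 \<le> z \<bullet> e \<and> z \<bullet> e < L")
      case True
      have "(\<lambda>N. AV N z) \<longlonglongrightarrow> norm (u z) powr p"
        unfolding AV_def using elim h0 hlim p by (intro tendsto_powr2 tendsto_norm tendsto_const) auto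
      moreover have "eventually (\<lambda>N. z \<in> win N) sequentially"
      proof -
        have "eventually (\<lambda>N. base N \<bullet> b \<le> z \<bullet> b \<and> z \<bullet> b < base N \<bullet> b + h N * R N b) sequentially"
          if b: "b \<in> Basis" for b
        proof (cases "b = e")
          case True2: True
          have "(\<lambda>N. L * (real N + 1) / (real N + 2)) \<longlonglongrightarrow> L" by real_asymp
          then have "eventually (\<lambda>N. z \<bullet> e < L * (real N + 1) / (real N + 2)) sequentially"
            using True order_tendstoD(1) by blast
          then show ?thesis by (rule eventually_mono) (use True True2 e in \<open>auto simp: hR base_b\<close>)
        next
          case False
          have "filterlim (\<lambda>N. L * (real N + 2) / 2) at_top sequentially" using L by real_asymp
          then have "eventually (\<lambda>N. \<bar>z \<bullet> b\<bar> < L * (real N + 2) / 2) sequentially"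
            by (simp add: filterlim_at_top_dense)
          then show ?thesis by (rule eventually_mono) (use False b in \<open>auto simp: hR base_b\<close>)
        qed
        then show ?thesis unfolding win_def mem_Collect_eq by (intro eventually_ball_finite) auto
      qed
      ultimately have "(\<lambda>N. indicator (win N) z * AV N z) \<longlonglongrightarrow> norm (u z) powr p"
        by (elim Lim_transform_eventually) (auto elim!: eventually_mono)
      then have "(\<lambda>N. ennreal (indicator (win N) z * AV N z)) \<longlonglongrightarrow> ennreal (norm (u z) powr p)"
        by (intro tendsto_ennrealI)
      then show ?thesis by (simp add: lim_imp_Liminf)
    qed (use zero in simp)
  qed
  have Klim: "(\<lambda>N. ennreal (root (d - 1) (K N))) \<longlonglongrightarrow> ennreal (root (d - 1) K')"
  proof (intro tendsto_ennrealI tendsto_real_root)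
    show "K \<longlonglongrightarrow> K'"
      unfolding K_def K'_def
    proof (intro tendsto_prod tendsto_power tendsto_add tendsto_const)
      fix b
      show "(\<lambda>N. sqrt U / (h N * R N b)) \<longlonglongrightarrow> (if b = e then sqrt U / L else 0)"
      proof (cases "b = e")
        case True
        have "(\<lambda>N. L * (real N + 1) / (real N + 2)) \<longlonglongrightarrow> L" by real_asymp
        from tendsto_divide[OF tendsto_const[of "sqrt U"] this] show ?thesis
          unfolding hR using True L by simp
      next
        case False
        have "(\<lambda>N. 1 / (real N + 2)) \<longlonglongrightarrow> 0" by real_asymp
        then have "(\<lambda>N. sqrt U / L * (1 / (real N + 2))) \<longlonglongrightarrow> 0" by (rule tendsto_mult_right_zero)
        then show ?thesis using False by (simp add: hR)
      qed
    qed
  qed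
  have nn: "(\<integral>\<^sup>+z. ennreal (norm (u z) powr p) \<partial>lborel) \<le> ennreal (root (d - 1) K')"
  proof -
    have "(\<integral>\<^sup>+z. ennreal (norm (u z) powr p) \<partial>lborel) \<le> (\<integral>\<^sup>+z. liminf (\<lambda>N. ennreal (indicator (win N) z * AV N z)) \<partial>lborel)"
      by (rule nn_integral_mono_AE[OF AElim])
    also have "\<dots> \<le> liminf (\<lambda>N. \<integral>\<^sup>+z. ennreal (indicator (win N) z * AV N z) \<partial>lborel)"
      by (rule nn_integral_liminf) measurable
    also have "\<dots> \<le> liminf (\<lambda>N. ennreal (root (d - 1) (K N)))"
      by (intro Liminf_mono always_eventually allI int_le)
    also have "\<dots> = ennreal (root (d - 1) K')" by (rule lim_imp_Liminf[OF _ Klim]) simp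
    finally show ?thesis .
  qed
  show int: "integrable lborel (\<lambda>z. norm (u z) powr p)"
    by (rule integrableI_nonneg) (use nn in \<open>auto simp: less_top[symmetric] top_unique\<close>)
  have "ennreal (LINT z|lborel. norm (u z) powr p) \<le> ennreal (root (d - 1) K')"
    using nn by (subst nn_integral_eq_integral[symmetric]) (use int in auto)
  then have "(LINT z|lborel. norm (u z) powr p) \<le> root (d - 1) K'"
    using K0 by (subst (asm) ennreal_le_iff) (auto simp: real_root_ge_zero)
  then have "(LINT z|lborel. norm (u z) powr p) ^ (d - 1) \<le> root (d - 1) K' ^ (d - 1)"
    by (intro power_mono) (auto intro!: integral_nonneg_AE)
  also have "\<dots> = K'" using d K0 by (intro real_root_pow_pos2) auto
  finally show "(LINT z|lborel. norm (u z) powr p) ^ (d - 1)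
       \<le> (\<Prod>b\<in>Basis. (4 * \<gamma> * sqrt (LINT z|lborel. (norm (g b z))\<^sup>2)
                + (if b = e then sqrt (LINT z|lborel. (norm (u z))\<^sup>2) / L else 0))\<^sup>2)"
    by (simp cong: if_cong add: K'_def \<Gamma>_def U_def)
qed

section \<open>Smooth functions\<close>

lemma C_k_SucI:
  assumes "\<And>x. (f has_derivative f' x) (at x)" "\<And>b. b \<in> Basis \<Longrightarrow> C_k k (\<lambda>x. f' x b)"
  shows "C_k (Suc k) f"
proof -
  have "frechet_derivative f (at x) = f' x" for x
    using frechet_derivative_at[OF assms(1)] by simp
  then show ?thesis using assms by (auto simp: differentiable_on_def differentiable_def)
qed

lemma C_k_has_derivative:
  "C_k (Suc k) f \<Longrightarrow> (f has_derivative frechet_derivative f (at x)) (at x)"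
  by (auto simp: differentiable_on_def frechet_derivative_works)

lemma C_k_SucD: "C_k (Suc k) f \<Longrightarrow> C_k k f"
proof (induction k arbitrary: f)
  case 0
  then show ?case by (simp add: differentiable_imp_continuous_on)
qed simp

lemma C_k_const: "C_k k (\<lambda>x. c)"
proof (induction k arbitrary: c)
  case (Suc k)
  show ?case by (rule C_k_SucI[where f' = "\<lambda>_ _. 0"]) (auto intro: Suc)
qed simp

lemma C_k_add: "C_k k f \<Longrightarrow> C_k k g \<Longrightarrow> C_k k (\<lambda>x. f x + g x)"
proof (induction k arbitrary: f g)
  case (Suc k)
  show ?case
    by (rule C_k_SucI[OF has_derivative_add[OF C_k_has_derivative[OF Suc.prems(1)] C_k_has_derivative[OF Suc.prems(2)]]])
       (use Suc in auto)
qed (auto intro: continuous_on_add)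

lemma C_k_mult: "C_k k f \<Longrightarrow> C_k k g \<Longrightarrow> C_k k (\<lambda>x. f x * g x)"
proof (induction k arbitrary: f g)
  case (Suc k)
  show ?case
    by (rule C_k_SucI[OF has_derivative_mult[OF C_k_has_derivative[OF Suc.prems(1)] C_k_has_derivative[OF Suc.prems(2)]]])
       (use Suc C_k_SucD[OF Suc.prems(1)] C_k_SucD[OF Suc.prems(2)] in \<open>auto intro!: C_k_add Suc.IH\<close>)
qed (auto intro: continuous_on_mult)

lemma C_k_sum: "(\<And>i. i \<in> I \<Longrightarrow> C_k k (f i)) \<Longrightarrow> C_k k (\<lambda>x. \<Sum>i\<in>I. f i x)"
  by (induction I rule: infinite_finite_induct) (auto intro: C_k_const C_k_add)

lemma C_k_prod: "(\<And>i. i \<in> I \<Longrightarrow> C_k k (f i)) \<Longrightarrow> C_k k (\<lambda>x. \<Prod>i\<in>I. f i x)"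
  by (induction I rule: infinite_finite_induct) (auto intro: C_k_const C_k_mult)

lemma C_k_compose_affine:
  fixes f :: "'b::euclidean_space \<Rightarrow> real" and L :: "'a::euclidean_space \<Rightarrow> 'b"
  assumes L: "linear L"
  shows "C_k k f \<Longrightarrow> C_k k (\<lambda>x. f (L x + c))"
proof (induction k arbitrary: f)
  case 0
  have "continuous_on UNIV L" using L by (simp add: linear_continuous_on linear_linear)
  then show ?case using 0 by (auto intro!: continuous_intros continuous_on_compose2[of UNIV f])
next
  case (Suc k)
  let ?D = "\<lambda>y. frechet_derivative f (at y)"
  have lin: "linear (?D y)" for y
    using C_k_has_derivative[OF Suc.prems] by (meson has_derivative_linear)
  have aff: "((\<lambda>x. L x + c) has_derivative L) (at x)" for x
    using L by (auto intro!: derivative_eq_intros linear_imp_has_derivative)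
  show ?case
  proof (rule C_k_SucI)
    show "((\<lambda>x. f (L x + c)) has_derivative (\<lambda>h. ?D (L x + c) (L h))) (at x)" for x
      by (rule has_derivative_compose[OF aff C_k_has_derivative[OF Suc.prems]])
    fix b :: 'a assume "b \<in> Basis"
    \<comment> \<open>\<open>C_k\<close> speaks only of derivatives along basis vectors, so the
      direction \<open>L b\<close> is expanded in the basis.\<close>
    have eq: "?D y (L b) = (\<Sum>e\<in>Basis. (L b \<bullet> e) * ?D y e)" for y
    proof -
      have "?D y (L b) = ?D y (\<Sum>e\<in>Basis. (L b \<bullet> e) *\<^sub>R e)" by (simp add: euclidean_representation)
      also have "\<dots> = (\<Sum>e\<in>Basis. (L b \<bullet> e) * ?D y e)"
        by (simp add: linear_sum[OF lin] linear_scale[OF lin])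
      finally show ?thesis .
    qed
    show "C_k k (\<lambda>x. ?D (L x + c) (L b))" unfolding eq
      by (intro C_k_sum C_k_mult C_k_const Suc.IH) (use Suc.prems in auto)
  qed
qed

lemma C_k_compose_real:
  fixes f :: "'a::euclidean_space \<Rightarrow> real"
  assumes "smooth \<phi>"
  shows "C_k k f \<Longrightarrow> C_k k (\<lambda>x. \<phi> (f x))"
  using assms
proof (induction k arbitrary: \<phi>)
  case 0
  then have "continuous_on UNIV \<phi>" by (metis C_k.simps(1) smooth_def)
  then show ?case using 0 by (auto intro!: continuous_on_compose2[of UNIV \<phi>])
next
  case (Suc k)
  have C: "C_k (Suc m) \<phi>" for m using Suc.prems by (auto simp: smooth_def)
  let ?D = "\<lambda>y. frechet_derivative \<phi> (at y)"
  have lin: "linear (?D y)" for y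
    using C_k_has_derivative[OF C] by (meson has_derivative_linear)
  have D1: "?D y h = h * ?D y 1" for y h
    using linear_scale[OF lin, of y h 1] by simp
  have sm: "smooth (\<lambda>y. ?D y 1)" using C by (auto simp: smooth_def)
  show ?case
  proof (rule C_k_SucI)
    show "((\<lambda>x. \<phi> (f x)) has_derivative (\<lambda>h. ?D (f x) (frechet_derivative f (at x) h))) (at x)" for x
      by (rule has_derivative_compose[OF C_k_has_derivative[OF Suc.prems(1)] C_k_has_derivative[OF C]])
    fix b :: 'a assume b: "b \<in> Basis"
    have eq: "(\<lambda>x. ?D (f x) (frechet_derivative f (at x) b)) = (\<lambda>x. frechet_derivative f (at x) b * ?D (f x) 1)"
      by (rule ext, rule D1)
    show "C_k k (\<lambda>x. ?D (f x) (frechet_derivative f (at x) b))"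
      unfolding eq
    proof (rule C_k_mult)
      show "C_k k (\<lambda>x. frechet_derivative f (at x) b)" using Suc.prems(1) b by simp
      show "C_k k (\<lambda>x. ?D (f x) 1)"
        by (rule Suc.IH[OF C_k_SucD[OF Suc.prems(1)] sm])
    qed
  qed
qed

lemma smooth_const: "smooth (\<lambda>x. c)"
  and smooth_add: "smooth f \<Longrightarrow> smooth g \<Longrightarrow> smooth (\<lambda>x. f x + g x)"
  and smooth_mult: "smooth f \<Longrightarrow> smooth g \<Longrightarrow> smooth (\<lambda>x. f x * g x)"
  and smooth_prod: "(\<And>i. i \<in> I \<Longrightarrow> smooth (F i)) \<Longrightarrow> smooth (\<lambda>x. \<Prod>i\<in>I. F i x)"
  and smooth_compose_real: "smooth \<phi> \<Longrightarrow> smooth f \<Longrightarrow> smooth (\<lambda>x. \<phi> (f x))"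
  by (auto simp: smooth_def intro: C_k_const C_k_add C_k_mult C_k_prod C_k_compose_real)

lemma smooth_compose_affine: "linear L \<Longrightarrow> smooth f \<Longrightarrow> smooth (\<lambda>x. f (L x + c))"
  by (auto simp: smooth_def intro: C_k_compose_affine)

lemma smooth_compose_linear: "linear L \<Longrightarrow> smooth f \<Longrightarrow> smooth (\<lambda>x. f (L x))"
  using smooth_compose_affine[of L f 0] by simp

lemma smooth_has_derivative: "smooth f \<Longrightarrow> (f has_derivative frechet_derivative f (at x)) (at x)"
  by (meson C_k_has_derivative smooth_def)

lemma smooth_frechet_derivative: "smooth f \<Longrightarrow> b \<in> Basis \<Longrightarrow> smooth (\<lambda>x. frechet_derivative f (at x) b)"
  unfolding smooth_def by (metis C_k.simps(2))

lemma smooth_continuous_on: "smooth f \<Longrightarrow> continuous_on S f"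
  by (metis C_k.simps(1) continuous_on_subset smooth_def subset_UNIV)

lemma smooth_of_real_derivative:
  fixes f f' :: "real \<Rightarrow> real"
  assumes "\<And>x. (f has_real_derivative f' x) (at x)" "smooth f'"
  shows "smooth f"
  unfolding smooth_def
proof
  fix k show "C_k k f"
    by (rule C_k_SucD, rule C_k_SucI[OF assms(1)[unfolded has_field_derivative_def]])
       (use assms(2) in \<open>simp add: smooth_def\<close>)
qed

lemma smooth_ident: "smooth (\<lambda>x::real. x)"
  by (rule smooth_of_real_derivative[where f' = "\<lambda>_. 1"]) (auto intro: smooth_const)

lemma smooth_diff: "smooth f \<Longrightarrow> smooth g \<Longrightarrow> smooth (\<lambda>x. f x - g x)"
  using smooth_add[OF _ smooth_mult[OF smooth_const[of "-1"], of g], of f] by simp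

lemma smooth_cos: "smooth (cos :: real \<Rightarrow> real)"
proof -
  \<comment> \<open>Each derivative leads to the other function, so the induction carries
    both.\<close>
  have "C_k k (cos :: real \<Rightarrow> real) \<and> C_k k (sin :: real \<Rightarrow> real)" for k
  proof (induction k)
    case (Suc k)
    have "C_k k (\<lambda>x. (-1) * sin x :: real)" by (intro C_k_mult C_k_const) (use Suc in auto)
    moreover have "(cos has_derivative (\<lambda>h. (- sin x) * h)) (at x)" for x :: real
      using DERIV_cos[of x] unfolding has_field_derivative_def .
    moreover have "(sin has_derivative (\<lambda>h. (cos x) * h)) (at x)" for x :: real
      using DERIV_sin[of x] unfolding has_field_derivative_def .
    ultimately have "C_k (Suc k) (cos :: real \<Rightarrow> real)" "C_k (Suc k) (sin :: real \<Rightarrow> real)"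
      using Suc by (auto intro: C_k_SucI[where f' = "\<lambda>x h. - sin x * h"] C_k_SucI[where f' = "\<lambda>x h. cos x * h"] simp del: C_k.simps)
    then show ?case by blast
  qed (auto intro!: continuous_intros)
  then show ?thesis by (auto simp: smooth_def)
qed

text \<open>The powers of \<open>1 / x\<close> close the family under differentiation up to linear
  combinations, so one induction proves all members smooth.\<close>

definition flat_exp :: "nat \<Rightarrow> real \<Rightarrow> real" where
  "flat_exp m x = (if 0 < x then (1 / x) ^ m * exp (- (1 / x)) else 0)"

lemma flat_exp_at_0: "(flat_exp m \<longlongrightarrow> 0) (at 0)"
proof (rule filterlim_split_at)
  have "((\<lambda>x. x ^ m / exp x) \<longlongrightarrow> (0::real)) at_top" by (rule tendsto_power_div_exp_0)
  then have "((\<lambda>x. (inverse x) ^ m / exp (inverse x)) \<longlongrightarrow> (0::real)) (at_right 0)"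
    by (rule filterlim_compose) (rule filterlim_inverse_at_top_right)
  moreover have "eventually (\<lambda>x. (inverse x) ^ m / exp (inverse x) = flat_exp m x) (at_right 0)"
    unfolding eventually_at_right_field
    by (auto simp: flat_exp_def exp_minus field_simps intro!: exI[of _ 1])
  ultimately show "(flat_exp m \<longlongrightarrow> 0) (at_right 0)" by (rule Lim_transform_eventually)
  have "eventually (\<lambda>x. 0 = flat_exp m x) (at_left 0)"
    unfolding eventually_at_left_field by (auto simp: flat_exp_def intro!: exI[of _ "-1"])
  then show "(flat_exp m \<longlongrightarrow> 0) (at_left 0)" by (rule Lim_transform_eventually[OF tendsto_const])
qed

lemma flat_exp_derivative:
  "(flat_exp m has_real_derivative flat_exp (m + 2) x - real m * flat_exp (m + 1) x) (at x)"
proof (cases x "0::real" rule: linorder_cases)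
  case less
  have "((\<lambda>_. 0) has_real_derivative 0) (at x)" by simp
  then have "(flat_exp m has_real_derivative 0) (at x)"
    by (rule has_field_derivative_transform_within[where d = "- x"])
       (use less in \<open>auto simp: flat_exp_def dist_real_def\<close>)
  then show ?thesis using less by (simp add: flat_exp_def)
next
  case equal
  \<comment> \<open>The difference quotient at 0 is the next member of the family, which tends to
    0.\<close>
  have "(\<lambda>h. (flat_exp m (0 + h) - flat_exp m 0) / h) = flat_exp (Suc m)"
    by (auto simp: flat_exp_def fun_eq_iff)
  then show ?thesis using equal flat_exp_at_0[of "Suc m"]
    by (simp add: DERIV_def flat_exp_def)
next
  case greater
  have "((\<lambda>x. (1 / x) ^ m * exp (- (1 / x))) has_real_derivative
      flat_exp (m + 2) x - real m * flat_exp (m + 1) x) (at x)"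
  proof -
    define y where "y = 1 / x"
    have 1: "((\<lambda>x. 1 / x) has_real_derivative - (y * y)) (at x)"
      using greater by (auto intro!: derivative_eq_intros simp: y_def)
    have 2: "((\<lambda>x. exp (- (1 / x))) has_real_derivative exp (- y) * (y * y)) (at x)"
      using DERIV_fun_exp[OF DERIV_minus[OF 1]] by (simp add: y_def)
    have "((\<lambda>x. (1 / x) ^ m * exp (- (1 / x))) has_real_derivative
      (real m * (- (y * y) * y ^ (m - Suc 0))) * exp (- y) + (exp (- y) * (y * y)) * y ^ m) (at x)"
      using DERIV_mult[OF DERIV_power[OF 1] 2] by (simp add: y_def)
    moreover have "(real m * (- (y * y) * y ^ (m - Suc 0))) * exp (- y) + (exp (- y) * (y * y)) * y ^ m
        = flat_exp (m + 2) x - real m * flat_exp (m + 1) x"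
      using greater by (cases m) (simp_all add: flat_exp_def y_def[symmetric] algebra_simps)
    ultimately show ?thesis by (simp only:)
  qed
  then show ?thesis
    by (rule has_field_derivative_transform_within[where d = x])
       (use greater in \<open>auto simp: flat_exp_def dist_real_def\<close>)
qed

lemma smooth_flat_exp: "smooth (flat_exp m)"
proof -
  have "C_k k (flat_exp m)" for k
  proof (induction k arbitrary: m)
    case 0
    show ?case using flat_exp_derivative by (auto intro!: DERIV_continuous_on)
  next
    case (Suc k)
    have "C_k k (\<lambda>x. flat_exp (m + 2) x + (- real m) * flat_exp (m + 1) x)"
      by (intro C_k_add C_k_mult C_k_const Suc)
    then show ?case
      by (intro C_k_SucI[OF flat_exp_derivative[unfolded has_field_derivative_def]]) simp
  qed
  then show ?thesis by (simp add: smooth_def)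
qed

text \<open>Smooth functions with values in [0, 1] that tend pointwise to the indicator of the
  positive reals. They never equal 1; only the limit enters, through dominated convergence.\<close>

definition soft_step :: "nat \<Rightarrow> real \<Rightarrow> real" where
  "soft_step n x = flat_exp 0 (real (Suc n) * x)"

lemma smooth_soft_step: "smooth (soft_step n)"
  unfolding soft_step_def[abs_def]
  by (rule smooth_compose_real[OF smooth_flat_exp]) (intro smooth_mult smooth_const smooth_ident)

lemma soft_step_bounds: "0 \<le> soft_step n x" "soft_step n x \<le> 1" "x \<le> 0 \<Longrightarrow> soft_step n x = 0"
  by (auto simp: soft_step_def flat_exp_def zero_less_mult_iff)

lemma soft_step_tendsto:
  assumes "0 < x"
  shows "(\<lambda>n. soft_step n x) \<longlonglongrightarrow> 1"
proof -
  have "(\<lambda>n. inverse (real (Suc n))) \<longlonglongrightarrow> 0" by (rule LIMSEQ_inverse_real_of_nat)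
  then have "(\<lambda>n. exp (- (inverse (real (Suc n)) * inverse x))) \<longlonglongrightarrow> exp (- (0 * inverse x))"
    by (intro tendsto_intros)
  then show ?thesis using assms by (simp add: soft_step_def flat_exp_def divide_inverse)
qed

lemma soft_step_pos: "0 < x \<Longrightarrow> 0 < soft_step n x"
  by (simp add: soft_step_def flat_exp_def)

lemma antiderivative_exists:
  fixes f :: "real \<Rightarrow> real"
  assumes "continuous_on UNIV f"
  shows "\<exists>F. \<forall>x. (F has_real_derivative f x) (at x)"
proof -
  have "((\<lambda>u. LBINT y=ereal 0..ereal u. f y) has_real_derivative f x) (at x)" for x
  proof -
    let ?a = "min 0 x - 1" and ?b = "max 0 x + 1"
    have "((\<lambda>u. LBINT y=ereal 0..ereal u. f y) has_vector_derivative f x) (at x within {?a..?b})"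
      by (rule interval_integral_FTC2) (auto intro: continuous_on_subset[OF assms])
    moreover have "at x within {?a..?b} = at x"
      by (rule at_within_interior) auto
    ultimately show ?thesis by (simp add: has_real_derivative_iff_has_vector_derivative)
  qed
  then show ?thesis by blast
qed

text \<open>The profile approximates the indicator of an interval; an antiderivative minus its own
  translate is then a trapezoid whose derivative is a difference of two profiles.\<close>

lemma trapezoid_exists:
  fixes \<psi> :: "real \<Rightarrow> real"
  assumes sm: "smooth \<psi>" and b: "\<And>s. 0 \<le> \<psi> s" "\<And>s. \<psi> s \<le> 1" and h: "0 < h" and t: "0 < t"
  obtains \<Phi> where "smooth \<Phi>" "\<And>s. (\<Phi> has_real_derivative \<psi> s - \<psi> (s - t)) (at s)"
    and "\<And>l r s. \<lbrakk>\<And>s. l \<le> s \<Longrightarrow> s \<le> r \<Longrightarrow> \<not> (a < s \<and> s < a + h) \<Longrightarrow> \<psi> s = 0;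
        l \<le> a - t; a + h + t \<le> r; l + t \<le> s; s \<le> r\<rbrakk>
        \<Longrightarrow> 0 \<le> \<Phi> s \<and> \<Phi> s \<le> h \<and> (\<not> (a \<le> s \<and> s \<le> a + h + t) \<longrightarrow> \<Phi> s = 0)"
    and "\<And>c. (\<forall>s. \<psi> (s + c) = \<psi> s) \<Longrightarrow> (\<forall>s. \<Phi> (s + c) = \<Phi> s)"
proof -
  obtain F where F: "\<And>x. (F has_real_derivative \<psi> x) (at x)"
    using antiderivative_exists[OF smooth_continuous_on[OF sm]] by blast
  define \<Phi> where "\<Phi> s = F s - F (s - t)" for s
  have d: "(\<Phi> has_real_derivative \<psi> s - \<psi> (s - t)) (at s)" for s
    unfolding \<Phi>_def[abs_def]
    by (auto intro!: derivative_eq_intros F DERIV_chain'[of "\<lambda>s. s - t" 1 s UNIV F "\<psi> (s - t)", simplified] )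
  have mono: "F x \<le> F y" if "x \<le> y" for x y
    by (rule DERIV_nonneg_imp_nondecreasing[OF that]) (use F b in blast)
  have lip: "F y - F x \<le> y - x" if "x \<le> y" for x y
  proof -
    have "(\<lambda>s. s - F s) x \<le> (\<lambda>s. s - F s) y"
      by (rule DERIV_nonneg_imp_nondecreasing[OF that])
         (use b in \<open>auto intro!: exI derivative_eq_intros F\<close>)
    then show ?thesis by simp
  qed
  have const: "F x = F y" if "x \<le> y" "\<And>s. x < s \<Longrightarrow> s < y \<Longrightarrow> \<psi> s = 0" for x y
  proof (cases "x = y")
    case False
    then have "x < y" using that by simp
    then show ?thesis
    proof (intro DERIV_isconst_end[of x y F, symmetric])
      show "continuous_on {x..y} F" by (meson DERIV_continuous_on F has_field_derivative_at_within)
      show "(F has_real_derivative 0) (at s)" if "x < s" "s < y" for s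
        using F[of s] \<open>\<And>s. x < s \<Longrightarrow> s < y \<Longrightarrow> \<psi> s = 0\<close>[OF that] by simp
    qed
  qed simp
  have Fh: "F (a + h) - F a \<le> h" using lip[of a "a + h"] h by simp
  show ?thesis
  proof
    show "smooth \<Phi>"
    proof (rule smooth_of_real_derivative[OF d])
      have "smooth (\<lambda>s. \<psi> (s + (- t)))" by (rule smooth_compose_affine[OF _ sm]) (rule linear_id[unfolded id_def])
      then show "smooth (\<lambda>s. \<psi> s - \<psi> (s - t))" by (intro smooth_diff sm) simp
    qed
    show "(\<Phi> has_real_derivative \<psi> s - \<psi> (s - t)) (at s)" for s by (rule d)
    \<comment> \<open>The support of \<open>\<psi>\<close> is known only on \<open>[l, r]\<close>
      because a periodic profile repeats its bump. The condition \<open>l + t \<le> s\<close> keeps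
      both \<open>s\<close> and \<open>s - t\<close> in that range, where the antiderivative is
      constant on either side of the bump and gains at most \<open>h\<close> across it.\<close>
    show "0 \<le> \<Phi> s \<and> \<Phi> s \<le> h \<and> (\<not> (a \<le> s \<and> s \<le> a + h + t) \<longrightarrow> \<Phi> s = 0)"
      if z: "\<And>s. l \<le> s \<Longrightarrow> s \<le> r \<Longrightarrow> \<not> (a < s \<and> s < a + h) \<Longrightarrow> \<psi> s = 0"
        and lr: "l \<le> a - t" "a + h + t \<le> r" and s: "l + t \<le> s" "s \<le> r" for l r s
    proof (intro conjI impI)
      have above: "F s = F (a + h)" if "a + h \<le> s" "s \<le> r" for s
        by (rule const[symmetric]) (use that z lr h t in auto)
      have below: "F s = F a" if "s \<le> a" "l \<le> s" for s
        by (rule const) (use that z lr h t in auto)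
      have lo: "F a \<le> F s" if "l \<le> s" for s
        using below[OF _ that] mono[of a s] by (metis linear order_refl)
      have hi: "F s \<le> F (a + h)" if "s \<le> r" for s
        using above[OF _ that] mono[of s "a + h"] by (metis linear order_refl)
      show "0 \<le> \<Phi> s" using mono[of "s - t" s] t by (simp add: \<Phi>_def)
      show "\<Phi> s \<le> h" using t lo[of "s - t"] hi[of s] s Fh by (simp add: \<Phi>_def)
      assume *: "\<not> (a \<le> s \<and> s \<le> a + h + t)"
      show "\<Phi> s = 0"
      proof (cases "s < a")
        case True
        then show ?thesis using below[of s] below[of "s - t"] s t by (simp add: \<Phi>_def)
      next
        case False
        then show ?thesis using above[of s] above[of "s - t"] s * t by (simp add: \<Phi>_def)
      qed
    qed
    show "\<forall>s. \<Phi> (s + c) = \<Phi> s" if per: "\<forall>s. \<psi> (s + c) = \<psi> s" for c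
    proof -
      have "((\<lambda>s. F (s + c) - F s) has_real_derivative 0) (at s)" for s
        using DERIV_diff[OF DERIV_shift[THEN iffD1, OF F[of "s + c"]] F[of s]] per by simp
      then have "F (x + c) - F x = F (y + c) - F y" for x y
        by (rule DERIV_isconst_all[rule_format])
      then have "F (s + c) - F s = F (s - t + c) - F (s - t)" for s by blast
      then show ?thesis by (auto simp: \<Phi>_def algebra_simps)
    qed
  qed
qed

lemma interval_profile:
  fixes a h :: real
  assumes "0 < h"
  obtains \<psi> :: "nat \<Rightarrow> real \<Rightarrow> real" where "\<And>n. smooth (\<psi> n)" "\<And>n s. 0 \<le> \<psi> n s" "\<And>n s. \<psi> n s \<le> 1"
    and "\<And>n s. \<not> (a < s \<and> s < a + h) \<Longrightarrow> \<psi> n s = 0"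
    and "\<And>n s. a < s \<Longrightarrow> s < a + h \<Longrightarrow> 0 < \<psi> n s"
    and "\<And>s. a < s \<Longrightarrow> s < a + h \<Longrightarrow> (\<lambda>n. \<psi> n s) \<longlonglongrightarrow> 1"
proof
  \<comment> \<open>The quadratic is positive exactly on the open interval.\<close>
  let ?\<psi> = "\<lambda>n s. soft_step n ((s - a) * (a + h - s))"
  show "smooth (?\<psi> n)" for n
    by (rule smooth_compose_real[OF smooth_soft_step]) (intro smooth_mult smooth_diff smooth_const smooth_ident)
  show "?\<psi> n s = 0" if "\<not> (a < s \<and> s < a + h)" for n s
    by (rule soft_step_bounds(3)) (use that assms in \<open>auto simp: mult_le_0_iff not_less\<close>)
qed (auto intro!: soft_step_bounds soft_step_tendsto soft_step_pos)

lemma periodic_interval_profile: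
  fixes a h :: real
  assumes h: "0 < h" "h \<le> 2 * pi"
  obtains \<psi> :: "nat \<Rightarrow> real \<Rightarrow> real" where "\<And>n. smooth (\<psi> n)" "\<And>n s. 0 \<le> \<psi> n s" "\<And>n s. \<psi> n s \<le> 1"
    and "\<And>n s. \<psi> n (s + 2 * pi) = \<psi> n s"
    and "\<And>n s. a + h - 2 * pi \<le> s \<Longrightarrow> s \<le> a + 2 * pi \<Longrightarrow> \<not> (a < s \<and> s < a + h) \<Longrightarrow> \<psi> n s = 0"
    and "\<And>s. a < s \<Longrightarrow> s < a + h \<Longrightarrow> (\<lambda>n. \<psi> n s) \<longlonglongrightarrow> 1"
proof
  define m where "m = a + h / 2"
  \<comment> \<open>\<open>cos (s - m)\<close> exceeds \<open>cos (h / 2)\<close> exactly when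
    \<open>s\<close> is closer than \<open>h / 2\<close> to the midpoint modulo
    \<open>2 * pi\<close>. This makes the profile periodic and smooth across the seam, up to the
    full period \<open>h = 2 * pi\<close>, where the threshold is -1.\<close>
  let ?\<psi> = "\<lambda>n s. soft_step n (cos (s - m) - cos (h / 2))"
  show "smooth (?\<psi> n)" for n
    by (rule smooth_compose_real[OF smooth_soft_step])
       (intro smooth_diff smooth_const smooth_compose_real[OF smooth_cos] smooth_ident)
  show "?\<psi> n (s + 2 * pi) = ?\<psi> n s" for n s
    using cos_periodic[of "s - m"] by (simp add: algebra_simps)
  show "?\<psi> n s = 0" if s: "a + h - 2 * pi \<le> s" "s \<le> a + 2 * pi" "\<not> (a < s \<and> s < a + h)" for n s
  proof (rule soft_step_bounds(3))
    have 1: "h / 2 \<le> \<bar>s - m\<bar>" "\<bar>s - m\<bar> \<le> 2 * pi - h / 2" using s h by (auto simp: m_def abs_if)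
    have "cos \<bar>s - m\<bar> \<le> cos (h / 2)"
    proof (cases "\<bar>s - m\<bar> \<le> pi")
      case True
      then show ?thesis using 1 h by (intro cos_monotone_0_pi_le) auto
    next
      case False
      have "cos \<bar>s - m\<bar> = cos (2 * pi - \<bar>s - m\<bar>)" by (metis cos_2pi_minus)
      also have "\<dots> \<le> cos (h / 2)" using 1 False h by (intro cos_monotone_0_pi_le) auto
      finally show ?thesis .
    qed
    then show "cos (s - m) - cos (h / 2) \<le> 0" by simp
  qed
  show "(\<lambda>n. ?\<psi> n s) \<longlonglongrightarrow> 1" if "a < s" "s < a + h" for s
  proof (rule soft_step_tendsto)
    have "\<bar>s - m\<bar> < h / 2" using that by (auto simp: m_def abs_if)
    then have "cos (h / 2) < cos \<bar>s - m\<bar>" using h by (intro cos_monotone_0_pi) auto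
    then show "0 < cos (s - m) - cos (h / 2)" by simp
  qed
qed (auto intro!: soft_step_bounds)

section \<open>Weak derivatives tested on boxes\<close>

text \<open>A Borel measure on the whole line carried by one period. It makes \<open>cylb\<close> a
  plain product of measures, to which Fubini applies, in contrast to the completed measure
  \<open>cyl\<close>.\<close>

definition circle_measure :: "real measure" where
  "circle_measure = density lborel (indicator {0..<2 * pi})"

definition cylb :: "('a::euclidean_space \<times> real) measure" where
  "cylb = lborel \<Otimes>\<^sub>M circle_measure"

abbreviation strip :: "('a \<times> real) set" where
  "strip \<equiv> UNIV \<times> {0..<2 * pi}"

lemma sets_circle_measure[measurable_cong]: "sets circle_measure = sets borel"
  by (simp add: circle_measure_def)

lemma space_circle_measure[simp]: "space circle_measure = UNIV"
  by (simp add: circle_measure_def)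

lemma emeasure_circle_measure: "emeasure circle_measure UNIV = ennreal (2 * pi)"
  by (simp add: circle_measure_def emeasure_density)

interpretation circle: finite_measure circle_measure
  by standard (simp add: emeasure_circle_measure)

interpretation cyl_pair: pair_sigma_finite "lborel :: 'a::euclidean_space measure" circle_measure ..

lemma sets_cylb[measurable_cong]: "sets (cylb :: ('a::euclidean_space \<times> real) measure) = sets borel"
proof -
  have "sets (cylb :: ('a \<times> real) measure) = sets (borel \<Otimes>\<^sub>M borel)" unfolding cylb_def by (rule sets_pair_measure_cong) (simp_all add: sets_circle_measure)
  then show ?thesis by (simp only: borel_prod)
qed

lemma space_cylb[simp]: "space cylb = UNIV"
  by (simp add: cylb_def space_pair_measure)

lemma strip_borel[measurable]: "(strip :: ('a::euclidean_space \<times> real) set) \<in> sets borel"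
  unfolding borel_prod[symmetric] by measurable

lemma cylb_eq_density: "(cylb :: ('a::euclidean_space \<times> real) measure) = density lborel (indicator strip)"
proof -
  have m: "(\<lambda>(x::'a, y::real). 1 * indicator {0..<2 * pi} y :: ennreal) \<in> borel_measurable borel"
    unfolding borel_prod[symmetric] by measurable
  have "(cylb :: ('a \<times> real) measure) = density lborel (\<lambda>_. 1) \<Otimes>\<^sub>M density lborel (indicator {0..<2 * pi})"
    by (simp add: cylb_def circle_measure_def density_1)
  also have "\<dots> = density (lborel \<Otimes>\<^sub>M lborel) (\<lambda>(x, y). 1 * indicator {0..<2 * pi} y)"
    by (rule pair_measure_density)
       (auto simp: sigma_finite_lborel intro: circle.sigma_finite_measure_axioms[unfolded circle_measure_def])
  also have "\<dots> = density lborel (indicator strip)"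
    unfolding lborel_prod by (rule density_cong) (use m in \<open>auto simp: split_beta indicator_def measurable_lborel1\<close>)
  finally show ?thesis .
qed

lemma integral_cylb:
  fixes f :: "_ \<Rightarrow> 'b::{banach, second_countable_topology}"
  assumes "f \<in> borel_measurable borel"
  shows "(LINT z|cylb. f z) = (LINT z|lborel. indicator strip z *\<^sub>R f z)"
  using assms unfolding cylb_eq_density
  by (subst integral_density[symmetric]) (auto simp: measurable_lborel1 ennreal_indicator)

lemma integrable_cylb_iff:
  fixes f :: "_ \<Rightarrow> 'b::{banach, second_countable_topology}"
  assumes "f \<in> borel_measurable borel"
  shows "integrable cylb f \<longleftrightarrow> integrable lborel (\<lambda>z. indicator strip z *\<^sub>R f z)"
  using assms unfolding cylb_eq_density
  by (subst integrable_density[symmetric]) (auto simp: measurable_lborel1 ennreal_indicator)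

lemma AE_cylb_iff: "(AE z in cylb. P z) \<longleftrightarrow> (AE z in lborel. z \<in> strip \<longrightarrow> P z)"
  unfolding cylb_eq_density by (subst AE_density) (auto simp: indicator_def measurable_lborel1)

text \<open>Along the line through \<open>z\<close> in direction \<open>c\<close> only the factor
  \<open>f c\<close> varies, which reduces the derivative to one variable.\<close>

lemma frechet_derivative_coordinate_product:
  fixes f :: "'a::euclidean_space \<Rightarrow> real \<Rightarrow> real"
  assumes sm: "\<And>b. b \<in> Basis \<Longrightarrow> smooth (f b)" and c: "c \<in> Basis"
    and D: "(f c has_real_derivative D) (at (z \<bullet> c))"
  shows "smooth (\<lambda>z. \<Prod>b\<in>Basis. f b (z \<bullet> b))"
    and "frechet_derivative (\<lambda>z. \<Prod>b\<in>Basis. f b (z \<bullet> b)) (at z) c = D * (\<Prod>b\<in>Basis - {c}. f b (z \<bullet> b))"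
proof -
  let ?F = "\<lambda>z::'a. \<Prod>b\<in>Basis. f b (z \<bullet> b)"
  have lin: "linear (\<lambda>z. z \<bullet> b)" for b :: 'a by (rule bounded_linear.linear) (rule bounded_linear_inner_left)
  show F: "smooth ?F"
    by (intro smooth_prod smooth_compose_linear[OF lin] sm)
  have curve: "((\<lambda>t. z + t *\<^sub>R c) has_derivative (\<lambda>t. t *\<^sub>R c)) (at 0)"
    by (auto intro!: derivative_eq_intros)
  have Fz: "(?F has_derivative frechet_derivative ?F (at z)) (at (z + 0 *\<^sub>R c))"
    using smooth_has_derivative[OF F, of z] by simp
  have 1: "((\<lambda>t. ?F (z + t *\<^sub>R c)) has_derivative (\<lambda>t. frechet_derivative ?F (at z) (t *\<^sub>R c))) (at 0)"
    by (rule has_derivative_compose[OF curve Fz])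
  have "?F (z + t *\<^sub>R c) = f c (z \<bullet> c + t) * (\<Prod>b\<in>Basis - {c}. f b (z \<bullet> b))" for t
  proof -
    have "?F (z + t *\<^sub>R c) = f c ((z + t *\<^sub>R c) \<bullet> c) * (\<Prod>b\<in>Basis - {c}. f b ((z + t *\<^sub>R c) \<bullet> b))"
      using c by (intro prod.remove) auto
    also have "(\<Prod>b\<in>Basis - {c}. f b ((z + t *\<^sub>R c) \<bullet> b)) = (\<Prod>b\<in>Basis - {c}. f b (z \<bullet> b))"
      by (rule prod.cong) (use c in \<open>auto simp: inner_add_left inner_Basis\<close>)
    finally show ?thesis using c by (simp add: inner_add_left)
  qed
  moreover have "((\<lambda>t. f c (z \<bullet> c + t) * (\<Prod>b\<in>Basis - {c}. f b (z \<bullet> b))) has_real_derivative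
      D * (\<Prod>b\<in>Basis - {c}. f b (z \<bullet> b))) (at 0)"
    by (rule DERIV_cmult_right) (use D DERIV_shift[of "f c" D 0 "z \<bullet> c"] in \<open>simp add: add.commute\<close>)
  ultimately have 2: "((\<lambda>t. ?F (z + t *\<^sub>R c)) has_derivative (\<lambda>t. D * (\<Prod>b\<in>Basis - {c}. f b (z \<bullet> b)) * t)) (at 0)"
    by (simp add: has_field_derivative_def)
  from fun_cong[OF has_derivative_unique[OF 1 2], of 1]
  show "frechet_derivative ?F (at z) c = D * (\<Prod>b\<in>Basis - {c}. f b (z \<bullet> b))" by simp
qed

lemma cyl_test_coordinate_product:
  fixes f :: "(real^'n) \<times> real \<Rightarrow> real \<Rightarrow> real"
  assumes sm: "\<And>b. b \<in> Basis \<Longrightarrow> smooth (f b)"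
    and per: "\<And>s. f (0, 1) (s + 2 * pi) = f (0, 1) s"
    and supp: "\<And>b s. b \<in> Basis \<Longrightarrow> b \<noteq> (0, 1) \<Longrightarrow> \<not> (l b \<le> s \<and> s \<le> r b) \<Longrightarrow> f b s = 0"
  shows "(\<lambda>z. \<Prod>b\<in>Basis. f b (z \<bullet> b)) \<in> cyl_test"
proof -
  let ?F = "\<lambda>z. \<Prod>b\<in>Basis. f b (z \<bullet> b)"
  have lin: "linear (\<lambda>z. z \<bullet> b)" for b :: "(real^'n) \<times> real" by (rule bounded_linear.linear) (rule bounded_linear_inner_left)
  have "smooth ?F" by (intro smooth_prod smooth_compose_linear[OF lin] sm)
  moreover have "y_periodic ?F"
    unfolding y_periodic_def
  proof (intro allI prod.cong refl)
    fix x :: "real^'n" and y :: real and b :: "(real^'n) \<times> real" assume b: "b \<in> Basis"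
    show "f b ((x, y + 2 * pi) \<bullet> b) = f b ((x, y) \<bullet> b)"
      using b per by (auto simp: Basis_prod_def)
  qed
  moreover have "bounded {x. \<exists>y. ?F (x, y) \<noteq> 0}"
  proof (rule bounded_subset)
    let ?l = "(\<Sum>i\<in>Basis. l (i, 0) *\<^sub>R i) :: real^'n" and ?r = "(\<Sum>i\<in>Basis. r (i, 0) *\<^sub>R i) :: real^'n"
    show "bounded (cbox ?l ?r)" by simp
    show "{x. \<exists>y. ?F (x, y) \<noteq> 0} \<subseteq> cbox ?l ?r"
    proof clarify
      fix x :: "real^'n" and y assume nz: "?F (x, y) \<noteq> 0"
      show "x \<in> cbox ?l ?r"
        unfolding mem_box
      proof
        fix i :: "real^'n" assume i: "i \<in> Basis"
        then have b: "(i, 0::real) \<in> Basis" by (simp add: Basis_prod_def)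
        have "f (i, 0) ((x, y) \<bullet> (i, 0)) \<noteq> 0" using nz b by (metis finite_Basis prod_zero)
        then have "l (i, 0) \<le> x \<bullet> i \<and> x \<bullet> i \<le> r (i, 0)" using supp[OF b] by force
        then show "?l \<bullet> i \<le> x \<bullet> i \<and> x \<bullet> i \<le> ?r \<bullet> i" using i by simp
      qed
    qed
  qed
  ultimately show ?thesis by (simp add: cyl_test_def compact_closure)
qed

text \<open>Only the direction \<open>e\<close>, later that of the circle, receives a periodic
  profile; its vanishing is claimed just on the stretch around a single bump.\<close>

lemma coordinate_profiles:
  fixes a :: "'a::euclidean_space"
  assumes h: "0 < h" "h \<le> 2 * pi"
  obtains \<psi> :: "'a \<Rightarrow> nat \<Rightarrow> real \<Rightarrow> real" where
    "\<And>b n. b \<in> Basis \<Longrightarrow> smooth (\<psi> b n)" "\<And>b n s. b \<in> Basis \<Longrightarrow> 0 \<le> \<psi> b n s" "\<And>b n s. b \<in> Basis \<Longrightarrow> \<psi> b n s \<le> 1"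
    "\<And>n s. e \<in> Basis \<Longrightarrow> \<psi> e n (s + 2 * pi) = \<psi> e n s"
    "\<And>b n s. b \<in> Basis \<Longrightarrow> (b = e \<Longrightarrow> a \<bullet> b + h - 2 * pi \<le> s \<and> s \<le> a \<bullet> b + 2 * pi) \<Longrightarrow>
       \<not> (a \<bullet> b < s \<and> s < a \<bullet> b + h) \<Longrightarrow> \<psi> b n s = 0"
    "\<And>b s. b \<in> Basis \<Longrightarrow> a \<bullet> b < s \<Longrightarrow> s < a \<bullet> b + h \<Longrightarrow> (\<lambda>n. \<psi> b n s) \<longlonglongrightarrow> 1"
proof -
  have "\<forall>b. \<exists>\<psi> :: nat \<Rightarrow> real \<Rightarrow> real. (\<forall>n. smooth (\<psi> n)) \<and> (\<forall>n s. 0 \<le> \<psi> n s) \<and> (\<forall>n s. \<psi> n s \<le> 1) \<and>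
     (b = e \<longrightarrow> (\<forall>n s. \<psi> n (s + 2 * pi) = \<psi> n s)) \<and>
     (\<forall>n s. (b = e \<longrightarrow> a \<bullet> b + h - 2 * pi \<le> s \<and> s \<le> a \<bullet> b + 2 * pi) \<longrightarrow>
       \<not> (a \<bullet> b < s \<and> s < a \<bullet> b + h) \<longrightarrow> \<psi> n s = 0) \<and>
     (\<forall>s. a \<bullet> b < s \<longrightarrow> s < a \<bullet> b + h \<longrightarrow> (\<lambda>n. \<psi> n s) \<longlonglongrightarrow> 1)" (is "\<forall>b. ?Q b")
  proof
    fix b
    show "?Q b"
    proof (cases "b = e")
      case True
      show ?thesis
        apply (rule periodic_interval_profile[OF h, of "a \<bullet> b"])
        subgoal for \<psi> by (intro exI[of _ \<psi>] conjI impI allI) (use True in auto)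
        done
    next
      case False
      show ?thesis
        apply (rule interval_profile[OF h(1), of "a \<bullet> b"])
        subgoal for \<psi> by (intro exI[of _ \<psi>] conjI impI allI) (use False in auto)
        done
    qed
  qed
  then obtain \<psi> where H: "\<forall>b. (\<forall>n. smooth (\<psi> b n)) \<and> (\<forall>n s. 0 \<le> \<psi> b n s) \<and> (\<forall>n s. \<psi> b n s \<le> 1) \<and>
     (b = e \<longrightarrow> (\<forall>n s. \<psi> b n (s + 2 * pi) = \<psi> b n s)) \<and>
     (\<forall>n s. (b = e \<longrightarrow> a \<bullet> b + h - 2 * pi \<le> s \<and> s \<le> a \<bullet> b + 2 * pi) \<longrightarrow>
       \<not> (a \<bullet> b < s \<and> s < a \<bullet> b + h) \<longrightarrow> \<psi> b n s = 0) \<and>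
     (\<forall>s. a \<bullet> b < s \<longrightarrow> s < a \<bullet> b + h \<longrightarrow> (\<lambda>n. \<psi> b n s) \<longlonglongrightarrow> 1)"
    by (rule choice[THEN exE])
  show ?thesis by (rule that[of \<psi>]) (use H in simp_all)
qed

lemma prod_indicator_tendsto:
  fixes F :: "'i \<Rightarrow> nat \<Rightarrow> real"
  assumes I: "finite I" and 0: "\<And>b n. b \<in> I \<Longrightarrow> \<not> P b \<Longrightarrow> F b n = 0"
    and 1: "\<And>b. b \<in> I \<Longrightarrow> P b \<Longrightarrow> F b \<longlonglongrightarrow> 1"
  shows "(\<lambda>n. \<Prod>b\<in>I. F b n) \<longlonglongrightarrow> of_bool (\<forall>b\<in>I. P b)"
proof (cases "\<forall>b\<in>I. P b")
  case True
  then have "(\<lambda>n. \<Prod>b\<in>I. F b n) \<longlonglongrightarrow> (\<Prod>b\<in>I. 1)" using 1 by (intro tendsto_prod) auto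
  then show ?thesis using True by simp
next
  case False
  then have "(\<Prod>b\<in>I. F b n) = 0" for n using I 0 by (metis prod_zero)
  moreover have "of_bool (\<forall>b\<in>I. P b) = (0::real)" using False by auto
  ultimately show ?thesis by (simp only: tendsto_const)
qed

lemma strip_inner: "z \<in> strip \<longleftrightarrow> 0 \<le> z \<bullet> (0, 1) \<and> z \<bullet> (0, 1) < 2 * pi"
  by (cases z) auto

lemma set_integrable_strip:
  fixes u :: "'a::euclidean_space \<times> real \<Rightarrow> complex"
  assumes [measurable]: "u \<in> borel_measurable borel"
    and u2: "integrable cylb (\<lambda>z. (norm (u z))\<^sup>2)" and A: "bounded A" "A \<in> sets borel"
  shows "integrable lborel (\<lambda>z. indicator A z *\<^sub>R (indicator strip z *\<^sub>R u z))"
proof -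
  have "integrable lborel (\<lambda>z. (norm (indicator strip z *\<^sub>R u z))\<^sup>2)"
  proof -
    have "(norm (indicator strip z *\<^sub>R u z))\<^sup>2 = indicator strip z *\<^sub>R (norm (u z))\<^sup>2" for z
      by (simp add: indicator_def)
    then show ?thesis using u2 by (simp only: integrable_cylb_iff[symmetric]) (simp add: integrable_cylb_iff)
  qed
  then have "set_integrable lborel A (\<lambda>z. indicator strip z *\<^sub>R u z)"
    using A emeasure_bounded_finite[OF A(1)] by (intro set_integrable_square) auto
  then show ?thesis by (simp add: set_integrable_def)
qed

text \<open>The test function is a trapezoid in direction \<open>c\<close> times interval profiles
  in the others. Its derivative along \<open>c\<close> is the smoothed indicator of the box minus
  that of the translate, and it is at most \<open>h\<close> on the swept box. The factor is the side
  \<open>h\<close> whatever the displacement \<open>t\<close>: with \<open>t = h\<close> the bound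
  feeds Gagliardo--Nirenberg, with \<open>t\<close> fixed and \<open>h\<close> tending to 0 it feeds
  the Poincare inequality.\<close>

lemma weak_deriv_box_difference:
  fixes u g :: "(real^'n) \<times> real \<Rightarrow> complex"
  assumes meas[measurable]: "u \<in> borel_measurable borel" "g \<in> borel_measurable borel"
    and u2: "integrable cylb (\<lambda>z. (norm (u z))\<^sup>2)" and g2: "integrable cylb (\<lambda>z. (norm (g z))\<^sup>2)"
    and wd: "is_weak_deriv cylb cyl_test c u g" and c: "c \<in> Basis"
    and h: "0 < h" and t: "0 < t"
    and a: "0 \<le> a \<bullet> (0, 1)" "(a + h *\<^sub>R One + t *\<^sub>R c) \<bullet> (0, 1) \<le> 2 * pi"
  shows "norm ((LINT z:box (a + t *\<^sub>R c) (a + t *\<^sub>R c + h *\<^sub>R One)|lborel. u z) - (LINT z:box a (a + h *\<^sub>R One)|lborel. u z))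
        \<le> h * (LINT z:box a (a + h *\<^sub>R One + t *\<^sub>R c)|lborel. norm (g z))"
proof -
  define e :: "(real^'n) \<times> real" where "e = (0, 1)"
  have e: "e \<in> Basis" by (simp add: e_def Basis_prod_def)
  have ah: "a \<bullet> e + h + t * (c \<bullet> e) \<le> 2 * pi"
    using a(2) e unfolding e_def[symmetric] by (simp add: inner_add_left)
  have ce: "c \<bullet> e = of_bool (c = e)" using c e by (simp add: inner_Basis)
  have ee[simp]: "e \<bullet> e = 1" using e by (simp add: inner_same_Basis)
  have a0: "0 \<le> a \<bullet> e" using a by (simp add: e_def)
  have ah2: "a \<bullet> e + h \<le> 2 * pi" using ah t by (cases "c = e") (auto simp: ce)
  have h2: "h \<le> 2 * pi" using ah a0 t e by (cases "c = e") (auto simp: ce inner_same_Basis)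
  obtain \<psi> :: "(real^'n) \<times> real \<Rightarrow> nat \<Rightarrow> real \<Rightarrow> real" where
    sm: "\<And>b n. b \<in> Basis \<Longrightarrow> smooth (\<psi> b n)" and nn: "\<And>b n s. b \<in> Basis \<Longrightarrow> 0 \<le> \<psi> b n s" and le1: "\<And>b n s. b \<in> Basis \<Longrightarrow> \<psi> b n s \<le> 1"
    and per: "\<And>n s. e \<in> Basis \<Longrightarrow> \<psi> e n (s + 2 * pi) = \<psi> e n s"
    and zero: "\<And>b n s. b \<in> Basis \<Longrightarrow> (b = e \<Longrightarrow> a \<bullet> b + h - 2 * pi \<le> s \<and> s \<le> a \<bullet> b + 2 * pi) \<Longrightarrow>
       \<not> (a \<bullet> b < s \<and> s < a \<bullet> b + h) \<Longrightarrow> \<psi> b n s = 0"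
    and lim: "\<And>b s. b \<in> Basis \<Longrightarrow> a \<bullet> b < s \<Longrightarrow> s < a \<bullet> b + h \<Longrightarrow> (\<lambda>n. \<psi> b n s) \<longlonglongrightarrow> 1"
    by (rule coordinate_profiles[OF h h2, where a = a and e = e]) blast
  have "\<exists>\<Phi>. smooth \<Phi> \<and> (\<forall>s. (\<Phi> has_real_derivative \<psi> c n s - \<psi> c n (s - t)) (at s)) \<and>
     (\<forall>l r s. (\<forall>s. l \<le> s \<longrightarrow> s \<le> r \<longrightarrow> \<not> (a \<bullet> c < s \<and> s < a \<bullet> c + h) \<longrightarrow> \<psi> c n s = 0) \<longrightarrow>
        l \<le> a \<bullet> c - t \<longrightarrow> a \<bullet> c + h + t \<le> r \<longrightarrow> l + t \<le> s \<longrightarrow> s \<le> r \<longrightarrow>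
        0 \<le> \<Phi> s \<and> \<Phi> s \<le> h \<and> (\<not> (a \<bullet> c \<le> s \<and> s \<le> a \<bullet> c + h + t) \<longrightarrow> \<Phi> s = 0)) \<and>
     (\<forall>q. (\<forall>s. \<psi> c n (s + q) = \<psi> c n s) \<longrightarrow> (\<forall>s. \<Phi> (s + q) = \<Phi> s))" (is "\<exists>\<Phi>. ?P n \<Phi>") for n
    apply (rule trapezoid_exists[where \<psi> = "\<psi> c n" and a = "a \<bullet> c", OF sm[OF c] nn[OF c] le1[OF c] h t])
    subgoal for \<Phi> by (intro exI[of _ \<Phi>] conjI) blast+
    done
  then have "\<forall>n. \<exists>\<Phi>. ?P n \<Phi>" by blast
  then obtain \<Phi> where H: "\<forall>n. ?P n (\<Phi> n)" by (rule choice[THEN exE])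
  have \<Phi>: "\<And>n. smooth (\<Phi> n)"
      "\<And>n s. (\<Phi> n has_real_derivative \<psi> c n s - \<psi> c n (s - t)) (at s)"
      "\<And>n l r s. \<lbrakk>\<And>s. l \<le> s \<Longrightarrow> s \<le> r \<Longrightarrow> \<not> (a \<bullet> c < s \<and> s < a \<bullet> c + h) \<Longrightarrow> \<psi> c n s = 0;
        l \<le> a \<bullet> c - t; a \<bullet> c + h + t \<le> r; l + t \<le> s; s \<le> r\<rbrakk> \<Longrightarrow>
        0 \<le> \<Phi> n s \<and> \<Phi> n s \<le> h \<and> (\<not> (a \<bullet> c \<le> s \<and> s \<le> a \<bullet> c + h + t) \<longrightarrow> \<Phi> n s = 0)"
      "\<And>n q s. (\<And>s. \<psi> c n (s + q) = \<psi> c n s) \<Longrightarrow> \<Phi> n (s + q) = \<Phi> n s"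
  proof -
    show "smooth (\<Phi> n)" "(\<Phi> n has_real_derivative \<psi> c n s - \<psi> c n (s - t)) (at s)" for n s
      using H[THEN spec, of n] by simp_all
    show "\<Phi> n (s + q) = \<Phi> n s" if "\<And>s. \<psi> c n (s + q) = \<psi> c n s" for n q s
      using H[THEN spec, of n, THEN conjunct2, THEN conjunct2, THEN conjunct2] that by blast
    show "0 \<le> \<Phi> n s \<and> \<Phi> n s \<le> h \<and> (\<not> (a \<bullet> c \<le> s \<and> s \<le> a \<bullet> c + h + t) \<longrightarrow> \<Phi> n s = 0)"
      if "\<And>s. l \<le> s \<Longrightarrow> s \<le> r \<Longrightarrow> \<not> (a \<bullet> c < s \<and> s < a \<bullet> c + h) \<Longrightarrow> \<psi> c n s = 0"
        "l \<le> a \<bullet> c - t" "a \<bullet> c + h + t \<le> r" "l + t \<le> s" "s \<le> r" for n l r s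
      using H[THEN spec, of n, THEN conjunct2, THEN conjunct2, THEN conjunct1, THEN spec[of _ l], THEN spec[of _ r], THEN spec[of _ s]] that
      by blast
  qed
  have zero_x: "\<psi> b n s = 0" if "b \<in> Basis" "b \<noteq> e" "\<not> (a \<bullet> b < s \<and> s < a \<bullet> b + h)" for b n s
    using zero[of b s n] that by blast
  have \<Phi>_x: "0 \<le> \<Phi> n s \<and> \<Phi> n s \<le> h \<and> (\<not> (a \<bullet> c \<le> s \<and> s \<le> a \<bullet> c + h + t) \<longrightarrow> \<Phi> n s = 0)"
    if "c \<noteq> e \<or> 0 \<le> s \<and> s \<le> 2 * pi" for n s
  proof (cases "c = e")
    case True
    \<comment> \<open>In the circle direction \<open>a \<bullet> c + h + t \<le> 2 * pi\<close>
      gives \<open>l + t \<le> 0\<close>, so the whole period lies in the range where the trapezoid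
      is known.\<close>
    show ?thesis
      by (rule \<Phi>(3)[where l = "a \<bullet> c + h - 2 * pi" and r = "a \<bullet> c + 2 * pi"])
         (use that True ah a0 h t zero[OF c] in \<open>auto simp: ce\<close>)
  next
    case False
    show ?thesis
      by (rule \<Phi>(3)[where l = "min (a \<bullet> c) s - t" and r = "max (a \<bullet> c + h + t) s"])
         (use that False zero_x[OF c] in auto)
  qed
  define fam where "fam n b = (if b = c then \<Phi> n else \<psi> b n)" for n b
  define \<phi> where "\<phi> n z = (\<Prod>b\<in>Basis. fam n b (z \<bullet> b))" for n z
  define \<rho> where "\<rho> n z = (\<Prod>b\<in>Basis. \<psi> b n (z \<bullet> b))" for n z
  define \<sigma> where "\<sigma> n z = (\<Prod>b\<in>Basis. \<psi> b n ((z - t *\<^sub>R c) \<bullet> b))" for n and z :: "(real^'n) \<times> real"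
  define Big where "Big = cbox a (a + h *\<^sub>R One + t *\<^sub>R c)"
  have smf: "smooth (fam n b)" if "b \<in> Basis" for n b using that \<Phi>(1) sm by (simp add: fam_def)
  have test: "\<phi> n \<in> cyl_test" for n
    unfolding \<phi>_def
  proof (rule cyl_test_coordinate_product[where l = "\<lambda>b. a \<bullet> b" and r = "\<lambda>b. a \<bullet> b + h + t", OF smf])
    show "fam n (0, 1) (s + 2 * pi) = fam n (0, 1) s" for s
      using per[OF e] \<Phi>(4)[of n "2 * pi" s] by (auto simp: fam_def e_def)
    fix b :: "(real^'n) \<times> real" and s
    assume "b \<in> Basis" "b \<noteq> (0, 1)" "\<not> (a \<bullet> b \<le> s \<and> s \<le> a \<bullet> b + h + t)"
    then show "fam n b s = 0" using zero_x[of b s n] \<Phi>_x[of s n] t by (auto simp: fam_def e_def)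
  qed
  have deriv: "frechet_derivative (\<phi> n) (at z) c = \<rho> n z - \<sigma> n z" for n z
  proof -
    have "frechet_derivative (\<phi> n) (at z) c = (\<psi> c n (z \<bullet> c) - \<psi> c n (z \<bullet> c - t)) * (\<Prod>b\<in>Basis - {c}. fam n b (z \<bullet> b))"
      unfolding \<phi>_def
      by (rule frechet_derivative_coordinate_product(2)[OF smf c]) (use \<Phi>(2) in \<open>auto simp: fam_def\<close>)
    also have "(\<Prod>b\<in>Basis - {c}. fam n b (z \<bullet> b)) = (\<Prod>b\<in>Basis - {c}. \<psi> b n (z \<bullet> b))"
      by (rule prod.cong) (auto simp: fam_def)
    finally have 1: "frechet_derivative (\<phi> n) (at z) c = (\<psi> c n (z \<bullet> c) - \<psi> c n (z \<bullet> c - t)) * (\<Prod>b\<in>Basis - {c}. \<psi> b n (z \<bullet> b))" .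
    have 2: "\<rho> n z = \<psi> c n (z \<bullet> c) * (\<Prod>b\<in>Basis - {c}. \<psi> b n (z \<bullet> b))"
      unfolding \<rho>_def by (rule prod.remove) (use c in auto)
    have "\<sigma> n z = \<psi> c n ((z - t *\<^sub>R c) \<bullet> c) * (\<Prod>b\<in>Basis - {c}. \<psi> b n ((z - t *\<^sub>R c) \<bullet> b))"
      unfolding \<sigma>_def by (rule prod.remove) (use c in auto)
    also have "(\<Prod>b\<in>Basis - {c}. \<psi> b n ((z - t *\<^sub>R c) \<bullet> b)) = (\<Prod>b\<in>Basis - {c}. \<psi> b n (z \<bullet> b))"
      by (rule prod.cong) (use c in \<open>auto simp: inner_diff_left inner_Basis\<close>)
    finally have 3: "\<sigma> n z = \<psi> c n (z \<bullet> c - t) * (\<Prod>b\<in>Basis - {c}. \<psi> b n (z \<bullet> b))"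
      using c by (simp add: inner_diff_left)
    show ?thesis unfolding 1 2 3 by (simp add: algebra_simps)
  qed
  have BigI: "z \<in> Big" if "\<And>b. b \<in> Basis \<Longrightarrow> a \<bullet> b \<le> z \<bullet> b \<and> z \<bullet> b \<le> a \<bullet> b + h + (if b = c then t else 0)" for z
    unfolding Big_def mem_box using that c by (fastforce simp: inner_add_left inner_Basis)
  have \<psi>_strip: "\<psi> b n (z \<bullet> b) = 0" if "z \<in> strip" "b \<in> Basis" "\<not> (a \<bullet> b < z \<bullet> b \<and> z \<bullet> b < a \<bullet> b + h)" for b n z
    by (rule zero) (use that a0 ah2 in \<open>auto simp: strip_inner e_def[symmetric]\<close>)
  have \<psi>_strip': "\<psi> b n ((z - t *\<^sub>R c) \<bullet> b) = 0"
    if "z \<in> strip" "b \<in> Basis" "\<not> (a \<bullet> b < (z - t *\<^sub>R c) \<bullet> b \<and> (z - t *\<^sub>R c) \<bullet> b < a \<bullet> b + h)" for b n z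
  proof (rule zero[OF that(2) _ that(3)])
    assume "b = e"
    then show "a \<bullet> b + h - 2 * pi \<le> (z - t *\<^sub>R c) \<bullet> b \<and> (z - t *\<^sub>R c) \<bullet> b \<le> a \<bullet> b + 2 * pi"
      using that(1) a0 ah ah2 t by (cases "c = e") (auto simp: strip_inner e_def[symmetric] ce inner_diff_left)
  qed
  have \<phi>_bd: "0 \<le> \<phi> n z \<and> \<phi> n z \<le> h * indicator Big z" if z: "z \<in> strip" for n z
  proof -
    have zc: "c \<noteq> e \<or> 0 \<le> z \<bullet> c \<and> z \<bullet> c \<le> 2 * pi" using z by (auto simp: strip_inner e_def)
    have eq: "\<phi> n z = \<Phi> n (z \<bullet> c) * (\<Prod>b\<in>Basis - {c}. \<psi> b n (z \<bullet> b))"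
    proof -
      have "\<phi> n z = fam n c (z \<bullet> c) * (\<Prod>b\<in>Basis - {c}. fam n b (z \<bullet> b))"
        unfolding \<phi>_def by (rule prod.remove) (use c in auto)
      also have "(\<Prod>b\<in>Basis - {c}. fam n b (z \<bullet> b)) = (\<Prod>b\<in>Basis - {c}. \<psi> b n (z \<bullet> b))"
        by (rule prod.cong) (auto simp: fam_def)
      finally show ?thesis by (simp add: fam_def)
    qed
    have p: "0 \<le> (\<Prod>b\<in>Basis - {c}. \<psi> b n (z \<bullet> b))" "(\<Prod>b\<in>Basis - {c}. \<psi> b n (z \<bullet> b)) \<le> 1"
      using nn le1 by (auto intro!: prod_nonneg prod_le_1)
    show ?thesis
    proof (cases "z \<in> Big")
      case True
      have "\<Phi> n (z \<bullet> c) * (\<Prod>b\<in>Basis - {c}. \<psi> b n (z \<bullet> b)) \<le> h * 1"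
        using \<Phi>_x[OF zc] p h by (intro mult_mono) auto
      then show ?thesis using True \<Phi>_x[OF zc, of n] p by (simp add: eq)
    next
      case False
      then obtain b where b: "b \<in> Basis" "\<not> (a \<bullet> b \<le> z \<bullet> b \<and> z \<bullet> b \<le> a \<bullet> b + h + (if b = c then t else 0))"
        using BigI by blast
      have "\<phi> n z = 0"
      proof (cases "b = c")
        case True
        then show ?thesis using \<Phi>_x[OF zc, of n] b by (auto simp: eq)
      next
        case False
        then have "\<psi> b n (z \<bullet> b) = 0" using \<psi>_strip[OF z b(1)] b by auto
        then have "(\<Prod>b\<in>Basis - {c}. \<psi> b n (z \<bullet> b)) = 0"
          using b False by (intro prod_zero) (auto intro!: bexI[of _ b])
        then show ?thesis by (simp add: eq)
      qed
      then show ?thesis using False by simp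
    qed
  qed
  have lim_\<rho>: "(\<lambda>n. \<rho> n z) \<longlonglongrightarrow> indicator (box a (a + h *\<^sub>R One)) z" if z: "z \<in> strip" for z
  proof -
    have "(\<lambda>n. \<rho> n z) \<longlonglongrightarrow> of_bool (\<forall>b\<in>Basis. a \<bullet> b < z \<bullet> b \<and> z \<bullet> b < a \<bullet> b + h)"
      unfolding \<rho>_def by (rule prod_indicator_tendsto) (auto intro: \<psi>_strip[OF z] lim)
    moreover have "indicator (box a (a + h *\<^sub>R One)) z = (of_bool (\<forall>b\<in>Basis. a \<bullet> b < z \<bullet> b \<and> z \<bullet> b < a \<bullet> b + h) :: real)"
      by (auto simp: indicator_def mem_box inner_add_left)
    ultimately show ?thesis by (simp only:)
  qed
  have lim_\<sigma>: "(\<lambda>n. \<sigma> n z) \<longlonglongrightarrow> indicator (box (a + t *\<^sub>R c) (a + t *\<^sub>R c + h *\<^sub>R One)) z" if z: "z \<in> strip" for z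
  proof -
    have "(\<lambda>n. \<sigma> n z) \<longlonglongrightarrow> of_bool (\<forall>b\<in>Basis. a \<bullet> b < (z - t *\<^sub>R c) \<bullet> b \<and> (z - t *\<^sub>R c) \<bullet> b < a \<bullet> b + h)"
      unfolding \<sigma>_def by (rule prod_indicator_tendsto) (auto intro: \<psi>_strip'[OF z] lim)
    moreover have "indicator (box (a + t *\<^sub>R c) (a + t *\<^sub>R c + h *\<^sub>R One)) z
        = (of_bool (\<forall>b\<in>Basis. a \<bullet> b < (z - t *\<^sub>R c) \<bullet> b \<and> (z - t *\<^sub>R c) \<bullet> b < a \<bullet> b + h) :: real)"
      by (auto simp: indicator_def mem_box inner_add_left inner_diff_left algebra_simps)
    ultimately show ?thesis by (simp only:)
  qed
  have \<rho>_bd: "\<bar>\<rho> n z - \<sigma> n z\<bar> \<le> indicator Big z" if z: "z \<in> strip" for n z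
  proof -
    have 01: "0 \<le> \<rho> n z" "\<rho> n z \<le> 1" "0 \<le> \<sigma> n z" "\<sigma> n z \<le> 1"
      unfolding \<rho>_def \<sigma>_def using nn le1 by (auto intro!: prod_nonneg prod_le_1)
    show ?thesis
    proof (cases "z \<in> Big")
      case False
      have "\<rho> n z = 0"
      proof (rule ccontr)
        assume "\<rho> n z \<noteq> 0"
        then have "\<forall>b\<in>Basis. \<psi> b n (z \<bullet> b) \<noteq> 0" unfolding \<rho>_def by (metis finite_Basis prod_zero)
        then have "\<forall>b\<in>Basis. a \<bullet> b < z \<bullet> b \<and> z \<bullet> b < a \<bullet> b + h" using \<psi>_strip[OF z] by blast
        then show False using BigI[of z] False t by fastforce
      qed
      moreover have "\<sigma> n z = 0"
      proof (rule ccontr)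
        assume "\<sigma> n z \<noteq> 0"
        then have "\<forall>b\<in>Basis. \<psi> b n ((z - t *\<^sub>R c) \<bullet> b) \<noteq> 0" unfolding \<sigma>_def by (metis finite_Basis prod_zero)
        then have "\<forall>b\<in>Basis. a \<bullet> b < (z - t *\<^sub>R c) \<bullet> b \<and> (z - t *\<^sub>R c) \<bullet> b < a \<bullet> b + h" using \<psi>_strip'[OF z] by blast
        then have "\<forall>b\<in>Basis. a \<bullet> b \<le> z \<bullet> b \<and> z \<bullet> b \<le> a \<bullet> b + h + (if b = c then t else 0)"
          using c t by (auto simp: inner_diff_left inner_Basis split: if_splits)
        then show False using BigI[of z] False by blast
      qed
      ultimately show ?thesis by simp
    qed (use 01 in auto)
  qed
  have contm: "\<phi> n \<in> borel_measurable borel" "\<rho> n \<in> borel_measurable borel" "\<sigma> n \<in> borel_measurable borel" for n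
  proof -
    have 1: "\<psi> b n \<in> borel_measurable borel" "fam n b \<in> borel_measurable borel" if "b \<in> Basis" for b
      using smooth_continuous_on[OF sm[OF that]] smooth_continuous_on[OF smf[OF that]]
      by (auto intro!: borel_measurable_continuous_onI)
    show "\<phi> n \<in> borel_measurable borel" unfolding \<phi>_def[abs_def]
      by (intro borel_measurable_prod measurable_compose[OF _ 1(2)]) auto
    show "\<rho> n \<in> borel_measurable borel" unfolding \<rho>_def[abs_def]
      by (intro borel_measurable_prod measurable_compose[OF _ 1(1)]) auto
    show "\<sigma> n \<in> borel_measurable borel" unfolding \<sigma>_def[abs_def]
      by (intro borel_measurable_prod measurable_compose[OF _ 1(1)]) auto
  qed
  note [measurable] = contm
  have [measurable]: "Big \<in> sets borel" by (simp add: Big_def)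
  have bdB: "bounded Big" by (simp add: Big_def)
  have iu: "integrable lborel (\<lambda>z. indicator Big z *\<^sub>R (indicator strip z *\<^sub>R u z))"
    by (rule set_integrable_strip[OF meas(1) u2 bdB]) simp
  have ig: "integrable lborel (\<lambda>z. indicator Big z *\<^sub>R (indicator strip z *\<^sub>R g z))"
    by (rule set_integrable_strip[OF meas(2) g2 bdB]) simp
  have sub: "Big \<subseteq> UNIV \<times> {0..2 * pi}"
  proof
    fix z assume "z \<in> Big"
    then have "a \<bullet> e \<le> z \<bullet> e \<and> z \<bullet> e \<le> (a + h *\<^sub>R One + t *\<^sub>R c) \<bullet> e" using e unfolding Big_def mem_box by blast
    then have "0 \<le> z \<bullet> e \<and> z \<bullet> e \<le> 2 * pi" using a0 a(2) unfolding e_def by linarith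
    then show "z \<in> UNIV \<times> {0..2 * pi}" by (cases z) (auto simp: e_def)
  qed
  let ?B1 = "box a (a + h *\<^sub>R One)" and ?B2 = "box (a + t *\<^sub>R c) (a + t *\<^sub>R c + h *\<^sub>R One)"
    and ?B = "box a (a + h *\<^sub>R One + t *\<^sub>R c)"
  have in_strip: "z \<in> strip" if "z \<in> ?B1 \<or> z \<in> ?B2 \<or> z \<in> ?B" for z
  proof -
    have tc: "0 \<le> t * (c \<bullet> e)" using t ce by simp
    have "(a \<bullet> e < z \<bullet> e \<and> z \<bullet> e < a \<bullet> e + h) \<or>
        (a \<bullet> e + t * (c \<bullet> e) < z \<bullet> e \<and> z \<bullet> e < a \<bullet> e + t * (c \<bullet> e) + h) \<or>
        (a \<bullet> e < z \<bullet> e \<and> z \<bullet> e < a \<bullet> e + h + t * (c \<bullet> e))"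
      using that e unfolding mem_box by (force simp: inner_add_left)
    then have "a \<bullet> e < z \<bullet> e \<and> z \<bullet> e < 2 * pi" using tc ah by linarith
    then show ?thesis using a0 by (simp add: strip_inner e_def)
  qed
  have "(\<lambda>n. LINT z|lborel. indicator strip z *\<^sub>R (u z * of_real (frechet_derivative (\<phi> n) (at z) c)))
      \<longlonglongrightarrow> (LINT z|lborel. indicator ?B1 z *\<^sub>R u z - indicator ?B2 z *\<^sub>R u z)"
  proof (rule integral_dominated_convergence[where w = "\<lambda>z. norm (indicator Big z *\<^sub>R (indicator strip z *\<^sub>R u z))"])
    show "integrable lborel (\<lambda>z. norm (indicator Big z *\<^sub>R (indicator strip z *\<^sub>R u z)))" using iu by (rule integrable_norm)
    show "AE z in lborel. (\<lambda>n. indicator strip z *\<^sub>R (u z * of_real (frechet_derivative (\<phi> n) (at z) c)))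
        \<longlonglongrightarrow> indicator ?B1 z *\<^sub>R u z - indicator ?B2 z *\<^sub>R u z"
    proof (rule AE_I2)
      fix z
      show "(\<lambda>n. indicator strip z *\<^sub>R (u z * of_real (frechet_derivative (\<phi> n) (at z) c)))
        \<longlonglongrightarrow> indicator ?B1 z *\<^sub>R u z - indicator ?B2 z *\<^sub>R u z"
      proof (cases "z \<in> strip")
        case True
        have "(\<lambda>n. u z * of_real (\<rho> n z - \<sigma> n z)) \<longlonglongrightarrow> u z * of_real (indicator ?B1 z - indicator ?B2 z)"
          by (intro tendsto_intros lim_\<rho>[OF True] lim_\<sigma>[OF True])
        then show ?thesis using True by (simp add: deriv scaleR_conv_of_real algebra_simps)
      next
        case False
        then show ?thesis using in_strip[of z] by (auto simp: indicator_def)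
      qed
    qed
    fix n
    show "AE z in lborel. norm (indicator strip z *\<^sub>R (u z * of_real (frechet_derivative (\<phi> n) (at z) c)))
        \<le> norm (indicator Big z *\<^sub>R (indicator strip z *\<^sub>R u z))"
    proof (rule AE_I2)
      fix z
      show "norm (indicator strip z *\<^sub>R (u z * of_real (frechet_derivative (\<phi> n) (at z) c)))
        \<le> norm (indicator Big z *\<^sub>R (indicator strip z *\<^sub>R u z))"
        using \<rho>_bd[of z n] mult_left_mono[of "\<bar>\<rho> n z - \<sigma> n z\<bar>" "indicator Big z" "norm (u z)"]
        by (cases "z \<in> strip") (auto simp: deriv norm_mult mult.commute simp del: of_real_diff)
    qed
  qed (unfold deriv, measurable)
  moreover have "norm (LINT z|lborel. indicator strip z *\<^sub>R (u z * of_real (frechet_derivative (\<phi> n) (at z) c)))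
      \<le> h * (LINT z:?B|lborel. norm (g z))" for n
  proof -
    have "(LINT z|lborel. indicator strip z *\<^sub>R (u z * of_real (frechet_derivative (\<phi> n) (at z) c)))
        = (LINT z|cylb. u z * of_real (frechet_derivative (\<phi> n) (at z) c))"
      unfolding deriv by (subst integral_cylb) measurable
    also have "\<dots> = - (LINT z|cylb. g z * of_real (\<phi> n z))"
      using wd test by (auto simp: is_weak_deriv_def)
    also have "(LINT z|cylb. g z * of_real (\<phi> n z)) = (LINT z|lborel. indicator strip z *\<^sub>R (g z * of_real (\<phi> n z)))"
      by (subst integral_cylb) measurable
    finally have "norm (LINT z|lborel. indicator strip z *\<^sub>R (u z * of_real (frechet_derivative (\<phi> n) (at z) c)))
       = norm (LINT z|lborel. indicator strip z *\<^sub>R (g z * of_real (\<phi> n z)))" by simp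
    also have "\<dots> \<le> (LINT z|lborel. h * norm (indicator Big z *\<^sub>R (indicator strip z *\<^sub>R g z)))"
    proof (rule order_trans[OF integral_norm_bound integral_mono])
      show bd: "norm (indicator strip z *\<^sub>R (g z * of_real (\<phi> n z))) \<le> h * norm (indicator Big z *\<^sub>R (indicator strip z *\<^sub>R g z))" for z
        using \<phi>_bd[of z n] mult_left_mono[of "\<phi> n z" "h * indicator Big z" "norm (g z)"]
        by (cases "z \<in> strip") (auto simp: norm_mult mult_ac)
      show int: "integrable lborel (\<lambda>z. h * norm (indicator Big z *\<^sub>R (indicator strip z *\<^sub>R g z)))"
        using ig by (intro integrable_mult_right integrable_norm)
      show "integrable lborel (\<lambda>z. norm (indicator strip z *\<^sub>R (g z * of_real (\<phi> n z))))"
        by (rule Bochner_Integration.integrable_bound[OF int])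
           (measurable, intro AE_I2, unfold real_norm_def abs_norm_cancel, rule order_trans[OF bd abs_ge_self])
    qed
    also have "\<dots> = h * (LINT z:Big|lborel. norm (indicator strip z *\<^sub>R g z))"
      by (simp add: set_lebesgue_integral_def mult.assoc)
    \<comment> \<open>The dominating box is closed and the claimed one open; they differ by a null
      set.\<close>
    also have "(LINT z:Big|lborel. norm (indicator strip z *\<^sub>R g z)) = (LINT z:?B|lborel. norm (indicator strip z *\<^sub>R g z))"
    proof -
      have 1: "set_integrable lborel Big (\<lambda>z. norm (indicator strip z *\<^sub>R g z))"
        using integrable_norm[OF ig] by (simp add: set_integrable_def mult.assoc)
      moreover have "set_integrable lborel ?B (\<lambda>z. norm (indicator strip z *\<^sub>R g z))"
        by (rule set_integrable_subset[OF 1]) (auto simp: Big_def box_subset_cbox)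
      ultimately show ?thesis
        by (simp add: set_borel_integral_eq_integral(2) Big_def integral_open_interval)
    qed
    also have "\<dots> = (LINT z:?B|lborel. norm (g z))"
      unfolding set_lebesgue_integral_def
      by (rule Bochner_Integration.integral_cong) (use in_strip in \<open>auto simp: indicator_def\<close>)
    finally show ?thesis .
  qed
  ultimately have "norm (LINT z|lborel. indicator ?B1 z *\<^sub>R u z - indicator ?B2 z *\<^sub>R u z) \<le> h * (LINT z:?B|lborel. norm (g z))"
    by (intro LIMSEQ_le_const2[OF tendsto_norm]) auto
  also have "(LINT z|lborel. indicator ?B1 z *\<^sub>R u z - indicator ?B2 z *\<^sub>R u z) = (LINT z:?B1|lborel. u z) - (LINT z:?B2|lborel. u z)"
  proof -
    have "integrable lborel (\<lambda>z. indicator A z *\<^sub>R u z)" if "A = ?B1 \<or> A = ?B2" for A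
    proof -
      have "integrable lborel (\<lambda>z. indicator A z *\<^sub>R (indicator strip z *\<^sub>R u z))"
        by (rule set_integrable_strip[OF meas(1) u2]) (use that in auto)
      moreover have "indicator A z *\<^sub>R (indicator strip z *\<^sub>R u z) = indicator A z *\<^sub>R u z" for z
        using in_strip[of z] that by (auto simp: indicator_def)
      ultimately show ?thesis by (simp only:)
    qed
    then show ?thesis unfolding set_lebesgue_integral_def by (intro Bochner_Integration.integral_diff) auto
  qed
  finally show ?thesis by (simp add: norm_minus_commute)
qed

text \<open>Products of profiles tend to indicators of boxes, so all box integrals of
  \<open>g\<close> inside the strip vanish, and Lebesgue differentiation concludes. This is the
  source of the uniqueness of weak derivatives.\<close>

lemma cyl_test_orthogonal_imp_zero:
  fixes g :: "(real^'n) \<times> real \<Rightarrow> complex"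
  assumes [measurable]: "g \<in> borel_measurable borel" and g2: "integrable cylb (\<lambda>z. (norm (g z))\<^sup>2)"
    and orth: "\<And>\<phi>. \<phi> \<in> cyl_test \<Longrightarrow> (LINT z|cylb. g z * of_real (\<phi> z)) = 0"
  shows "AE z in cylb. g z = 0"
proof -
  define e :: "(real^'n) \<times> real" where "e = (0, 1)"
  have e: "e \<in> Basis" by (simp add: e_def Basis_prod_def)
  define G where "G z = indicator strip z *\<^sub>R g z" for z
  have [measurable]: "G \<in> borel_measurable borel" unfolding G_def[abs_def] by measurable
  have G2: "integrable lborel (\<lambda>z. (norm (G z))\<^sup>2)"
  proof -
    have "(norm (G z))\<^sup>2 = indicator strip z *\<^sub>R (norm (g z))\<^sup>2" for z by (simp add: G_def indicator_def)
    then show ?thesis using g2 by (simp add: integrable_cylb_iff)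
  qed
  have box0: "(LINT z:box a (a + h *\<^sub>R One)|lborel. G z) = 0"
    if h: "0 < h" and a0: "0 \<le> a \<bullet> e" and ah: "a \<bullet> e + h \<le> 2 * pi" for a h
  proof -
    have h2: "h \<le> 2 * pi" using a0 ah by simp
    obtain \<psi> :: "(real^'n) \<times> real \<Rightarrow> nat \<Rightarrow> real \<Rightarrow> real" where
      sm: "\<And>b n. b \<in> Basis \<Longrightarrow> smooth (\<psi> b n)" and nn: "\<And>b n s. b \<in> Basis \<Longrightarrow> 0 \<le> \<psi> b n s" and le1: "\<And>b n s. b \<in> Basis \<Longrightarrow> \<psi> b n s \<le> 1"
      and per: "\<And>n s. e \<in> Basis \<Longrightarrow> \<psi> e n (s + 2 * pi) = \<psi> e n s"
      and zero: "\<And>b n s. b \<in> Basis \<Longrightarrow> (b = e \<Longrightarrow> a \<bullet> b + h - 2 * pi \<le> s \<and> s \<le> a \<bullet> b + 2 * pi) \<Longrightarrow>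
         \<not> (a \<bullet> b < s \<and> s < a \<bullet> b + h) \<Longrightarrow> \<psi> b n s = 0"
      and lim: "\<And>b s. b \<in> Basis \<Longrightarrow> a \<bullet> b < s \<Longrightarrow> s < a \<bullet> b + h \<Longrightarrow> (\<lambda>n. \<psi> b n s) \<longlonglongrightarrow> 1"
      by (rule coordinate_profiles[OF h h2, where a = a and e = e]) blast
    define \<rho> where "\<rho> n z = (\<Prod>b\<in>Basis. \<psi> b n (z \<bullet> b))" for n z
    have test: "\<rho> n \<in> cyl_test" for n
      unfolding \<rho>_def
    proof (rule cyl_test_coordinate_product[where l = "\<lambda>b. a \<bullet> b" and r = "\<lambda>b. a \<bullet> b + h"])
      show "\<psi> (0, 1) n (s + 2 * pi) = \<psi> (0, 1) n s" for s using per[OF e] by (simp add: e_def)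
      fix b :: "(real^'n) \<times> real" and s
      assume b: "b \<in> Basis" "b \<noteq> (0, 1)" "\<not> (a \<bullet> b \<le> s \<and> s \<le> a \<bullet> b + h)"
      show "\<psi> b n s = 0" by (rule zero) (use b in \<open>auto simp: e_def\<close>)
    qed (rule sm)
    have [measurable]: "\<rho> n \<in> borel_measurable borel" for n
      using test[of n] by (auto simp: cyl_test_def intro!: borel_measurable_continuous_onI smooth_continuous_on)
    have \<psi>_strip: "\<psi> b n (z \<bullet> b) = 0" if "z \<in> strip" "b \<in> Basis" "\<not> (a \<bullet> b < z \<bullet> b \<and> z \<bullet> b < a \<bullet> b + h)" for b n z
      by (rule zero) (use that a0 ah in \<open>auto simp: strip_inner e_def[symmetric]\<close>)
    let ?B = "box a (a + h *\<^sub>R One)"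
    have inB: "indicator ?B z = (of_bool (\<forall>b\<in>Basis. a \<bullet> b < z \<bullet> b \<and> z \<bullet> b < a \<bullet> b + h) :: real)" for z
      by (auto simp: indicator_def mem_box inner_add_left)
    have iG: "integrable lborel (\<lambda>z. indicator ?B z *\<^sub>R G z)"
      unfolding G_def[abs_def] by (rule set_integrable_strip) (use g2 in auto)
    have bd: "norm (G z * of_real (\<rho> n z)) \<le> norm (indicator ?B z *\<^sub>R G z)" for n z
    proof (cases "z \<in> strip \<and> \<rho> n z \<noteq> 0")
      case True
      then have "\<forall>b\<in>Basis. \<psi> b n (z \<bullet> b) \<noteq> 0" unfolding \<rho>_def by (metis finite_Basis prod_zero)
      then have "\<forall>b\<in>Basis. a \<bullet> b < z \<bullet> b \<and> z \<bullet> b < a \<bullet> b + h" using \<psi>_strip True by blast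
      moreover have "0 \<le> \<rho> n z" "\<rho> n z \<le> 1"
        unfolding \<rho>_def using nn le1 by (auto intro!: prod_nonneg prod_le_1)
      ultimately show ?thesis unfolding inB by (simp add: norm_mult mult_left_le)
    qed (auto simp: G_def)
    have "(\<lambda>n. LINT z|lborel. G z * of_real (\<rho> n z)) \<longlonglongrightarrow> (LINT z|lborel. indicator ?B z *\<^sub>R G z)"
    proof (rule integral_dominated_convergence[where w = "\<lambda>z. norm (indicator ?B z *\<^sub>R G z)"])
      show "AE z in lborel. (\<lambda>n. G z * of_real (\<rho> n z)) \<longlonglongrightarrow> indicator ?B z *\<^sub>R G z"
      proof (rule AE_I2)
        fix z
        show "(\<lambda>n. G z * of_real (\<rho> n z)) \<longlonglongrightarrow> indicator ?B z *\<^sub>R G z"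
        proof (cases "z \<in> strip")
          case True
          have "(\<lambda>n. \<rho> n z) \<longlonglongrightarrow> indicator ?B z"
            unfolding inB \<rho>_def by (rule prod_indicator_tendsto) (auto intro: \<psi>_strip[OF True] lim)
          then have "(\<lambda>n. G z * of_real (\<rho> n z)) \<longlonglongrightarrow> G z * of_real (indicator ?B z)"
            by (intro tendsto_intros)
          then show ?thesis by (simp add: scaleR_conv_of_real mult.commute)
        qed (simp add: G_def)
      qed
      show "AE z in lborel. norm (G z * of_real (\<rho> n z)) \<le> norm (indicator ?B z *\<^sub>R G z)" for n
        by (rule AE_I2) (rule bd)
    qed (use integrable_norm[OF iG] in measurable)
    moreover have "(LINT z|lborel. G z * of_real (\<rho> n z)) = 0" for n
    proof -
      have "(LINT z|lborel. G z * of_real (\<rho> n z)) = (LINT z|cylb. g z * of_real (\<rho> n z))"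
        by (subst integral_cylb) (measurable, simp add: G_def)
      then show ?thesis using orth[OF test] by simp
    qed
    ultimately have "(LINT z|lborel. indicator ?B z *\<^sub>R G z) = 0"
      by (simp add: LIMSEQ_const_iff)
    then show ?thesis by (simp add: set_lebesgue_integral_def)
  qed
  have "AE z in lborel. z \<in> strip \<longrightarrow> g z = 0"
    using avg_tendsto_AE[OF \<open>G \<in> _\<close> G2]
  proof eventually_elim
    case (elim z)
    show ?case
    proof
      assume z: "z \<in> strip"
      then have ze: "0 \<le> z \<bullet> e" "z \<bullet> e < 2 * pi" by (auto simp: strip_inner e_def)
      \<comment> \<open>The sequence depends on \<open>z\<close> so that the cubes with lower corner
        \<open>z\<close> stay below the end of the period.\<close>
      define h where "h n = (2 * pi - z \<bullet> e) * inverse (real (Suc n))" for n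
      have h: "0 < h n" for n using ze by (simp add: h_def)
      have "h \<longlonglongrightarrow> (2 * pi - z \<bullet> e) * 0"
        unfolding h_def by (intro tendsto_intros LIMSEQ_inverse_real_of_nat)
      then have "(\<lambda>n. avg (h n) G z) \<longlonglongrightarrow> G z" using elim h by auto
      moreover have "avg (h n) G z = 0" for n
      proof -
        have "h n \<le> (2 * pi - z \<bullet> e) * 1"
          unfolding h_def by (rule mult_left_mono) (use ze in \<open>auto simp: divide_simps\<close>)
        then show ?thesis unfolding avg_def by (subst box0) (use h ze in auto)
      qed
      ultimately have "G z = 0" by (simp add: LIMSEQ_const_iff)
      then show "g z = 0" using z by (simp add: G_def)
    qed
  qed
  then show ?thesis by (simp add: AE_cylb_iff)
qed

section \<open>Functions with square integrable gradient on the cylinder\<close>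

text \<open>A Borel function with explicit Borel weak derivatives in place of the
  \<open>SOME\<close> choice in \<open>cyl_deriv\<close>. Periodicity is restored later by
  \<open>periodize\<close>, as \<open>cylb\<close> sees a single period.\<close>

definition cyl_data ::
    "((real^'n) \<times> real \<Rightarrow> complex) \<Rightarrow> ((real^'n) \<times> real \<Rightarrow> (real^'n) \<times> real \<Rightarrow> complex) \<Rightarrow> bool" where
  "cyl_data v G \<longleftrightarrow> v \<in> borel_measurable borel \<and> integrable cylb (\<lambda>z. (norm (v z))\<^sup>2) \<and>
     (\<forall>b\<in>Basis. G b \<in> borel_measurable borel \<and> integrable cylb (\<lambda>z. (norm (G b z))\<^sup>2) \<and>
        is_weak_deriv cylb cyl_test b v (G b))"

definition sqint :: "'a measure \<Rightarrow> ('a \<Rightarrow> complex) \<Rightarrow> real" where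
  "sqint M v = (LINT z|M. (norm (v z))\<^sup>2)"

definition gradsq :: "((real^'n) \<times> real \<Rightarrow> (real^'n) \<times> real \<Rightarrow> complex) \<Rightarrow> real" where
  "gradsq G = (\<Sum>i\<in>UNIV. sqint cylb (G (axis i 1, 0)))"

definition pexp :: "'n::finite itself \<Rightarrow> real" where
  "pexp _ = nl_exponent (real CARD('n))"

lemma sqint_nonneg: "0 \<le> sqint M v"
  unfolding sqint_def by (rule integral_nonneg_AE) auto

lemma gradsq_nonneg: "0 \<le> gradsq G"
  unfolding gradsq_def by (intro sum_nonneg sqint_nonneg)

lemma Basis_cyl: "(Basis :: ((real^'n) \<times> real) set) = insert (0, 1) (range (\<lambda>i. (axis i 1, 0)))"
  by (auto simp: Basis_prod_def Basis_vec_def)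

lemma prod_Basis_cyl:
  "(\<Prod>b\<in>(Basis :: ((real^'n) \<times> real) set). f b) = f (0, 1) * (\<Prod>i\<in>UNIV. f (axis i 1, 0))"
proof -
  have "inj (\<lambda>i::'n. (axis i (1::real), 0::real))" by (auto simp: inj_on_def axis_eq_axis)
  then show ?thesis unfolding Basis_cyl by (subst prod.insert) (auto simp: prod.reindex zero_prod_def)
qed

lemma pexp_eq:
  assumes "2 \<le> CARD('n::finite)"
  shows "pexp TYPE('n) = 2 * (real CARD('n) + 1) / (real CARD('n) - 1)"
  using assms by (auto simp: pexp_def nl_exponent_def field_simps)

lemma norm_strip_power: "0 < q \<Longrightarrow> norm (indicator strip z *\<^sub>R (v z :: complex)) powr q = indicator strip z *\<^sub>R norm (v z) powr q"
  by (simp add: indicator_def)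

lemma norm_strip_square: "(norm (indicator strip z *\<^sub>R (v z :: complex)))\<^sup>2 = indicator strip z *\<^sub>R (norm (v z))\<^sup>2"
  by (simp add: indicator_def)

text \<open>The function is cut off to the strip and the critical inequality in dimension
  \<open>d + 1\<close> is applied. Its product has one factor for the circle, bounded by a multiple
  of \<open>B + M\<close>, and one for each of the \<open>d\<close> space directions, bounded by a
  multiple of the full \<open>x\<close>-gradient.\<close>

lemma cyl_Gagliardo_Nirenberg:
  assumes d2: "2 \<le> CARD('n::finite)"
  obtains C where "0 < C"
    "\<And>v (G :: (real^'n) \<times> real \<Rightarrow> (real^'n) \<times> real \<Rightarrow> complex). cyl_data v G \<Longrightarrow> integrable cylb (\<lambda>z. norm (v z) powr pexp TYPE('n))"
    "\<And>v (G :: (real^'n) \<times> real \<Rightarrow> (real^'n) \<times> real \<Rightarrow> complex). cyl_data v G \<Longrightarrow>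
       (LINT z|cylb. norm (v z) powr pexp TYPE('n)) ^ (CARD('n) - 1)
       \<le> C * gradsq G ^ CARD('n) * (sqint cylb (G (0, 1)) + sqint cylb v)"
proof -
  let ?d = "CARD('n)"
  define \<gamma> where "\<gamma> = 2 * real ?d / (real ?d - 1)"
  define p where "p = pexp TYPE('n)"
  have p: "p = 2 * (real ?d + 1) / (real ?d - 1)" unfolding p_def by (rule pexp_eq[OF d2])
  have p0: "0 < p" using d2 unfolding p by (auto intro!: divide_pos_pos)
  have g0: "0 < \<gamma>" using d2 by (auto simp: \<gamma>_def intro!: divide_pos_pos)
  \<comment> \<open>Each space direction contributes \<open>(4 * \<gamma>)\<^sup>2\<close>. The last
    factor comes from \<open>(x + y)\<^sup>2 \<le> 2 * x\<^sup>2 + 2 * y\<^sup>2\<close> in the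
    circle direction, together with \<open>2 / (2 * pi)\<^sup>2 \<le> 1\<close>.\<close>
  define C where "C = (16 * \<gamma>\<^sup>2) ^ ?d * (32 * \<gamma>\<^sup>2 + 1)"
  have DIM: "DIM((real^'n) \<times> real) = Suc ?d" by simp
  have main: "integrable cylb (\<lambda>z. norm (v z) powr p) \<and>
      (LINT z|cylb. norm (v z) powr p) ^ (?d - 1) \<le> C * gradsq G ^ ?d * (sqint cylb (G (0, 1)) + sqint cylb v)"
    if data: "cyl_data v G" for v and G :: "(real^'n) \<times> real \<Rightarrow> (real^'n) \<times> real \<Rightarrow> complex"
  proof -
    have vm[measurable]: "v \<in> borel_measurable borel" and v2: "integrable cylb (\<lambda>z. (norm (v z))\<^sup>2)"
      and Gm: "\<And>b. b \<in> Basis \<Longrightarrow> G b \<in> borel_measurable borel"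
      and G2: "\<And>b. b \<in> Basis \<Longrightarrow> integrable cylb (\<lambda>z. (norm (G b z))\<^sup>2)"
      and wd: "\<And>b. b \<in> Basis \<Longrightarrow> is_weak_deriv cylb cyl_test b v (G b)"
      using data by (auto simp: cyl_data_def)
    define u where "u z = indicator strip z *\<^sub>R v z" for z
    define g where "g b z = (if b \<in> Basis then indicator strip z *\<^sub>R G b z else 0)" for b z
    have um: "u \<in> borel_measurable borel" unfolding u_def by measurable
    have gm: "g b \<in> borel_measurable borel" for b
    proof (cases "b \<in> Basis")
      case True
      note [measurable] = Gm[OF True]
      show ?thesis using True unfolding g_def by simp
    qed (simp add: g_def[abs_def])
    have u2: "integrable lborel (\<lambda>z. (norm (u z))\<^sup>2)"
      unfolding u_def norm_strip_square using v2 by (simp add: integrable_cylb_iff)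
    have g2: "integrable lborel (\<lambda>z. (norm (g b z))\<^sup>2)" if b: "b \<in> Basis" for b
    proof -
      note [measurable] = Gm[OF b]
      have "(norm (g b z))\<^sup>2 = indicator strip z *\<^sub>R (norm (G b z))\<^sup>2" for z
        using b by (simp add: g_def indicator_def)
      then show ?thesis using G2[OF b] by (simp add: integrable_cylb_iff)
    qed
    have gi: "(LINT z|lborel. (norm (g b z))\<^sup>2) = sqint cylb (G b)" if b: "b \<in> Basis" for b
    proof -
      note [measurable] = Gm[OF b]
      have "(norm (g b z))\<^sup>2 = indicator strip z *\<^sub>R (norm (G b z))\<^sup>2" for z
        using b by (simp add: g_def indicator_def)
      then show ?thesis unfolding sqint_def by (subst integral_cylb) simp_all
    qed
    have ui: "(LINT z|lborel. (norm (u z))\<^sup>2) = sqint cylb v"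
      unfolding sqint_def u_def norm_strip_square by (subst integral_cylb) simp_all
    have e: "((0, 1) :: (real^'n) \<times> real) \<in> Basis" by (simp add: Basis_cyl)
    have cong: "(LINT z:A|lborel. F z) = (LINT z:A|lborel. F' z)" if "\<And>z. z \<in> A \<Longrightarrow> F z = F' z"
      for A and F F' :: "(real^'n) \<times> real \<Rightarrow> 'z::{banach,second_countable_topology}"
      unfolding set_lebesgue_integral_def by (rule Bochner_Integration.integral_cong) (use that in \<open>auto simp: indicator_def\<close>)
    have diff: "norm ((LINT z:box (a + h *\<^sub>R b) (a + h *\<^sub>R b + h *\<^sub>R One)|lborel. u z) - (LINT z:box a (a + h *\<^sub>R One)|lborel. u z))
        \<le> h * (LINT z:box a (a + h *\<^sub>R One + h *\<^sub>R b)|lborel. norm (g b z))"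
      if b: "b \<in> Basis" and h: "0 < h" and a: "0 \<le> a \<bullet> (0, 1)" "(a + h *\<^sub>R One + h *\<^sub>R b) \<bullet> (0, 1) \<le> 2 * pi" for b h a
    proof -
      have be: "0 \<le> b \<bullet> (0, 1)" using b e by (simp add: inner_Basis)
      have top: "a \<bullet> (0,1) + h + h * (b \<bullet> (0,1)) \<le> 2 * pi" using a(2) e by (simp add: inner_add_left inner_Basis)
      have hb: "0 \<le> h * (b \<bullet> (0,1))" using h be by simp
      have str: "z \<in> strip" if "z \<in> box (a + h *\<^sub>R b) (a + h *\<^sub>R b + h *\<^sub>R One) \<or> z \<in> box a (a + h *\<^sub>R One) \<or> z \<in> box a (a + h *\<^sub>R One + h *\<^sub>R b)" for z
      proof -
        have One1: "(One :: (real^'n) \<times> real) \<bullet> (0, 1) = 1" using e by simp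
        have "a \<bullet> (0,1) < z \<bullet> (0,1) \<and> z \<bullet> (0,1) < 2 * pi"
          using that unfolding mem_box
        proof (elim disjE)
          assume "\<forall>i\<in>Basis. (a + h *\<^sub>R b) \<bullet> i < z \<bullet> i \<and> z \<bullet> i < (a + h *\<^sub>R b + h *\<^sub>R One) \<bullet> i"
          from bspec[OF this e] show ?thesis using top hb unfolding inner_add_left inner_scaleR_left One1 by linarith
        next
          assume "\<forall>i\<in>Basis. a \<bullet> i < z \<bullet> i \<and> z \<bullet> i < (a + h *\<^sub>R One) \<bullet> i"
          from bspec[OF this e] show ?thesis using top hb unfolding inner_add_left inner_scaleR_left One1 by linarith
        next
          assume "\<forall>i\<in>Basis. a \<bullet> i < z \<bullet> i \<and> z \<bullet> i < (a + h *\<^sub>R One + h *\<^sub>R b) \<bullet> i"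
          from bspec[OF this e] show ?thesis using top hb unfolding inner_add_left inner_scaleR_left One1 by linarith
        qed
        then show ?thesis using a(1) by (simp add: strip_inner)
      qed
      have u1: "(LINT z:box (a + h *\<^sub>R b) (a + h *\<^sub>R b + h *\<^sub>R One)|lborel. u z) = (LINT z:box (a + h *\<^sub>R b) (a + h *\<^sub>R b + h *\<^sub>R One)|lborel. v z)"
        and u2: "(LINT z:box a (a + h *\<^sub>R One)|lborel. u z) = (LINT z:box a (a + h *\<^sub>R One)|lborel. v z)"
        and g1: "(LINT z:box a (a + h *\<^sub>R One + h *\<^sub>R b)|lborel. norm (g b z)) = (LINT z:box a (a + h *\<^sub>R One + h *\<^sub>R b)|lborel. norm (G b z))"
        by (intro cong; use str b in \<open>simp add: u_def g_def\<close>)+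
      show ?thesis unfolding u1 u2 g1
        by (rule weak_deriv_box_difference[OF vm Gm[OF b] v2 G2[OF b] wd[OF b] b h h a])
    qed
    have zero: "u z = 0" if "\<not> (0 \<le> z \<bullet> (0, 1) \<and> z \<bullet> (0, 1) < 2 * pi)" for z
      using that by (auto simp: u_def strip_inner simp del: inner_Pair mem_Times_iff)
    have up: "norm (u z) powr p = indicator strip z *\<^sub>R norm (v z) powr p" for z
      unfolding u_def by (rule norm_strip_power[OF p0])
    have R1: "integrable lborel (\<lambda>z. norm (u z) powr p)"
      unfolding p by (rule Gagliardo_Nirenberg_of_differences(1)[OF d2 DIM e _ um gm u2 g2 diff zero]) auto
    have R2: "(LINT z|lborel. norm (u z) powr p) ^ (?d - 1) \<le>
       (\<Prod>b\<in>Basis. (4 * \<gamma> * sqrt (LINT z|lborel. (norm (g b z))\<^sup>2) + (if b = (0,1) then sqrt (LINT z|lborel. (norm (u z))\<^sup>2) / (2 * pi) else 0))\<^sup>2)"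
      unfolding p \<gamma>_def by (rule Gagliardo_Nirenberg_of_differences(2)[OF d2 DIM e _ um gm u2 g2 diff zero]) auto
    have int: "integrable cylb (\<lambda>z. norm (v z) powr p)"
      using R1 unfolding up by (subst integrable_cylb_iff) auto
    have eq: "(LINT z|lborel. norm (u z) powr p) = (LINT z|cylb. norm (v z) powr p)"
      unfolding up by (subst integral_cylb) auto
    have bi: "(axis i 1, 0) \<in> (Basis :: ((real^'n) \<times> real) set)" for i by (simp add: Basis_cyl)
    let ?M = "sqint cylb v" and ?B = "sqint cylb (G (0, 1))" and ?A = "gradsq G"
    have "(LINT z|cylb. norm (v z) powr p) ^ (?d - 1) \<le>
       (4 * \<gamma> * sqrt ?B + sqrt ?M / (2 * pi))\<^sup>2 * (\<Prod>i\<in>(UNIV::'n set). (4 * \<gamma> * sqrt (sqint cylb (G (axis i 1, 0))))\<^sup>2)"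
      using R2 unfolding eq prod_Basis_cyl ui by (simp add: gi[OF e] gi[OF bi] axis_eq_0_iff)
    also have "\<dots> \<le> ((32 * \<gamma>\<^sup>2 + 1) * (?B + ?M)) * (\<Prod>i\<in>(UNIV::'n set). 16 * \<gamma>\<^sup>2 * ?A)"
    proof (intro mult_mono prod_mono conjI)
      have "(4 * \<gamma> * sqrt ?B + sqrt ?M / (2 * pi))\<^sup>2 \<le> 2 * (4 * \<gamma> * sqrt ?B)\<^sup>2 + 2 * (sqrt ?M / (2 * pi))\<^sup>2"
        using sum_squares_bound[of "4 * \<gamma> * sqrt ?B" "sqrt ?M / (2 * pi)"] by (simp add: power2_sum)
      also have "\<dots> = 32 * \<gamma>\<^sup>2 * ?B + ?M * (2 / (2 * pi)\<^sup>2)"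
        using sqint_nonneg[of cylb v] sqint_nonneg[of cylb "G (0,1)"] by (simp add: power_mult_distrib power_divide)
      also have "\<dots> \<le> 32 * \<gamma>\<^sup>2 * ?B + ?M * 1"
      proof (intro add_left_mono mult_left_mono sqint_nonneg)
        have "1 \<le> pi * pi" using pi_gt3 mult_mono[of 1 pi 1 pi] by simp
        then show "2 / (2 * pi)\<^sup>2 \<le> 1" by (simp add: power2_eq_square divide_simps)
      qed
      also have "\<dots> \<le> (32 * \<gamma>\<^sup>2 + 1) * (?B + ?M)"
        using sqint_nonneg[of cylb v] sqint_nonneg[of cylb "G (0,1)"] by (simp add: algebra_simps)
      finally show "(4 * \<gamma> * sqrt ?B + sqrt ?M / (2 * pi))\<^sup>2 \<le> (32 * \<gamma>\<^sup>2 + 1) * (?B + ?M)" .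
      fix i :: 'n
      have "sqint cylb (G (axis i 1, 0)) \<le> ?A"
        unfolding gradsq_def by (rule member_le_sum) (auto intro: sqint_nonneg)
      then show "(4 * \<gamma> * sqrt (sqint cylb (G (axis i 1, 0))))\<^sup>2 \<le> 16 * \<gamma>\<^sup>2 * ?A"
        by (simp add: power_mult_distrib sqint_nonneg mult_left_mono)
    qed (auto intro!: prod_nonneg mult_nonneg_nonneg add_nonneg_nonneg sqint_nonneg)
    also have "\<dots> = C * ?A ^ ?d * (?B + ?M)"
      by (simp add: C_def power_mult_distrib algebra_simps)
    finally show ?thesis using int by simp
  qed
  have "0 < C" using g0 by (auto simp: C_def intro!: mult_pos_pos add_pos_pos)
  from that[OF this] main show ?thesis unfolding p_def by blast
qed

section \<open>Estimates along the fibres and the Poincare inequality on the circle\<close>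

interpretation cylb: sigma_finite_measure "cylb :: ('a::euclidean_space \<times> real) measure"
  unfolding cylb_def by (rule sigma_finite_pair_measure) unfold_locales

interpretation lborel_cylb: pair_sigma_finite "lborel :: 'a::euclidean_space measure" "cylb :: ('b::euclidean_space \<times> real) measure" ..

lemma measure_circle: "measure circle_measure UNIV = 2 * pi"
  by (simp add: measure_def emeasure_circle_measure)

lemma AE_circle: "AE y in circle_measure. 0 \<le> y \<and> y < 2 * pi"
  unfolding circle_measure_def by (subst AE_density) (auto simp: indicator_def)

lemma square_integrable_circle:
  fixes f :: "real \<Rightarrow> complex"
  assumes "f \<in> borel_measurable borel" "integrable circle_measure (\<lambda>y. (norm (f y))\<^sup>2)"
  shows "integrable circle_measure f"
proof -
  have "set_integrable circle_measure UNIV f"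
    by (rule set_integrable_square) (use assms in \<open>auto simp: emeasure_circle_measure\<close>)
  then show ?thesis by (simp add: set_integrable_def)
qed

lemma borel_measurable_Pair_section:
  assumes "f \<in> borel_measurable borel"
  shows "(\<lambda>y. f (x::'a::euclidean_space, y::real)) \<in> borel_measurable borel"
    and "(\<lambda>x. f (x::'a::euclidean_space, y::real)) \<in> borel_measurable borel"
  by (rule measurable_compose[OF _ assms], simp flip: borel_prod)+

lemma cylb_section_square_integrable:
  fixes f :: "'a::euclidean_space \<times> real \<Rightarrow> complex"
  assumes [measurable]: "f \<in> borel_measurable borel" and "integrable cylb (\<lambda>z. (norm (f z))\<^sup>2)"
  shows "AE x in lborel. integrable circle_measure (\<lambda>y. (norm (f (x, y)))\<^sup>2) \<and> integrable circle_measure (\<lambda>y. f (x, y))"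
proof -
  have "AE x in lborel. integrable circle_measure (\<lambda>y. (norm (f (x, y)))\<^sup>2)"
    using assms(2) unfolding cylb_def by (rule cyl_pair.AE_integrable_fst')
  then show ?thesis
    by eventually_elim (auto intro!: square_integrable_circle borel_measurable_Pair_section)
qed

text \<open>Enlarging the swept box to the whole column over the cube, of measure
  \<open>2 * pi * h^d\<close>, makes the bound independent of the two heights.\<close>

lemma box_difference_square_le:
  fixes w g :: "(real^'n) \<times> real \<Rightarrow> complex"
  assumes meas[measurable]: "w \<in> borel_measurable borel" "g \<in> borel_measurable borel"
    and w2: "integrable cylb (\<lambda>z. (norm (w z))\<^sup>2)" and g2: "integrable cylb (\<lambda>z. (norm (g z))\<^sup>2)"
    and wd: "is_weak_deriv cylb cyl_test (0, 1) w g"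
    and h: "0 < h" and y: "0 \<le> y" "y < y'" "y' + h \<le> 2 * pi"
  shows "(norm (avg h (\<lambda>z. indicator strip z *\<^sub>R w z) (x, y') - avg h (\<lambda>z. indicator strip z *\<^sub>R w z) (x, y)))\<^sup>2
    \<le> 2 * pi / h ^ CARD('n) * (LINT z|cylb. indicator (box x (x + h *\<^sub>R One)) (fst z) * (norm (g z))\<^sup>2)"
proof -
  let ?d = "CARD('n)"
  let ?W = "\<lambda>z. indicator strip z *\<^sub>R w z"
  define Q where "Q = box x (x + h *\<^sub>R (One :: real^'n))"
  let ?A = "Q \<times> (UNIV :: real set)"
  have One_cyl: "(One :: (real^'n) \<times> real) = (One, 1)"
  proof (rule euclidean_eqI)
    fix b :: "(real^'n) \<times> real" assume b: "b \<in> Basis"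
    then have "One \<bullet> b = 1" by simp
    also have "1 = (One :: real^'n, 1::real) \<bullet> b" using b by (auto simp: Basis_prod_def)
    finally show "One \<bullet> b = (One :: real^'n, 1::real) \<bullet> b" .
  qed
  define a where "a = (x, y)"
  define t where "t = y' - y"
  have t: "0 < t" using y by (simp add: t_def)
  let ?e = "(0, 1) :: (real^'n) \<times> real"
  have ae: "a + t *\<^sub>R ?e = (x, y')" by (simp add: a_def t_def)
  have D: "norm ((LINT z:box (a + t *\<^sub>R ?e) (a + t *\<^sub>R ?e + h *\<^sub>R One)|lborel. w z) - (LINT z:box a (a + h *\<^sub>R One)|lborel. w z))
        \<le> h * (LINT z:box a (a + h *\<^sub>R One + t *\<^sub>R ?e)|lborel. norm (g z))"
  proof (rule weak_deriv_box_difference[OF meas w2 g2 wd _ h t])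
    show "?e \<in> Basis" by (simp add: Basis_cyl)
  qed (use y in \<open>auto simp: a_def t_def One_cyl\<close>)
  have boxes: "box (u, s) (u + h *\<^sub>R One, s + r) = box u (u + h *\<^sub>R One) \<times> {s<..<s + r}" for u :: "real^'n" and s r :: real
    by (auto simp: mem_box Basis_prod_def)
  have W: "avg h ?W (x, s) = (LINT z:box (x, s) ((x, s) + h *\<^sub>R One)|lborel. w z) /\<^sub>R h ^ Suc ?d" if "0 \<le> s" "s + h \<le> 2 * pi" for s
  proof -
    have "(LINT z:box (x, s) ((x, s) + h *\<^sub>R One)|lborel. ?W z) = (LINT z:box (x, s) ((x, s) + h *\<^sub>R One)|lborel. w z)"
      unfolding set_lebesgue_integral_def
      by (rule Bochner_Integration.integral_cong) (use that in \<open>auto simp: indicator_def One_cyl boxes\<close>)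
    then show ?thesis by (simp add: avg_def)
  qed
  let ?B = "box a (a + h *\<^sub>R One + t *\<^sub>R ?e)"
  have B: "?B = Q \<times> {y<..<y' + h}"
    using boxes[of x y "h + t"] by (simp add: a_def One_cyl t_def Q_def algebra_simps)
  have Am: "?A \<in> sets borel" unfolding borel_prod[symmetric] by (simp add: Q_def)
  have mQ: "emeasure lborel Q = ennreal (h ^ ?d)"
    unfolding Q_def using h by (subst emeasure_lborel_box) (auto simp: inner_add_left)
  have eA: "emeasure cylb ?A = ennreal (h ^ ?d * (2 * pi))"
    unfolding cylb_def using h
    by (subst circle.emeasure_pair_measure_Times) (auto simp: Q_def[symmetric] mQ emeasure_circle_measure ennreal_mult, simp add: Q_def)
  have mA: "measure cylb ?A = h ^ ?d * (2 * pi)" using h by (simp add: measure_def eA)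
  have iA: "set_integrable cylb ?A g"
    by (rule set_integrable_square) (use g2 Am in \<open>auto simp: eA sets_cylb\<close>)
  have le: "(LINT z:?B|lborel. norm (g z)) \<le> (LINT z:?A|cylb. norm (g z))"
  proof -
    have i1: "integrable lborel (\<lambda>z. indicator strip z *\<^sub>R (indicator ?A z *\<^sub>R norm (g z)))"
    proof -
      have "integrable cylb (\<lambda>z. indicator ?A z *\<^sub>R norm (g z))"
        using integrable_norm[OF iA[unfolded set_integrable_def]] by simp
      then show ?thesis using Am by (subst (asm) integrable_cylb_iff) auto
    qed
    have "(LINT z:?B|lborel. norm (g z)) \<le> (LINT z|lborel. indicator strip z *\<^sub>R (indicator ?A z *\<^sub>R norm (g z)))"
      unfolding set_lebesgue_integral_def
    proof (rule integral_mono')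
      show "integrable lborel (\<lambda>z. indicator strip z *\<^sub>R (indicator ?A z *\<^sub>R norm (g z)))" by (rule i1)
      show "indicator ?B z *\<^sub>R norm (g z) \<le> indicator strip z *\<^sub>R (indicator ?A z *\<^sub>R norm (g z))" for z
        unfolding B using y by (auto simp: indicator_def)
    qed auto
    also have "\<dots> = (LINT z:?A|cylb. norm (g z))"
      unfolding set_lebesgue_integral_def using Am by (subst integral_cylb) auto
    finally show ?thesis .
  qed
  have "norm (avg h ?W (x, y') - avg h ?W (x, y)) \<le> (LINT z:?A|cylb. norm (g z)) / h ^ ?d"
  proof -
    have "norm (avg h ?W (x, y') - avg h ?W (x, y)) =
      norm ((LINT z:box (a + t *\<^sub>R ?e) (a + t *\<^sub>R ?e + h *\<^sub>R One)|lborel. w z) - (LINT z:box a (a + h *\<^sub>R One)|lborel. w z)) / h ^ Suc ?d"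
      using y h unfolding ae
      by (subst (1 2) W) (auto simp: a_def scaleR_diff_right[symmetric] norm_mult norm_inverse norm_power divide_inverse simp del: power_Suc)
    also have "\<dots> \<le> h * (LINT z:?A|cylb. norm (g z)) / h ^ Suc ?d"
      using h by (intro divide_right_mono order_trans[OF D] mult_left_mono le) auto
    also have "\<dots> = (LINT z:?A|cylb. norm (g z)) / h ^ ?d" using h by simp
    finally show ?thesis .
  qed
  then have "(norm (avg h ?W (x, y') - avg h ?W (x, y)))\<^sup>2 \<le> ((LINT z:?A|cylb. norm (g z)) / h ^ ?d)\<^sup>2"
    by (intro power_mono) auto
  also have "\<dots> = (LINT z:?A|cylb. norm (g z))\<^sup>2 / (h ^ ?d)\<^sup>2" by (simp add: power_divide)
  also have "\<dots> \<le> (h ^ ?d * (2 * pi)) * (LINT z:?A|cylb. (norm (g z))\<^sup>2) / (h ^ ?d)\<^sup>2"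
    unfolding mA[symmetric]
    by (intro divide_right_mono set_integral_Cauchy_Schwarz) (use g2 Am in \<open>auto simp: eA sets_cylb\<close>)
  also have "\<dots> = 2 * pi / h ^ ?d * (LINT z:?A|cylb. (norm (g z))\<^sup>2)"
    using h by (simp add: power2_eq_square)
  also have "(LINT z:?A|cylb. (norm (g z))\<^sup>2) = (LINT z|cylb. indicator (box x (x + h *\<^sub>R One)) (fst z) * (norm (g z))\<^sup>2)"
    unfolding set_lebesgue_integral_def
    by (rule Bochner_Integration.integral_cong) (auto simp: indicator_def Q_def)
  finally show ?thesis .
qed

text \<open>\<open>\<beta> k x\<close> bounds the squared oscillation of the cube averages along the
  fibre over \<open>x\<close>, and its integral is \<open>2 * pi\<close> times the squared norm of
  the derivative for every \<open>k\<close>. In the limit \<open>\<beta>\<^sub>0 x\<close> bounds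
  the oscillation of \<open>w\<close> itself, and mean zero turns oscillation into size. The two
  factors \<open>2 * pi\<close> come from that integral and from the length of the fibre.\<close>

lemma cyl_Poincare:
  fixes w :: "(real^'n) \<times> real \<Rightarrow> complex"
  assumes data: "cyl_data w G" and mean: "AE x in lborel. (LINT y|circle_measure. w (x, y)) = 0"
  shows "sqint cylb w \<le> 4 * pi\<^sup>2 * sqint cylb (G (0, 1))"
proof -
  let ?d = "CARD('n)"
  define g where "g = G (0, 1)"
  have e: "(0, 1) \<in> (Basis :: ((real^'n) \<times> real) set)" by (simp add: Basis_cyl)
  have [measurable]: "w \<in> borel_measurable borel" "g \<in> borel_measurable borel"
    and w2: "integrable cylb (\<lambda>z. (norm (w z))\<^sup>2)" and g2: "integrable cylb (\<lambda>z. (norm (g z))\<^sup>2)"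
    and wd: "is_weak_deriv cylb cyl_test (0, 1) w g"
    using data e by (auto simp: cyl_data_def g_def)
  define W where "W z = indicator strip z *\<^sub>R w z" for z
  define h where "h k = inverse (real (Suc k))" for k
  have h0: "0 < h k" for k by (simp add: h_def)
  have hlim: "h \<longlonglongrightarrow> 0" unfolding h_def by (rule LIMSEQ_inverse_real_of_nat)
  define F where "F k x z = ennreal (indicator (box x (x + h k *\<^sub>R One)) (fst z) * (norm (g z))\<^sup>2)" for k and x :: "real^'n" and z :: "(real^'n) \<times> real"
  define \<beta> where "\<beta> k x = ennreal (2 * pi / h k ^ ?d) * (\<integral>\<^sup>+z. F k x z \<partial>cylb)" for k x
  have Fm[measurable]: "(\<lambda>(x, z). F k x z) \<in> borel_measurable (borel \<Otimes>\<^sub>M borel)" for k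
  proof -
    have fs: "fst \<in> borel \<rightarrow>\<^sub>M (borel :: (real^'n) measure)" "fst \<in> borel_measurable (borel :: ((real^'n) \<times> real) measure)"
      by (intro borel_measurable_continuous_onI continuous_intros)+
    have [measurable]: "Measurable.pred (borel \<Otimes>\<^sub>M borel) (\<lambda>(x, z::(real^'n) \<times> real). fst z \<in> box x (x + h k *\<^sub>R (One::real^'n)))"
      unfolding mem_box using fs by measurable
    have "(\<lambda>q. ennreal ((if (case q of (x, z) \<Rightarrow> fst z \<in> box x (x + h k *\<^sub>R (One::real^'n))) then 1 else 0) * (norm (g (snd q)))\<^sup>2))
        \<in> borel_measurable (borel \<Otimes>\<^sub>M borel)" by measurable
    also have "(\<lambda>q. ennreal ((if (case q of (x, z) \<Rightarrow> fst z \<in> box x (x + h k *\<^sub>R (One::real^'n))) then 1 else 0) * (norm (g (snd q)))\<^sup>2))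
       = (\<lambda>(x, z). F k x z)" by (auto simp: F_def fun_eq_iff indicator_def)
    finally show ?thesis .
  qed
  have \<beta>m[measurable]: "\<beta> k \<in> borel_measurable borel" for k
  proof -
    have "(\<lambda>(x, z). F k x z) \<in> borel_measurable (borel \<Otimes>\<^sub>M (cylb :: ((real^'n) \<times> real) measure))"
      using Fm[of k] by (simp add: measurable_cong_sets[OF sets_pair_measure_cong[OF refl sets_cylb] refl])
    then have "(\<lambda>x. \<integral>\<^sup>+z. F k x z \<partial>cylb) \<in> borel_measurable borel"
      by (rule cylb.borel_measurable_nn_integral)
    then show ?thesis unfolding \<beta>_def[abs_def] by measurable
  qed
  have int_\<beta>: "(\<integral>\<^sup>+x. \<beta> k x \<partial>lborel) = ennreal (2 * pi * sqint cylb g)" for k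
  proof -
    have Fm': "(\<lambda>(x, z). F k x z) \<in> borel_measurable (lborel \<Otimes>\<^sub>M (cylb :: ((real^'n) \<times> real) measure))"
      using Fm[of k] by (simp add: measurable_cong_sets[OF sets_pair_measure_cong[OF sets_lborel sets_cylb] refl])
    have "(\<integral>\<^sup>+x. \<beta> k x \<partial>lborel) = ennreal (2 * pi / h k ^ ?d) * (\<integral>\<^sup>+x. \<integral>\<^sup>+z. F k x z \<partial>cylb \<partial>lborel)"
      unfolding \<beta>_def by (rule nn_integral_cmult) (use cylb.borel_measurable_nn_integral[OF Fm'] in auto)
    also have "(\<integral>\<^sup>+x. \<integral>\<^sup>+z. F k x z \<partial>cylb \<partial>lborel) = (\<integral>\<^sup>+z. \<integral>\<^sup>+x. F k x z \<partial>lborel \<partial>cylb)"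
      by (rule lborel_cylb.Fubini'[OF Fm', symmetric])
    \<comment> \<open>For fixed \<open>z\<close> the corners \<open>x\<close> whose cube contains
      \<open>fst z\<close> form a cube of the same volume, which cancels the weight in
      \<open>\<beta>\<close>.\<close>
    also have "\<dots> = (\<integral>\<^sup>+z. ennreal (h k ^ ?d) * ennreal ((norm (g z))\<^sup>2) \<partial>cylb)"
    proof (rule nn_integral_cong)
      fix z :: "(real^'n) \<times> real"
      have "(\<integral>\<^sup>+x. F k x z \<partial>lborel) = (\<integral>\<^sup>+x. ennreal ((norm (g z))\<^sup>2) * indicator (box (fst z - h k *\<^sub>R One) (fst z)) x \<partial>lborel)"
        by (rule nn_integral_cong) (auto simp: F_def indicator_def mem_box inner_diff_left inner_add_left algebra_simps)
      also have "\<dots> = ennreal ((norm (g z))\<^sup>2) * emeasure lborel (box (fst z - h k *\<^sub>R One) (fst z))"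
        by (rule nn_integral_cmult_indicator) simp
      also have "emeasure lborel (box (fst z - h k *\<^sub>R One) (fst z)) = ennreal (h k ^ ?d)"
        using h0[of k] by (subst emeasure_lborel_box) (auto simp: inner_diff_left)
      finally show "(\<integral>\<^sup>+x. F k x z \<partial>lborel) = ennreal (h k ^ ?d) * ennreal ((norm (g z))\<^sup>2)" by (simp add: mult.commute)
    qed
    also have "\<dots> = ennreal (h k ^ ?d) * (\<integral>\<^sup>+z. ennreal ((norm (g z))\<^sup>2) \<partial>cylb)"
      by (rule nn_integral_cmult) measurable
    also have "(\<integral>\<^sup>+z. ennreal ((norm (g z))\<^sup>2) \<partial>cylb) = ennreal (sqint cylb g)"
      unfolding sqint_def by (rule nn_integral_eq_integral) (use g2 in auto)
    also have "ennreal (2 * pi / h k ^ ?d) * (ennreal (h k ^ ?d) * ennreal (sqint cylb g)) = ennreal (2 * pi * sqint cylb g)"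
      using h0[of k] sqint_nonneg[of cylb g] by (simp flip: ennreal_mult)
    finally show ?thesis .
  qed
  have diff: "ennreal ((norm (avg (h k) W (x, y') - avg (h k) W (x, y)))\<^sup>2) \<le> \<beta> k x"
    if "0 \<le> y" "0 \<le> y'" "y + h k \<le> 2 * pi" "y' + h k \<le> 2 * pi" for k x y y'
  proof -
    have i: "integrable cylb (\<lambda>z. indicator (box x (x + h k *\<^sub>R One)) (fst z) * (norm (g z))\<^sup>2)"
    proof (rule Bochner_Integration.integrable_bound[OF g2])
      have fs: "fst \<in> borel_measurable (borel :: ((real^'n) \<times> real) measure)"
        by (intro borel_measurable_continuous_onI continuous_intros)
      show "(\<lambda>z. indicator (box x (x + h k *\<^sub>R One)) (fst z) * (norm (g z))\<^sup>2) \<in> borel_measurable cylb"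
        using fs by measurable
    qed (auto simp: indicator_def)
    have "\<beta> k x = ennreal (2 * pi / h k ^ ?d * (LINT z|cylb. indicator (box x (x + h k *\<^sub>R One)) (fst z) * (norm (g z))\<^sup>2))"
      unfolding \<beta>_def F_def using h0[of k]
      by (subst nn_integral_eq_integral[OF i]) (auto simp flip: ennreal_mult)
    moreover have "(norm (avg (h k) W (x, y') - avg (h k) W (x, y)))\<^sup>2 \<le> 2 * pi / h k ^ ?d * (LINT z|cylb. indicator (box x (x + h k *\<^sub>R One)) (fst z) * (norm (g z))\<^sup>2)"
    proof (cases y y' rule: linorder_cases)
      case less
      then show ?thesis unfolding W_def using that by (intro box_difference_square_le w2 g2 wd h0) auto
    next
      case equal
      then show ?thesis using h0[of k] by (simp add: integral_nonneg_AE)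
    next
      case greater
      then show ?thesis unfolding W_def
        by (subst norm_minus_commute, intro box_difference_square_le w2 g2 wd h0) (use that in auto)
    qed
    ultimately show ?thesis by (simp add: ennreal_leI)
  qed
  define \<beta>\<^sub>0 where "\<beta>\<^sub>0 x = liminf (\<lambda>k. \<beta> k x)" for x
  have \<beta>0m[measurable]: "\<beta>\<^sub>0 \<in> borel_measurable borel" unfolding \<beta>\<^sub>0_def by measurable
  have W2: "integrable lborel (\<lambda>z. (norm (W z))\<^sup>2)"
    unfolding W_def norm_strip_square using w2 by (simp add: integrable_cylb_iff)
  have "AE z in cylb. \<forall>h. (\<forall>n::nat. 0 < h n) \<longrightarrow> h \<longlonglongrightarrow> 0 \<longrightarrow> (\<lambda>n. avg (h n) W z) \<longlonglongrightarrow> W z"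
    unfolding AE_cylb_iff using avg_tendsto_AE[OF _ W2] by (auto simp: W_def[abs_def])
  then have "AE z in cylb. (\<lambda>n. avg (h n) W z) \<longlonglongrightarrow> W z"
    by eventually_elim (use h0 hlim in auto)
  then have conv: "AE x in lborel. AE y in circle_measure. (\<lambda>n. avg (h n) W (x, y)) \<longlonglongrightarrow> W (x, y)"
    unfolding cylb_def by (rule cyl_pair.AE_pair)
  have AEx: "AE x in lborel. AE y in circle_measure. ennreal ((norm (w (x, y)))\<^sup>2) \<le> \<beta>\<^sub>0 x"
    using conv mean cylb_section_square_integrable[OF \<open>w \<in> _\<close> w2]
  proof eventually_elim
    case (elim x)
    have ae: "AE y in circle_measure. (\<lambda>n. avg (h n) W (x, y)) \<longlonglongrightarrow> w (x, y) \<and> 0 \<le> y \<and> y < 2 * pi"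
      using elim(1) AE_circle by eventually_elim (auto simp: W_def)
    have wx: "integrable circle_measure (\<lambda>y. w (x, y))" using elim by blast
    have lim: "ennreal ((norm (w (x, y) - w (x, y')))\<^sup>2) \<le> \<beta>\<^sub>0 x"
      if y: "(\<lambda>n. avg (h n) W (x, y)) \<longlonglongrightarrow> w (x, y) \<and> 0 \<le> y \<and> y < 2 * pi"
        and y': "(\<lambda>n. avg (h n) W (x, y')) \<longlonglongrightarrow> w (x, y') \<and> 0 \<le> y' \<and> y' < 2 * pi" for y y'
    proof -
      have "(\<lambda>k. ennreal ((norm (avg (h k) W (x, y) - avg (h k) W (x, y')))\<^sup>2)) \<longlonglongrightarrow> ennreal ((norm (w (x, y) - w (x, y')))\<^sup>2)"
        using y y' by (intro tendsto_ennrealI tendsto_intros) auto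
      then have "ennreal ((norm (w (x, y) - w (x, y')))\<^sup>2) = liminf (\<lambda>k. ennreal ((norm (avg (h k) W (x, y) - avg (h k) W (x, y')))\<^sup>2))"
        by (rule lim_imp_Liminf[OF sequentially_bot, symmetric])
      also have "\<dots> \<le> \<beta>\<^sub>0 x"
        unfolding \<beta>\<^sub>0_def
      proof (rule Liminf_mono)
        have "eventually (\<lambda>k. h k < 2 * pi - max y y') sequentially"
          using y y' by (intro order_tendstoD(2)[OF hlim]) auto
        then show "eventually (\<lambda>k. ennreal ((norm (avg (h k) W (x, y) - avg (h k) W (x, y')))\<^sup>2) \<le> \<beta> k x) sequentially"
          by eventually_elim (rule diff, use y y' in auto)
      qed
      finally show ?thesis .
    qed
    show ?case
      using ae
    proof eventually_elim
      case y: (elim y)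
      show ?case
      \<comment> \<open>\<open>\<beta>\<^sub>0 x\<close> is an extended real; where it is infinite
        the bound is trivial.\<close>
      proof (cases "\<beta>\<^sub>0 x")
        case (real b)
        have bd: "AE y' in circle_measure. norm (w (x, y) - w (x, y')) \<le> sqrt b"
          using ae
        proof eventually_elim
          case (elim y')
          have "(norm (w (x, y) - w (x, y')))\<^sup>2 \<le> b" using lim[OF y elim] real by (simp add: ennreal_le_iff)
          then show ?case by (rule real_le_rsqrt)
        qed
        have int: "integrable circle_measure (\<lambda>y'. w (x, y) - w (x, y'))" using wx by simp
        have "(LINT y'|circle_measure. w (x, y) - w (x, y')) = (2 * pi) *\<^sub>R w (x, y)"
          using wx elim(2) by (simp add: measure_circle)
        then have "2 * pi * norm (w (x, y)) = norm (LINT y'|circle_measure. w (x, y) - w (x, y'))" by (simp del: Bochner_Integration.integral_diff)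
        also have "\<dots> \<le> (LINT y'|circle_measure. norm (w (x, y) - w (x, y')))" by (rule integral_norm_bound)
        also have "\<dots> \<le> (LINT y'|circle_measure. sqrt b)"
          by (rule integral_mono_AE) (use integrable_norm[OF int] bd in auto)
        also have "\<dots> = 2 * pi * sqrt b" by (simp add: measure_circle)
        finally have "norm (w (x, y)) \<le> sqrt b" by simp
        then have "(norm (w (x, y)))\<^sup>2 \<le> (sqrt b)\<^sup>2" by (intro power_mono) auto
        then show ?thesis using real by (simp add: ennreal_leI)
      qed simp
    qed
  qed
  have "ennreal (sqint cylb w) = (\<integral>\<^sup>+z. ennreal ((norm (w z))\<^sup>2) \<partial>cylb)"
    unfolding sqint_def by (rule nn_integral_eq_integral[symmetric]) (use w2 in auto)
  also have "\<dots> = (\<integral>\<^sup>+x. \<integral>\<^sup>+y. ennreal ((norm (w (x, y)))\<^sup>2) \<partial>circle_measure \<partial>lborel)"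
  proof -
    have "(\<lambda>z. ennreal ((norm (w z))\<^sup>2)) \<in> borel_measurable (lborel \<Otimes>\<^sub>M circle_measure)"
      unfolding cylb_def[symmetric] by measurable
    from circle.nn_integral_fst[OF this] show ?thesis by (simp add: cylb_def)
  qed
  also have "\<dots> \<le> (\<integral>\<^sup>+x. \<integral>\<^sup>+y. \<beta>\<^sub>0 x \<partial>circle_measure \<partial>lborel)"
    using AEx by (intro nn_integral_mono_AE, elim eventually_mono) (rule nn_integral_mono_AE)
  also have "\<dots> = (\<integral>\<^sup>+x. ennreal (2 * pi) * \<beta>\<^sub>0 x \<partial>lborel)"
    by (simp add: emeasure_circle_measure mult.commute)
  also have "\<dots> = ennreal (2 * pi) * (\<integral>\<^sup>+x. \<beta>\<^sub>0 x \<partial>lborel)"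
    by (rule nn_integral_cmult) simp
  also have "\<dots> \<le> ennreal (2 * pi) * liminf (\<lambda>k. \<integral>\<^sup>+x. \<beta> k x \<partial>lborel)"
    unfolding \<beta>\<^sub>0_def by (intro mult_left_mono nn_integral_liminf) auto
  also have "\<dots> = ennreal (2 * pi * (2 * pi * sqint cylb g))"
    unfolding int_\<beta> by (simp add: Liminf_const sqint_nonneg flip: ennreal_mult)
  finally have "sqint cylb w \<le> 2 * pi * (2 * pi * sqint cylb g)"
    by (subst (asm) ennreal_le_iff) (auto simp: sqint_nonneg)
  then show ?thesis by (simp add: g_def power2_eq_square mult.assoc)
qed

section \<open>Averaging, tensoring and rescaling\<close>

lemma integrable_mult_bounded_support:
  fixes f :: "'a \<Rightarrow> complex" and \<psi> :: "'a \<Rightarrow> real"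
  assumes [measurable]: "f \<in> borel_measurable M" "\<psi> \<in> borel_measurable M"
    and f2: "integrable M (\<lambda>z. (norm (f z))\<^sup>2)" and A: "A \<in> sets M" "emeasure M A < \<infinity>"
    and bd: "AE z in M. \<bar>\<psi> z\<bar> \<le> C * indicator A z"
  shows "integrable M (\<lambda>z. f z * of_real (\<psi> z))"
proof -
  have "set_integrable M A f" by (rule set_integrable_square) (use A f2 in auto)
  then have i: "integrable M (\<lambda>z. C *\<^sub>R (indicator A z *\<^sub>R f z))"
    unfolding set_integrable_def by (rule integrable_scaleR_right)
  show ?thesis
  proof (rule Bochner_Integration.integrable_bound[OF i])
    show "AE z in M. norm (f z * of_real (\<psi> z)) \<le> norm (C *\<^sub>R (indicator A z *\<^sub>R f z))"
      using bd
    proof eventually_elim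
      case (elim z)
      then have "\<bar>\<psi> z\<bar> \<le> \<bar>C\<bar> * indicator A z" by (auto simp: indicator_def split: if_splits)
      from mult_left_mono[OF this, of "norm (f z)"] show ?case by (simp add: norm_mult abs_mult mult_ac)
    qed
  qed measurable
qed

lemma frechet_derivative_zero_open:
  assumes "open S" "z \<in> S" "\<And>z. z \<in> S \<Longrightarrow> f z = (0::real)"
  shows "frechet_derivative f (at z) b = 0"
proof -
  have "(f has_derivative (\<lambda>_. 0)) (at z)"
    by (rule has_derivative_transform_within_open[OF _ assms(1,2)]) (use assms(3) in auto)
  from frechet_derivative_at[OF this] show ?thesis by (metis)
qed

lemma borel_measurable_smooth:
  assumes "smooth \<phi>"
  shows "\<phi> \<in> borel_measurable borel" "b \<in> Basis \<Longrightarrow> (\<lambda>z. frechet_derivative \<phi> (at z) b) \<in> borel_measurable borel"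
  using assms smooth_frechet_derivative[OF assms]
  by (auto intro!: borel_measurable_continuous_onI smooth_continuous_on)

lemma continuous_bound_compact:
  fixes f :: "'a::topological_space \<Rightarrow> real"
  assumes "compact K" "continuous_on K f"
  obtains C where "\<And>x. x \<in> K \<Longrightarrow> \<bar>f x\<bar> \<le> C"
proof -
  have "bounded (f ` K)" using assms by (intro compact_imp_bounded compact_continuous_image)
  then show ?thesis using that by (auto simp: bounded_iff)
qed

lemma measurable_cylb_iff: "f \<in> borel_measurable cylb \<longleftrightarrow> f \<in> borel_measurable borel"
  by (simp only: measurable_cong_sets[OF sets_cylb refl])

text \<open>A test function is bounded on one period and vanishes off a column over a compact set.
  The column has finite measure, so square integrable functions are integrable on it.\<close>

lemma cyl_test_integrable:
  fixes f :: "(real^'n) \<times> real \<Rightarrow> complex"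
  assumes \<phi>: "\<phi> \<in> cyl_test" and b: "b \<in> Basis"
    and f: "f \<in> borel_measurable borel" "integrable cylb (\<lambda>z. (norm (f z))\<^sup>2)"
  shows "integrable cylb (\<lambda>z. f z * of_real (\<phi> z))"
    and "integrable cylb (\<lambda>z. f z * of_real (frechet_derivative \<phi> (at z) b))"
proof -
  define K where "K = closure {x. \<exists>y. \<phi> (x, y) \<noteq> 0}"
  have sm: "smooth \<phi>" and K: "compact K" using \<phi> by (auto simp: cyl_test_def K_def)
  define A where "A = K \<times> (UNIV::real set)"
  have KS: "K \<in> sets borel" using K by (simp add: borel_compact)
  have A: "A \<in> sets cylb" unfolding cylb_def A_def
    by (rule pair_measureI) (use KS in \<open>auto simp: sets_circle_measure\<close>)
  have eA: "emeasure cylb A < \<infinity>"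
  proof -
    have "emeasure cylb A = emeasure lborel K * emeasure circle_measure UNIV"
      unfolding cylb_def A_def by (rule circle.emeasure_pair_measure_Times) (use KS in \<open>auto simp: sets_circle_measure\<close>)
    then show ?thesis
      using emeasure_compact_finite[OF K] by (simp add: emeasure_circle_measure ennreal_mult_less_top)
  qed
  have z: "\<phi> z = 0" "frechet_derivative \<phi> (at z) b = 0" if "z \<notin> A" for z
  proof -
    have o: "open ((- K) \<times> (UNIV::real set))" using K by (intro open_Times) (auto simp: compact_imp_closed open_Compl)
    have zero: "\<phi> z = 0" if "z \<in> (- K) \<times> UNIV" for z
    proof -
      have "{x. \<exists>y. \<phi> (x, y) \<noteq> 0} \<subseteq> K" by (simp add: K_def closure_subset)
      then show ?thesis using that by (cases z) auto
    qed
    show "\<phi> z = 0" by (rule zero) (use that in \<open>cases z, auto simp: A_def\<close>)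
    show "frechet_derivative \<phi> (at z) b = 0"
      by (rule frechet_derivative_zero_open[OF o _ zero]) (use that in \<open>cases z, auto simp: A_def\<close>)
  qed
  have cK: "compact (K \<times> {0..2 * pi})" using K by (intro compact_Times) auto
  obtain C1 where C1: "\<And>z. z \<in> K \<times> {0..2 * pi} \<Longrightarrow> \<bar>\<phi> z\<bar> \<le> C1"
    by (rule continuous_bound_compact[OF cK smooth_continuous_on[OF sm]]) blast
  obtain C2 where C2: "\<And>z. z \<in> K \<times> {0..2 * pi} \<Longrightarrow> \<bar>frechet_derivative \<phi> (at z) b\<bar> \<le> C2"
    by (rule continuous_bound_compact[OF cK smooth_continuous_on[OF smooth_frechet_derivative[OF sm b]]]) blast
  have b1: "\<bar>\<phi> z\<bar> \<le> C1 * indicator A z" if "z \<in> strip" for z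
    using that z(1)[of z] C1[of z] by (cases "z \<in> A") (auto simp: A_def)
  have b2: "\<bar>frechet_derivative \<phi> (at z) b\<bar> \<le> C2 * indicator A z" if "z \<in> strip" for z
    using that z(2)[of z] C2[of z] by (cases "z \<in> A") (auto simp: A_def)
  show "integrable cylb (\<lambda>z. f z * of_real (\<phi> z))"
    by (rule integrable_mult_bounded_support[OF _ _ f(2) A eA, where C = C1])
       (use f borel_measurable_smooth[OF sm] b1 in \<open>auto simp: AE_cylb_iff measurable_cylb_iff\<close>)
  show "integrable cylb (\<lambda>z. f z * of_real (frechet_derivative \<phi> (at z) b))"
    by (rule integrable_mult_bounded_support[OF _ _ f(2) A eA, where C = C2])
       (use f borel_measurable_smooth(2)[OF sm b] b2 in \<open>auto simp: AE_cylb_iff measurable_cylb_iff\<close>)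
qed

text \<open>Functions independent of \<open>y\<close> qualify because the support condition of
  \<open>cyl_test\<close> concerns \<open>x\<close> alone.\<close>

lemma cyl_test_lift:
  fixes \<phi> :: "real^'n \<Rightarrow> real"
  assumes "\<phi> \<in> eu_test"
  shows "(\<lambda>z. \<phi> (fst z)) \<in> cyl_test"
    and "frechet_derivative (\<lambda>z::(real^'n) \<times> real. \<phi> (fst z)) (at z) b = frechet_derivative \<phi> (at (fst z)) (fst b)"
proof -
  have sm: "smooth \<phi>" using assms by (simp add: eu_test_def)
  have "smooth (\<lambda>z::(real^'n) \<times> real. \<phi> (fst z))"
    by (rule smooth_compose_linear[OF _ sm]) (rule linear_fst)
  then show "(\<lambda>z. \<phi> (fst z)) \<in> cyl_test" using assms by (auto simp: cyl_test_def eu_test_def y_periodic_def)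
  have "((\<lambda>z::(real^'n) \<times> real. \<phi> (fst z)) has_derivative (\<lambda>h. frechet_derivative \<phi> (at (fst z)) (fst h))) (at z)"
    by (rule has_derivative_compose[OF _ smooth_has_derivative[OF sm]])
       (auto intro!: derivative_eq_intros)
  from frechet_derivative_at[OF this]
  show "frechet_derivative (\<lambda>z::(real^'n) \<times> real. \<phi> (fst z)) (at z) b = frechet_derivative \<phi> (at (fst z)) (fst b)"
    by metis
qed

lemma cyl_test_slice:
  fixes \<phi> :: "(real^'n) \<times> real \<Rightarrow> real"
  assumes "\<phi> \<in> cyl_test"
  shows "(\<lambda>x. \<phi> (x, y)) \<in> eu_test"
    and "frechet_derivative (\<lambda>x. \<phi> (x, y)) (at x) v = frechet_derivative \<phi> (at (x, y)) (v, 0)"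
    and "((\<lambda>y. \<phi> (x, y)) has_real_derivative frechet_derivative \<phi> (at (x, y)) (0, 1)) (at y)"
proof -
  have sm: "smooth \<phi>" using assms by (simp add: cyl_test_def)
  have "smooth (\<lambda>x. \<phi> ((x, 0) + (0, y)))"
    by (rule smooth_compose_affine[OF _ sm, of "\<lambda>x. (x, 0)"]) (auto intro!: linearI)
  then have "smooth (\<lambda>x. \<phi> (x, y))" by simp
  moreover have "bounded {x. \<phi> (x, y) \<noteq> 0}"
    by (rule bounded_subset[of "{x. \<exists>y. \<phi> (x, y) \<noteq> 0}"]) (use assms in \<open>auto simp: cyl_test_def\<close>)
  ultimately show "(\<lambda>x. \<phi> (x, y)) \<in> eu_test" by (simp add: eu_test_def)
  have "((\<lambda>x. \<phi> (x, y)) has_derivative (\<lambda>h. frechet_derivative \<phi> (at (x, y)) (h, 0))) (at x)"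
    by (rule has_derivative_compose[OF _ smooth_has_derivative[OF sm]])
       (auto intro!: derivative_eq_intros)
  from frechet_derivative_at[OF this]
  show "frechet_derivative (\<lambda>x. \<phi> (x, y)) (at x) v = frechet_derivative \<phi> (at (x, y)) (v, 0)" by metis
  have lin: "linear (frechet_derivative \<phi> (at (x, y)))"
    using smooth_has_derivative[OF sm] by (meson has_derivative_linear)
  have "((\<lambda>y. \<phi> (x, y)) has_derivative (\<lambda>h. frechet_derivative \<phi> (at (x, y)) (0, h))) (at y)"
    by (rule has_derivative_compose[OF _ smooth_has_derivative[OF sm]])
       (auto intro!: derivative_eq_intros)
  moreover have "(\<lambda>h. frechet_derivative \<phi> (at (x, y)) (0, h)) = (\<lambda>h. frechet_derivative \<phi> (at (x, y)) (0, 1) * h)"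
  proof
    fix h
    from linear_scale[OF lin, of h "(0, 1)"]
    show "frechet_derivative \<phi> (at (x, y)) (0, h) = frechet_derivative \<phi> (at (x, y)) (0, 1) * h"
      by (simp only: scaleR_Pair scaleR_zero_right real_scaleR_def mult_1_left mult_1_right mult.commute)
  qed
  ultimately show "((\<lambda>y. \<phi> (x, y)) has_real_derivative frechet_derivative \<phi> (at (x, y)) (0, 1)) (at y)"
    unfolding has_field_derivative_def by (simp only:)
qed

definition eu_data :: "(real^'n \<Rightarrow> complex) \<Rightarrow> ('n \<Rightarrow> real^'n \<Rightarrow> complex) \<Rightarrow> bool" where
  "eu_data u g \<longleftrightarrow> u \<in> borel_measurable borel \<and> integrable lborel (\<lambda>x. (norm (u x))\<^sup>2) \<and>
     (\<forall>i. g i \<in> borel_measurable borel \<and> integrable lborel (\<lambda>x. (norm (g i x))\<^sup>2) \<and>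
        is_weak_deriv lborel eu_test (axis i 1) u (g i))"

lemma fst_snd_borel[measurable]:
  "fst \<in> borel \<rightarrow>\<^sub>M (borel :: 'a::euclidean_space measure)" "(snd :: 'a::euclidean_space \<times> real \<Rightarrow> real) \<in> borel_measurable borel"
  by (intro borel_measurable_continuous_onI continuous_intros)+

lemma integral_cylb_fst:
  fixes f :: "'a::euclidean_space \<times> real \<Rightarrow> 'b::{banach,second_countable_topology}"
  assumes "integrable cylb f"
  shows "(LINT z|cylb. f z) = (LINT x|lborel. LINT y|circle_measure. f (x, y))"
  using cyl_pair.integral_fst'[OF assms[unfolded cylb_def]] by (simp add: cylb_def)

lemma integrable_cylb_tensor:
  fixes a :: "'a::euclidean_space \<Rightarrow> 'b::{real_normed_field,banach,second_countable_topology}" and b :: "real \<Rightarrow> 'b"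
  assumes "integrable lborel a" "integrable circle_measure b"
  shows "integrable cylb (\<lambda>z. a (fst z) * b (snd z))"
    and "(LINT z|cylb. a (fst z) * b (snd z)) = (LINT x|lborel. a x) * (LINT y|circle_measure. b y)"
proof -
  have [measurable]: "a \<in> borel_measurable lborel" "b \<in> borel_measurable circle_measure"
    using assms by auto
  show i: "integrable cylb (\<lambda>z. a (fst z) * b (snd z))"
    unfolding cylb_def
  proof (rule cyl_pair.Fubini_integrable)
    show "integrable lborel (\<lambda>x. LINT y|circle_measure. norm (a (fst (x, y)) * b (snd (x, y))))"
      using assms by (simp add: norm_mult)
  qed (use assms in auto)
  show "(LINT z|cylb. a (fst z) * b (snd z)) = (LINT x|lborel. a x) * (LINT y|circle_measure. b y)"
    using integral_cylb_fst[OF i] by simp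
qed

lemma sum_norm_square_le: "(norm (a - b))\<^sup>2 \<le> 2 * (norm a)\<^sup>2 + 2 * (norm (b::complex))\<^sup>2"
proof -
  have "(norm (a - b))\<^sup>2 \<le> (norm a + norm b)\<^sup>2" by (intro power_mono norm_triangle_ineq4) auto
  also have "\<dots> \<le> 2 * (norm a)\<^sup>2 + 2 * (norm b)\<^sup>2"
    using sum_squares_bound[of "norm a" "norm b"] by (simp add: power2_sum)
  finally show ?thesis .
qed

lemma square_integrable_diff:
  fixes f g :: "'a \<Rightarrow> complex"
  assumes [measurable]: "f \<in> borel_measurable M" "g \<in> borel_measurable M"
    and "integrable M (\<lambda>z. (norm (f z))\<^sup>2)" "integrable M (\<lambda>z. (norm (g z))\<^sup>2)"
  shows "integrable M (\<lambda>z. (norm (f z - g z))\<^sup>2)"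
proof (rule Bochner_Integration.integrable_bound)
  show "integrable M (\<lambda>z. 2 * (norm (f z))\<^sup>2 + 2 * (norm (g z))\<^sup>2)" using assms by auto
  show "AE z in M. norm ((norm (f z - g z))\<^sup>2) \<le> norm (2 * (norm (f z))\<^sup>2 + 2 * (norm (g z))\<^sup>2)"
    using sum_norm_square_le by (intro AE_I2) (simp add: abs_of_nonneg)
qed measurable

section \<open>Averages over the circle\<close>

definition avg_y :: "('a \<times> real \<Rightarrow> complex) \<Rightarrow> 'a \<Rightarrow> complex" where
  "avg_y f x = (LINT y|circle_measure. f (x, y)) /\<^sub>R (2 * pi)"

context
  fixes f :: "'a::euclidean_space \<times> real \<Rightarrow> complex"
  assumes f[measurable]: "f \<in> borel_measurable borel" and f2: "integrable cylb (\<lambda>z. (norm (f z))\<^sup>2)"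
begin

lemma borel_measurable_avg_y: "avg_y f \<in> borel_measurable borel"
proof -
  have "f \<in> borel_measurable (lborel \<Otimes>\<^sub>M circle_measure)"
    using f unfolding measurable_cylb_iff[symmetric] cylb_def .
  then have "(\<lambda>(x, y). f (x, y)) \<in> borel_measurable (lborel \<Otimes>\<^sub>M circle_measure)"
    unfolding case_prod_eta .
  from circle.borel_measurable_lebesgue_integral[OF this]
  have "(\<lambda>x. LINT y|circle_measure. f (x, y)) \<in> borel_measurable borel"
    by simp
  then show ?thesis unfolding avg_y_def[abs_def] by (rule borel_measurable_scaleR[OF borel_measurable_const])
qed

lemma avg_y_mean_zero: "AE x in lborel. (LINT y|circle_measure. f (x, y) - avg_y f x) = 0"
  using cylb_section_square_integrable[OF f f2]
proof eventually_elim
  case (elim x)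
  have "(LINT y|circle_measure. f (x, y) - avg_y f x) = (LINT y|circle_measure. f (x, y)) - (2 * pi) *\<^sub>R avg_y f x"
    using elim by (subst Bochner_Integration.integral_diff) (simp_all add: measure_circle)
  then show ?case unfolding avg_y_def by simp
qed

lemma avg_y_square_integrable: "integrable lborel (\<lambda>x. (norm (avg_y f x))\<^sup>2)"
proof (rule Bochner_Integration.integrable_bound)
  note [measurable] = borel_measurable_avg_y
  show "integrable lborel (\<lambda>x. LINT y|circle_measure. (norm (f (x, y)))\<^sup>2)"
    using cyl_pair.integrable_fst'[OF f2[unfolded cylb_def]] .
  show "AE x in lborel. norm ((norm (avg_y f x))\<^sup>2) \<le> norm (LINT y|circle_measure. (norm (f (x, y)))\<^sup>2)"
    using cylb_section_square_integrable[OF f f2]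
  proof eventually_elim
    case (elim x)
    note [measurable] = borel_measurable_Pair_section(1)[OF f]
    have "(norm (avg_y f x))\<^sup>2 = (norm (LINT y|circle_measure. f (x, y)))\<^sup>2 / (2 * pi)\<^sup>2"
    proof -
      have "norm (avg_y f x) = norm (LINT y|circle_measure. f (x, y)) / (2 * pi)"
        by (simp add: avg_y_def field_simps)
      then show ?thesis by (simp only: power_divide)
    qed
    also have "\<dots> \<le> (LINT y|circle_measure. norm (f (x, y)))\<^sup>2 / (2 * pi)\<^sup>2"
      by (intro divide_right_mono power_mono integral_norm_bound) auto
    also have "\<dots> = (LINT y:UNIV|circle_measure. norm (f (x, y)))\<^sup>2 / (2 * pi)\<^sup>2"
      by (simp add: set_lebesgue_integral_def)
    also have "\<dots> \<le> (measure circle_measure UNIV * (LINT y:UNIV|circle_measure. (norm (f (x, y)))\<^sup>2)) / (2 * pi)\<^sup>2"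
      by (intro divide_right_mono set_integral_Cauchy_Schwarz) (use elim in \<open>auto simp: emeasure_circle_measure\<close>)
    also have "\<dots> = (LINT y|circle_measure. (norm (f (x, y)))\<^sup>2) / (2 * pi)"
      by (simp add: set_lebesgue_integral_def measure_circle power2_eq_square)
    also have "\<dots> \<le> (LINT y|circle_measure. (norm (f (x, y)))\<^sup>2) / 1"
      using pi_gt3 by (intro divide_left_mono integral_nonneg_AE) auto
    finally show ?case by (simp add: integral_nonneg_AE)
  qed
qed (use borel_measurable_avg_y in measurable)

lemma avg_y_residual_measurable: "(\<lambda>z. f z - avg_y f (fst z)) \<in> borel_measurable borel"
  using borel_measurable_avg_y by measurable

lemma avg_y_lift_square_integrable: "integrable cylb (\<lambda>z. (norm (avg_y f (fst z)))\<^sup>2)"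
  using integrable_cylb_tensor(1)[OF avg_y_square_integrable, of "\<lambda>_. 1"] by simp

lemma avg_y_residual_square_integrable: "integrable cylb (\<lambda>z. (norm (f z - avg_y f (fst z)))\<^sup>2)"
  by (rule square_integrable_diff)
     (use borel_measurable_avg_y f2 avg_y_lift_square_integrable in \<open>auto simp: measurable_cylb_iff\<close>)

text \<open>A factor depending on \<open>x\<close> alone leaves the fibre integral, which vanishes
  by \<open>avg_y_mean_zero\<close>. This orthogonality serves twice: it splits squared norms, and
  it removes the linear term of the potential.\<close>

lemma integral_cnj_avg_y:
  fixes k :: "'a \<Rightarrow> complex"
  assumes "integrable cylb (\<lambda>z. k (fst z) * (f z - avg_y f (fst z)))"
  shows "(LINT z|cylb. k (fst z) * (f z - avg_y f (fst z))) = 0"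
proof -
  note [measurable] = borel_measurable_avg_y
  have "(LINT z|cylb. k (fst z) * (f z - avg_y f (fst z))) = (LINT x|lborel. LINT y|circle_measure. k x * (f (x, y) - avg_y f x))"
    using integral_cylb_fst[OF assms] by simp
  also have "\<dots> = 0"
    by (rule integral_eq_zero_AE) (use avg_y_mean_zero in \<open>eventually_elim, simp\<close>)
  finally show ?thesis .
qed

lemma sqint_avg_y_decomposition:
  "sqint cylb f = 2 * pi * sqint lborel (avg_y f) + sqint cylb (\<lambda>z. f z - avg_y f (fst z))"
proof -
  note [measurable] = borel_measurable_avg_y
  let ?m = "\<lambda>z. avg_y f (fst z)" and ?r = "\<lambda>z. f z - avg_y f (fst z)"
  have int: "integrable cylb (\<lambda>z. cnj (?m z) * ?r z)"
  proof (rule Bochner_Integration.integrable_bound)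
    show "integrable cylb (\<lambda>z. (norm (?m z))\<^sup>2 + (norm (?r z))\<^sup>2)"
      using avg_y_lift_square_integrable avg_y_residual_square_integrable by auto
    show "AE z in cylb. norm (cnj (?m z) * ?r z) \<le> norm ((norm (?m z))\<^sup>2 + (norm (?r z))\<^sup>2)"
    proof (rule AE_I2)
      fix z
      have "2 * norm (?m z) * norm (?r z) \<le> (norm (?m z))\<^sup>2 + (norm (?r z))\<^sup>2" by (rule sum_squares_bound)
      moreover have "0 \<le> norm (?m z) * norm (?r z)" by simp
      ultimately have "norm (?m z) * norm (?r z) \<le> (norm (?m z))\<^sup>2 + (norm (?r z))\<^sup>2" by linarith
      then show "norm (cnj (?m z) * ?r z) \<le> norm ((norm (?m z))\<^sup>2 + (norm (?r z))\<^sup>2)"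
        by (simp add: norm_mult abs_of_nonneg)
    qed
    have "(\<lambda>z. cnj (?m z)) \<in> borel_measurable borel"
      by (rule measurable_compose[OF _ borel_measurable_continuous_onI[OF continuous_on_cnj[OF continuous_on_id]]]) measurable
    then show "(\<lambda>z. cnj (?m z) * ?r z) \<in> borel_measurable cylb"
      unfolding measurable_cylb_iff using avg_y_residual_measurable by measurable
  qed
  have eq: "(norm (f z))\<^sup>2 = (norm (?m z))\<^sup>2 + (norm (?r z))\<^sup>2 + 2 * Re (cnj (?m z) * ?r z)" for z
  proof -
    have "(norm (a + b))\<^sup>2 = (norm a)\<^sup>2 + (norm b)\<^sup>2 + 2 * Re (cnj a * b)" for a b :: complex
      by (simp add: cmod_power2) (simp add: power2_eq_square algebra_simps)
    from this[of "?m z" "?r z"] show ?thesis by simp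
  qed
  have "sqint cylb f = (LINT z|cylb. (norm (?m z))\<^sup>2) + (LINT z|cylb. (norm (?r z))\<^sup>2) + 2 * (LINT z|cylb. Re (cnj (?m z) * ?r z))"
  proof -
    have "(LINT z|cylb. A z + B z + 2 * C z) = (LINT z|cylb. A z) + (LINT z|cylb. B z) + 2 * (LINT z|cylb. C z)"
      if "integrable cylb A" "integrable cylb B" "integrable cylb C" for A B C :: "'a \<times> real \<Rightarrow> real"
      using that by simp
    from this[OF avg_y_lift_square_integrable avg_y_residual_square_integrable integrable_Re[OF int]]
    show ?thesis unfolding sqint_def eq .
  qed
  also have "(LINT z|cylb. Re (cnj (?m z) * ?r z)) = 0"
    unfolding integral_Re[OF int] using integral_cnj_avg_y[of "\<lambda>x. cnj (avg_y f x)"] int by simp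
  also have "(LINT z|cylb. (norm (?m z))\<^sup>2) = 2 * pi * sqint lborel (avg_y f)"
    using integrable_cylb_tensor(2)[OF avg_y_square_integrable, of "\<lambda>_. 1"]
    by (simp add: sqint_def measure_circle)
  finally show ?thesis by (simp add: sqint_def)
qed

lemma integral_avg_y_mult:
  assumes "integrable cylb (\<lambda>z. f z * of_real (\<phi> (fst z)))"
  shows "(LINT x|lborel. avg_y f x * of_real (\<phi> x)) = (LINT z|cylb. f z * of_real (\<phi> (fst z))) /\<^sub>R (2 * pi)"
  unfolding integral_cylb_fst[OF assms] by (simp add: avg_y_def)

end

text \<open>A Euclidean test function, extended constantly in \<open>y\<close>, is a test function
  on the cylinder; hence averaging commutes with the \<open>x\<close>-derivatives.\<close>

lemma eu_data_avg_y:
  fixes v :: "(real^'n) \<times> real \<Rightarrow> complex"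
  assumes data: "cyl_data v G"
  shows "eu_data (avg_y v) (\<lambda>i. avg_y (G (axis i 1, 0)))"
proof -
  have b: "(axis i 1, 0) \<in> (Basis :: ((real^'n) \<times> real) set)" for i by (simp add: Basis_cyl)
  have v: "v \<in> borel_measurable borel" "integrable cylb (\<lambda>z. (norm (v z))\<^sup>2)"
    and G: "G (axis i 1, 0) \<in> borel_measurable borel" "integrable cylb (\<lambda>z. (norm (G (axis i 1, 0) z))\<^sup>2)"
    and wd: "is_weak_deriv cylb cyl_test (axis i 1, 0) v (G (axis i 1, 0))" for i
    using data b[of i] by (auto simp: cyl_data_def)
  have "is_weak_deriv lborel eu_test (axis i 1) (avg_y v) (avg_y (G (axis i 1, 0)))" for i
    unfolding is_weak_deriv_def
  proof
    fix \<phi> :: "real^'n \<Rightarrow> real" assume \<phi>: "\<phi> \<in> eu_test"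
    note L = cyl_test_lift[OF \<phi>]
    have i1: "integrable cylb (\<lambda>z. v z * of_real (frechet_derivative \<phi> (at (fst z)) (axis i 1)))"
      using cyl_test_integrable(2)[OF L(1) b v] unfolding L(2) by simp
    have i2: "integrable cylb (\<lambda>z. G (axis i 1, 0) z * of_real (\<phi> (fst z)))"
      using cyl_test_integrable(1)[OF L(1) b G] .
    have "(LINT z|cylb. v z * of_real (frechet_derivative \<phi> (at (fst z)) (axis i 1))) = - (LINT z|cylb. G (axis i 1, 0) z * of_real (\<phi> (fst z)))"
    proof -
      have "(LINT z|cylb. v z * of_real (frechet_derivative (\<lambda>z. \<phi> (fst z)) (at z) (axis i 1, 0))) = - (LINT z|cylb. G (axis i 1, 0) z * of_real (\<phi> (fst z)))"
        using wd[of i] L(1) unfolding is_weak_deriv_def by blast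
      then show ?thesis unfolding L(2) fst_conv .
    qed
    then show "(LINT x|lborel. avg_y v x * of_real (frechet_derivative \<phi> (at x) (axis i 1))) = - (LINT x|lborel. avg_y (G (axis i 1, 0)) x * of_real (\<phi> x))"
      unfolding integral_avg_y_mult[OF v i1] integral_avg_y_mult[OF G i2] by simp
  qed
  then show ?thesis
    unfolding eu_data_def
    using borel_measurable_avg_y avg_y_square_integrable v G by blast
qed

lemma cyl_data_diff:
  fixes v v' :: "(real^'n) \<times> real \<Rightarrow> complex"
  assumes "cyl_data v G" "cyl_data v' G'"
  shows "cyl_data (\<lambda>z. v z - v' z) (\<lambda>b z. G b z - G' b z)"
  unfolding cyl_data_def
proof (intro conjI ballI)
  note A = assms[unfolded cyl_data_def]
  show "(\<lambda>z. v z - v' z) \<in> borel_measurable borel" using A by auto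
  show "integrable cylb (\<lambda>z. (norm (v z - v' z))\<^sup>2)"
    using A by (intro square_integrable_diff) (auto simp: measurable_cylb_iff)
  fix b :: "(real^'n) \<times> real" assume b: "b \<in> Basis"
  show "(\<lambda>z. G b z - G' b z) \<in> borel_measurable borel" using A b by (intro borel_measurable_diff) blast+
  show "integrable cylb (\<lambda>z. (norm (G b z - G' b z))\<^sup>2)"
    using A b by (intro square_integrable_diff) (auto simp: measurable_cylb_iff)
  show "is_weak_deriv cylb cyl_test b (\<lambda>z. v z - v' z) (\<lambda>z. G b z - G' b z)"
    unfolding is_weak_deriv_def
  proof
    fix \<phi> :: "(real^'n) \<times> real \<Rightarrow> real" assume \<phi>: "\<phi> \<in> cyl_test"
    have "(LINT z|cylb. v z * of_real (frechet_derivative \<phi> (at z) b)) = - (LINT z|cylb. G b z * of_real (\<phi> z))"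
      "(LINT z|cylb. v' z * of_real (frechet_derivative \<phi> (at z) b)) = - (LINT z|cylb. G' b z * of_real (\<phi> z))"
      using A b \<phi> by (auto simp: is_weak_deriv_def)
    moreover have "integrable cylb (\<lambda>z. v z * of_real (frechet_derivative \<phi> (at z) b))" "integrable cylb (\<lambda>z. v' z * of_real (frechet_derivative \<phi> (at z) b))"
       "integrable cylb (\<lambda>z. G b z * of_real (\<phi> z))" "integrable cylb (\<lambda>z. G' b z * of_real (\<phi> z))"
      using A b by (auto intro!: cyl_test_integrable[OF \<phi> b])
    ultimately show "(LINT z|cylb. (v z - v' z) * of_real (frechet_derivative \<phi> (at z) b)) = - (LINT z|cylb. (G b z - G' b z) * of_real (\<phi> z))"
      by (simp add: left_diff_distrib)
  qed
qed

section \<open>Products of a function of x with a profile on the circle\<close>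

lemma integral_circle_continuous:
  fixes f :: "real \<Rightarrow> 'b::euclidean_space"
  assumes f: "continuous_on UNIV f"
  shows "integrable circle_measure f" "(LINT y|circle_measure. f y) = integral {0..2 * pi} f"
proof -
  have fm: "f \<in> borel_measurable borel" using f by (rule borel_measurable_continuous_onI)
  have i: "set_integrable lborel {0..2 * pi} f"
    by (rule borel_integrable_compact[unfolded set_integrable_def[symmetric]]) (auto intro: continuous_on_subset[OF f])
  have ae: "AE y in lborel. indicator {0..<2 * pi} y *\<^sub>R f y = indicator {0..2 * pi} y *\<^sub>R f y"
    using AE_lborel_singleton[of "2 * pi"] by eventually_elim (auto simp: indicator_def)
  have i': "integrable lborel (\<lambda>y. indicator {0..<2 * pi} y *\<^sub>R f y)"
    using i unfolding set_integrable_def by (subst integrable_cong_AE[OF _ _ ae]) (use fm in auto)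
  have eq: "circle_measure = density lborel (\<lambda>y. ennreal (indicator {0..<2 * pi} y))"
    by (simp add: circle_measure_def ennreal_indicator)
  show "integrable circle_measure f"
    unfolding eq by (subst integrable_density) (use fm i' in auto)
  have "(LINT y|circle_measure. f y) = (LINT y|lborel. indicator {0..<2 * pi} y *\<^sub>R f y)"
    unfolding eq by (subst integral_density) (use fm in auto)
  also have "\<dots> = (LINT y:{0..2 * pi}|lborel. f y)"
    unfolding set_lebesgue_integral_def by (rule Bochner_Integration.integral_cong_AE[OF _ _ ae]) (use fm in auto)
  also have "\<dots> = integral {0..2 * pi} f" by (rule set_borel_integral_eq_integral(2)[OF i])
  finally show "(LINT y|circle_measure. f y) = integral {0..2 * pi} f" .
qed

lemma integral_circle_by_parts:
  fixes \<theta> \<theta>' \<phi> \<phi>' :: "real \<Rightarrow> real"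
  assumes \<theta>: "\<And>y. (\<theta> has_real_derivative \<theta>' y) (at y)" "continuous_on UNIV \<theta>'"
    and \<phi>: "\<And>y. (\<phi> has_real_derivative \<phi>' y) (at y)" "continuous_on UNIV \<phi>'"
    and per: "\<theta> (2 * pi) = \<theta> 0" "\<phi> (2 * pi) = \<phi> 0"
  shows "(LINT y|circle_measure. \<theta> y * \<phi>' y) = - (LINT y|circle_measure. \<theta>' y * \<phi> y)"
proof -
  have c: "continuous_on UNIV \<theta>" "continuous_on UNIV \<phi>"
    using DERIV_isCont[OF \<theta>(1)] DERIV_isCont[OF \<phi>(1)] by (simp_all add: continuous_at_imp_continuous_on)
  have "((\<lambda>y. \<theta> y * \<phi>' y + \<theta>' y * \<phi> y) has_integral (\<theta> (2 * pi) * \<phi> (2 * pi) - \<theta> 0 * \<phi> 0)) {0..2 * pi}"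
  proof (rule fundamental_theorem_of_calculus)
    fix y
    have "((\<lambda>y. \<theta> y * \<phi> y) has_real_derivative \<theta> y * \<phi>' y + \<theta>' y * \<phi> y) (at y)"
      using DERIV_mult[OF \<theta>(1)[of y] \<phi>(1)[of y]] by (simp only: mult.commute add.commute)
    then show "((\<lambda>y. \<theta> y * \<phi> y) has_vector_derivative \<theta> y * \<phi>' y + \<theta>' y * \<phi> y) (at y within {0..2 * pi})"
      unfolding has_real_derivative_iff_has_vector_derivative by (rule has_vector_derivative_at_within)
  qed simp
  then have "integral {0..2 * pi} (\<lambda>y. \<theta> y * \<phi>' y + \<theta>' y * \<phi> y) = 0" using per by (simp add: integral_unique)
  moreover have "(LINT y|circle_measure. \<theta> y * \<phi>' y + \<theta>' y * \<phi> y) = integral {0..2 * pi} (\<lambda>y. \<theta> y * \<phi>' y + \<theta>' y * \<phi> y)"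
    by (rule integral_circle_continuous(2)) (use c \<theta> \<phi> in \<open>auto intro!: continuous_intros\<close>)
  moreover have "integrable circle_measure (\<lambda>y. \<theta> y * \<phi>' y)" "integrable circle_measure (\<lambda>y. \<theta>' y * \<phi> y)"
    by (rule integral_circle_continuous(1); use c \<theta> \<phi> in \<open>auto intro!: continuous_intros\<close>)+
  ultimately show ?thesis by simp
qed

lemma cyl_test_y_derivative_continuous:
  assumes "\<phi> \<in> cyl_test"
  shows "continuous_on UNIV (\<lambda>y. frechet_derivative \<phi> (at (x, y)) (0, 1))"
proof -
  have sm: "smooth \<phi>" using assms by (simp add: cyl_test_def)
  have e: "(0, 1) \<in> (Basis :: ((real^'n) \<times> real) set)" by (simp add: Basis_cyl)
  show ?thesis
    by (rule continuous_on_compose2[OF smooth_continuous_on[OF smooth_frechet_derivative[OF sm e], of UNIV]])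
       (auto intro!: continuous_intros)
qed

text \<open>Gradients on the cylinder are indexed by basis vectors and not by \<open>'n\<close>; the
  sum over \<open>i\<close> reads the index back from \<open>b = (axis i 1, 0)\<close>.\<close>

definition tensor_grad ::
  "(real^'n \<Rightarrow> complex) \<Rightarrow> ('n \<Rightarrow> real^'n \<Rightarrow> complex) \<Rightarrow> (real \<Rightarrow> real) \<Rightarrow> (real \<Rightarrow> real) \<Rightarrow>
   (real^'n) \<times> real \<Rightarrow> (real^'n) \<times> real \<Rightarrow> complex" where
  "tensor_grad u g \<theta> \<theta>' b z = (if b = (0, 1) then u (fst z) * of_real (\<theta>' (snd z))
     else (\<Sum>i\<in>UNIV. of_real (fst b $ i) * g i (fst z)) * of_real (\<theta> (snd z)))"

lemma tensor_grad_simps: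
  "tensor_grad u g \<theta> \<theta>' (0, 1) = (\<lambda>z. u (fst z) * of_real (\<theta>' (snd z)))"
  "tensor_grad u g \<theta> \<theta>' (axis i 1, 0) = (\<lambda>z. g i (fst z) * of_real (\<theta> (snd z)))"
  by (auto simp: tensor_grad_def fun_eq_iff axis_def if_distrib[of of_real] if_distrib[of "\<lambda>a. a * _"] cong: if_cong)

lemma tensor_L2:
  fixes a :: "real^'n \<Rightarrow> complex"
  assumes a: "a \<in> borel_measurable borel" "integrable lborel (\<lambda>x. (norm (a x))\<^sup>2)"
    and \<theta>: "continuous_on UNIV (\<theta> :: real \<Rightarrow> real)"
  shows "(\<lambda>z. a (fst z) * of_real (\<theta> (snd z))) \<in> borel_measurable borel"
    and "integrable cylb (\<lambda>z. (norm (a (fst z) * of_real (\<theta> (snd z))))\<^sup>2)"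
    and "sqint cylb (\<lambda>z. a (fst z) * of_real (\<theta> (snd z))) = sqint lborel a * (LINT y|circle_measure. (\<theta> y)\<^sup>2)"
proof -
  have \<theta>m: "\<theta> \<in> borel_measurable borel" using \<theta> by (rule borel_measurable_continuous_onI)
  show "(\<lambda>z. a (fst z) * of_real (\<theta> (snd z))) \<in> borel_measurable borel"
    using a(1) \<theta>m by measurable
  have i: "integrable circle_measure (\<lambda>y. (\<theta> y)\<^sup>2)"
    by (rule integral_circle_continuous) (use \<theta> in \<open>auto intro!: continuous_intros\<close>)
  have eq: "(norm (a (fst z) * of_real (\<theta> (snd z))))\<^sup>2 = (norm (a (fst z)))\<^sup>2 * (\<theta> (snd z))\<^sup>2" for z
    by (simp add: norm_mult power_mult_distrib)
  show "integrable cylb (\<lambda>z. (norm (a (fst z) * of_real (\<theta> (snd z))))\<^sup>2)"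
    unfolding eq by (rule integrable_cylb_tensor(1)[OF a(2) i])
  show "sqint cylb (\<lambda>z. a (fst z) * of_real (\<theta> (snd z))) = sqint lborel a * (LINT y|circle_measure. (\<theta> y)\<^sup>2)"
    unfolding sqint_def eq by (rule integrable_cylb_tensor(2)[OF a(2) i])
qed

text \<open>The \<open>y\<close>-derivative is integration by parts on each fibre, where periodicity
  of profile and test function cancels the boundary terms. The \<open>x\<close>-derivatives are
  tested on each slice of constant \<open>y\<close>.\<close>

lemma cyl_data_tensor:
  fixes u :: "real^'n \<Rightarrow> complex"
  assumes data: "eu_data u g"
    and \<theta>: "\<And>y. (\<theta> has_real_derivative \<theta>' y) (at y)" "continuous_on UNIV \<theta>'" "\<theta> (2 * pi) = \<theta> 0"
  shows "cyl_data (\<lambda>z. u (fst z) * of_real (\<theta> (snd z))) (tensor_grad u g \<theta> \<theta>')"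
proof -
  have \<theta>c: "continuous_on UNIV \<theta>" using DERIV_isCont[OF \<theta>(1)] by (simp add: continuous_at_imp_continuous_on)
  have u: "u \<in> borel_measurable borel" "integrable lborel (\<lambda>x. (norm (u x))\<^sup>2)"
    and g: "g i \<in> borel_measurable borel" "integrable lborel (\<lambda>x. (norm (g i x))\<^sup>2)"
    and wd: "is_weak_deriv lborel eu_test (axis i 1) u (g i)" for i
    using data by (auto simp: eu_data_def)
  let ?v = "\<lambda>z. u (fst z) * of_real (\<theta> (snd z))"
  have e: "(0, 1) \<in> (Basis :: ((real^'n) \<times> real) set)" and bi: "(axis i 1, 0) \<in> (Basis :: ((real^'n) \<times> real) set)" for i
    by (simp_all add: Basis_cyl)
  have wy: "is_weak_deriv cylb cyl_test (0, 1) ?v (\<lambda>z. u (fst z) * of_real (\<theta>' (snd z)))"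
    unfolding is_weak_deriv_def
  proof
    fix \<phi> :: "(real^'n) \<times> real \<Rightarrow> real" assume \<phi>: "\<phi> \<in> cyl_test"
    let ?D = "\<lambda>z. frechet_derivative \<phi> (at z) (0, 1)"
    have i1: "integrable cylb (\<lambda>z. ?v z * of_real (?D z))"
      by (rule cyl_test_integrable(2)[OF \<phi> e tensor_L2(1,2)[OF u \<theta>c]])
    have i2: "integrable cylb (\<lambda>z. u (fst z) * of_real (\<theta>' (snd z)) * of_real (\<phi> z))"
      by (rule cyl_test_integrable(1)[OF \<phi> e tensor_L2(1,2)[OF u \<theta>(2)]])
    have inner: "(LINT y|circle_measure. u x * of_real (\<theta> y) * of_real (?D (x, y))) = - (LINT y|circle_measure. u x * of_real (\<theta>' y) * of_real (\<phi> (x, y)))" for x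
    proof -
      have "\<phi> (x, 0 + 2 * pi) = \<phi> (x, 0)" using \<phi> unfolding cyl_test_def y_periodic_def by blast
      then have "(LINT y|circle_measure. \<theta> y * ?D (x, y)) = - (LINT y|circle_measure. \<theta>' y * \<phi> (x, y))"
        by (intro integral_circle_by_parts \<theta> cyl_test_slice(3)[OF \<phi>] cyl_test_y_derivative_continuous[OF \<phi>]) simp
      then have "u x * of_real (LINT y|circle_measure. \<theta> y * ?D (x, y)) = - (u x * of_real (LINT y|circle_measure. \<theta>' y * \<phi> (x, y)))"
        by simp
      then show ?thesis by (simp add: mult.assoc flip: of_real_mult)
    qed
    show "(LINT z|cylb. ?v z * of_real (?D z)) = - (LINT z|cylb. u (fst z) * of_real (\<theta>' (snd z)) * of_real (\<phi> z))"
      unfolding integral_cylb_fst[OF i1] integral_cylb_fst[OF i2] fst_conv snd_conv inner by simp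
  qed
  have wx: "is_weak_deriv cylb cyl_test (axis i 1, 0) ?v (\<lambda>z. g i (fst z) * of_real (\<theta> (snd z)))" for i
    unfolding is_weak_deriv_def
  proof
    fix \<phi> :: "(real^'n) \<times> real \<Rightarrow> real" assume \<phi>: "\<phi> \<in> cyl_test"
    let ?D = "\<lambda>z. frechet_derivative \<phi> (at z) (axis i 1, 0)"
    have i1: "integrable cylb (\<lambda>z. ?v z * of_real (?D z))"
      by (rule cyl_test_integrable(2)[OF \<phi> bi tensor_L2(1,2)[OF u \<theta>c]])
    have i2: "integrable cylb (\<lambda>z. g i (fst z) * of_real (\<theta> (snd z)) * of_real (\<phi> z))"
      by (rule cyl_test_integrable(1)[OF \<phi> bi tensor_L2(1,2)[OF g \<theta>c]])
    have swap: "(LINT z|cylb. f z) = (LINT y|circle_measure. LINT x|lborel. f (x, y))" if "integrable cylb f" for f :: "(real^'n) \<times> real \<Rightarrow> complex"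
      using cyl_pair.integral_snd[of "\<lambda>x y. f (x, y)"] that by (simp add: cylb_def)
    have inner: "(LINT x|lborel. u x * of_real (\<theta> y) * of_real (?D (x, y))) = - (LINT x|lborel. g i x * of_real (\<theta> y) * of_real (\<phi> (x, y)))" for y
    proof -
      have "(LINT x|lborel. u x * of_real (?D (x, y))) = - (LINT x|lborel. g i x * of_real (\<phi> (x, y)))"
        using wd[of i] cyl_test_slice(1)[OF \<phi>, of y] unfolding is_weak_deriv_def cyl_test_slice(2)[OF \<phi>, symmetric] by blast
      then have "of_real (\<theta> y) * (LINT x|lborel. u x * of_real (?D (x, y))) = - (of_real (\<theta> y) * (LINT x|lborel. g i x * of_real (\<phi> (x, y))))"
        by simp
      then show ?thesis
        unfolding integral_mult_right_zero[symmetric] by (simp only: mult_ac)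
    qed
    show "(LINT z|cylb. ?v z * of_real (?D z)) = - (LINT z|cylb. g i (fst z) * of_real (\<theta> (snd z)) * of_real (\<phi> z))"
      unfolding swap[OF i1] swap[OF i2] fst_conv snd_conv inner by simp
  qed
  show ?thesis
    unfolding cyl_data_def Basis_cyl
    using tensor_L2[OF u \<theta>c] tensor_L2[OF u \<theta>(2)] tensor_L2[OF g \<theta>c] wx wy
    by (auto simp: tensor_grad_simps)
qed

section \<open>Dilation in x\<close>

lemma cylb_rescale:
  fixes f :: "(real^'n) \<times> real \<Rightarrow> 'b::{banach,second_countable_topology}"
  assumes f: "f \<in> borel_measurable borel" and \<mu>: "0 < \<mu>"
  shows "integrable cylb (\<lambda>z. f (\<mu> *\<^sub>R fst z, snd z)) \<longleftrightarrow> integrable cylb f"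
    and "(LINT z|cylb. f (\<mu> *\<^sub>R fst z, snd z)) = (LINT z|cylb. f z) /\<^sub>R \<mu> ^ CARD('n)"
proof -
  let ?S = "\<lambda>z::(real^'n) \<times> real. (\<mu> *\<^sub>R fst z, snd z)"
  define c :: "(real^'n) \<times> real \<Rightarrow> real" where "c j = (if j = (0, 1) then 1 else \<mu>)" for j
  have T: "(0 + (\<Sum>j\<in>Basis. (c j * (z \<bullet> j)) *\<^sub>R j)) = ?S z" for z
  proof (rule euclidean_eqI)
    fix b :: "(real^'n) \<times> real" assume b: "b \<in> Basis"
    have "(0 + (\<Sum>j\<in>Basis. (c j * (z \<bullet> j)) *\<^sub>R j)) \<bullet> b = c b * (z \<bullet> b)"
      using b by (simp add: inner_sum_left_Basis)
    also have "\<dots> = ?S z \<bullet> b" using b by (cases z) (auto simp: Basis_cyl c_def)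
    finally show "(0 + (\<Sum>j\<in>Basis. (c j * (z \<bullet> j)) *\<^sub>R j)) \<bullet> b = ?S z \<bullet> b" .
  qed
  have c0: "c j \<noteq> 0" for j using \<mu> by (simp add: c_def)
  have pc: "(\<Prod>j\<in>Basis. \<bar>c j\<bar>) = \<mu> ^ CARD('n)"
    unfolding prod_Basis_cyl using \<mu> by (simp add: c_def)
  have leb: "lborel = density (distr lborel borel ?S) (\<lambda>_. ennreal (\<mu> ^ CARD('n)))"
    using lborel_affine_euclidean[of c 0] c0 unfolding T pc by simp
  have Sm: "?S \<in> borel \<rightarrow>\<^sub>M borel"
    by (intro borel_measurable_continuous_onI continuous_intros)
  define F where "F z = indicator strip z *\<^sub>R f z" for z
  have Fm: "F \<in> borel_measurable borel" unfolding F_def[abs_def] using f by measurable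
  \<comment> \<open>The dilation leaves the second coordinate alone, so it commutes with the cut-off
    to the strip.\<close>
  have FS: "indicator strip z *\<^sub>R f (?S z) = F (?S z)" for z by (cases z) (simp add: F_def indicator_def)
  have fS: "(\<lambda>z. f (?S z)) \<in> borel_measurable borel" by (rule measurable_compose[OF Sm f])
  have "integrable cylb (\<lambda>z. f (?S z)) \<longleftrightarrow> integrable lborel (\<lambda>z. F (?S z))"
    unfolding integrable_cylb_iff[OF fS] FS ..
  also have "\<dots> \<longleftrightarrow> integrable (distr lborel borel ?S) F"
    by (subst integrable_distr_eq) (use Sm Fm in auto)
  also have "\<dots> \<longleftrightarrow> integrable (density (distr lborel borel ?S) (\<lambda>_. ennreal (\<mu> ^ CARD('n)))) F"
  proof -
    have sc: "integrable M (\<lambda>z. c *\<^sub>R F z) \<longleftrightarrow> integrable M F" if "c \<noteq> 0" for M and c :: real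
      using integrable_scaleR_right[of c M F] integrable_scaleR_right[of "inverse c" M "\<lambda>z. c *\<^sub>R F z"] that by auto
    show ?thesis using \<mu> by (subst integrable_density) (use Fm in \<open>auto simp: sc\<close>)
  qed
  also have "\<dots> \<longleftrightarrow> integrable cylb f"
    unfolding leb[symmetric] integrable_cylb_iff[OF f] F_def[abs_def] ..
  finally show "integrable cylb (\<lambda>z. f (?S z)) \<longleftrightarrow> integrable cylb f" .
  have "(LINT z|cylb. f z) = (LINT z|lborel. F z)" unfolding integral_cylb[OF f] F_def ..
  also have "\<dots> = (LINT z|density (distr lborel borel ?S) (\<lambda>_. ennreal (\<mu> ^ CARD('n))). F z)"
    by (subst leb) (rule refl)
  also have "\<dots> = \<mu> ^ CARD('n) *\<^sub>R (LINT z|distr lborel borel ?S. F z)"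
    using \<mu> Fm by (subst integral_density) auto
  also have "(LINT z|distr lborel borel ?S. F z) = (LINT z|lborel. F (?S z))"
    by (rule integral_distr) (use Sm Fm in auto)
  also have "\<dots> = (LINT z|cylb. f (?S z))" unfolding integral_cylb[OF fS] FS ..
  finally show "(LINT z|cylb. f (?S z)) = (LINT z|cylb. f z) /\<^sub>R \<mu> ^ CARD('n)" using \<mu> by simp
qed

text \<open>Test functions are pulled back by the inverse dilation, which preserves
  \<open>cyl_test\<close> because the circle variable is untouched. Each \<open>x\<close>-derivative
  gains a factor \<open>\<mu>\<close>, the \<open>y\<close>-derivative none.\<close>

lemma cyl_data_rescale:
  fixes v :: "(real^'n) \<times> real \<Rightarrow> complex"
  assumes data: "cyl_data v G" and a: "0 < a" and \<mu>: "0 < \<mu>"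
  shows "cyl_data (\<lambda>z. a *\<^sub>R v (\<mu> *\<^sub>R fst z, snd z))
     (\<lambda>b z. (if b = (0, 1) then a else a * \<mu>) *\<^sub>R G b (\<mu> *\<^sub>R fst z, snd z))"
proof -
  let ?S = "\<lambda>z::(real^'n) \<times> real. (\<mu> *\<^sub>R fst z, snd z)"
  have Sm: "?S \<in> borel \<rightarrow>\<^sub>M borel" by (intro borel_measurable_continuous_onI continuous_intros)
  have L2: "(\<lambda>z. r *\<^sub>R f (?S z)) \<in> borel_measurable borel \<and> integrable cylb (\<lambda>z. (norm (r *\<^sub>R f (?S z)))\<^sup>2)"
    if f: "f \<in> borel_measurable borel" "integrable cylb (\<lambda>z. (norm (f z))\<^sup>2)" for f :: "(real^'n) \<times> real \<Rightarrow> complex" and r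
  proof -
    have fS: "(\<lambda>z. f (?S z)) \<in> borel_measurable borel" by (rule measurable_compose[OF Sm f(1)])
    have "(\<lambda>z. (norm (f z))\<^sup>2) \<in> borel_measurable borel" using f(1) by measurable
    from cylb_rescale(1)[OF this \<mu>] f(2) have "integrable cylb (\<lambda>z. (norm (f (?S z)))\<^sup>2)" by simp
    then show ?thesis using fS by (simp add: power_mult_distrib)
  qed
  have wd: "is_weak_deriv cylb cyl_test b (\<lambda>z. a *\<^sub>R v (?S z)) (\<lambda>z. (if b = (0, 1) then a else a * \<mu>) *\<^sub>R G b (?S z))"
    if b: "b \<in> Basis" for b
    unfolding is_weak_deriv_def
  proof
    fix \<phi> :: "(real^'n) \<times> real \<Rightarrow> real" assume \<phi>: "\<phi> \<in> cyl_test"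
    have sm: "smooth \<phi>" using \<phi> by (simp add: cyl_test_def)
    define S' where "S' z = ((1 / \<mu>) *\<^sub>R fst z, snd z)" for z :: "(real^'n) \<times> real"
    define \<eta> where "\<eta> z = \<phi> (S' z)" for z
    have lin: "linear S'" unfolding S'_def by (auto intro!: linearI simp: scaleR_add_right)
    have S'S: "S' (?S z) = z" for z using \<mu> by (cases z) (simp add: S'_def)
    have sm\<eta>: "smooth \<eta>" unfolding \<eta>_def by (rule smooth_compose_linear[OF lin sm])
    have "bounded {x. \<exists>y. \<eta> (x, y) \<noteq> 0}"
    proof (rule bounded_subset)
      have "bounded {x. \<exists>y. \<phi> (x, y) \<noteq> 0}" using \<phi> by (simp add: cyl_test_def)
      then show "bounded ((*\<^sub>R) \<mu> ` {x. \<exists>y. \<phi> (x, y) \<noteq> 0})" by (rule bounded_scaling)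
      show "{x. \<exists>y. \<eta> (x, y) \<noteq> 0} \<subseteq> (*\<^sub>R) \<mu> ` {x. \<exists>y. \<phi> (x, y) \<noteq> 0}"
      proof clarify
        fix x y assume "\<eta> (x, y) \<noteq> 0"
        then show "x \<in> (*\<^sub>R) \<mu> ` {x. \<exists>y. \<phi> (x, y) \<noteq> 0}"
          using \<mu> by (intro image_eqI[of _ _ "(1 / \<mu>) *\<^sub>R x"]) (auto simp: \<eta>_def S'_def)
      qed
    qed
    then have \<eta>: "\<eta> \<in> cyl_test"
      using \<phi> sm\<eta> unfolding cyl_test_def y_periodic_def by (auto simp: \<eta>_def S'_def)
    define q where "q = (if b = (0, 1) then 1 else \<mu>)"
    have q: "0 < q" using \<mu> by (simp add: q_def)
    have D: "frechet_derivative \<phi> (at z) b = q * frechet_derivative \<eta> (at (?S z)) b" for z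
    proof -
      have blS': "(S' has_derivative S') (at (?S z))" by (rule linear_imp_has_derivative[OF lin])
      have "(\<eta> has_derivative (\<lambda>h. frechet_derivative \<phi> (at z) (S' h))) (at (?S z))"
        unfolding \<eta>_def[abs_def]
        by (rule has_derivative_compose[OF blS']) (use smooth_has_derivative[OF sm, of z] S'S[of z] in simp)
      from frechet_derivative_at[OF this]
      have 1: "frechet_derivative \<eta> (at (?S z)) b = frechet_derivative \<phi> (at z) (S' b)" by metis
      have 2: "S' b = (1 / q) *\<^sub>R b" using b \<mu> by (auto simp: S'_def q_def Basis_cyl)
      have "linear (frechet_derivative \<phi> (at z))" using smooth_has_derivative[OF sm] by (meson has_derivative_linear)
      then have "frechet_derivative \<phi> (at z) ((1 / q) *\<^sub>R b) = (1 / q) *\<^sub>R frechet_derivative \<phi> (at z) b"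
        by (rule linear_scale)
      then show ?thesis using q unfolding 1 2 by simp
    qed
    have vm: "v \<in> borel_measurable borel" and Gm: "G b \<in> borel_measurable borel" using data b by (auto simp: cyl_data_def)
    have \<eta>m: "\<eta> \<in> borel_measurable borel" "(\<lambda>z. frechet_derivative \<eta> (at z) b) \<in> borel_measurable borel"
      using borel_measurable_smooth[OF sm\<eta>] b by auto
    have m1: "(\<lambda>z. v z * of_real (frechet_derivative \<eta> (at z) b)) \<in> borel_measurable borel"
      and m2: "(\<lambda>z. G b z * of_real (\<eta> z)) \<in> borel_measurable borel"
      using vm Gm \<eta>m by measurable
    have "(LINT z|cylb. a *\<^sub>R v (?S z) * of_real (frechet_derivative \<phi> (at z) b))
      = (LINT z|cylb. (a * q) *\<^sub>R (v (?S z) * of_real (frechet_derivative \<eta> (at (?S z)) b)))"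
      unfolding D by (simp add: scaleR_conv_of_real mult_ac)
    also have "\<dots> = (a * q) *\<^sub>R ((LINT z|cylb. v z * of_real (frechet_derivative \<eta> (at z) b)) /\<^sub>R \<mu> ^ CARD('n))"
      using cylb_rescale(2)[OF m1 \<mu>] by simp
    also have "(LINT z|cylb. v z * of_real (frechet_derivative \<eta> (at z) b)) = - (LINT z|cylb. G b z * of_real (\<eta> z))"
      using data b \<eta> by (auto simp: cyl_data_def is_weak_deriv_def)
    also have "(a * q) *\<^sub>R ((- (LINT z|cylb. G b z * of_real (\<eta> z))) /\<^sub>R \<mu> ^ CARD('n))
       = - ((a * q) *\<^sub>R (LINT z|cylb. G b (?S z) * of_real (\<eta> (?S z))))"
      using cylb_rescale(2)[OF m2 \<mu>] by simp
    also have "\<dots> = - (LINT z|cylb. (a * q) *\<^sub>R G b (?S z) * of_real (\<phi> z))"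
      unfolding \<eta>_def S'S by simp
    also have "a * q = (if b = (0, 1) then a else a * \<mu>)" by (simp add: q_def)
    finally show "(LINT z|cylb. a *\<^sub>R v (?S z) * of_real (frechet_derivative \<phi> (at z) b))
       = - (LINT z|cylb. (if b = (0, 1) then a else a * \<mu>) *\<^sub>R G b (?S z) * of_real (\<phi> z))" .
  qed
  have vG: "v \<in> borel_measurable borel" "integrable cylb (\<lambda>z. (norm (v z))\<^sup>2)"
    "b \<in> Basis \<Longrightarrow> G b \<in> borel_measurable borel" "b \<in> Basis \<Longrightarrow> integrable cylb (\<lambda>z. (norm (G b z))\<^sup>2)" for b
    using data by (auto simp: cyl_data_def)
  show ?thesis unfolding cyl_data_def
    by (intro conjI ballI L2[OF vG(1,2), THEN conjunct1] L2[OF vG(1,2), THEN conjunct2] wd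
        L2[OF vG(3,4), THEN conjunct1] L2[OF vG(3,4), THEN conjunct2])
qed

lemma sqint_rescale:
  fixes f :: "(real^'n) \<times> real \<Rightarrow> complex"
  assumes "f \<in> borel_measurable borel" "0 < \<mu>"
  shows "sqint cylb (\<lambda>z. r *\<^sub>R f (\<mu> *\<^sub>R fst z, snd z)) = r\<^sup>2 * sqint cylb f / \<mu> ^ CARD('n)"
proof -
  have "(\<lambda>z. (norm (f z))\<^sup>2) \<in> borel_measurable borel" using assms(1) by measurable
  from cylb_rescale(2)[OF this assms(2)] show ?thesis
    by (simp add: sqint_def power_mult_distrib divide_inverse mult_ac)
qed

text \<open>Difference quotients along \<open>b\<close> integrate to zero by translation invariance,
  and the mean value theorem dominates them by a multiple of the indicator of a fixed ball.\<close>

lemma integral_frechet_derivative_compact_support: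
  fixes f :: "real^'n \<Rightarrow> real"
  assumes f: "f \<in> eu_test" and b: "b \<in> Basis"
  shows "(LINT x|lborel. frechet_derivative f (at x) b) = 0"
proof -
  have sm: "smooth f" and bd: "bounded {x. f x \<noteq> 0}" using f by (auto simp: eu_test_def)
  let ?D = "\<lambda>x. frechet_derivative f (at x) b"
  obtain r where r: "\<And>x. f x \<noteq> 0 \<Longrightarrow> norm x \<le> r" using bd by (auto simp: bounded_iff)
  have cK: "compact (cball (0 :: real^'n) (r + 2))" by simp
  obtain C where C: "\<And>x. x \<in> cball 0 (r + 2) \<Longrightarrow> \<bar>?D x\<bar> \<le> C"
    by (rule continuous_bound_compact[OF cK smooth_continuous_on[OF smooth_frechet_derivative[OF sm b]]]) blast
  have deriv: "((\<lambda>t. f (x + t *\<^sub>R b)) has_real_derivative ?D (x + t *\<^sub>R b)) (at t)" for x t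
  proof -
    have c: "((\<lambda>t. x + t *\<^sub>R b) has_derivative (\<lambda>t. t *\<^sub>R b)) (at t)" by (auto intro!: derivative_eq_intros)
    have "((\<lambda>t. f (x + t *\<^sub>R b)) has_derivative (\<lambda>h. frechet_derivative f (at (x + t *\<^sub>R b)) (h *\<^sub>R b))) (at t)"
      by (rule has_derivative_compose[OF c smooth_has_derivative[OF sm]])
    moreover have "linear (frechet_derivative f (at (x + t *\<^sub>R b)))"
      using smooth_has_derivative[OF sm] by (meson has_derivative_linear)
    then have "(\<lambda>h. frechet_derivative f (at (x + t *\<^sub>R b)) (h *\<^sub>R b)) = (\<lambda>h. ?D (x + t *\<^sub>R b) * h)"
      by (auto simp: linear_scale mult.commute)
    ultimately show ?thesis unfolding has_field_derivative_def by simp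
  qed
  define h where "h n = inverse (real (Suc n))" for n
  have h: "0 < h n" "h n \<le> 1" for n by (auto simp: h_def divide_simps)
  define q where "q n x = (f (x + h n *\<^sub>R b) - f x) / h n" for n x
  have fm: "f \<in> borel_measurable borel" "?D \<in> borel_measurable borel" using borel_measurable_smooth[OF sm] b by auto
  have nb: "norm b = 1" using b by simp
  have q_bd: "\<bar>q n x\<bar> \<le> C * indicator (cball 0 (r + 1)) x" for n x
  proof (cases "x \<in> cball 0 (r + 1)")
    case True
    obtain t where t: "0 < t" "t < h n" "f (x + h n *\<^sub>R b) - f (x + 0 *\<^sub>R b) = (h n - 0) * ?D (x + t *\<^sub>R b)"
      using MVT2[OF h(1)[of n], of "\<lambda>t. f (x + t *\<^sub>R b)" "\<lambda>t. ?D (x + t *\<^sub>R b)"] deriv by blast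
    have "q n x = ?D (x + t *\<^sub>R b)" using t h(1)[of n] by (simp add: q_def)
    moreover have "norm (x + t *\<^sub>R b) \<le> norm x + \<bar>t\<bar> * norm b" by (metis norm_scaleR norm_triangle_ineq)
    then have "x + t *\<^sub>R b \<in> cball 0 (r + 2)" using True t h(2)[of n] nb by simp
    ultimately show ?thesis using C True by simp
  next
    case False
    then have x: "r + 1 < norm x" by simp
    have "norm x \<le> norm (x + h n *\<^sub>R b) + norm (h n *\<^sub>R b)" by (metis add_diff_cancel_right' norm_triangle_ineq4)
    then have "r < norm (x + h n *\<^sub>R b)" using x h[of n] nb by simp
    then have "f (x + h n *\<^sub>R b) = 0" "f x = 0" using r[of "x + h n *\<^sub>R b"] r[of x] x by auto
    then show ?thesis using False by (simp add: q_def)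
  qed
  have "(\<lambda>n. LINT x|lborel. q n x) \<longlonglongrightarrow> (LINT x|lborel. ?D x)"
  proof (rule integral_dominated_convergence[where w = "\<lambda>x. C * indicator (cball 0 (r + 1)) x"])
    show "integrable lborel (\<lambda>x. C * indicator (cball (0 :: real^'n) (r + 1)) x)"
      using emeasure_bounded_finite[of "cball (0 :: real^'n) (r + 1)"] by (intro integrable_mult_right) auto
    show "AE x in lborel. (\<lambda>n. q n x) \<longlonglongrightarrow> ?D x"
    proof (rule AE_I2)
      fix x
      have "((\<lambda>t. (f (x + t *\<^sub>R b) - f x) / t) \<longlongrightarrow> ?D x) (at 0)"
        using deriv[of x 0] by (simp add: has_field_derivative_iff)
      moreover have "filterlim h (at 0) sequentially"
        unfolding filterlim_at using h(1) LIMSEQ_inverse_real_of_nat unfolding h_def by auto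
      ultimately show "(\<lambda>n. q n x) \<longlonglongrightarrow> ?D x" unfolding q_def by (rule filterlim_compose)
    qed
    show "AE x in lborel. norm (q n x) \<le> C * indicator (cball 0 (r + 1)) x" for n using q_bd by simp
  qed (use fm in \<open>auto simp: q_def\<close>)
  moreover have "(LINT x|lborel. q n x) = 0" for n
  proof -
    have if_: "integrable lborel f"
    proof -
      obtain C' where C': "\<And>x. x \<in> cball 0 r \<Longrightarrow> \<bar>f x\<bar> \<le> C'"
        by (rule continuous_bound_compact[OF compact_cball smooth_continuous_on[OF sm]]) blast
      have "integrable lborel (\<lambda>x. C' * indicator (cball (0 :: real^'n) r) x)"
        using emeasure_bounded_finite[of "cball (0 :: real^'n) r"] by (intro integrable_mult_right) auto
      then show ?thesis
      proof (rule Bochner_Integration.integrable_bound)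
        show "AE x in lborel. norm (f x) \<le> norm (C' * indicator (cball 0 r) x)"
        proof (rule AE_I2)
          fix x show "norm (f x) \<le> norm (C' * indicator (cball 0 r) x)"
            using C'[of x] r[of x] by (cases "f x = 0") auto
        qed
      qed (use fm in auto)
    qed
    have "integrable (distr lborel borel ((+) (h n *\<^sub>R b))) f" unfolding lborel_distr_plus by (rule if_)
    then have i2: "integrable lborel (\<lambda>x. f (h n *\<^sub>R b + x))"
      by (subst (asm) integrable_distr_eq) (use fm in auto)
    have "(LINT x|lborel. f (h n *\<^sub>R b + x)) = (LINT x|distr lborel borel ((+) (h n *\<^sub>R b)). f x)"
      by (rule integral_distr[symmetric]) (use fm in auto)
    also have "\<dots> = (LINT x|lborel. f x)" by (simp only: lborel_distr_plus)
    finally show ?thesis using if_ i2 by (simp add: q_def add.commute)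
  qed
  ultimately show ?thesis by (simp add: LIMSEQ_const_iff)
qed

text \<open>One nonzero competitor; rescaling it will show that the constraint sets are nonempty, so
  that their infima are meaningful.\<close>

lemma eu_data_bump:
  obtains u :: "real^'n \<Rightarrow> complex" and g where "eu_data u g" "0 < sqint lborel u"
proof -
  obtain \<psi> :: "nat \<Rightarrow> real \<Rightarrow> real" where \<psi>: "\<And>n. smooth (\<psi> n)" "\<And>n s. \<not> (0 < s \<and> s < 0 + 1) \<Longrightarrow> \<psi> n s = 0"
     "\<And>n s. 0 < s \<Longrightarrow> s < 0 + 1 \<Longrightarrow> 0 < \<psi> n s"
    by (rule interval_profile[OF zero_less_one, of 0]) blast
  define \<beta> :: "real^'n \<Rightarrow> real" where "\<beta> x = (\<Prod>b\<in>Basis. \<psi> 0 (x \<bullet> b))" for x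
  have lin: "linear (\<lambda>z. z \<bullet> b)" for b :: "real^'n" by (rule bounded_linear.linear) (rule bounded_linear_inner_left)
  have sm: "smooth \<beta>" unfolding \<beta>_def by (intro smooth_prod smooth_compose_linear[OF lin] \<psi>)
  have supp: "x \<in> cbox 0 One" if "\<beta> x \<noteq> 0" for x
  proof -
    have "\<forall>b\<in>Basis. \<psi> 0 (x \<bullet> b) \<noteq> 0" using that unfolding \<beta>_def by (metis finite_Basis prod_zero)
    then have "\<forall>b\<in>Basis. 0 < x \<bullet> b \<and> x \<bullet> b < 0 + 1" using \<psi>(2) by blast
    then show ?thesis by (auto simp: mem_box less_imp_le)
  qed
  have "bounded {x. \<beta> x \<noteq> 0}" by (rule bounded_subset[OF bounded_cbox]) (use supp in blast)
  then have \<beta>: "\<beta> \<in> eu_test" using sm by (simp add: eu_test_def)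
  define g where "g i x = complex_of_real (frechet_derivative \<beta> (at x) (axis i 1))" for i x
  have bi: "axis i 1 \<in> (Basis :: (real^'n) set)" for i by simp
  have m: "\<beta> \<in> borel_measurable borel" "(\<lambda>x. frechet_derivative \<beta> (at x) (axis i 1)) \<in> borel_measurable borel" for i
    using borel_measurable_smooth[OF sm] bi by auto
  have bsupp: "integrable lborel (\<lambda>x. (norm (complex_of_real (F x)))\<^sup>2)" "integrable lborel F"
    if F: "continuous_on UNIV F" "\<And>x. x \<notin> cbox 0 One \<Longrightarrow> F x = 0" for F :: "real^'n \<Rightarrow> real"
  proof -
    have "integrable lborel (\<lambda>x. indicator (cbox 0 One) x *\<^sub>R H x)" if "continuous_on UNIV H" for H :: "real^'n \<Rightarrow> real"
      by (rule borel_integrable_compact) (auto intro: continuous_on_subset[OF that])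
    from this[of "\<lambda>x. (F x)\<^sup>2"] this[of F] F(1)
    have "integrable lborel (\<lambda>x. indicator (cbox 0 One) x *\<^sub>R (F x)\<^sup>2)" "integrable lborel (\<lambda>x. indicator (cbox 0 One) x *\<^sub>R F x)"
      by (auto intro!: continuous_intros)
    moreover have "indicator (cbox 0 One) x *\<^sub>R (F x)\<^sup>2 = (norm (complex_of_real (F x)))\<^sup>2" "indicator (cbox 0 One) x *\<^sub>R F x = F x" for x
      using F(2)[of x] by (auto simp: indicator_def)
    ultimately show "integrable lborel (\<lambda>x. (norm (complex_of_real (F x)))\<^sup>2)" "integrable lborel F" by (simp_all only:)
  qed
  have gz: "frechet_derivative \<beta> (at x) (axis i 1) = 0" if "x \<notin> cbox 0 One" for x i
    by (rule frechet_derivative_zero_open[of "- cbox 0 One"]) (use that supp in auto)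
  have wd: "is_weak_deriv lborel eu_test (axis i 1) (\<lambda>x. of_real (\<beta> x)) (g i)" for i
    unfolding is_weak_deriv_def
  proof
    fix \<phi> :: "real^'n \<Rightarrow> real" assume \<phi>: "\<phi> \<in> eu_test"
    then have sm\<phi>: "smooth \<phi>" by (simp add: eu_test_def)
    let ?D = "\<lambda>f x. frechet_derivative f (at x) (axis i 1)"
    have "bounded {x. \<beta> x * \<phi> x \<noteq> 0}" by (rule bounded_subset[OF bounded_cbox]) (use supp in auto)
    then have t: "(\<lambda>x. \<beta> x * \<phi> x) \<in> eu_test" using smooth_mult[OF sm sm\<phi>] by (simp add: eu_test_def)
    have D: "?D (\<lambda>x. \<beta> x * \<phi> x) x = \<beta> x * ?D \<phi> x + ?D \<beta> x * \<phi> x" for x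
    proof -
      have "((\<lambda>x. \<beta> x * \<phi> x) has_derivative (\<lambda>h. \<beta> x * frechet_derivative \<phi> (at x) h + frechet_derivative \<beta> (at x) h * \<phi> x)) (at x)"
        by (rule has_derivative_mult[OF smooth_has_derivative[OF sm] smooth_has_derivative[OF sm\<phi>]])
      from frechet_derivative_at[OF this] show ?thesis by metis
    qed
    have c: "continuous_on UNIV \<beta>" "continuous_on UNIV \<phi>" "continuous_on UNIV (?D \<phi>)" "continuous_on UNIV (?D \<beta>)"
      using sm sm\<phi> smooth_frechet_derivative[OF sm bi] smooth_frechet_derivative[OF sm\<phi> bi] by (auto intro: smooth_continuous_on)
    have i: "integrable lborel (\<lambda>x. \<beta> x * ?D \<phi> x)" "integrable lborel (\<lambda>x. ?D \<beta> x * \<phi> x)"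
      by (rule bsupp(2); use c supp gz in \<open>auto intro!: continuous_intros\<close>)+
    have "(LINT x|lborel. \<beta> x * ?D \<phi> x + ?D \<beta> x * \<phi> x) = 0"
      using integral_frechet_derivative_compact_support[OF t bi, of i] unfolding D .
    then have "(LINT x|lborel. \<beta> x * ?D \<phi> x) = - (LINT x|lborel. ?D \<beta> x * \<phi> x)" using i by simp
    then have "complex_of_real (LINT x|lborel. \<beta> x * ?D \<phi> x) = - complex_of_real (LINT x|lborel. ?D \<beta> x * \<phi> x)" by simp
    then show "(LINT x|lborel. complex_of_real (\<beta> x) * of_real (?D \<phi> x)) = - (LINT x|lborel. g i x * of_real (\<phi> x))"
      unfolding g_def of_real_mult[symmetric] integral_complex_of_real .
  qed
  have data: "eu_data (\<lambda>x. of_real (\<beta> x)) g"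
    unfolding eu_data_def
  proof (intro conjI allI wd)
    show "(\<lambda>x. complex_of_real (\<beta> x)) \<in> borel_measurable borel" using m by measurable
    show "g i \<in> borel_measurable borel" for i unfolding g_def[abs_def] using m(2)[of i] by measurable
    show "integrable lborel (\<lambda>x. (norm (complex_of_real (\<beta> x)))\<^sup>2)"
      by (rule bsupp(1)) (use smooth_continuous_on[OF sm] supp in auto)
    show "integrable lborel (\<lambda>x. (norm (g i x))\<^sup>2)" for i
      unfolding g_def by (rule bsupp(1)) (use smooth_continuous_on[OF smooth_frechet_derivative[OF sm bi]] gz in auto)
  qed
  have "0 < sqint lborel (\<lambda>x. complex_of_real (\<beta> x))"
  proof (rule ccontr)
    assume "\<not> ?thesis"
    then have "(LINT x|lborel. (norm (complex_of_real (\<beta> x)))\<^sup>2) = 0"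
      using sqint_nonneg[of lborel "\<lambda>x. complex_of_real (\<beta> x)"] unfolding sqint_def by linarith
    then have "AE x in lborel. (norm (complex_of_real (\<beta> x)))\<^sup>2 = 0"
      by (subst (asm) integral_nonneg_eq_0_iff_AE) (use data in \<open>auto simp: eu_data_def\<close>)
    then have "AE x in lborel. x \<notin> box 0 (One :: real^'n)"
    proof eventually_elim
      case (elim x)
      have "\<beta> x \<noteq> 0" if "x \<in> box 0 One"
        unfolding \<beta>_def using that \<psi>(3)[where n = 0] by (fastforce simp: mem_box)
      then show ?case using elim by auto
    qed
    then have "emeasure lborel (box 0 (One :: real^'n)) = 0" by (subst (asm) AE_iff_measurable[OF _ refl]) auto
    then show False by (subst (asm) emeasure_lborel_box) auto
  qed
  then show ?thesis using that data by blast
qed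

section \<open>Borel representatives\<close>

text \<open>\<open>M\<close> is a completed measure and \<open>N\<close> its restriction to Borel sets. Every notion in the
  statement is invariant under passing to a Borel representative.\<close>

locale borel_representatives =
  fixes M N :: "'a::euclidean_space measure" and \<Phi> :: "('a \<Rightarrow> real) set"
  assumes idm: "(\<lambda>z. z) \<in> M \<rightarrow>\<^sub>M borel"
    and N: "N = distr M borel (\<lambda>z. z)"
    and AE_N: "\<And>P. (AE z in M. P z) \<longleftrightarrow> (AE z in N. P z)"
    and rep: "\<And>f :: 'a \<Rightarrow> complex. f \<in> borel_measurable M \<Longrightarrow> \<exists>g\<in>borel_measurable borel. AE z in M. f z = g z"
    and test: "\<And>\<phi>. \<phi> \<in> \<Phi> \<Longrightarrow> smooth \<phi>"
begin

lemma measurable_M: "f \<in> borel_measurable borel \<Longrightarrow> f \<in> borel_measurable M"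
  by (rule measurable_compose[OF idm])

lemma integral_N:
  fixes f :: "'a \<Rightarrow> 'b::{banach,second_countable_topology}"
  shows "f \<in> borel_measurable borel \<Longrightarrow> (LINT z|N. f z) = (LINT z|M. f z)"
  unfolding N by (rule integral_distr[OF idm])

lemma integrable_N:
  fixes f :: "'a \<Rightarrow> 'b::{banach,second_countable_topology}"
  shows "f \<in> borel_measurable borel \<Longrightarrow> integrable N f \<longleftrightarrow> integrable M f"
  unfolding N by (rule integrable_distr_eq[OF idm])

lemma integral_rep:
  fixes f g :: "'a \<Rightarrow> 'b::{banach,second_countable_topology}"
  assumes "f \<in> borel_measurable M" "g \<in> borel_measurable borel" "AE z in M. f z = g z"
  shows "(LINT z|M. f z) = (LINT z|N. g z)"
  unfolding integral_N[OF assms(2)]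
  by (rule Bochner_Integration.integral_cong_AE) (use assms measurable_M in auto)

lemma integrable_rep:
  fixes f g :: "'a \<Rightarrow> 'b::{banach,second_countable_topology}"
  assumes "f \<in> borel_measurable M" "g \<in> borel_measurable borel" "AE z in M. f z = g z"
  shows "integrable M f \<longleftrightarrow> integrable N g"
  unfolding integrable_N[OF assms(2)]
  by (rule integrable_cong_AE) (use assms measurable_M in auto)

lemma is_weak_deriv_rep:
  assumes m: "u \<in> borel_measurable M" "g \<in> borel_measurable M" "v \<in> borel_measurable borel" "G \<in> borel_measurable borel"
    and ae: "AE z in M. u z = v z" "AE z in M. g z = G z" and b: "b \<in> Basis"
  shows "is_weak_deriv M \<Phi> b u g \<longleftrightarrow> is_weak_deriv N \<Phi> b v G"
proof -
  have "(LINT z|M. u z * of_real (frechet_derivative \<phi> (at z) b)) = (LINT z|N. v z * of_real (frechet_derivative \<phi> (at z) b))"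
    "(LINT z|M. g z * of_real (\<phi> z)) = (LINT z|N. G z * of_real (\<phi> z))" if "\<phi> \<in> \<Phi>" for \<phi>
  proof -
    note bm = borel_measurable_smooth[OF test[OF that]]
    have [measurable]: "\<phi> \<in> borel_measurable M" "(\<lambda>z. frechet_derivative \<phi> (at z) b) \<in> borel_measurable M"
      using bm b measurable_M by blast+
    have [measurable]: "\<phi> \<in> borel_measurable borel" "(\<lambda>z. frechet_derivative \<phi> (at z) b) \<in> borel_measurable borel"
      using bm b by blast+
    note [measurable] = m
    show "(LINT z|M. u z * of_real (frechet_derivative \<phi> (at z) b)) = (LINT z|N. v z * of_real (frechet_derivative \<phi> (at z) b))"
      by (rule integral_rep) (measurable, use ae(1) in \<open>auto elim: eventually_mono\<close>)
    show "(LINT z|M. g z * of_real (\<phi> z)) = (LINT z|N. G z * of_real (\<phi> z))"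
      by (rule integral_rep) (measurable, use ae(2) in \<open>auto elim: eventually_mono\<close>)
  qed
  then show ?thesis by (auto simp: is_weak_deriv_def)
qed

lemma L2_rep:
  assumes "u \<in> L2_space M"
  obtains v where "v \<in> borel_measurable borel" "integrable N (\<lambda>z. (norm (v z))\<^sup>2)" "AE z in M. u z = v z"
proof -
  have u: "u \<in> borel_measurable M" "integrable M (\<lambda>z. (norm (u z))\<^sup>2)" using assms by (auto simp: L2_space_def)
  obtain v where v: "v \<in> borel_measurable borel" "AE z in M. u z = v z" using rep[OF u(1)] by blast
  have "integrable M (\<lambda>z. (norm (u z))\<^sup>2) \<longleftrightarrow> integrable N (\<lambda>z. (norm (v z))\<^sup>2)"
    by (rule integrable_rep) (use u v in \<open>auto elim: eventually_mono\<close>)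
  with u v that show ?thesis by blast
qed

lemma L2_of_rep:
  assumes "v \<in> borel_measurable borel" "integrable N (\<lambda>z. (norm (v z))\<^sup>2)"
  shows "v \<in> L2_space M"
  using assms measurable_M by (subst (asm) integrable_N) (auto simp: L2_space_def)

end

lemma complex_lebesgue_ex_borel:
  fixes f :: "'a::euclidean_space \<Rightarrow> complex"
  assumes "f \<in> borel_measurable lebesgue"
  shows "\<exists>g\<in>borel_measurable borel. AE z in lborel. f z = g z"
proof -
  have "(\<lambda>z. Re (f z)) \<in> borel_measurable (completion lborel)" "(\<lambda>z. Im (f z)) \<in> borel_measurable (completion lborel)"
    using assms by measurable
  then obtain g1 g2 where g: "g1 \<in> borel_measurable lborel" "AE z in lborel. Re (f z) = g1 z"
    "g2 \<in> borel_measurable lborel" "AE z in lborel. Im (f z) = g2 z"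
    using completion_ex_borel_measurable_real by metis
  show ?thesis
  proof (rule bexI[of _ "\<lambda>z. Complex (g1 z) (g2 z)"])
    show "AE z in lborel. f z = Complex (g1 z) (g2 z)"
      using g(2,4) by eventually_elim (simp add: complex_eq_iff)
    have "(\<lambda>z. of_real (g1 z) + \<i> * of_real (g2 z)) \<in> borel_measurable borel" using g by measurable
    then show "(\<lambda>z. Complex (g1 z) (g2 z)) \<in> borel_measurable borel" by (simp add: Complex_eq)
  qed
qed

interpretation eu: borel_representatives "lebesgue :: (real^'n) measure" lborel eu_test
proof
  show idm: "(\<lambda>z. z) \<in> (lebesgue :: (real^'n) measure) \<rightarrow>\<^sub>M borel"
    by (rule measurable_completion) simp
  show "lborel = distr (lebesgue :: (real^'n) measure) borel (\<lambda>z. z)"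
    by (rule measure_eqI) (auto simp: emeasure_distr[OF idm])
  show "(AE z in lebesgue. P z) \<longleftrightarrow> (AE z in lborel. P z)" for P :: "real^'n \<Rightarrow> bool"
    by (rule AE_completion_iff)
  show "\<exists>g\<in>borel_measurable borel. AE z in lebesgue. f z = g z" if "f \<in> borel_measurable lebesgue" for f :: "real^'n \<Rightarrow> complex"
    using complex_lebesgue_ex_borel[OF that] by (simp add: AE_completion_iff)
qed (simp add: eu_test_def)

lemma strip_lebesgue: "(strip :: ((real^'n) \<times> real) set) \<in> sets lebesgue"
  using strip_borel by (metis sets_completionI_sets sets_lborel)

lemma AE_cyl_iff: "(AE z in cyl. P z) \<longleftrightarrow> (AE z in cylb. P z)"
  unfolding cyl_def AE_cylb_iff using strip_lebesgue
  by (subst AE_restrict_space_iff) (auto simp: AE_completion_iff)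

interpretation cy: borel_representatives "cyl :: ((real^'n) \<times> real) measure" cylb cyl_test
proof
  show idm: "(\<lambda>z. z) \<in> (cyl :: ((real^'n) \<times> real) measure) \<rightarrow>\<^sub>M borel"
    unfolding cyl_def by (intro measurable_restrict_space1 measurable_completion) simp
  show "cylb = distr (cyl :: ((real^'n) \<times> real) measure) borel (\<lambda>z. z)"
  proof (rule measure_eqI)
    fix A :: "((real^'n) \<times> real) set" assume "A \<in> sets cylb"
    then have A: "A \<in> sets borel" by (simp add: sets_cylb)
    have "emeasure (distr (cyl :: ((real^'n) \<times> real) measure) borel (\<lambda>z. z)) A = emeasure cyl (A \<inter> strip)"
      by (subst emeasure_distr[OF idm A]) (simp add: cyl_def space_restrict_space Int_commute)
    also have "\<dots> = emeasure lebesgue (A \<inter> strip)"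
      unfolding cyl_def by (rule emeasure_restrict_space) (use strip_lebesgue in auto)
    also have "\<dots> = emeasure lborel (A \<inter> strip)" using A strip_borel by simp
    also have "\<dots> = emeasure cylb A"
    proof -
      have "emeasure cylb A = (\<integral>\<^sup>+z. indicator strip z * indicator A z \<partial>lborel)"
        unfolding cylb_eq_density by (rule emeasure_density) (use A borel_measurable_indicator[OF strip_borel] in auto)
      also have "\<dots> = (\<integral>\<^sup>+z. indicator (A \<inter> strip) z \<partial>lborel)"
        by (rule nn_integral_cong) (auto simp: indicator_def)
      also have "\<dots> = emeasure lborel (A \<inter> strip)"
        by (rule nn_integral_indicator) (use A strip_borel in auto)
      finally show ?thesis ..
    qed
    finally show "emeasure cylb A = emeasure (distr cyl borel (\<lambda>z. z)) A" ..
  qed (simp add: sets_cylb)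
  show "(AE z in cyl. P z) \<longleftrightarrow> (AE z in cylb. P z)" for P :: "(real^'n) \<times> real \<Rightarrow> bool"
    by (rule AE_cyl_iff)
  show "\<exists>g\<in>borel_measurable borel. AE z in cyl. f z = g z" if f: "f \<in> borel_measurable cyl" for f :: "(real^'n) \<times> real \<Rightarrow> complex"
  proof -
    have "(\<lambda>z. if z \<in> strip then f z else 0) \<in> borel_measurable lebesgue"
      using f unfolding cyl_def by (rule borel_measurable_if_I[OF _ strip_lebesgue])
    then obtain g where g: "g \<in> borel_measurable borel" "AE z in lborel. (if z \<in> strip then f z else 0) = g z"
      using complex_lebesgue_ex_borel by blast
    have "AE z in cyl. f z = g z"
      unfolding AE_cyl_iff AE_cylb_iff using g(2) by eventually_elim auto
    then show ?thesis using g(1) by blast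
  qed
qed (simp add: cyl_test_def)

section \<open>The functionals of the statement computed from Borel data\<close>

lemma Lp_norm_2: "(Lp_norm M 2 u)\<^sup>2 = (LINT z|M. (norm (u z))\<^sup>2)"
proof -
  have "0 \<le> (LINT z|M. (norm (u z))\<^sup>2)" by (rule integral_nonneg_AE) auto
  moreover have "norm (u z) powr 2 = (norm (u z))\<^sup>2" for z by (simp add: powr_numeral)
  ultimately show ?thesis unfolding Lp_norm_def
    by (simp add: powr_half_sqrt)
qed

lemma Lp_norm_powr: "0 < p \<Longrightarrow> Lp_norm M p u powr p = (LINT z|M. norm (u z) powr p)"
proof -
  have "0 \<le> (LINT z|M. norm (u z) powr p)" by (rule integral_nonneg_AE) auto
  then show "0 < p \<Longrightarrow> ?thesis" by (simp add: Lp_norm_def powr_powr)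
qed

lemma norm_vec_square: "(norm (v :: complex^'n))\<^sup>2 = (\<Sum>i\<in>UNIV. (norm (v $ i))\<^sup>2)"
  by (simp add: norm_vec_def L2_set_def sum_nonneg)

text \<open>The link between the functionals of the statement, built on derivatives selected by
  \<open>SOME\<close>, and Borel data to which Fubini applies.\<close>

definition represents :: "((real^'n) \<times> real \<Rightarrow> complex) \<Rightarrow> ((real^'n) \<times> real \<Rightarrow> complex) \<Rightarrow>
    ((real^'n) \<times> real \<Rightarrow> (real^'n) \<times> real \<Rightarrow> complex) \<Rightarrow> bool" where
  "represents u v G \<longleftrightarrow> u \<in> cyl_H1 \<and> cyl_data v G \<and> (AE z in cyl. u z = v z) \<and>
     (\<forall>b\<in>Basis. AE z in cyl. cyl_deriv b u z = G b z)"

lemma cyl_deriv_in_L2: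
  assumes "u \<in> cyl_H1" "b \<in> Basis"
  shows "cyl_deriv b u \<in> cyl_L2 \<and> is_weak_deriv cyl cyl_test b u (cyl_deriv b u)"
proof -
  have "\<exists>g. g \<in> cyl_L2 \<and> is_weak_deriv cyl cyl_test b u g" using assms by (auto simp: cyl_H1_def)
  then show ?thesis unfolding cyl_deriv_def by (rule someI_ex)
qed

lemma cyl_H1_represented:
  assumes u: "u \<in> cyl_H1"
  obtains v G where "represents u v G"
proof -
  have uL: "u \<in> L2_space cyl" using u by (auto simp: cyl_H1_def cyl_L2_def)
  obtain v where v: "v \<in> borel_measurable borel" "integrable cylb (\<lambda>z. (norm (v z))\<^sup>2)" "AE z in cyl. u z = v z"
    by (rule cy.L2_rep[OF uL])
  have "\<forall>b\<in>Basis. \<exists>g. g \<in> borel_measurable borel \<and> integrable cylb (\<lambda>z. (norm (g z))\<^sup>2) \<and> (AE z in cyl. cyl_deriv b u z = g z)"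
  proof
    fix b :: "(real^'a) \<times> real" assume b: "b \<in> Basis"
    have "cyl_deriv b u \<in> L2_space cyl" using cyl_deriv_in_L2[OF u b] by (auto simp: cyl_L2_def)
    then show "\<exists>g. g \<in> borel_measurable borel \<and> integrable cylb (\<lambda>z. (norm (g z))\<^sup>2) \<and> (AE z in cyl. cyl_deriv b u z = g z)"
      by (rule cy.L2_rep) blast
  qed
  then obtain G where "\<forall>b\<in>Basis. G b \<in> borel_measurable borel \<and> integrable cylb (\<lambda>z. (norm (G b z))\<^sup>2) \<and> (AE z in cyl. cyl_deriv b u z = G b z)"
    by (rule bchoice[THEN exE])
  note G = bspec[OF this]
  have "is_weak_deriv cylb cyl_test b v (G b)" if b: "b \<in> Basis" for b
  proof -
    have D: "cyl_deriv b u \<in> borel_measurable cyl" "is_weak_deriv cyl cyl_test b u (cyl_deriv b u)"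
      using cyl_deriv_in_L2[OF u b] by (auto simp: cyl_L2_def L2_space_def)
    have um: "u \<in> borel_measurable cyl" using uL by (simp add: L2_space_def)
    show ?thesis
      by (rule cy.is_weak_deriv_rep[THEN iffD1, OF um D(1) v(1) _ v(3) _ b D(2)]) (use G[OF b] in auto)
  qed
  then have "cyl_data v G" unfolding cyl_data_def using v G by auto
  then have "represents u v G" unfolding represents_def using u v(3) G by auto
  then show ?thesis by (rule that)
qed

text \<open>Membership in \<open>cyl_H1\<close> demands genuine periodicity, whereas Borel data are
  controlled on one period only. Values change off the strip alone, which is a null set for
  \<open>cyl\<close>.\<close>

definition periodize :: "('a \<times> real \<Rightarrow> 'b) \<Rightarrow> 'a \<times> real \<Rightarrow> 'b" where
  "periodize f z = f (fst z, snd z - 2 * pi * of_int \<lfloor>snd z / (2 * pi)\<rfloor>)"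

lemma periodize_strip: "z \<in> strip \<Longrightarrow> periodize f z = f z"
proof -
  assume "z \<in> strip"
  then have "0 \<le> snd z / (2 * pi)" "snd z / (2 * pi) < 1" by auto
  then have "\<lfloor>snd z / (2 * pi)\<rfloor> = 0" by linarith
  then show ?thesis by (simp add: periodize_def)
qed

lemma y_periodic_periodize: "y_periodic (periodize f)"
proof -
  have "\<lfloor>(y + 2 * pi) / (2 * pi)\<rfloor> = \<lfloor>y / (2 * pi)\<rfloor> + 1" for y :: real
    by (simp add: add_divide_distrib)
  then show ?thesis by (simp add: y_periodic_def periodize_def algebra_simps)
qed

lemma borel_measurable_periodize:
  fixes f :: "'a::euclidean_space \<times> real \<Rightarrow> complex"
  assumes "f \<in> borel_measurable borel"
  shows "periodize f \<in> borel_measurable borel"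
proof -
  have "(\<lambda>z::'a \<times> real. (fst z, snd z - 2 * pi * real_of_int \<lfloor>snd z / (2 * pi)\<rfloor>)) \<in> borel \<rightarrow>\<^sub>M (borel \<Otimes>\<^sub>M borel)"
    using fst_snd_borel by (intro measurable_Pair) measurable
  then have "(\<lambda>z::'a \<times> real. (fst z, snd z - 2 * pi * real_of_int \<lfloor>snd z / (2 * pi)\<rfloor>)) \<in> borel \<rightarrow>\<^sub>M borel"
    by (simp only: borel_prod)
  from measurable_compose[OF this assms] show ?thesis by (simp add: periodize_def[abs_def])
qed

lemma weak_deriv_unique:
  fixes v g g' :: "(real^'n) \<times> real \<Rightarrow> complex"
  assumes b: "b \<in> Basis"
    and g: "g \<in> borel_measurable borel" "integrable cylb (\<lambda>z. (norm (g z))\<^sup>2)" "is_weak_deriv cylb cyl_test b v g"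
    and g': "g' \<in> borel_measurable borel" "integrable cylb (\<lambda>z. (norm (g' z))\<^sup>2)" "is_weak_deriv cylb cyl_test b v g'"
  shows "AE z in cylb. g z = g' z"
proof -
  have "AE z in cylb. g z - g' z = 0"
  proof (rule cyl_test_orthogonal_imp_zero)
    show "(\<lambda>z. g z - g' z) \<in> borel_measurable borel" using g g' by measurable
    show "integrable cylb (\<lambda>z. (norm (g z - g' z))\<^sup>2)"
      by (rule square_integrable_diff) (use g g' in \<open>auto simp: measurable_cylb_iff\<close>)
    fix \<phi> :: "(real^'n) \<times> real \<Rightarrow> real" assume \<phi>: "\<phi> \<in> cyl_test"
    have "(LINT z|cylb. g z * of_real (\<phi> z)) = (LINT z|cylb. g' z * of_real (\<phi> z))"
      using trans[OF sym[OF bspec[OF g(3)[unfolded is_weak_deriv_def] \<phi>]] bspec[OF g'(3)[unfolded is_weak_deriv_def] \<phi>]]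
      unfolding neg_equal_iff_equal .
    then show "(LINT z|cylb. (g z - g' z) * of_real (\<phi> z)) = 0"
      using cyl_test_integrable(1)[OF \<phi> b g(1,2)] cyl_test_integrable(1)[OF \<phi> b g'(1,2)]
      by (simp add: left_diff_distrib)
  qed
  then show ?thesis by simp
qed

text \<open>Uniqueness of weak derivatives identifies the \<open>SOME\<close> choice with the given
  \<open>G\<close> almost everywhere.\<close>

lemma cyl_data_represents:
  fixes v :: "(real^'n) \<times> real \<Rightarrow> complex"
  assumes data: "cyl_data v G"
  obtains u where "represents u v G"
proof -
  define u where "u = periodize v"
  have AEp: "AE z in cyl. periodize f z = f z" for f :: "(real^'n) \<times> real \<Rightarrow> complex"
    unfolding AE_cyl_iff AE_cylb_iff by (rule AE_I2) (use periodize_strip in blast)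
  have pL2: "periodize f \<in> cyl_L2" if "f \<in> borel_measurable borel" "integrable cylb (\<lambda>z. (norm (f z))\<^sup>2)" for f :: "(real^'n) \<times> real \<Rightarrow> complex"
  proof -
    have m: "periodize f \<in> borel_measurable borel" by (rule borel_measurable_periodize[OF that(1)])
    have "integrable cyl (\<lambda>z. (norm (periodize f z))\<^sup>2) \<longleftrightarrow> integrable cylb (\<lambda>z. (norm (f z))\<^sup>2)"
      by (rule cy.integrable_rep) (use cy.measurable_M[OF m] that(1) AEp[of f] in \<open>auto elim: eventually_mono\<close>)
    then show ?thesis using that(2) cy.measurable_M[OF m] y_periodic_periodize by (auto simp: cyl_L2_def L2_space_def)
  qed
  have v: "v \<in> borel_measurable borel" "integrable cylb (\<lambda>z. (norm (v z))\<^sup>2)"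
    and G: "\<And>b. b \<in> Basis \<Longrightarrow> G b \<in> borel_measurable borel" "\<And>b. b \<in> Basis \<Longrightarrow> integrable cylb (\<lambda>z. (norm (G b z))\<^sup>2)"
      "\<And>b. b \<in> Basis \<Longrightarrow> is_weak_deriv cylb cyl_test b v (G b)"
    using data by (auto simp: cyl_data_def)
  have um: "u \<in> borel_measurable cyl" unfolding u_def by (rule cy.measurable_M[OF borel_measurable_periodize[OF v(1)]])
  have uv: "AE z in cyl. u z = v z" unfolding u_def by (rule AEp)
  have "is_weak_deriv cyl cyl_test b u (periodize (G b))" if b: "b \<in> Basis" for b
    by (subst cy.is_weak_deriv_rep[OF um cy.measurable_M[OF borel_measurable_periodize[OF G(1)[OF b]]] v(1) G(1)[OF b] uv AEp b])
       (rule G(3)[OF b])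
  then have uH: "u \<in> cyl_H1" unfolding cyl_H1_def using pL2[OF v] pL2[OF G(1,2)] u_def by blast
  have "AE z in cyl. cyl_deriv b u z = G b z" if b: "b \<in> Basis" for b
  proof -
    have D: "cyl_deriv b u \<in> L2_space cyl" "cyl_deriv b u \<in> borel_measurable cyl" "is_weak_deriv cyl cyl_test b u (cyl_deriv b u)"
      using cyl_deriv_in_L2[OF uH b] by (auto simp: cyl_L2_def L2_space_def)
    obtain g where g: "g \<in> borel_measurable borel" "integrable cylb (\<lambda>z. (norm (g z))\<^sup>2)" "AE z in cyl. cyl_deriv b u z = g z"
      by (rule cy.L2_rep[OF D(1)])
    have "is_weak_deriv cylb cyl_test b v g"
      by (rule cy.is_weak_deriv_rep[THEN iffD1, OF um D(2) v(1) g(1) uv g(3) b D(3)])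
    from weak_deriv_unique[OF b g(1,2) this G(1)[OF b] G(2)[OF b] G(3)[OF b]]
    have "AE z in cyl. g z = G b z" unfolding AE_cyl_iff .
    with g(3) show ?thesis by eventually_elim simp
  qed
  then show ?thesis using that uH uv data unfolding represents_def by blast
qed

lemma represents_values:
  fixes u v :: "(real^'n) \<times> real \<Rightarrow> complex"
  assumes R: "represents u v G" and p: "0 < p"
  shows "cyl_M u = sqint cylb v"
    and "(Lp_norm cyl 2 (cyl_grad_x u))\<^sup>2 = gradsq G"
    and "(Lp_norm cyl 2 (cyl_grad u))\<^sup>2 = gradsq G + sqint cylb (G (0, 1))"
    and "Lp_norm cyl p u powr p = (LINT z|cylb. norm (v z) powr p)"
proof -
  have uH: "u \<in> cyl_H1" and data: "cyl_data v G" and uv: "AE z in cyl. u z = v z"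
    and D: "\<And>b. b \<in> Basis \<Longrightarrow> AE z in cyl. cyl_deriv b u z = G b z"
    using R by (auto simp: represents_def)
  have um: "u \<in> borel_measurable cyl" using uH by (auto simp: cyl_H1_def cyl_L2_def L2_space_def)
  have Dm: "cyl_deriv b u \<in> borel_measurable cyl" if "b \<in> Basis" for b
    using cyl_deriv_in_L2[OF uH that] by (auto simp: cyl_L2_def L2_space_def)
  have v: "v \<in> borel_measurable borel" and G: "\<And>b. b \<in> Basis \<Longrightarrow> G b \<in> borel_measurable borel"
     and G2: "\<And>b. b \<in> Basis \<Longrightarrow> integrable cylb (\<lambda>z. (norm (G b z))\<^sup>2)"
    using data by (auto simp: cyl_data_def)
  have e: "(0, 1) \<in> (Basis :: ((real^'n) \<times> real) set)" and bi: "(axis i 1, 0) \<in> (Basis :: ((real^'n) \<times> real) set)" for i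
    by (simp_all add: Basis_cyl)
  show "cyl_M u = sqint cylb v"
    unfolding cyl_M_def Lp_norm_2 sqint_def
    by (rule cy.integral_rep) (use um v uv in \<open>auto elim: eventually_mono\<close>)
  show "Lp_norm cyl p u powr p = (LINT z|cylb. norm (v z) powr p)"
    unfolding Lp_norm_powr[OF p]
    by (rule cy.integral_rep) (use um v uv in \<open>auto elim: eventually_mono\<close>)
  have AEi: "AE z in cyl. \<forall>i. cyl_deriv (axis i 1, 0) u z = G (axis i 1, 0) z"
    using D[OF bi] by (simp add: AE_all_countable)
  have "(Lp_norm cyl 2 (cyl_grad_x u))\<^sup>2 = (LINT z|cylb. (\<Sum>i\<in>UNIV. (norm (G (axis i 1, 0) z))\<^sup>2))"
    unfolding Lp_norm_2 norm_vec_square cyl_grad_x_def vec_lambda_beta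
  proof (rule cy.integral_rep)
    show "(\<lambda>z. \<Sum>i\<in>UNIV. (norm (cyl_deriv (axis i 1, 0) u z))\<^sup>2) \<in> borel_measurable cyl"
      using Dm[OF bi] by measurable
    show "(\<lambda>z. \<Sum>i\<in>UNIV. (norm (G (axis i 1, 0) z))\<^sup>2) \<in> borel_measurable borel"
      using G[OF bi] by measurable
  qed (use AEi in \<open>auto elim: eventually_mono\<close>)
  also have "\<dots> = gradsq G"
    unfolding gradsq_def sqint_def by (rule Bochner_Integration.integral_sum) (rule G2[OF bi])
  finally show "(Lp_norm cyl 2 (cyl_grad_x u))\<^sup>2 = gradsq G" .
  have "(Lp_norm cyl 2 (cyl_grad u))\<^sup>2 = (LINT z|cylb. (\<Sum>i\<in>UNIV. (norm (G (axis i 1, 0) z))\<^sup>2) + (norm (G (0, 1) z))\<^sup>2)"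
    unfolding Lp_norm_2 cyl_grad_def norm_Pair cyl_deriv_y_def
  proof (subst real_sqrt_pow2, force, unfold norm_vec_square cyl_grad_x_def vec_lambda_beta, rule cy.integral_rep)
    show "(\<lambda>z. (\<Sum>i\<in>UNIV. (norm (cyl_deriv (axis i 1, 0) u z))\<^sup>2) + (norm (cyl_deriv (0, 1) u z))\<^sup>2) \<in> borel_measurable cyl"
      using Dm[OF bi] Dm[OF e] by measurable
    show "(\<lambda>z. (\<Sum>i\<in>UNIV. (norm (G (axis i 1, 0) z))\<^sup>2) + (norm (G (0, 1) z))\<^sup>2) \<in> borel_measurable borel"
      using G[OF bi] G[OF e] by measurable
    show "AE z in cyl. (\<Sum>i\<in>UNIV. (norm (cyl_deriv (axis i 1, 0) u z))\<^sup>2) + (norm (cyl_deriv (0, 1) u z))\<^sup>2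
       = (\<Sum>i\<in>UNIV. (norm (G (axis i 1, 0) z))\<^sup>2) + (norm (G (0, 1) z))\<^sup>2"
      using AEi D[OF e] by eventually_elim simp
  qed
  also have "\<dots> = gradsq G + sqint cylb (G (0, 1))"
    unfolding gradsq_def sqint_def
    by (subst Bochner_Integration.integral_add) (auto intro!: G2[OF bi] G2[OF e] Bochner_Integration.integral_sum)
  finally show "(Lp_norm cyl 2 (cyl_grad u))\<^sup>2 = gradsq G + sqint cylb (G (0, 1))" .
qed

section \<open>The same dictionary on Euclidean space\<close>

definition eu_represents :: "(real^'n \<Rightarrow> complex) \<Rightarrow> (real^'n \<Rightarrow> complex) \<Rightarrow> ('n \<Rightarrow> real^'n \<Rightarrow> complex) \<Rightarrow> bool" where
  "eu_represents u v g \<longleftrightarrow> u \<in> eu_H1 \<and> eu_data v g \<and> (AE x in lebesgue. u x = v x) \<and>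
     (\<forall>i. AE x in lebesgue. eu_deriv (axis i 1) u x = g i x)"

lemma Basis_vec_eq: "(Basis :: (real^'n) set) = range (\<lambda>i. axis i 1)"
  by (auto simp: Basis_vec_def)

lemma eu_deriv_in_L2:
  assumes "u \<in> eu_H1" "b \<in> Basis"
  shows "eu_deriv b u \<in> L2_space lebesgue \<and> is_weak_deriv lebesgue eu_test b u (eu_deriv b u)"
proof -
  have "\<exists>g. g \<in> L2_space lebesgue \<and> is_weak_deriv lebesgue eu_test b u g" using assms by (auto simp: eu_H1_def)
  then show ?thesis unfolding eu_deriv_def by (rule someI_ex)
qed

lemma eu_H1_represented:
  fixes u :: "real^'n \<Rightarrow> complex"
  assumes u: "u \<in> eu_H1"
  obtains v g where "eu_represents u v g"
proof -
  have uL: "u \<in> L2_space lebesgue" using u by (auto simp: eu_H1_def)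
  obtain v where v: "v \<in> borel_measurable borel" "integrable lborel (\<lambda>z. (norm (v z))\<^sup>2)" "AE z in lebesgue. u z = v z"
    by (rule eu.L2_rep[OF uL])
  have bi: "axis i 1 \<in> (Basis :: (real^'n) set)" for i by simp
  have "\<forall>i. \<exists>g. g \<in> borel_measurable borel \<and> integrable lborel (\<lambda>z. (norm (g z))\<^sup>2) \<and> (AE z in lebesgue. eu_deriv (axis i 1) u z = g z)"
  proof
    fix i
    have "eu_deriv (axis i 1) u \<in> L2_space lebesgue" using eu_deriv_in_L2[OF u bi] by blast
    then show "\<exists>g. g \<in> borel_measurable borel \<and> integrable lborel (\<lambda>z. (norm (g z))\<^sup>2) \<and> (AE z in lebesgue. eu_deriv (axis i 1) u z = g z)"
      by (rule eu.L2_rep) blast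
  qed
  then obtain g where "\<forall>i. g i \<in> borel_measurable borel \<and> integrable lborel (\<lambda>z. (norm (g i z))\<^sup>2) \<and> (AE z in lebesgue. eu_deriv (axis i 1) u z = g i z)"
    by (rule choice[THEN exE])
  note g = spec[OF this]
  have "is_weak_deriv lborel eu_test (axis i 1) v (g i)" for i
  proof -
    have D: "eu_deriv (axis i 1) u \<in> borel_measurable lebesgue" "is_weak_deriv lebesgue eu_test (axis i 1) u (eu_deriv (axis i 1) u)"
      using eu_deriv_in_L2[OF u bi] by (auto simp: L2_space_def)
    have um: "u \<in> borel_measurable lebesgue" using uL by (simp add: L2_space_def)
    show ?thesis
      by (rule eu.is_weak_deriv_rep[THEN iffD1, OF um D(1) v(1) _ v(3) _ bi D(2)]) (use g[of i] in auto)
  qed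
  then have "eu_data v g" unfolding eu_data_def using v g by auto
  then have "eu_represents u v g" unfolding eu_represents_def using u v(3) g by auto
  then show ?thesis by (rule that)
qed

text \<open>The difference is lifted to the cylinder; testing slice by slice shows it orthogonal to
  all of \<open>cyl_test\<close>, hence zero there. Since the circle has positive measure, the
  conclusion descends to almost every \<open>x\<close>.\<close>

lemma eu_weak_deriv_unique:
  fixes v g g' :: "real^'n \<Rightarrow> complex"
  assumes g: "g \<in> borel_measurable borel" "integrable lborel (\<lambda>z. (norm (g z))\<^sup>2)" "is_weak_deriv lborel eu_test (axis i 1) v g"
    and g': "g' \<in> borel_measurable borel" "integrable lborel (\<lambda>z. (norm (g' z))\<^sup>2)" "is_weak_deriv lborel eu_test (axis i 1) v g'"
  shows "AE z in lborel. g z = g' z"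
proof -
  let ?f = "\<lambda>z::(real^'n) \<times> real. g (fst z) - g' (fst z)"
  have b: "(axis i 1, 0) \<in> (Basis :: ((real^'n) \<times> real) set)" by (simp add: Basis_cyl)
  have L: "(\<lambda>z::(real^'n) \<times> real. h (fst z)) \<in> borel_measurable borel" "integrable cylb (\<lambda>z. (norm (h (fst z)))\<^sup>2)"
    if "h \<in> borel_measurable borel" "integrable lborel (\<lambda>z. (norm (h z))\<^sup>2)" for h :: "real^'n \<Rightarrow> complex"
    using tensor_L2(1,2)[OF that, of "\<lambda>_. 1"] by simp_all
  have m: "?f \<in> borel_measurable borel" using L(1)[OF g(1,2)] L(1)[OF g'(1,2)] by measurable
  have i: "integrable cylb (\<lambda>z. (norm (?f z))\<^sup>2)"
    by (rule square_integrable_diff) (use L[OF g(1,2)] L[OF g'(1,2)] in \<open>auto simp: measurable_cylb_iff\<close>)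
  have "AE z in cylb. ?f z = 0"
  proof (rule cyl_test_orthogonal_imp_zero[OF m i])
    fix \<phi> :: "(real^'n) \<times> real \<Rightarrow> real" assume \<phi>: "\<phi> \<in> cyl_test"
    have int: "integrable cylb (\<lambda>z. g (fst z) * of_real (\<phi> z))" "integrable cylb (\<lambda>z. g' (fst z) * of_real (\<phi> z))"
      using cyl_test_integrable(1)[OF \<phi> b] L[OF g(1,2)] L[OF g'(1,2)] by blast+
    have swap: "(LINT z|cylb. f z) = (LINT y|circle_measure. LINT x|lborel. f (x, y))" if "integrable cylb f" for f :: "(real^'n) \<times> real \<Rightarrow> complex"
      using cyl_pair.integral_snd[of "\<lambda>x y. f (x, y)"] that by (simp add: cylb_def)
    have "(LINT x|lborel. g x * of_real (\<phi> (x, y))) = (LINT x|lborel. g' x * of_real (\<phi> (x, y)))" for y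
      using trans[OF sym[OF bspec[OF g(3)[unfolded is_weak_deriv_def] cyl_test_slice(1)[OF \<phi>]]] bspec[OF g'(3)[unfolded is_weak_deriv_def] cyl_test_slice(1)[OF \<phi>]]]
      unfolding neg_equal_iff_equal .
    then have "(LINT z|cylb. g (fst z) * of_real (\<phi> z)) = (LINT z|cylb. g' (fst z) * of_real (\<phi> z))"
      unfolding swap[OF int(1)] swap[OF int(2)] by simp
    then show "(LINT z|cylb. ?f z * of_real (\<phi> z)) = 0"
      using int by (simp add: left_diff_distrib)
  qed
  then have "AE x in lborel. AE y in circle_measure. g x - g' x = 0"
    unfolding cylb_def by (drule_tac cyl_pair.AE_pair) simp
  then show ?thesis
  proof eventually_elim
    case (elim x)
    show ?case
    proof (rule ccontr)
      assume "g x \<noteq> g' x"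
      then have "AE y in circle_measure. False" using elim by simp
      then show False using emeasure_circle_measure by (simp add: eventually_False ae_filter_eq_bot_iff)
    qed
  qed
qed

lemma eu_data_represents:
  fixes v :: "real^'n \<Rightarrow> complex"
  assumes data: "eu_data v g"
  shows "eu_represents v v g"
proof -
  have v: "v \<in> borel_measurable borel" "integrable lborel (\<lambda>z. (norm (v z))\<^sup>2)"
    and g: "g i \<in> borel_measurable borel" "integrable lborel (\<lambda>z. (norm (g i z))\<^sup>2)" "is_weak_deriv lborel eu_test (axis i 1) v (g i)" for i
    using data by (auto simp: eu_data_def)
  have bi: "axis i 1 \<in> (Basis :: (real^'n) set)" for i by simp
  have vm: "v \<in> borel_measurable lebesgue" by (rule eu.measurable_M[OF v(1)])
  have "is_weak_deriv lebesgue eu_test (axis i 1) v (g i)" for i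
    by (subst eu.is_weak_deriv_rep[OF vm eu.measurable_M[OF g(1)] v(1) g(1) _ _ bi]) (auto intro: g(3))
  then have vH: "v \<in> eu_H1" unfolding eu_H1_def Basis_vec_eq using eu.L2_of_rep[OF v] eu.L2_of_rep[OF g(1,2)] by blast
  have "AE z in lebesgue. eu_deriv (axis i 1) v z = g i z" for i
  proof -
    have D: "eu_deriv (axis i 1) v \<in> L2_space lebesgue" "eu_deriv (axis i 1) v \<in> borel_measurable lebesgue" "is_weak_deriv lebesgue eu_test (axis i 1) v (eu_deriv (axis i 1) v)"
      using eu_deriv_in_L2[OF vH bi] by (auto simp: L2_space_def)
    obtain h where h: "h \<in> borel_measurable borel" "integrable lborel (\<lambda>z. (norm (h z))\<^sup>2)" "AE z in lebesgue. eu_deriv (axis i 1) v z = h z"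
      by (rule eu.L2_rep[OF D(1)])
    have "is_weak_deriv lborel eu_test (axis i 1) v h"
      by (rule eu.is_weak_deriv_rep[THEN iffD1, OF vm D(2) v(1) h(1) _ h(3) bi D(3)]) simp
    from eu_weak_deriv_unique[OF h(1,2) this g]
    have "AE z in lebesgue. h z = g i z" unfolding AE_completion_iff .
    with h(3) show ?thesis by eventually_elim simp
  qed
  then show ?thesis unfolding eu_represents_def using vH data by simp
qed

lemma eu_represents_values:
  fixes u v :: "real^'n \<Rightarrow> complex"
  assumes R: "eu_represents u v g" and p: "0 < p"
  shows "eu_M u = sqint lborel v"
    and "(Lp_norm lebesgue 2 (eu_grad u))\<^sup>2 = (\<Sum>i\<in>UNIV. sqint lborel (g i))"
    and "Lp_norm lebesgue p u powr p = (LINT z|lborel. norm (v z) powr p)"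
proof -
  have uH: "u \<in> eu_H1" and data: "eu_data v g" and uv: "AE z in lebesgue. u z = v z"
    and D: "\<And>i. AE z in lebesgue. eu_deriv (axis i 1) u z = g i z"
    using R by (auto simp: eu_represents_def)
  have um: "u \<in> borel_measurable lebesgue" using uH by (auto simp: eu_H1_def L2_space_def)
  have bi: "axis i 1 \<in> (Basis :: (real^'n) set)" for i by simp
  have Dm: "eu_deriv (axis i 1) u \<in> borel_measurable lebesgue" for i
    using eu_deriv_in_L2[OF uH bi] by (auto simp: L2_space_def)
  have v: "v \<in> borel_measurable borel" and g: "\<And>i. g i \<in> borel_measurable borel"
     and g2: "\<And>i. integrable lborel (\<lambda>z. (norm (g i z))\<^sup>2)"
    using data by (auto simp: eu_data_def)
  show "eu_M u = sqint lborel v"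
    unfolding eu_M_def Lp_norm_2 sqint_def
    by (rule eu.integral_rep) (use um v uv in \<open>auto elim: eventually_mono\<close>)
  show "Lp_norm lebesgue p u powr p = (LINT z|lborel. norm (v z) powr p)"
    unfolding Lp_norm_powr[OF p]
    by (rule eu.integral_rep) (use um v uv in \<open>auto elim: eventually_mono\<close>)
  have AEi: "AE z in lebesgue. \<forall>i. eu_deriv (axis i 1) u z = g i z"
    unfolding AE_all_countable using D by blast
  have "(Lp_norm lebesgue 2 (eu_grad u))\<^sup>2 = (LINT z|lborel. (\<Sum>i\<in>UNIV. (norm (g i z))\<^sup>2))"
    unfolding Lp_norm_2 norm_vec_square eu_grad_def vec_lambda_beta
  proof (rule eu.integral_rep)
    show "(\<lambda>z. \<Sum>i\<in>UNIV. (norm (eu_deriv (axis i 1) u z))\<^sup>2) \<in> borel_measurable lebesgue"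
      using Dm by measurable
    show "(\<lambda>z. \<Sum>i\<in>UNIV. (norm (g i z))\<^sup>2) \<in> borel_measurable borel"
      using g by measurable
  qed (use AEi in \<open>auto elim: eventually_mono\<close>)
  also have "\<dots> = (\<Sum>i\<in>UNIV. sqint lborel (g i))"
    unfolding sqint_def by (rule Bochner_Integration.integral_sum) (rule g2)
  finally show "(Lp_norm lebesgue 2 (eu_grad u))\<^sup>2 = (\<Sum>i\<in>UNIV. sqint lborel (g i))" .
qed

section \<open>Splitting off the average over the circle\<close>

text \<open>A concave power lies below its tangent at 1; this is the weighted arithmetic-geometric
  mean inequality for \<open>x\<close> and 1.\<close>

lemma powr_le_tangent:
  fixes x s :: real
  assumes "0 \<le> x" "0 \<le> s" "s \<le> 1"
  shows "x powr s \<le> 1 + s * (x - 1)"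
proof (cases "x = 0")
  case False
  then have "x powr s * 1 powr (1 - s) \<le> s * x + (1 - s) * 1"
    by (intro Youngs_inequality_0) (use assms in auto)
  then show ?thesis by (simp add: algebra_simps)
qed (use assms in auto)

text \<open>An expansion with exact linear term, since that is the term which will integrate to
  zero. If \<open>b\<close> is at most as large as \<open>a\<close>, writing
  \<open>|a + b|^2 = |a|^2 (1 + r)\<close> splits the power into \<open>1 + r\<close> and the
  \<open>s\<close>-th power of \<open>(1 + r)^2\<close>, and the tangent bound for
  \<open>s \<le> 1\<close> leaves a cubic in \<open>r\<close>. If \<open>b\<close> is larger,
  everything is at most a multiple of \<open>|b|^p\<close>. Later \<open>s = 1 / (d - 1)\<close>,
  whence \<open>p \<le> 6\<close>.\<close>

lemma norm_add_powr_le: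
  fixes a b :: complex and s p :: real
  assumes s: "0 < s" "s \<le> 1" and p: "p = 2 + 4 * s"
  shows "norm (a + b) powr p \<le> norm a powr p + p * (norm a powr (p - 2) * Re (cnj a * b))
     + 100 * (norm a powr (p - 2) * (norm b)\<^sup>2 + norm b powr p)"
proof (cases "a = 0")
  case False
  define A where "A = norm a"
  have A: "0 < A" using False by (simp add: A_def)
  define \<beta> where "\<beta> = norm b / A"
  define \<rho> where "\<rho> = Re (cnj a * b) / A\<^sup>2"
  have \<beta>: "0 \<le> \<beta>" "norm b = \<beta> * A" using A by (auto simp: \<beta>_def)
  have R: "Re (cnj a * b) = \<rho> * A\<^sup>2" using A by (simp add: \<rho>_def)
  have "\<bar>Re (cnj a * b)\<bar> \<le> norm (cnj a * b)" by (rule abs_Re_le_cmod)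
  also have "\<dots> = \<beta> * A\<^sup>2" using \<beta> by (simp add: norm_mult A_def power2_eq_square)
  finally have "\<bar>\<rho>\<bar> * A\<^sup>2 \<le> \<beta> * A\<^sup>2" unfolding R by (simp add: abs_mult)
  then have \<rho>: "\<bar>\<rho>\<bar> \<le> \<beta>" using A by simp
  have Ap: "A powr p = A powr (p - 2) * A\<^sup>2" using A by (simp add: powr_diff powr_numeral)
  show ?thesis
  proof (cases "\<beta> \<le> 1")
    case True
    define r where "r = 2 * \<rho> + \<beta>\<^sup>2"
    have sq: "(norm (a + b))\<^sup>2 = A\<^sup>2 * (1 + r)"
    proof -
      have "(norm (a + b))\<^sup>2 = (norm a)\<^sup>2 + (norm b)\<^sup>2 + 2 * Re (cnj a * b)"
        by (simp add: cmod_power2) (simp add: power2_eq_square algebra_simps)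
      then show ?thesis unfolding R \<beta>(2) by (simp add: r_def A_def power_mult_distrib algebra_simps)
    qed
    then have "0 \<le> A\<^sup>2 * (1 + r)" by (metis zero_le_power2)
    then have r1: "0 \<le> 1 + r" using A by (simp add: zero_le_mult_iff)
    have "norm (a + b) powr p = ((norm (a + b))\<^sup>2) powr (p / 2)"
      by (simp add: powr_powr flip: powr_numeral)
    also have "\<dots> = A powr p * (1 + r) powr (p / 2)"
      unfolding sq using A r1 by (simp add: powr_mult powr_powr flip: powr_numeral)
    also have "(1 + r) powr (p / 2) = (1 + r) * ((1 + r)\<^sup>2) powr s"
    proof (cases "1 + r = 0")
      case False
      then have "0 < 1 + r" using r1 by simp
      have "p / 2 = 1 + 2 * s" using p by simp
      then have "(1 + r) powr (p / 2) = (1 + r) powr 1 * (1 + r) powr (2 * s)" by (simp only: powr_add)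
      also have "(1 + r) powr (2 * s) = ((1 + r)\<^sup>2) powr s"
        using \<open>0 < 1 + r\<close> by (simp add: powr_powr flip: powr_numeral)
      finally show ?thesis using \<open>0 < 1 + r\<close> by simp
    qed (simp only: powr_zero_eq_one mult_zero_left powr_0)
    also have "A powr p * ((1 + r) * ((1 + r)\<^sup>2) powr s) \<le> A powr p * (1 + p * \<rho> + 100 * \<beta>\<^sup>2)"
    proof (intro mult_left_mono)
      have "((1 + r)\<^sup>2) powr s \<le> 1 + s * ((1 + r)\<^sup>2 - 1)" by (rule powr_le_tangent) (use s in auto)
      then have "(1 + r) * ((1 + r)\<^sup>2) powr s \<le> (1 + r) * (1 + s * ((1 + r)\<^sup>2 - 1))" using r1 by (intro mult_left_mono)
      also have "\<dots> = 1 + (1 + 2 * s) * r + s * (3 * r\<^sup>2 + r * r\<^sup>2)"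
        by (simp add: power2_eq_square algebra_simps)
      also have "\<dots> \<le> 1 + (1 + 2 * s) * r + 1 * (54 * \<beta>\<^sup>2)"
      proof -
        have b2: "\<beta>\<^sup>2 \<le> \<beta>" using True \<beta> by (simp add: power2_eq_square mult_left_le)
        have "\<bar>r\<bar> \<le> 3 * \<beta>" unfolding r_def using \<rho> b2 zero_le_power2[of \<beta>] by linarith
        then have r3: "\<bar>r\<bar> \<le> 3" "r\<^sup>2 \<le> 9 * \<beta>\<^sup>2" using True \<beta> abs_le_square_iff[of r "3 * \<beta>"] by (auto simp: power_mult_distrib)
        have "r * r\<^sup>2 \<le> 3 * r\<^sup>2" using r3 by (intro mult_right_mono) auto
        then have "3 * r\<^sup>2 + r * r\<^sup>2 \<le> 54 * \<beta>\<^sup>2" using r3 by linarith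
        then have "s * (3 * r\<^sup>2 + r * r\<^sup>2) \<le> s * (54 * \<beta>\<^sup>2)" using s by (intro mult_left_mono) auto
        also have "\<dots> \<le> 1 * (54 * \<beta>\<^sup>2)" using s by (intro mult_right_mono) auto
        finally show ?thesis by simp
      qed
      \<comment> \<open>\<open>(1 + 2 * s) * (2 * \<rho>) = p * \<rho>\<close> is the exact linear
        term; what remains is at most
        \<open>3 * \<beta>\<^sup>2 + 54 * \<beta>\<^sup>2\<close>.\<close>
      also have "\<dots> \<le> 1 + p * \<rho> + 100 * \<beta>\<^sup>2"
      proof -
        define q where "q = \<beta>\<^sup>2"
        have q: "0 \<le> q" by (simp add: q_def)
        have "2 * s * q \<le> 2 * q" using s q by (simp add: mult_left_le_one_le)
        then show ?thesis unfolding r_def p q_def[symmetric] using q by (simp add: algebra_simps)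
      qed
      finally show "(1 + r) * ((1 + r)\<^sup>2) powr s \<le> 1 + p * \<rho> + 100 * \<beta>\<^sup>2" .
    qed simp
    also have "\<dots> = A powr p + p * (A powr (p - 2) * Re (cnj a * b)) + 100 * (A powr (p - 2) * (norm b)\<^sup>2)"
      unfolding Ap R \<beta>(2) by (simp add: power_mult_distrib algebra_simps)
    also have "\<dots> \<le> A powr p + p * (A powr (p - 2) * Re (cnj a * b)) + 100 * (A powr (p - 2) * (norm b)\<^sup>2 + norm b powr p)"
      by simp
    finally show ?thesis unfolding A_def .
  next
    case False
    then have Ab: "A \<le> norm b" using A \<beta> by simp
    \<comment> \<open>Crude bounds suffice here: at most 64 multiples of \<open>|b|^p\<close> from
      the power and, because \<open>p \<le> 6\<close>, at most 6 from the linear term.\<close>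
    have "norm (a + b) \<le> 2 * norm b" using norm_triangle_ineq[of a b] Ab by (simp add: A_def)
    then have "norm (a + b) powr p \<le> (2 * norm b) powr p" using p s by (intro powr_mono2) auto
    also have "\<dots> = 2 powr p * norm b powr p" by (simp add: powr_mult)
    also have "\<dots> \<le> 2 powr 6 * norm b powr p" using p s by (intro mult_right_mono powr_mono) auto
    also have "\<dots> = 64 * norm b powr p" by simp
    finally have 1: "norm (a + b) powr p \<le> 64 * norm b powr p" .
    have "\<bar>A powr (p - 2) * Re (cnj a * b)\<bar> = A powr (p - 2) * \<bar>Re (cnj a * b)\<bar>" by (simp add: abs_mult)
    also have "\<dots> \<le> A powr (p - 2) * (A * norm b)"
      using abs_Re_le_cmod[of "cnj a * b"] by (intro mult_left_mono) (auto simp: norm_mult A_def)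
    also have "\<dots> \<le> norm b powr (p - 2) * (norm b * norm b)"
      using Ab A p s by (intro mult_mono powr_mono2) auto
    also have "\<dots> = norm b powr p"
      using Ab A by (simp add: powr_diff powr_numeral power2_eq_square)
    finally have 2: "\<bar>A powr (p - 2) * Re (cnj a * b)\<bar> \<le> norm b powr p" .
    have "p * \<bar>A powr (p - 2) * Re (cnj a * b)\<bar> \<le> 6 * norm b powr p"
      using 2 p s by (intro mult_mono) auto
    moreover have "- (p * (A powr (p - 2) * Re (cnj a * b))) \<le> p * \<bar>A powr (p - 2) * Re (cnj a * b)\<bar>"
    proof -
      have "- (p * t) \<le> p * \<bar>t\<bar>" for t using p s by (metis abs_ge_minus_self mult_left_mono mult_minus_right add_nonneg_nonneg less_imp_le zero_le_numeral mult_nonneg_nonneg)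
      then show ?thesis .
    qed
    moreover have "0 \<le> A powr p" "0 \<le> A powr (p - 2) * (norm b)\<^sup>2" "0 \<le> norm b powr p" by auto
    ultimately have "norm (a + b) powr p \<le> A powr p + p * (A powr (p - 2) * Re (cnj a * b)) + 100 * (A powr (p - 2) * (norm b)\<^sup>2 + norm b powr p)"
      using 1 by argo
    then show ?thesis unfolding A_def .
  qed
qed simp

text \<open>Young's inequality after dividing by both integrals. The same pointwise bound with both
  divisors equal to 1 gives integrability.\<close>

lemma Holder_powr_square:
  fixes f g :: "'a \<Rightarrow> real"
  assumes [measurable]: "f \<in> borel_measurable M" "g \<in> borel_measurable M"
    and nn: "\<And>z. 0 \<le> f z" "\<And>z. 0 \<le> g z" and p: "2 < p"
    and int: "integrable M (\<lambda>z. f z powr p)" "integrable M (\<lambda>z. g z powr p)"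
  shows "integrable M (\<lambda>z. f z powr (p - 2) * (g z)\<^sup>2)"
    and "(LINT z|M. f z powr (p - 2) * (g z)\<^sup>2)
      \<le> (LINT z|M. f z powr p) powr ((p - 2) / p) * (LINT z|M. g z powr p) powr (2 / p)"
proof -
  define \<alpha> where "\<alpha> = (p - 2) / p"
  have ab: "0 < \<alpha>" "0 < 2 / p" "\<alpha> + 2 / p = 1" using p by (auto simp: \<alpha>_def field_simps)
  have young: "a powr (p - 2) * b\<^sup>2 \<le> I powr \<alpha> * J powr (2 / p) * (\<alpha> * (a powr p / I) + 2 / p * (b powr p / J))"
    if "0 \<le> a" "0 \<le> b" "0 < I" "0 < J" for a b I J :: real
  proof (cases "a = 0 \<or> b = 0")
    case True
    then show ?thesis using that ab p by (auto intro!: mult_nonneg_nonneg add_nonneg_nonneg)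
  next
    case False
    then have ab0: "0 < a" "0 < b" using that by auto
    have "(a powr p / I) powr \<alpha> * (b powr p / J) powr (2 / p) \<le> \<alpha> * (a powr p / I) + 2 / p * (b powr p / J)"
      by (rule Youngs_inequality_0) (use ab ab0 that in auto)
    moreover have "(a powr p / I) powr \<alpha> * (b powr p / J) powr (2 / p) = a powr (p - 2) * b\<^sup>2 / (I powr \<alpha> * J powr (2 / p))"
    proof -
      have "(b powr p) powr (2 / p) = b\<^sup>2" using p ab0 by (simp add: powr_powr powr_numeral)
      moreover have "(a powr p) powr \<alpha> = a powr (p - 2)" using p by (simp add: powr_powr \<alpha>_def)
      ultimately show ?thesis using that ab0 by (simp add: powr_divide)
    qed
    ultimately show ?thesis using that by (simp add: pos_divide_le_eq mult.commute)
  qed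
  let ?H = "\<lambda>z. f z powr (p - 2) * (g z)\<^sup>2"
  show i: "integrable M ?H"
  proof (rule Bochner_Integration.integrable_bound)
    show "integrable M (\<lambda>z. \<alpha> * f z powr p + 2 / p * g z powr p)" using int by auto
    show "AE z in M. norm (?H z) \<le> norm (\<alpha> * f z powr p + 2 / p * g z powr p)"
    proof (rule AE_I2)
      fix z
      have "0 \<le> \<alpha> * f z powr p + 2 / p * g z powr p" using ab by (intro add_nonneg_nonneg mult_nonneg_nonneg) auto
      then show "norm (?H z) \<le> norm (\<alpha> * f z powr p + 2 / p * g z powr p)"
        using young[OF nn(1)[of z] nn(2)[of z], of 1 1] by (simp add: abs_of_nonneg)
    qed
  qed measurable
  let ?I = "LINT z|M. f z powr p" and ?J = "LINT z|M. g z powr p"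
  have I0: "0 \<le> ?I" "0 \<le> ?J" by (auto intro!: integral_nonneg_AE)
  show "(LINT z|M. ?H z) \<le> ?I powr ((p - 2) / p) * ?J powr (2 / p)"
  proof (cases "?I = 0 \<or> ?J = 0")
    case True
    have "AE z in M. ?H z = 0"
      using True
    proof
      assume "?I = 0"
      then have "AE z in M. f z powr p = 0" by (subst (asm) integral_nonneg_eq_0_iff_AE[OF int(1)]) auto
      then show ?thesis by eventually_elim auto
    next
      assume "?J = 0"
      then have "AE z in M. g z powr p = 0" by (subst (asm) integral_nonneg_eq_0_iff_AE[OF int(2)]) auto
      then show ?thesis by eventually_elim auto
    qed
    then have "(LINT z|M. ?H z) = 0" by (rule integral_eq_zero_AE)
    then show ?thesis by simp
  next
    case False
    then have pos: "0 < ?I" "0 < ?J" using I0 by (simp_all add: less_le)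
    have "(LINT z|M. ?H z) \<le> (LINT z|M. ?I powr \<alpha> * ?J powr (2 / p) * (\<alpha> * (f z powr p / ?I) + 2 / p * (g z powr p / ?J)))"
      by (rule integral_mono[OF i]) (use int young nn pos in auto)
    also have "\<dots> = ?I powr \<alpha> * ?J powr (2 / p) * (\<alpha> + 2 / p)"
      using int pos by simp
    finally show ?thesis unfolding ab(3) unfolding \<alpha>_def by simp
  qed
qed

text \<open>The attainable values of mass, gradient and potential. From here on functions matter
  only through the tuples they attain, so the variational problem becomes one about sets of real
  tuples.\<close>

definition eu_vals :: "'n::finite itself \<Rightarrow> real \<Rightarrow> real \<Rightarrow> real \<Rightarrow> bool" where
  "eu_vals n M A P \<longleftrightarrow> (\<exists>u (g :: 'n \<Rightarrow> real^'n \<Rightarrow> complex). eu_data u g \<and> M = sqint lborel u \<and>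
     A = (\<Sum>i\<in>UNIV. sqint lborel (g i)) \<and> P = (LINT x|lborel. norm (u x) powr pexp n))"

definition cyl_vals :: "'n::finite itself \<Rightarrow> real \<Rightarrow> real \<Rightarrow> real \<Rightarrow> real \<Rightarrow> bool" where
  "cyl_vals n M A B P \<longleftrightarrow> (\<exists>v (G :: (real^'n) \<times> real \<Rightarrow> (real^'n) \<times> real \<Rightarrow> complex). cyl_data v G \<and> M = sqint cylb v \<and>
     A = gradsq G \<and> B = sqint cylb (G (0, 1)) \<and> P = (LINT z|cylb. norm (v z) powr pexp n))"

lemma pexp_gt_2: "2 \<le> CARD('n::finite) \<Longrightarrow> 2 < pexp TYPE('n)"
  by (simp add: pexp_def nl_exponent_def)

lemma cyl_vals_rescale:
  assumes V: "cyl_vals TYPE('n::finite) M A B P" and a: "0 < a" and l: "0 < l"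
  shows "cyl_vals TYPE('n) (a\<^sup>2 * M / l ^ CARD('n)) (a\<^sup>2 * l\<^sup>2 * A / l ^ CARD('n)) (a\<^sup>2 * B / l ^ CARD('n))
     (a powr pexp TYPE('n) * P / l ^ CARD('n))"
proof -
  obtain v and G :: "(real^'n) \<times> real \<Rightarrow> (real^'n) \<times> real \<Rightarrow> complex" where data: "cyl_data v G"
    and vals: "M = sqint cylb v" "A = gradsq G" "B = sqint cylb (G (0, 1))" "P = (LINT z|cylb. norm (v z) powr pexp TYPE('n))"
    using V by (auto simp: cyl_vals_def)
  have v: "v \<in> borel_measurable borel" and G: "\<And>b. b \<in> Basis \<Longrightarrow> G b \<in> borel_measurable borel"
    using data by (auto simp: cyl_data_def)
  have e: "(0, 1) \<in> (Basis :: ((real^'n) \<times> real) set)" and bi: "(axis i 1, 0) \<in> (Basis :: ((real^'n) \<times> real) set)" for i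
    by (simp_all add: Basis_cyl)
  let ?S = "\<lambda>z::(real^'n) \<times> real. (l *\<^sub>R fst z, snd z)"
  have P: "(LINT z|cylb. norm (a *\<^sub>R v (?S z)) powr pexp TYPE('n)) = a powr pexp TYPE('n) * P / l ^ CARD('n)"
  proof -
    have m: "(\<lambda>z. norm (v z) powr pexp TYPE('n)) \<in> borel_measurable borel" using v by measurable
    show ?thesis unfolding vals using cylb_rescale(2)[OF m l] a by (simp add: powr_mult divide_inverse)
  qed
  have A: "(\<Sum>i\<in>UNIV. sqint cylb (\<lambda>z. (a * l) *\<^sub>R G (axis i 1, 0) (?S z))) = a\<^sup>2 * l\<^sup>2 * A / l ^ CARD('n)"
    unfolding vals gradsq_def sqint_rescale[OF G[OF bi] l]
    by (simp add: sum_distrib_left sum_divide_distrib power_mult_distrib)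
  show ?thesis unfolding cyl_vals_def
    by (intro exI conjI, rule cyl_data_rescale[OF data a l])
       (use A P in \<open>simp_all add: vals gradsq_def sqint_rescale[OF v l] sqint_rescale[OF G[OF e] l]\<close>)
qed

lemma potential_tensor:
  fixes u :: "real^'n \<Rightarrow> complex"
  assumes "integrable lborel (\<lambda>x. norm (u x) powr p)" "continuous_on UNIV (\<theta> :: real \<Rightarrow> real)" "0 < p"
  shows "(LINT z|cylb. norm (u (fst z) * of_real (\<theta> (snd z))) powr p)
     = (LINT x|lborel. norm (u x) powr p) * (LINT y|circle_measure. \<bar>\<theta> y\<bar> powr p)"
proof -
  have "continuous_on UNIV (\<lambda>y. \<bar>\<theta> y\<bar> powr p)" using assms by (intro continuous_on_powr' continuous_intros) auto
  then have i: "integrable circle_measure (\<lambda>y. \<bar>\<theta> y\<bar> powr p)" by (rule integral_circle_continuous(1))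
  show ?thesis using integrable_cylb_tensor(2)[OF assms(1) i] by (simp add: norm_mult powr_mult)
qed

text \<open>Read off from the cylinder: the constant lift has integrable potential there, and Fubini
  divides out the circle.\<close>

lemma eu_data_potential_integrable:
  fixes u :: "real^'n \<Rightarrow> complex"
  assumes d2: "2 \<le> CARD('n::finite)" and data: "eu_data u g"
  shows "integrable lborel (\<lambda>x. norm (u x) powr pexp TYPE('n))"
proof -
  obtain C where C: "\<And>v (G :: (real^'n) \<times> real \<Rightarrow> (real^'n) \<times> real \<Rightarrow> complex). cyl_data v G \<Longrightarrow> integrable cylb (\<lambda>z. norm (v z) powr pexp TYPE('n))"
    by (rule cyl_Gagliardo_Nirenberg[OF d2]) blast
  have "cyl_data (\<lambda>z. u (fst z) * of_real 1) (tensor_grad u g (\<lambda>_. 1) (\<lambda>_. 0))"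
    by (rule cyl_data_tensor[OF data]) auto
  from C[OF this] have "integrable cylb (\<lambda>z. norm (u (fst z)) powr pexp TYPE('n))" by simp
  from cyl_pair.integrable_fst'[OF this[unfolded cylb_def]]
  have "integrable lborel (\<lambda>x. 2 * pi * norm (u x) powr pexp TYPE('n))" by (simp add: measure_circle)
  from integrable_mult_right[OF this, of "inverse (2 * pi)"] show ?thesis by simp
qed

lemma cyl_vals_of_eu_vals:
  assumes d2: "2 \<le> CARD('n::finite)" and V: "eu_vals TYPE('n) M A P"
    and \<theta>: "\<And>y. (\<theta> has_real_derivative \<theta>' y) (at y)" "continuous_on UNIV \<theta>'" "\<theta> (2 * pi) = \<theta> 0"
  shows "cyl_vals TYPE('n) (M * (LINT y|circle_measure. (\<theta> y)\<^sup>2)) (A * (LINT y|circle_measure. (\<theta> y)\<^sup>2))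
     (M * (LINT y|circle_measure. (\<theta>' y)\<^sup>2)) (P * (LINT y|circle_measure. \<bar>\<theta> y\<bar> powr pexp TYPE('n)))"
proof -
  obtain u and g :: "'n \<Rightarrow> real^'n \<Rightarrow> complex" where data: "eu_data u g" and vals: "M = sqint lborel u"
    "A = (\<Sum>i\<in>UNIV. sqint lborel (g i))" "P = (LINT x|lborel. norm (u x) powr pexp TYPE('n))"
    using V by (auto simp: eu_vals_def)
  have c: "continuous_on UNIV \<theta>" using DERIV_isCont[OF \<theta>(1)] by (simp add: continuous_at_imp_continuous_on)
  have u: "u \<in> borel_measurable borel" "integrable lborel (\<lambda>x. (norm (u x))\<^sup>2)"
    and g: "g i \<in> borel_measurable borel" "integrable lborel (\<lambda>x. (norm (g i x))\<^sup>2)" for i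
    using data by (auto simp: eu_data_def)
  show ?thesis unfolding cyl_vals_def
    by (intro exI conjI, rule cyl_data_tensor[OF data \<theta>])
       (use potential_tensor[OF eu_data_potential_integrable[OF d2 data] c] pexp_gt_2[OF d2] in
        \<open>simp_all add: vals gradsq_def tensor_grad_simps tensor_L2(3)[OF u c] tensor_L2(3)[OF u \<theta>(2)] tensor_L2(3)[OF g c] sum_distrib_right\<close>)
qed

lemma cyl_vals_constant:
  assumes "2 \<le> CARD('n::finite)" "eu_vals TYPE('n) M A P"
  shows "cyl_vals TYPE('n) (2 * pi * M) (2 * pi * A) 0 (2 * pi * P)"
  using cyl_vals_of_eu_vals[OF assms, of "\<lambda>_. 1" "\<lambda>_. 0"] by (simp add: measure_circle mult.commute)

text \<open>Weak derivatives of the dilated function are obtained by lifting to the cylinder,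
  dilating there and averaging back.\<close>

lemma eu_vals_rescale:
  assumes d2: "2 \<le> CARD('n::finite)" and V: "eu_vals TYPE('n) M A P" and a: "0 < a" and l: "0 < l"
  shows "eu_vals TYPE('n) (a\<^sup>2 * M / l ^ CARD('n)) (a\<^sup>2 * l\<^sup>2 * A / l ^ CARD('n)) (a powr pexp TYPE('n) * P / l ^ CARD('n))"
proof -
  obtain u and g :: "'n \<Rightarrow> real^'n \<Rightarrow> complex" where data: "eu_data u g" and vals: "M = sqint lborel u"
    "A = (\<Sum>i\<in>UNIV. sqint lborel (g i))" "P = (LINT x|lborel. norm (u x) powr pexp TYPE('n))"
    using V by (auto simp: eu_vals_def)
  have u: "u \<in> borel_measurable borel" "integrable lborel (\<lambda>x. (norm (u x))\<^sup>2)"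
    and g: "g i \<in> borel_measurable borel" "integrable lborel (\<lambda>x. (norm (g i x))\<^sup>2)" for i
    using data by (auto simp: eu_data_def)
  have avg: "avg_y (\<lambda>z. h (fst z)) = h" for h :: "real^'n \<Rightarrow> complex"
    by (auto simp: avg_y_def measure_circle)
  have cd: "cyl_data (\<lambda>z. u (fst z) * of_real 1) (tensor_grad u g (\<lambda>_. 1) (\<lambda>_. 0))"
    by (rule cyl_data_tensor[OF data]) auto
  have "eu_data (avg_y (\<lambda>z. a *\<^sub>R u (l *\<^sub>R fst z))) (\<lambda>i. avg_y (\<lambda>z. (a * l) *\<^sub>R g i (l *\<^sub>R fst z)))"
    using eu_data_avg_y[OF cyl_data_rescale[OF cd a l]] by (simp add: tensor_grad_simps)
  then have ed: "eu_data (\<lambda>x. a *\<^sub>R u (l *\<^sub>R x)) (\<lambda>i x. (a * l) *\<^sub>R g i (l *\<^sub>R x))"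
    unfolding avg[of "\<lambda>x. a *\<^sub>R u (l *\<^sub>R x)"] avg[of "\<lambda>x. (a * l) *\<^sub>R g i (l *\<^sub>R x)" for i] .
  have scale: "(LINT x|lborel. F (l *\<^sub>R x)) = (LINT x|lborel. F x) / l ^ CARD('n)"
    if F: "integrable lborel (\<lambda>x. F x)" "integrable lborel (\<lambda>x. F (l *\<^sub>R x))" for F :: "real^'n \<Rightarrow> real"
  proof -
    have m: "(\<lambda>z::(real^'n) \<times> real. F (fst z)) \<in> borel_measurable borel"
      using measurable_compose[OF fst_snd_borel(1), of F borel] borel_measurable_integrable[OF F(1)] by simp
    have "(LINT z|cylb. H (fst z)) = (LINT x|lborel. H x) * (2 * pi)" if "integrable lborel H" for H :: "real^'n \<Rightarrow> real"
      using integrable_cylb_tensor(2)[OF that, of "\<lambda>_. 1"] by (simp add: measure_circle)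
    from cylb_rescale(2)[OF m l] this[OF F(1)] this[OF F(2)]
    have "(LINT x|lborel. F (l *\<^sub>R x)) * (2 * pi) = ((LINT x|lborel. F x) / l ^ CARD('n)) * (2 * pi)"
      by (simp add: divide_inverse mult_ac)
    then show ?thesis unfolding mult_cancel_right by simp
  qed
  have sq: "sqint lborel (\<lambda>x. r *\<^sub>R h (l *\<^sub>R x)) = r\<^sup>2 * sqint lborel h / l ^ CARD('n)"
    if "integrable lborel (\<lambda>x. (norm (h x))\<^sup>2)" "integrable lborel (\<lambda>x. (norm (r *\<^sub>R h (l *\<^sub>R x)))\<^sup>2)" "r \<noteq> 0" for h :: "real^'n \<Rightarrow> complex" and r
  proof -
    have "integrable lborel (\<lambda>x. (norm (h (l *\<^sub>R x)))\<^sup>2)"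
      using integrable_mult_right[OF that(2), of "inverse (r\<^sup>2)"] that(3) by (simp add: power_mult_distrib)
    from scale[OF that(1) this] show ?thesis by (simp add: sqint_def power_mult_distrib)
  qed
  have Pint: "integrable lborel (\<lambda>x. norm (a *\<^sub>R u (l *\<^sub>R x)) powr pexp TYPE('n))"
    by (rule eu_data_potential_integrable[OF d2 ed])
  have "integrable lborel (\<lambda>x. norm (u (l *\<^sub>R x)) powr pexp TYPE('n))"
    using integrable_mult_right[OF Pint, of "inverse (a powr pexp TYPE('n))"] a by (simp add: powr_mult)
  from scale[OF eu_data_potential_integrable[OF d2 data] this]
  have P: "(LINT x|lborel. norm (a *\<^sub>R u (l *\<^sub>R x)) powr pexp TYPE('n)) = a powr pexp TYPE('n) * P / l ^ CARD('n)"
    using a by (simp add: vals powr_mult)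
  have M: "sqint lborel (\<lambda>x. a *\<^sub>R u (l *\<^sub>R x)) = a\<^sup>2 * M / l ^ CARD('n)"
    unfolding vals by (rule sq) (use u ed a in \<open>auto simp: eu_data_def\<close>)
  have "sqint lborel (\<lambda>x. (a * l) *\<^sub>R g i (l *\<^sub>R x)) = (a * l)\<^sup>2 * sqint lborel (g i) / l ^ CARD('n)" for i
    by (rule sq) (use g ed a l in \<open>auto simp: eu_data_def\<close>)
  then have A: "(\<Sum>i\<in>UNIV. sqint lborel (\<lambda>x. (a * l) *\<^sub>R g i (l *\<^sub>R x))) = a\<^sup>2 * l\<^sup>2 * A / l ^ CARD('n)"
    unfolding vals by (simp add: sum_distrib_left sum_divide_distrib power_mult_distrib)
  show ?thesis unfolding eu_vals_def using ed M A P by metis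
qed

lemma vals_nonneg:
  "cyl_vals TYPE('n::finite) M A B P \<Longrightarrow> 0 \<le> M \<and> 0 \<le> A \<and> 0 \<le> B \<and> 0 \<le> P"
  "eu_vals TYPE('n::finite) M A P \<Longrightarrow> 0 \<le> M \<and> 0 \<le> A \<and> 0 \<le> P"
  unfolding cyl_vals_def eu_vals_def
  by (auto intro!: sqint_nonneg gradsq_nonneg sum_nonneg integral_nonneg_AE)

lemma cyl_vals_potential_pos:
  assumes d2: "2 \<le> CARD('n::finite)" and V: "cyl_vals TYPE('n) M A B P" and M: "0 < M"
  shows "0 < P"
proof (rule ccontr)
  assume neg: "\<not> 0 < P"
  obtain C where C: "\<And>v (G :: (real^'n) \<times> real \<Rightarrow> (real^'n) \<times> real \<Rightarrow> complex). cyl_data v G \<Longrightarrow> integrable cylb (\<lambda>z. norm (v z) powr pexp TYPE('n))"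
    by (rule cyl_Gagliardo_Nirenberg[OF d2]) blast
  obtain v and G :: "(real^'n) \<times> real \<Rightarrow> (real^'n) \<times> real \<Rightarrow> complex" where data: "cyl_data v G"
    and vals: "M = sqint cylb v" "P = (LINT z|cylb. norm (v z) powr pexp TYPE('n))"
    using V by (auto simp: cyl_vals_def)
  have "P = 0" using neg vals_nonneg(1)[OF V] by simp
  then have "AE z in cylb. norm (v z) powr pexp TYPE('n) = 0"
    unfolding vals by (subst (asm) integral_nonneg_eq_0_iff_AE[OF C[OF data]]) auto
  then have "AE z in cylb. (norm (v z))\<^sup>2 = 0" by eventually_elim auto
  then have "M = 0" unfolding vals sqint_def by (rule integral_eq_zero_AE)
  then show False using M by simp
qed

text \<open>For the mean-zero remainder \<open>w\<close> the Poincare inequality replaces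
  \<open>B + M\<close> by a multiple of \<open>B\<close>, so its potential \<open>P\<^sub>1\<close>
  is controlled by \<open>A\<^sub>1\<close> and \<open>B\<close> alone. In the expansion of the
  potential around the average the linear term has a coefficient \<open>k\<close> depending on
  \<open>x\<close> only, and vanishes; Hoelder's inequality turns the quadratic term into the mixed
  product of \<open>P\<^sub>0\<close> and \<open>P\<^sub>1\<close>.\<close>

lemma cyl_vals_split:
  assumes d2: "2 \<le> CARD('n::finite)"
  obtains C where "0 < C"
    "\<And>M A B P. cyl_vals TYPE('n) M A B P \<Longrightarrow> P ^ (CARD('n) - 1) \<le> C * A ^ CARD('n) * (B + M)"
    "\<And>M A B P. cyl_vals TYPE('n) M A B P \<Longrightarrow> \<exists>M\<^sub>0 A\<^sub>0 P\<^sub>0 A\<^sub>1 P\<^sub>1. eu_vals TYPE('n) M\<^sub>0 A\<^sub>0 P\<^sub>0 \<and> 2 * pi * M\<^sub>0 \<le> M \<and>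
        A = 2 * pi * A\<^sub>0 + A\<^sub>1 \<and> 0 \<le> A\<^sub>1 \<and> 0 \<le> P\<^sub>1 \<and> P\<^sub>1 ^ (CARD('n) - 1) \<le> C * A\<^sub>1 ^ CARD('n) * B \<and>
        P \<le> 2 * pi * P\<^sub>0 + 100 * ((2 * pi * P\<^sub>0) powr ((pexp TYPE('n) - 2) / pexp TYPE('n)) * P\<^sub>1 powr (2 / pexp TYPE('n)) + P\<^sub>1)"
proof -
  let ?d = "CARD('n)"
  define p where "p = pexp TYPE('n)"
  have p2: "2 < p" unfolding p_def by (rule pexp_gt_2[OF d2])
  obtain C where C0: "0 < C" and Ci: "\<And>v (G :: (real^'n) \<times> real \<Rightarrow> (real^'n) \<times> real \<Rightarrow> complex). cyl_data v G \<Longrightarrow> integrable cylb (\<lambda>z. norm (v z) powr p)"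
    and CGN: "\<And>v (G :: (real^'n) \<times> real \<Rightarrow> (real^'n) \<times> real \<Rightarrow> complex). cyl_data v G \<Longrightarrow>
       (LINT z|cylb. norm (v z) powr p) ^ (?d - 1) \<le> C * gradsq G ^ ?d * (sqint cylb (G (0, 1)) + sqint cylb v)"
    unfolding p_def by (rule cyl_Gagliardo_Nirenberg[OF d2]) blast
  \<comment> \<open>The 1 accounts for \<open>B\<close> itself, \<open>4 * pi\<^sup>2\<close> for
    the mass of the remainder.\<close>
  define C' where "C' = C * (1 + 4 * pi\<^sup>2)"
  have CC': "C \<le> C'" using C0 by (simp add: C'_def)
  have C'0: "0 < C'" using C0 CC' by simp
  show ?thesis
  proof (rule that[OF C'0])
    fix M A B P assume V: "cyl_vals TYPE('n) M A B P"
    obtain v and G :: "(real^'n) \<times> real \<Rightarrow> (real^'n) \<times> real \<Rightarrow> complex" where data: "cyl_data v G"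
      and vals: "M = sqint cylb v" "A = gradsq G" "B = sqint cylb (G (0, 1))" "P = (LINT z|cylb. norm (v z) powr p)"
      using V by (auto simp: cyl_vals_def p_def)
    have nn: "0 \<le> M" "0 \<le> A" "0 \<le> B" "0 \<le> P" using vals_nonneg(1)[OF V] by auto
    have "P ^ (?d - 1) \<le> C * A ^ ?d * (B + M)" using CGN[OF data] by (simp add: vals)
    also have "\<dots> \<le> C' * A ^ ?d * (B + M)" using CC' nn by (intro mult_right_mono) auto
    finally show "P ^ (?d - 1) \<le> C' * A ^ ?d * (B + M)" .
    have bi: "(axis i 1, 0) \<in> (Basis :: ((real^'n) \<times> real) set)" and e: "(0,1) \<in> (Basis :: ((real^'n) \<times> real) set)" for i
      by (simp_all add: Basis_cyl)
    have v: "v \<in> borel_measurable borel" "integrable cylb (\<lambda>z. (norm (v z))\<^sup>2)"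
      and G: "\<And>i. G (axis i 1, 0) \<in> borel_measurable borel" "\<And>i. integrable cylb (\<lambda>z. (norm (G (axis i 1, 0) z))\<^sup>2)"
      using data bi by (auto simp: cyl_data_def)
    let ?m = "avg_y v" and ?g = "\<lambda>i. avg_y (G (axis i 1, 0))"
    have ed: "eu_data ?m ?g" by (rule eu_data_avg_y[OF data])
    have cm: "cyl_data (\<lambda>z. ?m (fst z) * of_real 1) (tensor_grad ?m ?g (\<lambda>_. 1) (\<lambda>_. 0))"
      by (rule cyl_data_tensor[OF ed]) auto
    define w where "w z = v z - ?m (fst z)" for z
    define H where "H b z = G b z - tensor_grad ?m ?g (\<lambda>_. 1) (\<lambda>_. 0) b z" for b z
    have wd: "cyl_data w H" using cyl_data_diff[OF data cm] by (simp add: w_def[abs_def] H_def[abs_def])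
    have He: "H (0, 1) = G (0, 1)" by (auto simp: H_def tensor_grad_simps)
    have Hi: "H (axis i 1, 0) = (\<lambda>z. G (axis i 1, 0) z - ?g i (fst z))" for i by (auto simp: H_def tensor_grad_simps)
    define M0 where "M0 = sqint lborel ?m"
    define A0 where "A0 = (\<Sum>i\<in>UNIV. sqint lborel (?g i))"
    define P0 where "P0 = (LINT x|lborel. norm (?m x) powr p)"
    define A1 where "A1 = gradsq H"
    define P1 where "P1 = (LINT z|cylb. norm (w z) powr p)"
    have eu: "eu_vals TYPE('n) M0 A0 P0" unfolding eu_vals_def M0_def A0_def P0_def p_def using ed by blast
    have M0: "2 * pi * M0 \<le> M"
      unfolding vals M0_def sqint_avg_y_decomposition[OF v] by (simp add: sqint_nonneg)
    have A01: "A = 2 * pi * A0 + A1"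
      unfolding vals A0_def A1_def gradsq_def Hi
      by (subst sqint_avg_y_decomposition[OF G]) (simp add: sum.distrib sum_distrib_left)
    have A1: "0 \<le> A1" unfolding A1_def by (rule gradsq_nonneg)
    have P1: "0 \<le> P1" unfolding P1_def by (rule integral_nonneg_AE) auto
    have "sqint cylb w \<le> 4 * pi\<^sup>2 * sqint cylb (H (0, 1))"
      by (rule cyl_Poincare[OF wd]) (use avg_y_mean_zero[OF v] in \<open>simp add: w_def\<close>)
    then have Poin: "B + sqint cylb w \<le> (1 + 4 * pi\<^sup>2) * B" unfolding He vals by (simp add: algebra_simps)
    have "P1 ^ (?d - 1) \<le> C * A1 ^ ?d * (B + sqint cylb w)"
      using CGN[OF wd] unfolding He by (simp add: P1_def A1_def vals)
    also have "\<dots> \<le> C * A1 ^ ?d * ((1 + 4 * pi\<^sup>2) * B)"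
      using Poin C0 A1 by (intro mult_left_mono) auto
    finally have P1le: "P1 ^ (?d - 1) \<le> C' * A1 ^ ?d * B" by (simp add: C'_def mult_ac)
    have mi: "integrable cylb (\<lambda>z. norm (?m (fst z)) powr p)" using Ci[OF cm] by simp
    have wi: "integrable cylb (\<lambda>z. norm (w z) powr p)" by (rule Ci[OF wd])
    have mm: "(\<lambda>z. ?m (fst z)) \<in> borel_measurable borel" "w \<in> borel_measurable borel"
      using borel_measurable_avg_y[OF v] wd by (auto simp: cyl_data_def)
    have P0': "(LINT z|cylb. norm (?m (fst z)) powr p) = 2 * pi * P0"
      using potential_tensor[OF eu_data_potential_integrable[OF d2 ed], of "\<lambda>_. 1"] p2
      by (simp add: P0_def p_def measure_circle)
    have hol: "integrable cylb (\<lambda>z. norm (?m (fst z)) powr (p - 2) * (norm (w z))\<^sup>2)"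
      "(LINT z|cylb. norm (?m (fst z)) powr (p - 2) * (norm (w z))\<^sup>2) \<le> (2 * pi * P0) powr ((p - 2) / p) * P1 powr (2 / p)"
    proof -
      have mm2: "(\<lambda>z. norm (?m (fst z))) \<in> borel_measurable cylb" "(\<lambda>z. norm (w z)) \<in> borel_measurable cylb"
        unfolding measurable_cylb_iff by (rule measurable_compose[OF mm(1) borel_measurable_norm], rule measurable_compose[OF mm(2) borel_measurable_norm])
      show "integrable cylb (\<lambda>z. norm (?m (fst z)) powr (p - 2) * (norm (w z))\<^sup>2)"
        "(LINT z|cylb. norm (?m (fst z)) powr (p - 2) * (norm (w z))\<^sup>2) \<le> (2 * pi * P0) powr ((p - 2) / p) * P1 powr (2 / p)"
        using Holder_powr_square[OF mm2 norm_ge_zero norm_ge_zero p2 mi wi] unfolding P0' P1_def .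
    qed
    define k where "k x = of_real (norm (?m x) powr (p - 2)) * cnj (?m x)" for x
    have km: "(\<lambda>z::(real^'n) \<times> real. k (fst z)) \<in> borel_measurable borel"
    proof -
      have "(\<lambda>z. cnj (?m (fst z))) \<in> borel_measurable (borel :: ((real^'n) \<times> real) measure)"
        by (rule measurable_compose[OF mm(1) borel_measurable_continuous_onI[OF continuous_on_cnj[OF continuous_on_id]]])
      moreover note [measurable] = mm(1)
      have "(\<lambda>z. complex_of_real (norm (?m (fst z)) powr (p - 2))) \<in> borel_measurable (borel :: ((real^'n) \<times> real) measure)"
        by measurable
      ultimately show ?thesis unfolding k_def by (intro borel_measurable_times)
    qed
    have ki: "integrable cylb (\<lambda>z. k (fst z) * w z)"
    proof (rule Bochner_Integration.integrable_bound)
      show "integrable cylb (\<lambda>z. norm (?m (fst z)) powr p + norm (?m (fst z)) powr (p - 2) * (norm (w z))\<^sup>2)"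
        using mi hol by auto
      show "(\<lambda>z. k (fst z) * w z) \<in> borel_measurable cylb" using km mm by (simp add: measurable_cylb_iff)
      show "AE z in cylb. norm (k (fst z) * w z) \<le> norm (norm (?m (fst z)) powr p + norm (?m (fst z)) powr (p - 2) * (norm (w z))\<^sup>2)"
      proof (rule AE_I2)
        fix z
        let ?a = "norm (?m (fst z))" and ?b = "norm (w z)"
        have ap: "?a powr p = ?a powr (p - 2) * ?a\<^sup>2" by (cases "?m (fst z) = 0") (auto simp: powr_diff powr_numeral)
        have "2 * ?a * ?b \<le> ?a\<^sup>2 + ?b\<^sup>2" by (rule sum_squares_bound)
        moreover have "0 \<le> ?a * ?b" by simp
        ultimately have "?a * ?b \<le> ?a\<^sup>2 + ?b\<^sup>2" by linarith
        from mult_left_mono[OF this, of "?a powr (p - 2)"]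
        have "?a powr (p - 2) * (?a * ?b) \<le> ?a powr p + ?a powr (p - 2) * ?b\<^sup>2" unfolding ap by (simp add: distrib_left)
        then show "norm (k (fst z) * w z) \<le> norm (?a powr p + ?a powr (p - 2) * ?b\<^sup>2)"
          by (simp add: k_def norm_mult mult.assoc abs_of_nonneg)
      qed
    qed
    have k0: "(LINT z|cylb. k (fst z) * w z) = 0"
      using integral_cnj_avg_y[OF v, of k] ki by (simp add: w_def)
    have Re0: "integrable cylb (\<lambda>z. norm (?m (fst z)) powr (p - 2) * Re (cnj (?m (fst z)) * w z))"
      "(LINT z|cylb. norm (?m (fst z)) powr (p - 2) * Re (cnj (?m (fst z)) * w z)) = 0"
    proof -
      have eq: "norm (?m (fst z)) powr (p - 2) * Re (cnj (?m (fst z)) * w z) = Re (k (fst z) * w z)" for z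
        by (simp add: k_def mult.assoc)
      show "integrable cylb (\<lambda>z. norm (?m (fst z)) powr (p - 2) * Re (cnj (?m (fst z)) * w z))"
        unfolding eq by (rule integrable_Re[OF ki])
      show "(LINT z|cylb. norm (?m (fst z)) powr (p - 2) * Re (cnj (?m (fst z)) * w z)) = 0"
        unfolding eq integral_Re[OF ki] k0 by simp
    qed
    define s where "s = 1 / (real ?d - 1)"
    have s: "0 < s" "s \<le> 1" "p = 2 + 4 * s" using d2 by (auto simp: s_def p_def pexp_def nl_exponent_def divide_simps)
    have "P \<le> (LINT z|cylb. norm (?m (fst z)) powr p + p * (norm (?m (fst z)) powr (p - 2) * Re (cnj (?m (fst z)) * w z))
        + 100 * (norm (?m (fst z)) powr (p - 2) * (norm (w z))\<^sup>2 + norm (w z) powr p))"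
      unfolding vals
    proof (rule integral_mono[OF Ci[OF data]])
      show "norm (v z) powr p \<le> norm (?m (fst z)) powr p + p * (norm (?m (fst z)) powr (p - 2) * Re (cnj (?m (fst z)) * w z))
        + 100 * (norm (?m (fst z)) powr (p - 2) * (norm (w z))\<^sup>2 + norm (w z) powr p)" for z
        using norm_add_powr_le[OF s, of "?m (fst z)" "w z"] by (simp add: w_def)
    qed (use mi wi hol Re0 in \<open>intro Bochner_Integration.integrable_add integrable_mult_right\<close>)
    also have "\<dots> = (LINT z|cylb. norm (?m (fst z)) powr p) + p * (LINT z|cylb. norm (?m (fst z)) powr (p - 2) * Re (cnj (?m (fst z)) * w z))
       + 100 * ((LINT z|cylb. norm (?m (fst z)) powr (p - 2) * (norm (w z))\<^sup>2) + (LINT z|cylb. norm (w z) powr p))"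
    proof -
      have "(LINT z|cylb. a z + p * b z + 100 * (c z + e z)) = (LINT z|cylb. a z) + p * (LINT z|cylb. b z) + 100 * ((LINT z|cylb. c z) + (LINT z|cylb. e z))"
        if "integrable cylb a" "integrable cylb b" "integrable cylb c" "integrable cylb e" for a b c e :: "(real^'n) \<times> real \<Rightarrow> real"
        using that by simp
      from this[OF mi Re0(1) hol(1) wi] show ?thesis .
    qed
    also have "\<dots> \<le> 2 * pi * P0 + 100 * ((2 * pi * P0) powr ((p - 2) / p) * P1 powr (2 / p) + P1)"
      unfolding P0' Re0(2) using hol(2) by (simp add: P1_def)
    finally have Ple: "P \<le> 2 * pi * P0 + 100 * ((2 * pi * P0) powr ((p - 2) / p) * P1 powr (2 / p) + P1)" .
    show "\<exists>M\<^sub>0 A\<^sub>0 P\<^sub>0 A\<^sub>1 P\<^sub>1. eu_vals TYPE('n) M\<^sub>0 A\<^sub>0 P\<^sub>0 \<and> 2 * pi * M\<^sub>0 \<le> M \<and>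
        A = 2 * pi * A\<^sub>0 + A\<^sub>1 \<and> 0 \<le> A\<^sub>1 \<and> 0 \<le> P\<^sub>1 \<and> P\<^sub>1 ^ (CARD('n) - 1) \<le> C' * A\<^sub>1 ^ CARD('n) * B \<and>
        P \<le> 2 * pi * P\<^sub>0 + 100 * ((2 * pi * P\<^sub>0) powr ((pexp TYPE('n) - 2) / pexp TYPE('n)) * P\<^sub>1 powr (2 / pexp TYPE('n)) + P\<^sub>1)"
      using eu M0 A01 A1 P1 P1le Ple unfolding p_def by blast
  qed
qed

lemma eu_vals_exists: "\<exists>M A P. eu_vals TYPE('n::finite) M A P \<and> 0 < M"
  by (rule eu_data_bump[where ?'n = 'n]) (auto simp: eu_vals_def)

section \<open>The variational problem in terms of mass, gradients and potential\<close>

definition kap :: "'n::finite itself \<Rightarrow> real" where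
  "kap _ = real CARD('n) / (real CARD('n) + 1)"

lemma energy_on_constraint:
  fixes d A B P :: real
  assumes "0 < d" "A = d / (d + 1) * P"
  shows "1 / 2 * (A + B) - (d - 1) / (2 * (d + 1)) * P = A / (2 * d) + B / 2"
proof -
  have "P = A * (d + 1) / d" using assms by (simp add: field_simps)
  then show ?thesis using assms(1) by (simp add: divide_simps) (simp add: algebra_simps)
qed

lemma cyl_admissible_vals:
  fixes u :: "(real^'n) \<times> real \<Rightarrow> complex"
  assumes d2: "2 \<le> CARD('n)" and u: "u \<in> cyl_admissible c"
  obtains A B P where "cyl_vals TYPE('n) c A B P" "A = kap TYPE('n) * P"
    "cyl_E u = A / (2 * real CARD('n)) + B / 2" "B = 0 \<Longrightarrow> AE z in cyl. cyl_deriv_y u z = 0"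
proof -
  have uH: "u \<in> cyl_H1" and M: "cyl_M u = c" and Q: "cyl_Q u = 0" using u by (auto simp: cyl_admissible_def)
  obtain v G where R: "represents u v G" by (rule cyl_H1_represented[OF uH])
  have p0: "0 < pexp TYPE('n)" using pexp_gt_2[OF d2] by simp
  note val = represents_values[OF R p0]
  define A where "A = gradsq G"
  define B where "B = sqint cylb (G (0, 1))"
  define P where "P = (LINT z|cylb. norm (v z) powr pexp TYPE('n))"
  have data: "cyl_data v G" using R by (simp add: represents_def)
  have V: "cyl_vals TYPE('n) c A B P"
    unfolding cyl_vals_def A_def B_def P_def using data val(1) M by blast
  have AP: "A = kap TYPE('n) * P"
    using Q val(2,4) by (simp add: cyl_Q_def A_def P_def kap_def pexp_def Let_def)
  have E: "cyl_E u = A / (2 * real CARD('n)) + B / 2"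
  proof -
    have "cyl_E u = 1 / 2 * (A + B) - (real CARD('n) - 1) / (2 * (real CARD('n) + 1)) * P"
      using val(3,4) by (simp add: cyl_E_def A_def B_def P_def pexp_def Let_def)
    also have "\<dots> = A / (2 * real CARD('n)) + B / 2"
      by (rule energy_on_constraint) (use AP in \<open>auto simp: kap_def\<close>)
    finally show ?thesis .
  qed
  have e: "(0, 1) \<in> (Basis :: ((real^'n) \<times> real) set)" by (simp add: Basis_cyl)
  have "AE z in cyl. cyl_deriv_y u z = 0" if "B = 0"
  proof -
    have "integrable cylb (\<lambda>z. (norm (G (0, 1) z))\<^sup>2)" using data e by (auto simp: cyl_data_def)
    then have "AE z in cylb. (norm (G (0, 1) z))\<^sup>2 = 0"
      using that unfolding B_def sqint_def by (subst (asm) integral_nonneg_eq_0_iff_AE) auto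
    then have "AE z in cyl. G (0, 1) z = 0" unfolding AE_cyl_iff by eventually_elim simp
    moreover have "AE z in cyl. cyl_deriv (0, 1) u z = G (0, 1) z" using R e by (auto simp: represents_def)
    ultimately show ?thesis unfolding cyl_deriv_y_def by eventually_elim simp
  qed
  then show ?thesis using that V AP E by blast
qed

lemma cyl_vals_admissible:
  assumes d2: "2 \<le> CARD('n::finite)" and V: "cyl_vals TYPE('n) c A B P" and AP: "A = kap TYPE('n) * P"
  obtains u :: "(real^'n) \<times> real \<Rightarrow> complex" where "u \<in> cyl_admissible c" "cyl_E u = A / (2 * real CARD('n)) + B / 2"
proof -
  obtain v and G :: "(real^'n) \<times> real \<Rightarrow> (real^'n) \<times> real \<Rightarrow> complex" where data: "cyl_data v G"
    and vals: "c = sqint cylb v" "A = gradsq G" "B = sqint cylb (G (0, 1))" "P = (LINT z|cylb. norm (v z) powr pexp TYPE('n))"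
    using V by (auto simp: cyl_vals_def)
  obtain u where R: "represents u v G" by (rule cyl_data_represents[OF data])
  have p0: "0 < pexp TYPE('n)" using pexp_gt_2[OF d2] by simp
  note val = represents_values[OF R p0]
  have "u \<in> cyl_H1" using R by (simp add: represents_def)
  moreover have "cyl_M u = c" using val(1) vals by simp
  moreover have "cyl_Q u = 0"
    using AP val(2,4) by (simp add: cyl_Q_def vals kap_def pexp_def Let_def)
  moreover have "cyl_E u = A / (2 * real CARD('n)) + B / 2"
  proof -
    have "cyl_E u = 1 / 2 * (A + B) - (real CARD('n) - 1) / (2 * (real CARD('n) + 1)) * P"
      using val(3,4) by (simp add: cyl_E_def vals pexp_def Let_def)
    also have "\<dots> = A / (2 * real CARD('n)) + B / 2"
      by (rule energy_on_constraint) (use AP in \<open>auto simp: kap_def\<close>)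
    finally show ?thesis .
  qed
  ultimately show ?thesis using that by (auto simp: cyl_admissible_def)
qed

lemma cyl_m_eq_Inf:
  assumes d2: "2 \<le> CARD('n::finite)"
  shows "cyl_m TYPE('n) c = Inf {A / (2 * real CARD('n)) + B / 2 | A B P. cyl_vals TYPE('n) c A B P \<and> A = kap TYPE('n) * P}"
proof -
  have "cyl_E ` (cyl_admissible c :: ((real^'n) \<times> real \<Rightarrow> complex) set)
      = {A / (2 * real CARD('n)) + B / 2 | A B P. cyl_vals TYPE('n) c A B P \<and> A = kap TYPE('n) * P}" (is "?L = ?R")
  proof
    show "?L \<subseteq> ?R"
    proof clarify
      fix u :: "(real^'n) \<times> real \<Rightarrow> complex" assume "u \<in> cyl_admissible c"
      then show "\<exists>A B P. cyl_E u = A / (2 * real CARD('n)) + B / 2 \<and> cyl_vals TYPE('n) c A B P \<and> A = kap TYPE('n) * P"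
        by (rule cyl_admissible_vals[OF d2]) blast
    qed
    show "?R \<subseteq> ?L"
    proof clarify
      fix P B assume "cyl_vals TYPE('n) c (kap TYPE('n) * P) B P"
      then obtain u :: "(real^'n) \<times> real \<Rightarrow> complex" where "u \<in> cyl_admissible c" "cyl_E u = kap TYPE('n) * P / (2 * real CARD('n)) + B / 2"
        by (rule cyl_vals_admissible[OF d2 _ refl])
      then show "kap TYPE('n) * P / (2 * real CARD('n)) + B / 2 \<in> ?L" by (metis imageI)
    qed
  qed
  then show ?thesis by (simp add: cyl_m_def)
qed

lemma eu_m_eq_Inf:
  assumes d2: "2 \<le> CARD('n::finite)"
  shows "eu_m TYPE('n) c = Inf {A / (2 * real CARD('n)) | A P. eu_vals TYPE('n) c A P \<and> A = kap TYPE('n) * P}"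
proof -
  have p0: "0 < pexp TYPE('n)" using pexp_gt_2[OF d2] by simp
  have E: "u \<in> eu_admissible c \<longleftrightarrow> u \<in> eu_H1 \<and> sqint lborel v = c \<and> (\<Sum>i\<in>UNIV. sqint lborel (g i)) = kap TYPE('n) * (LINT x|lborel. norm (v x) powr pexp TYPE('n))"
    "u \<in> eu_admissible c \<Longrightarrow> eu_E u = (\<Sum>i\<in>UNIV. sqint lborel (g i)) / (2 * real CARD('n))"
    if R: "eu_represents u v g" for u v :: "real^'n \<Rightarrow> complex" and g
  proof -
    note val = eu_represents_values[OF R p0]
    show *: "u \<in> eu_admissible c \<longleftrightarrow> u \<in> eu_H1 \<and> sqint lborel v = c \<and> (\<Sum>i\<in>UNIV. sqint lborel (g i)) = kap TYPE('n) * (LINT x|lborel. norm (v x) powr pexp TYPE('n))"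
      using val by (simp add: eu_admissible_def eu_Q_def kap_def pexp_def Let_def)
    assume "u \<in> eu_admissible c"
    then have AP: "(\<Sum>i\<in>UNIV. sqint lborel (g i)) = kap TYPE('n) * (LINT x|lborel. norm (v x) powr pexp TYPE('n))" using * by simp
    have "eu_E u = 1 / 2 * ((\<Sum>i\<in>UNIV. sqint lborel (g i)) + 0) - (real CARD('n) - 1) / (2 * (real CARD('n) + 1)) * (LINT x|lborel. norm (v x) powr pexp TYPE('n))"
      using val by (simp add: eu_E_def pexp_def Let_def)
    also have "\<dots> = (\<Sum>i\<in>UNIV. sqint lborel (g i)) / (2 * real CARD('n)) + 0 / 2"
      by (rule energy_on_constraint) (use AP in \<open>auto simp: kap_def\<close>)
    finally show "eu_E u = (\<Sum>i\<in>UNIV. sqint lborel (g i)) / (2 * real CARD('n))" by simp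
  qed
  have "eu_E ` (eu_admissible c :: (real^'n \<Rightarrow> complex) set)
      = {A / (2 * real CARD('n)) | A P. eu_vals TYPE('n) c A P \<and> A = kap TYPE('n) * P}" (is "?L = ?R")
  proof
    show "?L \<subseteq> ?R"
    proof clarify
      fix u :: "real^'n \<Rightarrow> complex" assume u: "u \<in> eu_admissible c"
      then obtain v g where R: "eu_represents u v g" using eu_H1_represented by (auto simp: eu_admissible_def)
      have "eu_vals TYPE('n) c (\<Sum>i\<in>UNIV. sqint lborel (g i)) (LINT x|lborel. norm (v x) powr pexp TYPE('n))"
        using R E(1)[OF R] u unfolding eu_vals_def eu_represents_def by (intro exI[of _ v] exI[of _ g]) auto
      then show "\<exists>A P. eu_E u = A / (2 * real CARD('n)) \<and> eu_vals TYPE('n) c A P \<and> A = kap TYPE('n) * P"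
        using E[OF R] u by blast
    qed
    show "?R \<subseteq> ?L"
    proof clarify
      fix P assume V: "eu_vals TYPE('n) c (kap TYPE('n) * P) P"
      obtain v and g :: "'n \<Rightarrow> real^'n \<Rightarrow> complex" where data: "eu_data v g" and vals: "c = sqint lborel v"
        "kap TYPE('n) * P = (\<Sum>i\<in>UNIV. sqint lborel (g i))" "P = (LINT x|lborel. norm (v x) powr pexp TYPE('n))"
        using V by (auto simp: eu_vals_def)
      have R: "eu_represents v v g" by (rule eu_data_represents[OF data])
      have "v \<in> eu_admissible c" using E(1)[OF R] R vals by (auto simp: eu_represents_def)
      then show "kap TYPE('n) * P / (2 * real CARD('n)) \<in> ?L" using E(2)[OF R] vals(2) by (intro image_eqI[of _ _ v]) simp_all
    qed
  qed
  then show ?thesis by (simp add: eu_m_def)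
qed

text \<open>The amplitude \<open>l^((d-1)/2)\<close> is the scaling of the critical power in
  dimension \<open>d + 1\<close>; it makes \<open>x\<close>-gradient and potential grow by the same
  factor.\<close>

lemma dilation_exponents:
  assumes d2: "2 \<le> CARD('n::finite)" and l: "0 < l"
  obtains a :: real where "0 < a" "a\<^sup>2 = l ^ (CARD('n) - 1)" "a powr pexp TYPE('n) = l ^ (CARD('n) + 1)"
proof
  let ?d = "real CARD('n)"
  let ?a = "l powr ((?d - 1) / 2)"
  have d: "real (CARD('n) - 1) = ?d - 1" using d2 by simp
  show "0 < ?a" using l by simp
  have "?a\<^sup>2 = l powr (of_nat 2 * ((?d - 1) / 2))" using l by (intro powr_power) simp
  also have "of_nat 2 * ((?d - 1) / 2) = real (CARD('n) - 1)" unfolding d by simp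
  finally have "?a\<^sup>2 = l powr (real (CARD('n) - 1))" .
  then show "?a\<^sup>2 = l ^ (CARD('n) - 1)" using l by (simp only: powr_realpow)
  have e: "(?d - 1) / 2 * pexp TYPE('n) = real (CARD('n) + 1)" using d2 unfolding pexp_eq[OF d2] by (simp add: field_simps)
  have "?a powr pexp TYPE('n) = l powr ((?d - 1) / 2 * pexp TYPE('n))" by (rule powr_powr)
  then have "?a powr pexp TYPE('n) = l powr (real (CARD('n) + 1))" by (simp only: e)
  then show "?a powr pexp TYPE('n) = l ^ (CARD('n) + 1)" using l by (simp only: powr_realpow)
qed

text \<open>The constraint \<open>A = kap TYPE('n) * P\<close> survives because \<open>A\<close> and
  \<open>P\<close> share a factor, while \<open>B\<close> scales like the mass. This is how one mass
  is traded for another.\<close>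

lemma vals_dilate:
  assumes d2: "2 \<le> CARD('n::finite)" and l: "0 < l"
  shows "cyl_vals TYPE('n) M A B P \<Longrightarrow> cyl_vals TYPE('n) (M / l) (l * A) (B / l) (l * P)"
    and "eu_vals TYPE('n) M A P \<Longrightarrow> eu_vals TYPE('n) (M / l) (l * A) (l * P)"
proof -
  obtain a :: real where a: "0 < a" "a\<^sup>2 = l ^ (CARD('n) - 1)" "a powr pexp TYPE('n) = l ^ (CARD('n) + 1)"
    by (rule dilation_exponents[OF d2 l])
  obtain m where m: "CARD('n) = Suc m" using d2 by (cases "CARD('n)") auto
  have eq: "a\<^sup>2 * X / l ^ CARD('n) = X / l" "a\<^sup>2 * l\<^sup>2 * X / l ^ CARD('n) = l * X" "a powr pexp TYPE('n) * X / l ^ CARD('n) = l * X" for X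
    using l unfolding a(2,3) m by (simp_all add: power2_eq_square)
  show "cyl_vals TYPE('n) M A B P \<Longrightarrow> cyl_vals TYPE('n) (M / l) (l * A) (B / l) (l * P)"
    using cyl_vals_rescale[where ?'n = 'n, OF _ a(1) l, of M A B P] unfolding eq .
  show "eu_vals TYPE('n) M A P \<Longrightarrow> eu_vals TYPE('n) (M / l) (l * A) (l * P)"
    using eu_vals_rescale[where ?'n = 'n, OF d2 _ a(1) l, of M A P] unfolding eq .
qed

lemma kap_pos: "0 < kap TYPE('n::finite)" "kap TYPE('n) < 1"
  by (simp_all add: kap_def)

text \<open>The quantity \<open>A\<^sup>d M / (\<kappa> P)\<^sup>d\<^sup>-\<^sup>1\<close> is invariant under amplitude and dilation; on the constraint
  it equals \<open>A M\<close>.\<close>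

lemma normalize:
  assumes d2: "2 \<le> CARD('n::finite)" and pos: "0 < M" "0 < A" "0 < P" "0 < m"
  defines "A' \<equiv> A ^ CARD('n) * M / ((kap TYPE('n) * P) ^ (CARD('n) - 1) * m)"
  shows "cyl_vals TYPE('n) M A B P \<Longrightarrow> \<exists>B' P'. cyl_vals TYPE('n) m A' B' P' \<and> A' = kap TYPE('n) * P'"
    and "eu_vals TYPE('n) M A P \<Longrightarrow> \<exists>P'. eu_vals TYPE('n) m A' P' \<and> A' = kap TYPE('n) * P'"
proof -
  let ?n = "CARD('n)"
  \<comment> \<open>The amplitude \<open>a\<close> solves \<open>a^(p-2) = q\<close>, with
    \<open>p - 2 = 4 / (d - 1)\<close>, and thereby restores the constraint. The dilation
    \<open>l\<close> then adjusts the mass without disturbing it.\<close>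
  define q where "q = A / (kap TYPE('n) * P)"
  have q: "0 < q" using pos kap_pos[where ?'n='n] by (simp add: q_def)
  define a where "a = q powr ((real ?n - 1) / 4)"
  have a: "0 < a" using q by (simp add: a_def)
  have d: "real (?n - 1) = real ?n - 1" using d2 by simp
  have a4: "a ^ 4 = q ^ (?n - 1)"
  proof -
    have "a ^ 4 = q powr (of_nat 4 * ((real ?n - 1) / 4))" unfolding a_def using q by (intro powr_power) simp
    also have "of_nat 4 * ((real ?n - 1) / 4) = real (?n - 1)" unfolding d by simp
    finally have "a ^ 4 = q powr (real (?n - 1))" .
    then show ?thesis using q by (simp only: powr_realpow)
  qed
  have ap: "a powr pexp TYPE('n) = a\<^sup>2 * q"
  proof -
    have "pexp TYPE('n) = 2 + 4 / (real ?n - 1)" by (simp add: pexp_def nl_exponent_def)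
    then have "a powr pexp TYPE('n) = a powr 2 * a powr (4 / (real ?n - 1))" by (simp only: powr_add)
    also have "a powr (4 / (real ?n - 1)) = q powr ((real ?n - 1) / 4 * (4 / (real ?n - 1)))"
      unfolding a_def by (rule powr_powr)
    also have "(real ?n - 1) / 4 * (4 / (real ?n - 1)) = 1" using d2 by simp
    also have "q powr 1 = q" using q by simp
    finally show ?thesis using a by simp
  qed
  define l where "l = a\<^sup>2 * M / m"
  have l: "0 < l" using a pos by (simp add: l_def)
  have m: "a\<^sup>2 * M / l = m" using a pos by (simp add: l_def)
  have A'1: "l * (a\<^sup>2 * A) = A'"
  proof -
    obtain k where k: "?n = Suc k" using d2 by (cases ?n) auto
    have "l * (a\<^sup>2 * A) = a ^ 4 * (M * A / m)" unfolding l_def by (simp add: power2_eq_square power4_eq_xxxx)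
    also have "\<dots> = A'" unfolding a4 A'_def q_def k by (simp add: power_divide)
    finally show ?thesis .
  qed
  have A'2: "A' = kap TYPE('n) * (l * (a powr pexp TYPE('n) * P))"
  proof -
    have "a\<^sup>2 * A = kap TYPE('n) * (a powr pexp TYPE('n) * P)"
      unfolding ap q_def using pos kap_pos[where ?'n='n] by simp
    then show ?thesis unfolding A'1[symmetric] by simp
  qed
  show "\<exists>B' P'. cyl_vals TYPE('n) m A' B' P' \<and> A' = kap TYPE('n) * P'" if V: "cyl_vals TYPE('n) M A B P"
  proof -
    have "cyl_vals TYPE('n) (a\<^sup>2 * M) (a\<^sup>2 * A) (a\<^sup>2 * B) (a powr pexp TYPE('n) * P)"
      using cyl_vals_rescale[OF V a, of 1] by simp
    from vals_dilate(1)[OF d2 l this] show ?thesis unfolding m A'1 using A'2 by blast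
  qed
  show "\<exists>P'. eu_vals TYPE('n) m A' P' \<and> A' = kap TYPE('n) * P'" if V: "eu_vals TYPE('n) M A P"
  proof -
    have "eu_vals TYPE('n) (a\<^sup>2 * M) (a\<^sup>2 * A) (a powr pexp TYPE('n) * P)"
      using eu_vals_rescale[OF d2 V a, of 1] by simp
    from vals_dilate(2)[OF d2 l this] show ?thesis unfolding m A'1 using A'2 by blast
  qed
qed

section \<open>A profile on the circle that beats the constant one\<close>

lemma powr_ge_tangent:
  fixes x q :: real
  assumes "0 \<le> x" "1 \<le> q"
  shows "1 + q * (x - 1) \<le> x powr q"
proof -
  have "(x powr q) powr (1 / q) \<le> 1 + (1 / q) * (x powr q - 1)"
    by (rule powr_le_tangent) (use assms in auto)
  then have "x \<le> 1 + (1 / q) * (x powr q - 1)" using assms by (simp add: powr_powr)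
  then have "q * x \<le> q * (1 + (1 / q) * (x powr q - 1))" using assms by (intro mult_left_mono) auto
  then show ?thesis using assms by (simp add: algebra_simps)
qed

lemma integral_circle_sin_square: "(LINT y|circle_measure. (sin y)\<^sup>2) = pi"
proof -
  have "((\<lambda>y. (sin y)\<^sup>2) has_integral (2 * pi - sin (2 * pi) * cos (2 * pi)) / 2 - (0 - sin 0 * cos 0) / 2) {0..2 * pi}"
  proof (rule fundamental_theorem_of_calculus)
    fix y :: real
    have "((\<lambda>y. (y - sin y * cos y) / 2) has_real_derivative (1 - (cos y * cos y - sin y * sin y)) / 2) (at y)"
      by (auto intro!: derivative_eq_intros)
    moreover have "(1 - (cos y * cos y - sin y * sin y)) / 2 = (sin y)\<^sup>2"
      using sin_cos_squared_add[of y] by (simp add: power2_eq_square)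
    ultimately show "((\<lambda>y. (y - sin y * cos y) / 2) has_vector_derivative (sin y)\<^sup>2) (at y within {0..2 * pi})"
      by (simp add: has_real_derivative_iff_has_vector_derivative has_vector_derivative_at_within)
  qed simp
  then show ?thesis by (subst integral_circle_continuous(2)) (auto intro!: continuous_intros integral_unique)
qed

text \<open>Strict Jensen inequality: \<open>2 * (sin y)\<^sup>2\<close> has mean 1 on the circle,
  and its convex power lies above the tangent at 1, strictly so at \<open>y = 0\<close>.\<close>

lemma integral_circle_sin_powr_gt:
  assumes q: "1 < q"
  shows "2 * pi * (1 / 2) powr q < (LINT y|circle_measure. \<bar>sin y\<bar> powr (2 * q))"
proof -
  define f where "f y = \<bar>sin y\<bar> powr (2 * q) - (1 / 2) powr q * (1 + q * (2 * (sin y)\<^sup>2 - 1))" for y :: real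
  have sq: "\<bar>sin y\<bar> powr (2 * q) = (1 / 2) powr q * (2 * (sin y)\<^sup>2) powr q" for y :: real
  proof -
    have "\<bar>sin y\<bar> powr (2 * q) = ((sin y)\<^sup>2) powr q" by (simp add: powr_powr[symmetric])
    also have "(sin y)\<^sup>2 = (1 / 2) * (2 * (sin y)\<^sup>2)" by simp
    finally show ?thesis by (simp only: powr_mult zero_le_divide_1_iff)
  qed
  have f0: "0 \<le> f y" for y
  proof -
    have "(1 / 2) powr q * (1 + q * (2 * (sin y)\<^sup>2 - 1)) \<le> (1 / 2) powr q * (2 * (sin y)\<^sup>2) powr q"
      by (intro mult_left_mono powr_ge_tangent) (use q in auto)
    then show ?thesis unfolding f_def sq by simp
  qed
  have c1: "continuous_on S (\<lambda>y. \<bar>sin y\<bar> powr (2 * q))" for S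
    by (intro continuous_on_powr' continuous_intros) (use q in auto)
  have cf: "continuous_on S f" for S unfolding f_def by (intro continuous_intros c1)
  have f00: "0 < f 0" using q by (simp add: f_def mult_pos_neg)
  have i: "integrable circle_measure (\<lambda>y. \<bar>sin y\<bar> powr (2 * q))" "integrable circle_measure (\<lambda>y. (sin y)\<^sup>2)"
    by (rule integral_circle_continuous(1); intro c1 continuous_intros)+
  have "(LINT y|circle_measure. f y) = (LINT y|circle_measure. \<bar>sin y\<bar> powr (2 * q)) - (1 / 2) powr q * (2 * pi + q * (2 * pi - 2 * pi))"
    unfolding f_def using i integral_circle_sin_square by (simp add: measure_circle)
  moreover have "(LINT y|circle_measure. f y) = integral {0..2 * pi} f" by (rule integral_circle_continuous(2)[OF cf])
  moreover have "0 < integral {0..2 * pi} f"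
  proof -
    have nn: "0 \<le> integral {0..2 * pi} f" by (intro integral_nonneg integrable_continuous_interval cf f0)
    have "integral {0..2 * pi} f \<noteq> 0"
      using integral_eq_0_iff[OF cf, of 0 "2 * pi"] f0 f00 by (auto simp: order_less_imp_not_eq2)
    then show ?thesis using nn by simp
  qed
  ultimately show ?thesis by (simp add: mult.commute)
qed

section \<open>The threshold mass\<close>

text \<open>The best constant of the Euclidean problem in cylinder units: the factors
  \<open>1 / (2 * pi)\<close> give the constant lift mass 1 and \<open>x\<close>-gradient
  \<open>A\<close>.\<close>

definition sharp_const :: "'n::finite itself \<Rightarrow> real" where
  "sharp_const n = Inf {A. \<exists>P. eu_vals n (1 / (2 * pi)) (A / (2 * pi)) P \<and> A / (2 * pi) = kap n * P}"

text \<open>On the constraint the inequality has one more power of \<open>A\<close> on the right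
  than on the left, which bounds \<open>A\<close> away from 0 as long as \<open>B\<close> is
  bounded.\<close>

lemma unit_mass_lower_bound:
  fixes A B P C :: real and n :: nat
  assumes GN: "P ^ (n - 1) \<le> C * A ^ n * (B + 1)" and AP: "A = k * P" and pos: "0 < P" "0 < k" "0 < C" "0 \<le> B" and n: "2 \<le> n"
  shows "1 / (C * k ^ (n - 1) * (B + 1)) \<le> A"
proof -
  have A: "0 < A" using AP pos by simp
  obtain m where m: "n = Suc m" using n by (cases n) auto
  have "A ^ m = k ^ m * P ^ m" unfolding AP by (simp add: power_mult_distrib)
  also have "\<dots> \<le> k ^ m * (C * A ^ Suc m * (B + 1))" using GN pos unfolding m by (intro mult_left_mono) auto
  also have "\<dots> = A ^ m * (C * k ^ m * (B + 1) * A)" by (simp add: mult_ac)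
  finally have "A ^ m * 1 \<le> A ^ m * (C * k ^ m * (B + 1) * A)" by simp
  then have "1 \<le> C * k ^ m * (B + 1) * A" using A by (subst (asm) mult_le_cancel_left_pos) auto
  then show ?thesis using pos unfolding m by (simp add: pos_divide_le_eq mult_ac)
qed

context
  assumes d2: "2 \<le> CARD('n::finite)"
begin

lemma eu_vals_positive:
  assumes V: "eu_vals TYPE('n) M A P" and M: "0 < M"
  shows "0 < A" "0 < P"
proof -
  obtain C where C: "0 < C" "\<And>M A B P. cyl_vals TYPE('n) M A B P \<Longrightarrow> P ^ (CARD('n) - 1) \<le> C * A ^ CARD('n) * (B + M)"
    by (rule cyl_vals_split[OF d2]) blast
  have V': "cyl_vals TYPE('n) (2 * pi * M) (2 * pi * A) 0 (2 * pi * P)" by (rule cyl_vals_constant[OF d2 V])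
  have P: "0 < 2 * pi * P" by (rule cyl_vals_potential_pos[OF d2 V']) (use M in simp)
  then show "0 < P" by (simp add: zero_less_mult_iff)
  show "0 < A"
  proof (rule ccontr)
    assume "\<not> 0 < A"
    then have "A = 0" using vals_nonneg(2)[OF V] by simp
    then have e: "C * (2 * pi * A) ^ CARD('n) * (0 + 2 * pi * M) = 0" using d2 by simp
    have "(2 * pi * P) ^ (CARD('n) - 1) \<le> 0" using C(2)[OF V'] unfolding e .
    then show False using P by (metis not_less zero_less_power)
  qed
qed

lemma sharp_set_nonempty: "{A. \<exists>P. eu_vals TYPE('n) (1 / (2 * pi)) (A / (2 * pi)) P \<and> A / (2 * pi) = kap TYPE('n) * P} \<noteq> {}" (is "?S \<noteq> {}")
proof -
  obtain M A P where V: "eu_vals TYPE('n) M A P" and M: "0 < M" using eu_vals_exists[where ?'n = 'n] by blast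
  obtain P' where P': "eu_vals TYPE('n) (1 / (2 * pi)) (A ^ CARD('n) * M / ((kap TYPE('n) * P) ^ (CARD('n) - 1) * (1 / (2 * pi)))) P'"
      "A ^ CARD('n) * M / ((kap TYPE('n) * P) ^ (CARD('n) - 1) * (1 / (2 * pi))) = kap TYPE('n) * P'"
    using normalize(2)[OF d2 M eu_vals_positive[OF V M], of "1 / (2 * pi)"] V by auto
  define X where "X = A ^ CARD('n) * M / ((kap TYPE('n) * P) ^ (CARD('n) - 1) * (1 / (2 * pi)))"
  have "2 * pi * X / (2 * pi) = X" by simp
  then have "2 * pi * X \<in> ?S" using P' unfolding X_def[symmetric] by auto
  then show ?thesis by blast
qed

lemma sharp_set_lower_bound:
  obtains l where "0 < l" "\<And>A P. eu_vals TYPE('n) (1 / (2 * pi)) (A / (2 * pi)) P \<Longrightarrow> A / (2 * pi) = kap TYPE('n) * P \<Longrightarrow> l \<le> A"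
proof -
  obtain C where C: "0 < C" "\<And>M A B P. cyl_vals TYPE('n) M A B P \<Longrightarrow> P ^ (CARD('n) - 1) \<le> C * A ^ CARD('n) * (B + M)"
    by (rule cyl_vals_split[OF d2]) blast
  show ?thesis
  proof (rule that[of "1 / (C * kap TYPE('n) ^ (CARD('n) - 1) * (0 + 1))"])
    show "0 < 1 / (C * kap TYPE('n) ^ (CARD('n) - 1) * (0 + 1))" using C kap_pos[where ?'n = 'n] by simp
    fix A P assume V: "eu_vals TYPE('n) (1 / (2 * pi)) (A / (2 * pi)) P" and AP: "A / (2 * pi) = kap TYPE('n) * P"
    have V': "cyl_vals TYPE('n) 1 A 0 (2 * pi * P)" using cyl_vals_constant[OF d2 V] by simp
    show "1 / (C * kap TYPE('n) ^ (CARD('n) - 1) * (0 + 1)) \<le> A"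
    proof (rule unit_mass_lower_bound[OF C(2)[OF V'] _ _ _ C(1) _ d2])
      show "A = kap TYPE('n) * (2 * pi * P)" using AP by (simp add: field_simps)
      show "0 < 2 * pi * P" using eu_vals_positive(2)[OF V] by simp
    qed (use kap_pos in auto)
  qed
qed

lemma sharp_const_le: "eu_vals TYPE('n) (1 / (2 * pi)) (A / (2 * pi)) P \<Longrightarrow> A / (2 * pi) = kap TYPE('n) * P \<Longrightarrow> sharp_const TYPE('n) \<le> A"
proof -
  obtain l where l: "\<And>A P. eu_vals TYPE('n) (1 / (2 * pi)) (A / (2 * pi)) P \<Longrightarrow> A / (2 * pi) = kap TYPE('n) * P \<Longrightarrow> l \<le> A"
    by (rule sharp_set_lower_bound) blast
  show "eu_vals TYPE('n) (1 / (2 * pi)) (A / (2 * pi)) P \<Longrightarrow> A / (2 * pi) = kap TYPE('n) * P \<Longrightarrow> sharp_const TYPE('n) \<le> A"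
    unfolding sharp_const_def by (rule cInf_lower) (auto intro!: bdd_belowI[of _ l] l)
qed

lemma sharp_const_pos: "0 < sharp_const TYPE('n)"
proof -
  obtain l where l: "0 < l" "\<And>A P. eu_vals TYPE('n) (1 / (2 * pi)) (A / (2 * pi)) P \<Longrightarrow> A / (2 * pi) = kap TYPE('n) * P \<Longrightarrow> l \<le> A"
    by (rule sharp_set_lower_bound) blast
  have "l \<le> sharp_const TYPE('n)"
    unfolding sharp_const_def by (rule cInf_greatest[OF sharp_set_nonempty]) (auto intro: l)
  then show ?thesis using l by simp
qed

text \<open>Normalising to the constraint and to mass \<open>1 / (2 * pi)\<close> turns
  \<open>sharp_const_le\<close> into a scale-invariant inequality. It can then be applied to circle
  averages, which need not satisfy the constraint. At mass 0 the potential vanishes.\<close>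

lemma sharp_Gagliardo_Nirenberg:
  assumes V: "eu_vals TYPE('n) M A P"
  shows "sharp_const TYPE('n) * (kap TYPE('n) * (2 * pi * P)) ^ (CARD('n) - 1) \<le> (2 * pi * A) ^ CARD('n) * (2 * pi * M)"
proof (cases "0 < M")
  case True
  let ?n = "CARD('n)"
  obtain k where k: "?n = Suc k" using d2 by (cases ?n) auto
  note pos = eu_vals_positive[OF V True]
  define X where "X = A ^ ?n * M / ((kap TYPE('n) * P) ^ (?n - 1) * (1 / (2 * pi)))"
  obtain P' where P': "eu_vals TYPE('n) (1 / (2 * pi)) X P'" "X = kap TYPE('n) * P'"
    using normalize(2)[OF d2 True pos, of "1 / (2 * pi)"] V unfolding X_def by auto
  have "sharp_const TYPE('n) \<le> 2 * pi * X" by (rule sharp_const_le[of _ P']) (use P' in auto)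
  moreover have kP: "0 < kap TYPE('n) * P" using pos kap_pos[where ?'n = 'n] by simp
  ultimately have "sharp_const TYPE('n) * (kap TYPE('n) * (2 * pi * P)) ^ (?n - 1) \<le> 2 * pi * X * (kap TYPE('n) * (2 * pi * P)) ^ (?n - 1)"
    using pos(2) kap_pos(1)[where ?'n = 'n] by (intro mult_right_mono zero_le_power mult_nonneg_nonneg) auto
  also have "\<dots> = (2 * pi * A) ^ ?n * (2 * pi * M)"
  proof -
    have "(kap TYPE('n) * (2 * pi * P)) ^ k = (2 * pi) ^ k * (kap TYPE('n) * P) ^ k"
      unfolding power_mult_distrib[symmetric] by (simp add: mult_ac)
    moreover have "kap TYPE('n) \<noteq> 0" "P \<noteq> 0" using kP by auto
    ultimately show ?thesis unfolding X_def k by (simp add: power_mult_distrib mult_ac)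
  qed
  finally show ?thesis .
next
  case False
  then have M: "M = 0" using vals_nonneg(2)[OF V] by simp
  obtain C where C: "0 < C" "\<And>M A B P. cyl_vals TYPE('n) M A B P \<Longrightarrow> P ^ (CARD('n) - 1) \<le> C * A ^ CARD('n) * (B + M)"
    by (rule cyl_vals_split[OF d2]) blast
  have "(2 * pi * P) ^ (CARD('n) - 1) \<le> 0" using C(2)[OF cyl_vals_constant[OF d2 V]] M by simp
  moreover have "0 \<le> (2 * pi * P) ^ (CARD('n) - 1)" using vals_nonneg(2)[OF V] by simp
  ultimately have "(2 * pi * P) ^ (CARD('n) - 1) = 0" by (rule antisym)
  then show ?thesis unfolding power_mult_distrib[of "kap TYPE('n)"] M by (simp only: mult_zero_right)
qed

text \<open>Dilation by \<open>c\<close> and by its inverse match competitors of mass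
  \<open>c / (2 * pi)\<close> with those defining \<open>sharp_const\<close>, so the two infima
  differ by a factor.\<close>

lemma eu_m_value:
  assumes c: "0 < c"
  shows "2 * pi * eu_m TYPE('n) (inverse (2 * pi) * c) = sharp_const TYPE('n) / (2 * real CARD('n)) / c"
proof -
  let ?d = "real CARD('n)"
  have d: "0 < ?d" using d2 by simp
  define S where "S = {A / (2 * ?d) | A P. eu_vals TYPE('n) (inverse (2 * pi) * c) A P \<and> A = kap TYPE('n) * P}"
  define L where "L = sharp_const TYPE('n)"
  have S1: "L / (2 * pi * c) / (2 * ?d) \<le> x" if x: "x \<in> S" for x
  proof -
    obtain A P where A: "x = A / (2 * ?d)" "eu_vals TYPE('n) (inverse (2 * pi) * c) A P" "A = kap TYPE('n) * P"
      using x unfolding S_def by blast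
    have "inverse (2 * pi) * c / c = 1 / (2 * pi)" using c by (simp add: inverse_eq_divide)
    with vals_dilate(2)[OF d2 c A(2)] have V: "eu_vals TYPE('n) (1 / (2 * pi)) (c * A) (c * P)" by (simp only:)
    have e: "2 * pi * (c * A) / (2 * pi) = c * A" by simp
    have "L \<le> 2 * pi * (c * A)" unfolding L_def
    proof (rule sharp_const_le[of _ "c * P"], unfold e)
      show "c * A = kap TYPE('n) * (c * P)" unfolding A(3) by (rule mult.left_commute)
    qed (rule V)
    then have "L / (2 * pi * c) \<le> A" using c by (simp add: pos_divide_le_eq mult_ac)
    then show ?thesis unfolding A(1) using d by (intro divide_right_mono) auto
  qed
  have S2: "X / (2 * pi * c) / (2 * ?d) \<in> S" if X: "eu_vals TYPE('n) (1 / (2 * pi)) (X / (2 * pi)) P" "X / (2 * pi) = kap TYPE('n) * P" for X P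
  proof -
    have ic: "0 < inverse c" using c by simp
    have "1 / (2 * pi) / inverse c = inverse (2 * pi) * c" using c by (simp add: inverse_eq_divide)
    with vals_dilate(2)[OF d2 ic X(1)]
    have V: "eu_vals TYPE('n) (inverse (2 * pi) * c) (inverse c * (X / (2 * pi))) (inverse c * P)" by (simp only:)
    have "inverse c * (X / (2 * pi)) = kap TYPE('n) * (inverse c * P)" using X(2) by simp
    with V have "inverse c * (X / (2 * pi)) / (2 * ?d) \<in> S" unfolding S_def by blast
    moreover have "inverse c * (X / (2 * pi)) / (2 * ?d) = X / (2 * pi * c) / (2 * ?d)" using c by (simp add: inverse_eq_divide mult_ac)
    ultimately show ?thesis by (simp only:)
  qed
  have ne: "S \<noteq> {}" using sharp_set_nonempty S2 by blast
  have bdd: "bdd_below S" using S1 by (rule bdd_belowI)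
  have "L / (2 * pi * c) / (2 * ?d) \<le> Inf S" by (rule cInf_greatest[OF ne S1])
  moreover have "2 * pi * c * (2 * ?d) * Inf S \<le> L"
    unfolding L_def sharp_const_def
  proof (rule cInf_greatest[OF sharp_set_nonempty])
    fix X assume "X \<in> {A. \<exists>P. eu_vals TYPE('n) (1 / (2 * pi)) (A / (2 * pi)) P \<and> A / (2 * pi) = kap TYPE('n) * P}"
    then have "Inf S \<le> X / (2 * pi * c) / (2 * ?d)" using S2 by (intro cInf_lower[OF _ bdd]) blast
    then have "Inf S \<le> X / (2 * pi * c * (2 * ?d))" by simp
    then show "2 * pi * c * (2 * ?d) * Inf S \<le> X" using c d by (subst (asm) pos_le_divide_eq) (auto simp: mult.commute)
  qed
  then have "Inf S \<le> L / (2 * pi * c * (2 * ?d))" using c d by (subst pos_le_divide_eq) (auto simp: mult.commute)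
  ultimately have "Inf S = L / (2 * pi * c * (2 * ?d))" by simp
  then show ?thesis unfolding eu_m_eq_Inf[OF d2] S_def[symmetric] L_def by simp
qed

lemma cyl_m_le:
  assumes c: "0 < c" and V: "cyl_vals TYPE('n) 1 A B P" "A = kap TYPE('n) * P"
  shows "cyl_m TYPE('n) c \<le> (A / (2 * real CARD('n)) + c\<^sup>2 * B / 2) / c"
proof -
  have ic: "0 < inverse c" using c by simp
  have "cyl_vals TYPE('n) c (inverse c * A) (c * B) (inverse c * P)"
    using vals_dilate(1)[OF d2 ic V(1)] c by (simp add: inverse_eq_divide mult.commute[of B])
  moreover have "inverse c * A = kap TYPE('n) * (inverse c * P)" using V(2) by simp
  ultimately have mem: "inverse c * A / (2 * real CARD('n)) + c * B / 2 \<in>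
     {A / (2 * real CARD('n)) + B / 2 | A B P. cyl_vals TYPE('n) c A B P \<and> A = kap TYPE('n) * P}" by blast
  have "cyl_m TYPE('n) c \<le> inverse c * A / (2 * real CARD('n)) + c * B / 2"
    unfolding cyl_m_eq_Inf[OF d2]
    by (rule cInf_lower[OF mem]) (use vals_nonneg(1) in \<open>fastforce intro!: bdd_belowI[of _ 0] add_nonneg_nonneg divide_nonneg_nonneg\<close>)
  also have "\<dots> = (A / (2 * real CARD('n)) + c\<^sup>2 * B / 2) / c"
    using c by (simp add: power2_eq_square field_simps)
  finally show ?thesis .
qed

lemma cyl_vals_unit_of_eu: "eu_vals TYPE('n) (1 / (2 * pi)) (A / (2 * pi)) P \<Longrightarrow> A / (2 * pi) = kap TYPE('n) * P \<Longrightarrow>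
  cyl_vals TYPE('n) 1 A 0 (2 * pi * P) \<and> A = kap TYPE('n) * (2 * pi * P)"
  using cyl_vals_constant[OF d2, of "1 / (2 * pi)" "A / (2 * pi)" P] by (simp add: field_simps)

lemma cyl_m_le_constant:
  assumes c: "0 < c"
  shows "cyl_m TYPE('n) c \<le> sharp_const TYPE('n) / (2 * real CARD('n)) / c"
proof -
  have d: "0 < real CARD('n)" using d2 by simp
  have "c * (2 * real CARD('n)) * cyl_m TYPE('n) c \<le> sharp_const TYPE('n)"
    unfolding sharp_const_def
  proof (rule cInf_greatest[OF sharp_set_nonempty])
    fix A assume "A \<in> {A. \<exists>P. eu_vals TYPE('n) (1 / (2 * pi)) (A / (2 * pi)) P \<and> A / (2 * pi) = kap TYPE('n) * P}"
    then obtain P where "cyl_vals TYPE('n) 1 A 0 P" "A = kap TYPE('n) * P" using cyl_vals_unit_of_eu by blast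
    from cyl_m_le[OF c this] have "cyl_m TYPE('n) c \<le> A / (2 * real CARD('n) * c)" by simp
    then show "c * (2 * real CARD('n)) * cyl_m TYPE('n) c \<le> A"
      using c d by (subst (asm) pos_le_divide_eq) (auto simp: mult_ac)
  qed
  then have "cyl_m TYPE('n) c \<le> sharp_const TYPE('n) / (2 * real CARD('n) * c)"
    using c d by (subst pos_le_divide_eq) (auto simp: mult_ac)
  then show ?thesis by simp
qed

lemma cyl_m_ge:
  assumes c: "0 < c" and K: "\<And>A B P. cyl_vals TYPE('n) 1 A B P \<Longrightarrow> A = kap TYPE('n) * P \<Longrightarrow> K \<le> A / (2 * real CARD('n)) + c\<^sup>2 * B / 2"
  shows "K / c \<le> cyl_m TYPE('n) c"
  unfolding cyl_m_eq_Inf[OF d2]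
proof (rule cInf_greatest)
  have ic: "0 < inverse c" using c by simp
  obtain A P where "cyl_vals TYPE('n) 1 A 0 P" "A = kap TYPE('n) * P"
    using sharp_set_nonempty cyl_vals_unit_of_eu by blast
  then have "cyl_vals TYPE('n) c (inverse c * A) 0 (inverse c * P) \<and> inverse c * A = kap TYPE('n) * (inverse c * P)"
    using vals_dilate(1)[OF d2 ic, of 1 A 0 P] c by (simp add: inverse_eq_divide)
  then show "{A / (2 * real CARD('n)) + B / 2 | A B P. cyl_vals TYPE('n) c A B P \<and> A = kap TYPE('n) * P} \<noteq> {}" by blast
  fix x assume "x \<in> {A / (2 * real CARD('n)) + B / 2 | A B P. cyl_vals TYPE('n) c A B P \<and> A = kap TYPE('n) * P}"
  then obtain A B P where x: "x = A / (2 * real CARD('n)) + B / 2" and V: "cyl_vals TYPE('n) c A B P" "A = kap TYPE('n) * P" by blast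
  have "cyl_vals TYPE('n) 1 (c * A) (B / c) (c * P)" using vals_dilate(1)[OF d2 c V(1)] c by simp
  moreover have "c * A = kap TYPE('n) * (c * P)" using V(2) by simp
  ultimately have "K \<le> c * A / (2 * real CARD('n)) + c\<^sup>2 * (B / c) / 2" by (rule K)
  also have "\<dots> = x * c" using c unfolding x by (simp add: power2_eq_square algebra_simps)
  finally show "K / c \<le> x" using c by (simp add: pos_divide_le_eq)
qed

text \<open>Tensoring with \<open>sin\<close> multiplies mass and \<open>x\<close>-gradient by
  \<open>pi\<close> and the potential by \<open>\<tau>\<close>. After normalisation the gradient is
  \<open>A * r\<close> with \<open>r = pi^k / (4 * \<tau>^k)\<close>, and Jensen's bound with
  \<open>q * k = k + 2\<close> says exactly \<open>r < 1\<close>. Only \<open>A\<close> has to be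
  small, as the weight \<open>c\<^sup>2\<close> makes \<open>B\<close> negligible for small
  \<open>c\<close>.\<close>

lemma small_mass_gap:
  obtains A B P where "cyl_vals TYPE('n) 1 A B P" "A = kap TYPE('n) * P" "A < sharp_const TYPE('n)"
proof -
  let ?n = "CARD('n)"
  obtain k where k: "?n = Suc k" using d2 by (cases ?n) auto
  have k1: "1 \<le> k" using d2 k by simp
  define q where "q = (real ?n + 1) / (real ?n - 1)"
  have q: "1 < q" using d2 by (simp add: q_def)
  have pq: "pexp TYPE('n) = 2 * q" unfolding pexp_eq[OF d2] q_def by simp
  define \<tau> where "\<tau> = (LINT y|circle_measure. \<bar>sin y\<bar> powr pexp TYPE('n))"
  have \<tau>gt: "2 * pi * (1 / 2) powr q < \<tau>" unfolding \<tau>_def pq by (rule integral_circle_sin_powr_gt[OF q])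
  have \<tau>0: "0 < \<tau>" by (rule less_trans[OF _ \<tau>gt]) simp
  define r where "r = pi ^ k / (4 * \<tau> ^ k)"
  have "pi ^ k = 4 * (2 * pi * (1 / 2) powr q) ^ k"
  proof -
    have "q * real k = real (k + 2)" using k k1 by (simp add: q_def field_simps)
    moreover have "((1 / 2 :: real) powr q) ^ k = (1 / 2) powr (real k * q)" by (rule powr_power) simp
    ultimately have "((1 / 2 :: real) powr q) ^ k = (1 / 2) powr (real (k + 2))" by (simp add: mult.commute)
    also have "\<dots> = (1 / 2) ^ (k + 2)" by (rule powr_realpow) simp
    finally have h: "((1 / 2 :: real) powr q) ^ k = (1 / 2) ^ (k + 2)" .
    have "4 * (2 * pi * (1 / 2) powr q) ^ k = 4 * ((2 * pi) ^ k * ((1 / 2) powr q) ^ k)" by (simp only: power_mult_distrib)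
    also have "\<dots> = pi ^ k * (4 * (2 ^ k * (1 / 2) ^ (k + 2)))" unfolding h by (simp add: power_mult_distrib)
    also have "4 * (2 ^ k * (1 / 2) ^ (k + 2)) = (1 :: real)" by (simp add: power_add power_divide)
    finally show ?thesis by simp
  qed
  also have "\<dots> < 4 * \<tau> ^ k" using \<tau>gt k1 by (intro mult_strict_left_mono power_strict_mono) auto
  finally have r: "r < 1" using \<tau>0 by (simp add: r_def)
  have r0: "0 < r" using \<tau>0 by (simp add: r_def)
  define L where "L = sharp_const TYPE('n)"
  have L: "0 < L" unfolding L_def by (rule sharp_const_pos)
  \<comment> \<open>A competitor within the factor \<open>1 / r\<close> of the infimum falls below
    the infimum after multiplication by \<open>r\<close>.\<close>
  have "L < L / r" using L r r0 by (simp add: pos_less_divide_eq)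
  then obtain A where A: "A \<in> {A. \<exists>P. eu_vals TYPE('n) (1 / (2 * pi)) (A / (2 * pi)) P \<and> A / (2 * pi) = kap TYPE('n) * P}" "A < L / r"
    using cInf_lessD[OF sharp_set_nonempty] unfolding L_def sharp_const_def by blast
  then obtain P where V: "eu_vals TYPE('n) (1 / (2 * pi)) (A / (2 * pi)) P" and AP: "A / (2 * pi) = kap TYPE('n) * P" by blast
  have A0: "0 < A" using eu_vals_positive(1)[OF V] by (simp add: zero_less_divide_iff)
  have P0: "0 < P" using eu_vals_positive(2)[OF V] by simp
  have "cyl_vals TYPE('n) (1 / (2 * pi) * (LINT y|circle_measure. (sin y)\<^sup>2)) (A / (2 * pi) * (LINT y|circle_measure. (sin y)\<^sup>2))
     (1 / (2 * pi) * (LINT y|circle_measure. (cos y)\<^sup>2)) (P * (LINT y|circle_measure. \<bar>sin y\<bar> powr pexp TYPE('n)))"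
    by (rule cyl_vals_of_eu_vals[OF d2 V]) (auto intro!: continuous_intros derivative_eq_intros)
  then have V2: "cyl_vals TYPE('n) (1 / 2) (A / 2) (1 / (2 * pi) * (LINT y|circle_measure. (cos y)\<^sup>2)) (P * \<tau>)"
    unfolding integral_circle_sin_square \<tau>_def by simp
  have "0 < (1/2 :: real)" "0 < A / 2" "0 < P * \<tau>" "0 < (1::real)" using A0 P0 \<tau>0 by auto
  from normalize(1)[OF d2 this V2] obtain B' P' where
    N: "cyl_vals TYPE('n) 1 ((A / 2) ^ ?n * (1 / 2) / ((kap TYPE('n) * (P * \<tau>)) ^ (?n - 1) * 1)) B' P'"
      "(A / 2) ^ ?n * (1 / 2) / ((kap TYPE('n) * (P * \<tau>)) ^ (?n - 1) * 1) = kap TYPE('n) * P'" by blast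
  have "(A / 2) ^ ?n * (1 / 2) / ((kap TYPE('n) * (P * \<tau>)) ^ (?n - 1) * 1) = A * r"
  proof -
    have e: "kap TYPE('n) * (P * \<tau>) = A / (2 * pi) * \<tau>" using AP by simp
    show ?thesis unfolding e k r_def using A0 \<tau>0 by (simp add: power_mult_distrib power_divide divide_simps)
  qed
  moreover have "A * r < L" using A(2) r0 by (simp add: pos_less_divide_eq)
  ultimately show ?thesis using that N unfolding L_def by metis
qed

text \<open>The circle average obeys the sharp inequality, so its potential falls short of the
  constraint by a factor \<open>\<theta>\<close> that measures how far \<open>A\<close> is below the
  optimum. The shortfall must be supplied by the remainder, which contributes at most
  \<open>A\<^sub>1 / 2\<close> plus a multiple of \<open>B\<close>. Hence a deficit in
  \<open>A\<close> costs a proportional amount of \<open>B\<close>.\<close>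

lemma linear_gap:
  obtains K \<epsilon> where "0 < K" "0 < \<epsilon>"
    "\<And>A B P. cyl_vals TYPE('n) 1 A B P \<Longrightarrow> A = kap TYPE('n) * P \<Longrightarrow> A < sharp_const TYPE('n) \<Longrightarrow> B \<le> \<epsilon> \<Longrightarrow>
       sharp_const TYPE('n) - A \<le> K * B"
proof -
  let ?n = "CARD('n)"
  define k where "k = ?n - 1"
  have kn: "?n = Suc k" and k1: "1 \<le> k" using d2 by (auto simp: k_def)
  define \<kappa> where "\<kappa> = kap TYPE('n)"
  have \<kappa>: "0 < \<kappa>" "\<kappa> < 1" using kap_pos by (auto simp: \<kappa>_def)
  define L where "L = sharp_const TYPE('n)"
  have L: "0 < L" unfolding L_def by (rule sharp_const_pos)
  define p where "p = pexp TYPE('n)"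
  have p2: "2 < p" unfolding p_def by (rule pexp_gt_2[OF d2])
  define \<alpha> where "\<alpha> = (p - 2) / p"
  have \<alpha>0: "0 < \<alpha>" using p2 by (simp add: \<alpha>_def)
  define s where "s = 1 / real k"
  have s: "0 < s" "s \<le> 1" using k1 by (auto simp: s_def)
  obtain C where C: "0 < C"
    "\<And>M A B P. cyl_vals TYPE('n) M A B P \<Longrightarrow> P ^ k \<le> C * A ^ ?n * (B + M)"
    "\<And>M A B P. cyl_vals TYPE('n) M A B P \<Longrightarrow> \<exists>M\<^sub>0 A\<^sub>0 P\<^sub>0 A\<^sub>1 P\<^sub>1. eu_vals TYPE('n) M\<^sub>0 A\<^sub>0 P\<^sub>0 \<and> 2 * pi * M\<^sub>0 \<le> M \<and>
        A = 2 * pi * A\<^sub>0 + A\<^sub>1 \<and> 0 \<le> A\<^sub>1 \<and> 0 \<le> P\<^sub>1 \<and> P\<^sub>1 ^ k \<le> C * A\<^sub>1 ^ ?n * B \<and>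
        P \<le> 2 * pi * P\<^sub>0 + 100 * ((2 * pi * P\<^sub>0) powr \<alpha> * P\<^sub>1 powr (2 / p) + P\<^sub>1)"
    unfolding k_def p_def \<alpha>_def by (rule cyl_vals_split[OF d2]) blast
  \<comment> \<open>The first factor bounds the Hoelder term through
    \<open>\<pi>\<^sub>0 \<le> L / \<kappa>\<close>; \<open>4 ^ ?n\<close> comes from the case
    \<open>A\<^sub>1 \<le> 4 * X\<close> below.\<close>
  define K1 where "K1 = (100 * (L / \<kappa>) powr \<alpha>) ^ (k + 2) * C * 4 ^ ?n"
  have K1: "0 < K1" using L \<kappa> C by (simp add: K1_def)
  define l0 where "l0 = 1 / (C * \<kappa> ^ k * 2)"
  have l0: "0 < l0" using C \<kappa> by (simp add: l0_def)
  \<comment> \<open>The three bounds yield, in this order, \<open>l0 \<le> A\<close>, then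
    \<open>100 * P\<^sub>1 \<le> A\<^sub>1 / 4\<close>, and finally
    \<open>t \<le> 1 / 4\<close>.\<close>
  define \<epsilon> where "\<epsilon> = min 1 (min ((1 / 400) ^ k / (C * L)) (l0 / (4 * K1)))"
  have \<epsilon>: "0 < \<epsilon>" "\<epsilon> \<le> 1" "C * L * \<epsilon> \<le> (1 / 400) ^ k" "K1 * \<epsilon> \<le> l0 / 4"
  proof -
    show "0 < \<epsilon>" "\<epsilon> \<le> 1" using C L l0 K1 by (auto simp: \<epsilon>_def)
    have "\<epsilon> \<le> (1 / 400) ^ k / (C * L)" "\<epsilon> \<le> l0 / (4 * K1)" by (auto simp: \<epsilon>_def)
    then have "\<epsilon> * (C * L) \<le> (1 / 400) ^ k" "\<epsilon> * (4 * K1) \<le> l0" using C L K1 by (auto simp: pos_le_divide_eq)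
    then show "C * L * \<epsilon> \<le> (1 / 400) ^ k" "K1 * \<epsilon> \<le> l0 / 4" by (auto simp: mult_ac)
  qed
  show ?thesis
  proof (rule that[of "L * K1 / (s * l0)" \<epsilon>])
    show "0 < L * K1 / (s * l0)" using L K1 s l0 by simp
    show "0 < \<epsilon>" by (rule \<epsilon>)
    fix A B P assume V: "cyl_vals TYPE('n) 1 A B P" and AP': "A = kap TYPE('n) * P" and AL': "A < sharp_const TYPE('n)" and B: "B \<le> \<epsilon>"
    have AP: "A = \<kappa> * P" and AL: "A < L" using AP' AL' by (auto simp: \<kappa>_def L_def)
    have B0: "0 \<le> B" using vals_nonneg(1)[OF V] by simp
    have P0: "0 < P" by (rule cyl_vals_potential_pos[OF d2 V]) simp
    have A0: "0 < A" using AP P0 \<kappa> by simp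
    obtain M\<^sub>0 A\<^sub>0 P\<^sub>0 A\<^sub>1 P\<^sub>1 where E: "eu_vals TYPE('n) M\<^sub>0 A\<^sub>0 P\<^sub>0" and M\<^sub>0: "2 * pi * M\<^sub>0 \<le> 1" and A01: "A = 2 * pi * A\<^sub>0 + A\<^sub>1"
      and A\<^sub>1: "0 \<le> A\<^sub>1" and P\<^sub>1: "0 \<le> P\<^sub>1" "P\<^sub>1 ^ k \<le> C * A\<^sub>1 ^ ?n * B"
      and PP: "P \<le> 2 * pi * P\<^sub>0 + 100 * ((2 * pi * P\<^sub>0) powr \<alpha> * P\<^sub>1 powr (2 / p) + P\<^sub>1)"
      using C(3)[OF V] by blast
    define a where "a = 2 * pi * A\<^sub>0"
    define \<pi>\<^sub>0 where "\<pi>\<^sub>0 = 2 * pi * P\<^sub>0"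
    have nn: "0 \<le> a" "0 \<le> \<pi>\<^sub>0" "0 \<le> M\<^sub>0" using vals_nonneg(2)[OF E] by (auto simp: a_def \<pi>\<^sub>0_def)
    have aA: "A = a + A\<^sub>1" using A01 by (simp add: a_def)
    \<comment> \<open>In the sharp inequality one of the \<open>k + 1\<close> powers of
      \<open>a\<close> is bounded by \<open>A\<close>, so the \<open>k\<close>-th root of
      \<open>A / L\<close> is what remains as a factor.\<close>
    define \<theta> where "\<theta> = (A / L) powr s"
    have \<theta>0: "0 \<le> \<theta>" by (simp add: \<theta>_def)
    have \<theta>k: "\<theta> ^ k = A / L" unfolding \<theta>_def using A0 L k1 by (subst powr_power) (auto simp: s_def)
    have \<theta>le: "\<theta> \<le> 1 + s * (A / L - 1)" unfolding \<theta>_def using s A0 L by (intro powr_le_tangent) auto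
    have \<theta>1: "\<theta> \<le> 1"
    proof -
      have "s * (A / L - 1) \<le> 0" using s AL L by (intro mult_nonneg_nonpos) auto
      then show ?thesis using \<theta>le by simp
    qed
    have \<pi>a: "\<kappa> * \<pi>\<^sub>0 \<le> a * \<theta>"
    proof (rule power_le_imp_le_base)
      have "L * (\<kappa> * \<pi>\<^sub>0) ^ k \<le> a ^ ?n * (2 * pi * M\<^sub>0)"
        using sharp_Gagliardo_Nirenberg[OF E] by (simp add: L_def \<kappa>_def \<pi>\<^sub>0_def a_def k_def)
      also have "\<dots> \<le> a ^ ?n * 1" using M\<^sub>0 nn by (intro mult_left_mono) auto
      also have "\<dots> = a * a ^ k" by (simp add: kn)
      also have "\<dots> \<le> A * a ^ k" using aA A\<^sub>1 nn by (intro mult_right_mono) auto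
      finally have "(\<kappa> * \<pi>\<^sub>0) ^ k \<le> A * a ^ k / L" using L by (simp add: pos_le_divide_eq mult.commute)
      also have "\<dots> = (a * \<theta>) ^ k" by (simp add: power_mult_distrib \<theta>k)
      finally show "(\<kappa> * \<pi>\<^sub>0) ^ Suc (k - 1) \<le> (a * \<theta>) ^ Suc (k - 1)" using k1 by simp
      show "0 \<le> a * \<theta>" using nn \<theta>0 by simp
    qed
    have \<pi>L: "\<pi>\<^sub>0 \<le> L / \<kappa>"
    proof -
      have "a * \<theta> \<le> a * 1" using \<theta>1 nn by (intro mult_left_mono)
      then have "\<kappa> * \<pi>\<^sub>0 \<le> L" using \<pi>a aA A\<^sub>1 AL by linarith
      then show ?thesis using \<kappa> by (simp add: pos_le_divide_eq mult.commute)
    qed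
    have P1le: "100 * P\<^sub>1 \<le> A\<^sub>1 / 4"
    proof -
      have "P\<^sub>1 \<le> A\<^sub>1 * (1 / 400)"
      proof (rule power_le_imp_le_base)
        have "P\<^sub>1 ^ k \<le> C * A\<^sub>1 ^ ?n * B" by (rule P\<^sub>1)
        also have "\<dots> = A\<^sub>1 ^ k * (C * A\<^sub>1 * B)" by (simp add: kn mult_ac)
        also have "\<dots> \<le> A\<^sub>1 ^ k * (C * L * \<epsilon>)"
          using C A\<^sub>1 aA nn AL B B0 L by (intro mult_left_mono mult_mono) auto
        also have "\<dots> \<le> A\<^sub>1 ^ k * (1 / 400) ^ k" using \<epsilon>(3) A\<^sub>1 by (intro mult_left_mono) auto
        finally show "P\<^sub>1 ^ Suc (k - 1) \<le> (A\<^sub>1 * (1 / 400)) ^ Suc (k - 1)" using k1 by (simp only: power_mult_distrib) simp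
      qed (use A\<^sub>1 in simp)
      then show ?thesis by simp
    qed
    define X where "X = 100 * (\<pi>\<^sub>0 powr \<alpha> * P\<^sub>1 powr (2 / p))"
    have X0: "0 \<le> X" by (simp add: X_def)
    \<comment> \<open>The exponent \<open>k + 2\<close> equals \<open>p * k / 2\<close>, so the
      potential of the remainder enters as \<open>P\<^sub>1 ^ k\<close>, the very power that its own
      inequality controls.\<close>
    have Xk: "X ^ (k + 2) \<le> (100 * (L / \<kappa>) powr \<alpha>) ^ (k + 2) * (C * A\<^sub>1 ^ ?n * B)"
    proof -
      have "(P\<^sub>1 powr (2 / p)) ^ (k + 2) = P\<^sub>1 ^ k"
      proof (cases "P\<^sub>1 = 0")
        case False
        have e: "p = 2 * (real k + 2) / real k" unfolding p_def pexp_eq[OF d2] kn by simp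
        have "0 < real k" "0 < real k + 2" using k1 by auto
        then have "real (k + 2) * (2 / p) = real k" unfolding e by (simp add: divide_simps)
        then have "(P\<^sub>1 powr (2 / p)) ^ (k + 2) = P\<^sub>1 powr (real k)"
          using False P\<^sub>1 by (subst powr_power) auto
        then show ?thesis using False P\<^sub>1 by (simp add: powr_realpow)
      qed (use k1 in simp)
      then have "X ^ (k + 2) = (100 * \<pi>\<^sub>0 powr \<alpha>) ^ (k + 2) * P\<^sub>1 ^ k"
        unfolding X_def mult.assoc[symmetric] power_mult_distrib[of "100 * \<pi>\<^sub>0 powr \<alpha>"] by simp
      also have "\<dots> \<le> (100 * (L / \<kappa>) powr \<alpha>) ^ (k + 2) * (C * A\<^sub>1 ^ ?n * B)"
        using \<pi>L nn \<alpha>0 P\<^sub>1 by (intro mult_mono power_mono powr_mono2) auto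
      finally show ?thesis .
    qed
    \<comment> \<open>If \<open>X\<close> exceeds \<open>A\<^sub>1 / 4\<close>, then
      \<open>A\<^sub>1\<close> is replaced by \<open>4 * X\<close> in \<open>Xk\<close>. Of the
      \<open>k + 2\<close> powers of \<open>X\<close> all but one cancel, and the bound comes out
      linear in \<open>B\<close>.\<close>
    have Xle: "X \<le> A\<^sub>1 / 4 + K1 * B"
    proof (cases "X \<le> A\<^sub>1 / 4")
      case True
      then show ?thesis using K1 B0 by (simp add: add_increasing2)
    next
      case False
      then have X: "0 < X" "A\<^sub>1 \<le> 4 * X" using A\<^sub>1 by auto
      have "X ^ ?n * X = X ^ (k + 2)" by (simp add: kn)
      also note Xk
      also have "(100 * (L / \<kappa>) powr \<alpha>) ^ (k + 2) * (C * A\<^sub>1 ^ ?n * B) \<le> (100 * (L / \<kappa>) powr \<alpha>) ^ (k + 2) * (C * (4 * X) ^ ?n * B)"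
        using X A\<^sub>1 C B0 by (intro mult_left_mono mult_right_mono power_mono) auto
      also have "\<dots> = X ^ ?n * (K1 * B)" unfolding K1_def power_mult_distrib[of 4] by (simp only: mult_ac)
      finally have "X \<le> K1 * B" using X by (subst (asm) mult_le_cancel_left_pos) auto
      then show ?thesis using A\<^sub>1 by simp
    qed
    have "A \<le> \<kappa> * \<pi>\<^sub>0 + \<kappa> * (X + 100 * P\<^sub>1)"
      using mult_left_mono[OF PP, of \<kappa>] \<kappa> unfolding AP X_def \<pi>\<^sub>0_def by (simp add: distrib_left)
    also have "\<dots> \<le> a * \<theta> + 1 * (X + 100 * P\<^sub>1)"
      using \<kappa> X0 P\<^sub>1 by (intro add_mono \<pi>a mult_right_mono) auto
    also have "\<dots> \<le> a * \<theta> + (A\<^sub>1 / 2 + K1 * B)" using Xle P1le by simp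
    finally have key: "a * (1 - \<theta>) + A\<^sub>1 * (1 / 2) \<le> K1 * B" unfolding aA by (simp add: algebra_simps)
    \<comment> \<open>The minimum serves both coefficients of \<open>key\<close> at once. Smallness
      of \<open>B\<close> excludes the value \<open>1 / 2\<close>, leaving
      \<open>1 - \<theta>\<close>, which is at least \<open>s * (1 - A / L)\<close> by the tangent
      bound.\<close>
    define t where "t = min (1 - \<theta>) (1 / 2)"
    have t0: "0 \<le> t" using \<theta>1 by (simp add: t_def)
    have "A * t = a * t + A\<^sub>1 * t" unfolding aA by (simp add: algebra_simps)
    also have "\<dots> \<le> a * (1 - \<theta>) + A\<^sub>1 * (1 / 2)" using nn A\<^sub>1 by (intro add_mono mult_left_mono) (simp_all only: t_def min.cobounded1 min.cobounded2)
    finally have At: "A * t \<le> K1 * B" using key by simp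
    have "1 / (C * \<kappa> ^ k * (B + 1)) \<le> A"
      using unit_mass_lower_bound[of P ?n C A B \<kappa>] C(2)[OF V] AP P0 \<kappa> C(1) B0 d2 by (simp add: k_def)
    moreover have "l0 \<le> 1 / (C * \<kappa> ^ k * (B + 1))"
      unfolding l0_def using C \<kappa> B B0 \<epsilon>(2) by (intro divide_left_mono mult_left_mono) (auto intro!: mult_pos_pos)
    ultimately have lA: "l0 \<le> A" by simp
    have l0t: "l0 * t \<le> K1 * B" using mult_right_mono[OF lA t0] At by simp
    have "K1 * B \<le> K1 * \<epsilon>" using B K1 by simp
    then have "l0 * t \<le> l0 * (1 / 4)" using l0t \<epsilon>(4) by simp
    then have "t \<le> 1 / 4" using l0 by (subst (asm) mult_le_cancel_left_pos) auto
    then have tt: "t = 1 - \<theta>" unfolding t_def by (auto simp: min_def split: if_splits)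
    have "s * (1 - A / L) \<le> 1 - \<theta>" using \<theta>le by (simp add: algebra_simps)
    then have "l0 * (s * (1 - A / L)) \<le> K1 * B" using l0t l0 unfolding tt by (meson mult_left_mono order_trans less_imp_le)
    then have "l0 * (s * (1 - A / L)) * L \<le> K1 * B * L" using L by (intro mult_right_mono) auto
    moreover have "l0 * (s * (1 - A / L)) * L = (L - A) * (s * l0)" using L by (simp add: field_simps)
    ultimately have "(L - A) * (s * l0) \<le> L * K1 * B" by (simp only: mult_ac)
    then have "L - A \<le> L * K1 * B / (s * l0)" using s l0 by (subst pos_le_divide_eq) auto
    then show "sharp_const TYPE('n) - A \<le> L * K1 / (s * l0) * B" by (simp add: L_def)
  qed
qed

text \<open>A competitor with \<open>B > 0\<close> and \<open>A\<close> below the optimum demands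
  that \<open>c\<^sup>2\<close> be at least \<open>2 * (L - A / (2 * ?d)) / B\<close>. The infimum
  of the admissible \<open>c\<close> meets each of these demands itself, so the inequality still
  holds at the threshold. Here \<open>L\<close> includes the division by twice the
  dimension.\<close>

lemma threshold_exists:
  fixes L :: real
  defines "L \<equiv> sharp_const TYPE('n) / (2 * real CARD('n))"
  obtains c\<^sub>0 where "0 < c\<^sub>0"
    "\<And>c. 0 < c \<Longrightarrow> c < c\<^sub>0 \<Longrightarrow> \<exists>A B P. cyl_vals TYPE('n) 1 A B P \<and> A = kap TYPE('n) * P \<and> A / (2 * real CARD('n)) + c\<^sup>2 * B / 2 < L"
    "\<And>A B P. cyl_vals TYPE('n) 1 A B P \<Longrightarrow> A = kap TYPE('n) * P \<Longrightarrow> L \<le> A / (2 * real CARD('n)) + c\<^sub>0\<^sup>2 * B / 2"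
proof -
  let ?d = "real CARD('n)"
  have d: "0 < ?d" using d2 by simp
  have sL: "sharp_const TYPE('n) = L * (2 * ?d)" using d by (simp add: L_def)
  have L0: "0 < L" unfolding L_def using sharp_const_pos d by simp
  define S where "S = {c. 0 < c \<and> (\<forall>A B P. cyl_vals TYPE('n) 1 A B P \<longrightarrow> A = kap TYPE('n) * P \<longrightarrow> L \<le> A / (2 * ?d) + c\<^sup>2 * B / 2)}"
  have ne: "S \<noteq> {}"
  proof -
    obtain K \<epsilon> where K: "0 < K" "0 < \<epsilon>"
      "\<And>A B P. cyl_vals TYPE('n) 1 A B P \<Longrightarrow> A = kap TYPE('n) * P \<Longrightarrow> A < sharp_const TYPE('n) \<Longrightarrow> B \<le> \<epsilon> \<Longrightarrow>
         sharp_const TYPE('n) - A \<le> K * B"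
      by (rule linear_gap) blast
    \<comment> \<open>The summand \<open>K / ?d\<close> settles competitors with
      \<open>B \<le> \<epsilon>\<close> through the linear gap, and
      \<open>2 * L / \<epsilon>\<close> those with larger \<open>B\<close>.\<close>
    define c where "c = sqrt (K / ?d + 2 * L / \<epsilon>)"
    have pos: "0 < K / ?d + 2 * L / \<epsilon>" using K d L0 by (intro add_pos_pos) auto
    have c: "0 < c" "c\<^sup>2 = K / ?d + 2 * L / \<epsilon>" using pos by (auto simp: c_def)
    have "L \<le> A / (2 * ?d) + c\<^sup>2 * B / 2" if V: "cyl_vals TYPE('n) 1 A B P" "A = kap TYPE('n) * P" for A B P
    proof -
      have nn: "0 \<le> A" "0 \<le> B" using vals_nonneg(1)[OF V(1)] by auto
      show ?thesis
      proof (cases "A < sharp_const TYPE('n) \<and> B \<le> \<epsilon>")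
        case True
        then have "L * (2 * ?d) - A \<le> K * B" using K(3)[OF V] sL by simp
        then have "(L * (2 * ?d) - A) / (2 * ?d) \<le> K * B / (2 * ?d)" using d by (intro divide_right_mono) auto
        then have "L - A / (2 * ?d) \<le> K * B / (2 * ?d)" using d by (simp add: diff_divide_distrib)
        moreover have "K * B / (2 * ?d) \<le> c\<^sup>2 * B / 2"
        proof -
          have "(K / ?d) * B \<le> c\<^sup>2 * B" unfolding c(2) using nn L0 K by (intro mult_right_mono) auto
          then have "(K / ?d) * B / 2 \<le> c\<^sup>2 * B / 2" by (rule divide_right_mono) simp_all
          moreover have "(K / ?d) * B / 2 = K * B / (2 * ?d)" by simp
          ultimately show ?thesis by (simp only:)
        qed
        ultimately show ?thesis by linarith
      next
        case False
        then consider "sharp_const TYPE('n) \<le> A" | "\<epsilon> < B" by linarith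
        then show ?thesis
        proof cases
          case 1
          then have "L \<le> A / (2 * ?d)" using d unfolding sL by (simp add: pos_le_divide_eq)
          then show ?thesis using nn by (simp add: add_increasing2)
        next
          case 2
          have "2 * L = (2 * L / \<epsilon>) * \<epsilon>" using K by simp
          also have "\<dots> \<le> c\<^sup>2 * B" unfolding c(2) using 2 K d L0 by (intro mult_mono) auto
          finally have "L \<le> c\<^sup>2 * B / 2" by simp
          then show ?thesis using nn d by (simp add: add_increasing)
        qed
      qed
    qed
    then have "c \<in> S" using c by (simp add: S_def)
    then show ?thesis by blast
  qed
  have lower: "sqrt (2 * (L - A / (2 * ?d)) / B) \<le> c"
    if V: "cyl_vals TYPE('n) 1 A B P" "A = kap TYPE('n) * P" and B: "0 < B" and c: "c \<in> S" for A B P c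
  proof -
    have "L \<le> A / (2 * ?d) + c\<^sup>2 * B / 2" using c V by (auto simp: S_def)
    then have "2 * (L - A / (2 * ?d)) \<le> c\<^sup>2 * B" by simp
    then have "2 * (L - A / (2 * ?d)) / B \<le> c\<^sup>2" using B by (simp add: pos_divide_le_eq)
    moreover have "0 \<le> c" using c by (simp add: S_def)
    ultimately show ?thesis by (intro real_le_lsqrt)
  qed
  \<comment> \<open>A competitor with \<open>B = 0\<close> below the optimum would defeat every
    \<open>c\<close>, contradicting \<open>ne\<close>.\<close>
  have Bpos: "0 < B" if V: "cyl_vals TYPE('n) 1 A B P" "A = kap TYPE('n) * P" and A: "A / (2 * ?d) < L" for A B P
  proof (rule ccontr)
    assume "\<not> 0 < B"
    then have "B = 0" using vals_nonneg(1)[OF V(1)] by simp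
    moreover obtain c where "c \<in> S" using ne by blast
    ultimately show False using V A by (fastforce simp: S_def)
  qed
  have bdd: "bdd_below S" by (rule bdd_belowI[of _ 0]) (simp add: S_def)
  define c\<^sub>0 where "c\<^sub>0 = Inf S"
  have c0: "0 < c\<^sub>0"
  proof -
    obtain A B P where V: "cyl_vals TYPE('n) 1 A B P" "A = kap TYPE('n) * P" "A < sharp_const TYPE('n)"
      by (rule small_mass_gap)
    have A: "A / (2 * ?d) < L" using V(3) d unfolding sL by (simp add: pos_divide_less_eq)
    have B: "0 < B" by (rule Bpos[OF V(1,2) A])
    have "0 < sqrt (2 * (L - A / (2 * ?d)) / B)" using A B by simp
    also have "\<dots> \<le> c\<^sub>0" unfolding c\<^sub>0_def by (rule cInf_greatest[OF ne]) (rule lower[OF V(1,2) B])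
    finally show ?thesis .
  qed
  have at: "L \<le> A / (2 * ?d) + c\<^sub>0\<^sup>2 * B / 2" if V: "cyl_vals TYPE('n) 1 A B P" "A = kap TYPE('n) * P" for A B P
  proof (cases "A / (2 * ?d) < L")
    case True
    have B: "0 < B" by (rule Bpos[OF V True])
    have "sqrt (2 * (L - A / (2 * ?d)) / B) \<le> c\<^sub>0" unfolding c\<^sub>0_def by (rule cInf_greatest[OF ne]) (rule lower[OF V B])
    then have "(sqrt (2 * (L - A / (2 * ?d)) / B))\<^sup>2 \<le> c\<^sub>0\<^sup>2" using True B by (intro power_mono) auto
    then have "2 * (L - A / (2 * ?d)) / B \<le> c\<^sub>0\<^sup>2" using True B by simp
    then have "2 * (L - A / (2 * ?d)) \<le> c\<^sub>0\<^sup>2 * B" using B by (simp add: pos_divide_le_eq)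
    then show ?thesis by simp
  next
    case False
    then show ?thesis using vals_nonneg(1)[OF V(1)] by (simp add: add_increasing2)
  qed
  have below: "\<exists>A B P. cyl_vals TYPE('n) 1 A B P \<and> A = kap TYPE('n) * P \<and> A / (2 * ?d) + c\<^sup>2 * B / 2 < L" if c: "0 < c" "c < c\<^sub>0" for c
  proof -
    have "c \<notin> S" using c(2) cInf_lower[OF _ bdd, of c] unfolding c\<^sub>0_def by auto
    then show ?thesis using c(1) unfolding S_def by (auto simp: not_le)
  qed
  show ?thesis by (rule that[OF c0 below at])
qed

end

theorem theorem1p1:
  assumes "CARD('n::finite) \<ge> 2"
  shows "\<exists>c\<^sub>0::real. c\<^sub>0 > 0
    \<and> (\<forall>c. 0 < c \<and> c < c\<^sub>0 \<longrightarrow> cyl_m TYPE('n) c < 2 * pi * eu_m TYPE('n) (inverse (2 * pi) * c))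
    \<and> (\<forall>c\<ge>c\<^sub>0. cyl_m TYPE('n) c = 2 * pi * eu_m TYPE('n) (inverse (2 * pi) * c))
    \<and> (\<forall>c>c\<^sub>0. \<forall>u :: (real^'n) \<times> real \<Rightarrow> complex.
          cyl_minimizer c u \<longrightarrow> (AE z in cyl. cyl_deriv_y u z = 0))"
proof -
  note d2 = assms
  let ?d = "real CARD('n)"
  define L where "L = sharp_const TYPE('n) / (2 * ?d)"
  obtain c\<^sub>0 where c0: "0 < c\<^sub>0"
    and below: "\<And>c. 0 < c \<Longrightarrow> c < c\<^sub>0 \<Longrightarrow> \<exists>A B P. cyl_vals TYPE('n) 1 A B P \<and> A = kap TYPE('n) * P \<and> A / (2 * ?d) + c\<^sup>2 * B / 2 < L"
    and at: "\<And>A B P. cyl_vals TYPE('n) 1 A B P \<Longrightarrow> A = kap TYPE('n) * P \<Longrightarrow> L \<le> A / (2 * ?d) + c\<^sub>0\<^sup>2 * B / 2"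
    unfolding L_def by (rule threshold_exists[OF d2]) blast
  have eu: "2 * pi * eu_m TYPE('n) (inverse (2 * pi) * c) = L / c" if "0 < c" for c
    unfolding L_def by (rule eu_m_value[OF d2 that])
  have strict: "cyl_m TYPE('n) c < L / c" if c: "0 < c" "c < c\<^sub>0" for c
  proof -
    obtain A B P where V: "cyl_vals TYPE('n) 1 A B P" "A = kap TYPE('n) * P" and lt: "A / (2 * ?d) + c\<^sup>2 * B / 2 < L"
      using below[OF c] by blast
    have "cyl_m TYPE('n) c \<le> (A / (2 * ?d) + c\<^sup>2 * B / 2) / c" by (rule cyl_m_le[OF d2 c(1) V])
    also have "\<dots> < L / c" using lt c by (intro divide_strict_right_mono) auto
    finally show ?thesis .
  qed
  have equal: "cyl_m TYPE('n) c = L / c" if c: "c\<^sub>0 \<le> c" for c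
  proof (rule antisym)
    have c': "0 < c" using c c0 by simp
    show "cyl_m TYPE('n) c \<le> L / c" unfolding L_def by (rule cyl_m_le_constant[OF d2 c'])
    show "L / c \<le> cyl_m TYPE('n) c"
    proof (rule cyl_m_ge[OF d2 c'])
      fix A B P assume V: "cyl_vals TYPE('n) 1 A B P" "A = kap TYPE('n) * P"
      have "c\<^sub>0\<^sup>2 * B \<le> c\<^sup>2 * B" using vals_nonneg(1)[OF V(1)] c c0 by (intro mult_right_mono power_mono) auto
      then show "L \<le> A / (2 * ?d) + c\<^sup>2 * B / 2" using at[OF V] by simp
    qed
  qed
  have minim: "AE z in cyl. cyl_deriv_y u z = 0" if c: "c\<^sub>0 < c" and u: "cyl_minimizer c u" for c and u :: "(real^'n) \<times> real \<Rightarrow> complex"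
  proof -
    have c': "0 < c" using c c0 by simp
    obtain A B P where V: "cyl_vals TYPE('n) c A B P" "A = kap TYPE('n) * P" "cyl_E u = A / (2 * ?d) + B / 2"
      and B0: "B = 0 \<Longrightarrow> AE z in cyl. cyl_deriv_y u z = 0"
      using u cyl_admissible_vals[OF d2, of u c] unfolding cyl_minimizer_def by metis
    have E: "A / (2 * ?d) + B / 2 = L / c" using u V(3) equal[of c] c by (simp add: cyl_minimizer_def)
    have V1: "cyl_vals TYPE('n) 1 (c * A) (B / c) (c * P)" using vals_dilate(1)[OF d2 c' V(1)] c' by simp
    have "L \<le> c * A / (2 * ?d) + c\<^sub>0\<^sup>2 * (B / c) / 2" by (rule at[OF V1]) (use V(2) in simp)
    moreover have "L = c * A / (2 * ?d) + c * B / 2"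
    proof -
      have "L = c * (L / c)" using c' by simp
      also have "\<dots> = c * A / (2 * ?d) + c * B / 2" unfolding E[symmetric] by (simp add: distrib_left)
      finally show ?thesis .
    qed
    ultimately have "c * B \<le> c\<^sub>0\<^sup>2 * B / c" by simp
    then have "c\<^sup>2 * B \<le> c\<^sub>0\<^sup>2 * B" using c' by (simp add: pos_le_divide_eq power2_eq_square mult_ac)
    moreover have "c\<^sub>0\<^sup>2 < c\<^sup>2" using c c0 by (intro power_strict_mono) auto
    moreover have "0 \<le> B" using vals_nonneg(1)[OF V(1)] by simp
    ultimately have "B = 0" by (metis mult_le_cancel_right not_le order_antisym)
    then show ?thesis by (rule B0)
  qed
  show ?thesis
    using c0 strict equal minim eu by (intro exI[of _ c\<^sub>0]) (auto simp del: times_divide_eq_left)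
qed

end
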